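(* Let $\Xi\subset\mathcal V_{\rm nc}$ be a full nc subset, $\mathcal R,\mathcal U,\mathcal Y$ Hilbert spaces, $Q_0\in\mathcal T(\Xi;\mathcal L(\mathcal R,\mathbb C)_{\rm nc})$, $\mathbb D_{Q_0}=\{Z\in\Xi:\|Q_0(Z)\|<1\}$, with associated scalar kernel $k_{Q_0}$ on $\mathbb D_{Q_0}$ (see context). A graded function $S:\mathbb D_{Q_0}\to\mathcal L(\mathcal U,\mathcal Y)_{\rm nc}$ is an nc function which is in the contractive multiplier class $\overline{\mathcal B}\mathcal M(k_{Q_0}\otimes I_{\mathcal U},k_{Q_0}\otimes I_{\mathcal Y})$ if and only if there exist a Hilbert space $\mathcal X$ and a contractive (equivalently, even unitary) operator $$\mathbf U=\begin{bmatrix}A&B\\C&D\end{bmatrix}:\begin{bmatrix}\mathcal X\\\mathcal U\end{bmatrix}\to\begin{bmatrix}\mathcal R\otimes\mathcal X\\\mathcal Y\end{bmatrix}$$ such that $$S(Z)=D^{(n)}+C^{(n)}\big(I-(Q_0(Z)\otimes I_{\mathcal X})A^{(n)}\big)^{-1}(Q_0(Z)\otimes I_{\mathcal X})B^{(n)}$$ for all $Z\in\mathbb D_{Q_0,n}$ and all $n\in\mathbb N$, where $A^{(n)}=I_n\otimes A$, $B^{(n)}=I_n\otimes B$, $C^{(n)}=I_n\otimes C$, $D^{(n)}=I_n\otimes D$.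
   Context: All vector spaces are over $\mathbb C$; the Hilbert spaces $\mathcal R,\mathcal U,\mathcal Y$ are nonzero. $\mathcal L(\mathcal H,\mathcal K)^{n\times m}\cong\mathcal L(\mathcal H^m,\mathcal K^n)$ for Hilbert spaces. For $P\in\mathbb C^{n\times m}$, $P\otimes I_{\mathcal H}\in\mathcal L(\mathcal H^m,\mathcal H^n)$. For $Z\in\Xi_n$, $Q_0(Z)\in\mathcal L(\mathcal R^n,\mathbb C^n)$ and $Q_0(Z)\otimes I_{\mathcal X}:(\mathcal R\otimes\mathcal X)^n\to\mathcal X^n$. nc functions. $\mathcal V_{\rm nc}=\coprod_{n\ge1}\mathcal V^{n\times n}$, $\Omega_n=\Omega\cap\mathcal V^{n\times n}$. A function $f:\Omega\to\mathcal V_{0,{\rm nc}}$ ($\Omega\subset\mathcal V_{\rm nc}$) is graded if $f(\Omega_n)\subset\mathcal V_0^{n\times n}$; it is an nc function if graded and $Z\in\Omega_n$, $\widetilde Z\in\Omega_m$, $\alpha\in\mathbb C^{m\times n}$, $\alpha Z=\widetilde Z\alpha$ imply $\alpha f(Z)=f(\widetilde Z)\alpha$. $\mathcal T(\Omega;\mathcal V_{0,{\rm nc}})$ is the set of nc functions. Full nc sets. $\Xi\subset\mathcal V_{\rm nc}$ is a full nc subset if it is closed under direct sums and $Z\in\Xi_n$, $\widetilde Z\in\mathcal V^{m\times m}$, $\mathcal I\widetilde Z=Z\mathcal I$ with $\mathcal I\in\mathbb C^{n\times m}$ injective imply $\widetilde Z\in\Xi_m$. The kernel $k_{Q_0}$.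 For $W\in\mathbb D_{Q_0,m}$, $Q_0(W)^*:\mathbb C^m\to\mathbb C^m\otimes\mathcal R\cong\mathcal R^m$. Define $(L_{Q_0(W)^*})^{(0)}=I_{\mathbb C^m}$ and, for $k\ge1$, $(L_{Q_0(W)^*})^{(k)}=(Q_0(W)^*\otimes I_{\mathcal R^{\otimes(k-1)}})\cdots(Q_0(W)^*\otimes I_{\mathcal R})Q_0(W)^*:\mathbb C^m\to\mathbb C^m\otimes\mathcal R^{\otimes k}$. Then for $Z\in\mathbb D_{Q_0,n}$, $W\in\mathbb D_{Q_0,m}$, $P\in\mathbb C^{n\times m}$, $k_{Q_0}(Z,W)(P)=\sum_{k=0}^\infty(L_{Q_0(Z)^*})^{(k)*}(P\otimes I_{\mathcal R^{\otimes k}})(L_{Q_0(W)^*})^{(k)}\in\mathbb C^{n\times m}$, and $(k_{Q_0}\otimes I_{\mathcal H})(Z,W)(P)=k_{Q_0}(Z,W)(P)\otimes I_{\mathcal H}$. cp nc kernels and multipliers. For a Hilbert space $\mathcal H$, a cp nc kernel $K:\mathbb D\times\mathbb D\to\mathcal L(\mathbb C,\mathcal L(\mathcal H))_{\rm nc}$ assigns to $Z\in\mathbb D_n,W\in\mathbb D_m$ a linear map $K(Z,W):\mathbb C^{n\times m}\to\mathcal L(\mathcal H)^{n\times m}$ with $\alpha K(Z,W)(P)\beta^*=K(\widetilde Z,\widetilde W)(\alpha P\beta^* )$ whenever $\alpha Z=\widetilde Z\alpha$, $\beta W=\widetilde W\beta$, and such that $[P_{ij}]\mapsto[K(Z^{(i)},Z^{(j)})(P_{ij})]$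 is a positive map for every finite list $Z^{(1)},\dots,Z^{(n)}\in\mathbb D$. For such $K$ on a set $\mathbb D$ closed under direct sums, $\mathcal H(K)$ is the unique Hilbert space of nc functions $f:\mathbb D\to\mathcal L(\mathbb C,\mathcal H)_{\rm nc}$ that contains the functions $K_{W,v,y}(Z)u=K(Z,W)(uv)y$ ($W\in\mathbb D_m$, $v\in\mathbb C^{1\times m}$, $y\in\mathcal H^m$, $Z\in\mathbb D_n$, $u\in\mathbb C^n$) and satisfies $\langle f(W)v^*,y\rangle_{\mathcal H^m}=\langle f,K_{W,v,y}\rangle_{\mathcal H(K)}$. An nc function $S:\mathbb D\to\mathcal L(\mathcal U,\mathcal Y)_{\rm nc}$ belongs to $\overline{\mathcal B}\mathcal M(K',K)$ if $(M_Sf)(W)=S(W)f(W)$ defines an operator $M_S:\mathcal H(K')\to\mathcal H(K)$ with $\|M_S\|\le1$. *)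

theory Defs
  imports
    Complex_Main
    "HOL-Library.Function_Algebras"
    "HOL-Library.Product_Plus"
    "Jordan_Normal_Form.Matrix"
begin

section \<open>Complex vector spaces\<close>

class scaleC =
  fixes scaleC :: "complex \<Rightarrow> 'a \<Rightarrow> 'a" (infixr "*\<^sub>C" 75)

class complex_vector = scaleC + ab_group_add +
  assumes scaleC_add_right: "a *\<^sub>C (x + y) = a *\<^sub>C x + a *\<^sub>C y"
    and scaleC_add_left: "(a + b) *\<^sub>C x = a *\<^sub>C x + b *\<^sub>C x"
    and scaleC_scaleC: "a *\<^sub>C (b *\<^sub>C x) = (a * b) *\<^sub>C x"
    and scaleC_one: "1 *\<^sub>C x = x"

interpretation complex_vector: vector_space "scaleC :: complex \<Rightarrow> 'a \<Rightarrow> 'a::complex_vector"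
  by unfold_locales (simp_all add: scaleC_add_right scaleC_add_left scaleC_scaleC scaleC_one)

instantiation complex :: complex_vector
begin
definition "a *\<^sub>C (x::complex) = a * x"
instance by intro_classes (simp_all add: scaleC_complex_def algebra_simps)
end

instantiation "fun" :: (type, complex_vector) complex_vector
begin
definition "a *\<^sub>C (f::'a \<Rightarrow> 'b) = (\<lambda>x. a *\<^sub>C f x)"
instance
  by intro_classes
    (simp_all add: scaleC_fun_def fun_eq_iff scaleC_add_right scaleC_add_left scaleC_scaleC scaleC_one)
end

instantiation prod :: (complex_vector, complex_vector) complex_vector
begin
definition "a *\<^sub>C (p::'a \<times> 'b) = (a *\<^sub>C fst p, a *\<^sub>C snd p)"
instance
  by intro_classes
    (simp_all add: scaleC_prod_def prod_eq_iff scaleC_add_right scaleC_add_left scaleC_scaleC scaleC_one)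
end


section \<open>Hilbert spaces and bounded operators\<close>

text \<open>A Hilbert space is a linear subspace of some ambient complex vector space, equipped with its
  own inner product (linear in the first argument). The values of the inner product off the carrier
  are irrelevant.\<close>

record 'a hspace =
  hcarrier :: "'a set"
  hinner :: "'a \<Rightarrow> 'a \<Rightarrow> complex"

definition hnorm :: "'a hspace \<Rightarrow> 'a \<Rightarrow> real" where
  "hnorm H x = sqrt (Re (hinner H x x))"

definition hilbert_space :: "'a::complex_vector hspace \<Rightarrow> bool" where
  "hilbert_space H \<longleftrightarrow>
     complex_vector.subspace (hcarrier H) \<and>
     (\<forall>x\<in>hcarrier H. \<forall>y\<in>hcarrier H. hinner H y x = cnj (hinner H x y)) \<and>
     (\<forall>x\<in>hcarrier H. \<forall>y\<in>hcarrier H. \<forall>z\<in>hcarrier H.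
        hinner H (x + y) z = hinner H x z + hinner H y z) \<and>
     (\<forall>x\<in>hcarrier H. \<forall>y\<in>hcarrier H. \<forall>a. hinner H (a *\<^sub>C x) y = a * hinner H x y) \<and>
     (\<forall>x\<in>hcarrier H. 0 \<le> Re (hinner H x x)) \<and>
     (\<forall>x\<in>hcarrier H. hinner H x x = 0 \<longrightarrow> x = 0) \<and>
     (\<forall>s::nat \<Rightarrow> 'a. (\<forall>n. s n \<in> hcarrier H) \<longrightarrow>
        (\<forall>e>0. \<exists>N. \<forall>m\<ge>N. \<forall>n\<ge>N. hnorm H (s m - s n) < e) \<longrightarrow>
        (\<exists>x\<in>hcarrier H. (\<lambda>n. hnorm H (s n - x)) \<longlonglongrightarrow> 0))"

text \<open>\<open>bop H K\<close> is the space of bounded operators from \<open>H\<close> to \<open>K\<close>. Operators are extended by \<open>0\<close>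
  off the carrier of \<open>H\<close>, so that equality, sums and composition of operators are those of HOL
  functions; the identity operator is then \<open>id_op H\<close>.\<close>

definition bop :: "'a::complex_vector hspace \<Rightarrow> 'b::complex_vector hspace \<Rightarrow> ('a \<Rightarrow> 'b) set" where
  "bop H K = {T.
     (\<forall>x\<in>hcarrier H. T x \<in> hcarrier K) \<and>
     (\<forall>x\<in>hcarrier H. \<forall>y\<in>hcarrier H. T (x + y) = T x + T y) \<and>
     (\<forall>x\<in>hcarrier H. \<forall>a. T (a *\<^sub>C x) = a *\<^sub>C T x) \<and>
     (\<exists>c. \<forall>x\<in>hcarrier H. hnorm K (T x) \<le> c * hnorm H x) \<and>
     (\<forall>x. x \<notin> hcarrier H \<longrightarrow> T x = 0)}"

definition id_op :: "'a::complex_vector hspace \<Rightarrow> 'a \<Rightarrow> 'a" where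
  "id_op H = (\<lambda>x. if x \<in> hcarrier H then x else 0)"

definition op_norm :: "'a::complex_vector hspace \<Rightarrow> 'b::complex_vector hspace \<Rightarrow> ('a \<Rightarrow> 'b) \<Rightarrow> real" where
  "op_norm H K T = Sup {hnorm K (T x) | x. x \<in> hcarrier H \<and> hnorm H x \<le> 1}"

definition contractive_op :: "'a::complex_vector hspace \<Rightarrow> 'b::complex_vector hspace \<Rightarrow> ('a \<Rightarrow> 'b) \<Rightarrow> bool" where
  "contractive_op H K T \<longleftrightarrow> T \<in> bop H K \<and> op_norm H K T \<le> 1"

definition unitary_op :: "'a::complex_vector hspace \<Rightarrow> 'b::complex_vector hspace \<Rightarrow> ('a \<Rightarrow> 'b) \<Rightarrow> bool" where
  "unitary_op H K T \<longleftrightarrow> T \<in> bop H K \<and> T ` hcarrier H = hcarrier K \<and>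
     (\<forall>x\<in>hcarrier H. \<forall>y\<in>hcarrier H. hinner K (T x) (T y) = hinner H x y)"

definition op_adjoint :: "'a::complex_vector hspace \<Rightarrow> 'b::complex_vector hspace \<Rightarrow> ('a \<Rightarrow> 'b) \<Rightarrow> 'b \<Rightarrow> 'a" where
  "op_adjoint H K T = (THE T'. T' \<in> bop K H \<and>
     (\<forall>x\<in>hcarrier H. \<forall>y\<in>hcarrier K. hinner K (T x) y = hinner H x (T' y)))"

definition op_inverse :: "'a::complex_vector hspace \<Rightarrow> ('a \<Rightarrow> 'a) \<Rightarrow> 'a \<Rightarrow> 'a" where
  "op_inverse H T = (THE T'. T' \<in> bop H H \<and> T' \<circ> T = id_op H \<and> T \<circ> T' = id_op H)"

definition complex_hspace :: "complex hspace" where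
  "complex_hspace = \<lparr>hcarrier = UNIV, hinner = (\<lambda>x y. x * cnj y)\<rparr>"

definition hsum :: "'a hspace \<Rightarrow> 'b hspace \<Rightarrow> ('a \<times> 'b) hspace" where
  "hsum H K = \<lparr>hcarrier = hcarrier H \<times> hcarrier K,
     hinner = (\<lambda>p q. hinner H (fst p) (fst q) + hinner K (snd p) (snd q))\<rparr>"

text \<open>The \<open>n\<close>-fold direct sum of \<open>H\<close>: sequences vanishing from index \<open>n\<close> on. Matrices in
  \<open>L(H,K)\<^sup>n\<^sup>\<times>\<^sup>m\<close> are represented by operators in \<open>bop (hpow m H) (hpow n K)\<close>.\<close>

definition hpow :: "nat \<Rightarrow> 'a::complex_vector hspace \<Rightarrow> (nat \<Rightarrow> 'a) hspace" where
  "hpow n H = \<lparr>hcarrier = {x. (\<forall>i<n. x i \<in> hcarrier H) \<and> (\<forall>i\<ge>n. x i = 0)},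
     hinner = (\<lambda>x y. \<Sum>i<n. hinner H (x i) (y i))\<rparr>"

abbreviation cpow :: "nat \<Rightarrow> (nat \<Rightarrow> complex) hspace" where
  "cpow n \<equiv> hpow n complex_hspace"

text \<open>\<open>P \<otimes> I\<^sub>H\<close> for a scalar matrix \<open>P\<close>, and \<open>I\<^sub>n \<otimes> A\<close> for an operator \<open>A\<close> defined on \<open>H\<close>.\<close>

definition mat_op :: "complex mat \<Rightarrow> 'a::complex_vector hspace \<Rightarrow> (nat \<Rightarrow> 'a) \<Rightarrow> (nat \<Rightarrow> 'a)" where
  "mat_op P H = (\<lambda>x. if x \<in> hcarrier (hpow (dim_col P) H)
     then (\<lambda>i. if i < dim_row P then (\<Sum>j<dim_col P. P $$ (i, j) *\<^sub>C x j) else 0) else 0)"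

definition ampliation :: "nat \<Rightarrow> 'a::complex_vector hspace \<Rightarrow> ('a \<Rightarrow> 'b::complex_vector) \<Rightarrow> (nat \<Rightarrow> 'a) \<Rightarrow> (nat \<Rightarrow> 'b)" where
  "ampliation n H A = (\<lambda>x. if x \<in> hcarrier (hpow n H)
     then (\<lambda>i. if i < n then A (x i) else 0) else 0)"

definition op_to_mat :: "nat \<Rightarrow> nat \<Rightarrow> ((nat \<Rightarrow> complex) \<Rightarrow> (nat \<Rightarrow> complex)) \<Rightarrow> complex mat" where
  "op_to_mat n m T = mat n m (\<lambda>(i, j). T (\<lambda>l. if l = j then 1 else 0) i)"

definition block_op ::
  "'x::complex_vector hspace \<Rightarrow> 'u::complex_vector hspace \<Rightarrow>
   ('x \<Rightarrow> 't::complex_vector) \<Rightarrow> ('u \<Rightarrow> 't) \<Rightarrow> ('x \<Rightarrow> 'y::complex_vector) \<Rightarrow> ('u \<Rightarrow> 'y) \<Rightarrow> 'x \<times> 'u \<Rightarrow> 't \<times> 'y" where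
  "block_op X U A B C D = (\<lambda>p. if p \<in> hcarrier (hsum X U)
     then (A (fst p) + B (snd p), C (fst p) + D (snd p)) else 0)"


section \<open>Hilbert space tensor products\<close>

text \<open>The Hilbert space of complex functions on \<open>E\<close> (extended by \<open>0\<close>) with reproducing kernel
  \<open>\<kappa>\<close>; \<open>rk_point E \<kappa> e\<close> is the function representing evaluation at \<open>e\<close>. The space is unique up to the
  irrelevant values of the inner product off the carrier, so the choice below is harmless.\<close>

definition rk_point :: "'e set \<Rightarrow> ('e \<Rightarrow> 'e \<Rightarrow> complex) \<Rightarrow> 'e \<Rightarrow> 'e \<Rightarrow> complex" where
  "rk_point E \<kappa> e = (\<lambda>e'. if e' \<in> E then \<kappa> e' e else 0)"

definition is_rk_space :: "'e set \<Rightarrow> ('e \<Rightarrow> 'e \<Rightarrow> complex) \<Rightarrow> ('e \<Rightarrow> complex) hspace \<Rightarrow> bool" where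
  "is_rk_space E \<kappa> H \<longleftrightarrow> hilbert_space H \<and>
     (\<forall>f\<in>hcarrier H. \<forall>e. e \<notin> E \<longrightarrow> f e = 0) \<and>
     (\<forall>e\<in>E. rk_point E \<kappa> e \<in> hcarrier H \<and> (\<forall>f\<in>hcarrier H. f e = hinner H f (rk_point E \<kappa> e)))"

definition rk_space :: "'e set \<Rightarrow> ('e \<Rightarrow> 'e \<Rightarrow> complex) \<Rightarrow> ('e \<Rightarrow> complex) hspace" where
  "rk_space E \<kappa> = (SOME H. is_rk_space E \<kappa> H)"

text \<open>A vector \<open>t\<close> of the Hilbert tensor product of \<open>R\<close> and \<open>X\<close> is identified with the function
  \<open>(r, x) \<mapsto> \<langle>t, r \<otimes> x\<rangle>\<close>, which determines it since the elementary tensors are total. As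
  \<open>\<langle>r' \<otimes> x', r \<otimes> x\<rangle> = \<langle>r', r\<rangle> \<langle>x', x\<rangle>\<close>, the tensor product becomes the reproducing kernel space
  of the product kernel, and \<open>r \<otimes> x\<close> becomes the kernel function of the point \<open>(r, x)\<close>. In the same
  way, the \<open>k\<close>-fold tensor power of \<open>R\<close> is a space of functions on lists of length \<open>k\<close>, so that all
  tensor powers live in one ambient vector space.\<close>

definition tensor_kernel :: "'r hspace \<Rightarrow> 'x hspace \<Rightarrow> 'r \<times> 'x \<Rightarrow> 'r \<times> 'x \<Rightarrow> complex" where
  "tensor_kernel R X = (\<lambda>p q. hinner R (fst q) (fst p) * hinner X (snd q) (snd p))"

definition htensor :: "'r hspace \<Rightarrow> 'x hspace \<Rightarrow> ('r \<times> 'x \<Rightarrow> complex) hspace" where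
  "htensor R X = rk_space (hcarrier R \<times> hcarrier X) (tensor_kernel R X)"

definition elem_tensor :: "'r hspace \<Rightarrow> 'x hspace \<Rightarrow> 'r \<Rightarrow> 'x \<Rightarrow> ('r \<times> 'x \<Rightarrow> complex)" where
  "elem_tensor R X r x = rk_point (hcarrier R \<times> hcarrier X) (tensor_kernel R X) (r, x)"

definition tuples :: "nat \<Rightarrow> 'r hspace \<Rightarrow> 'r list set" where
  "tuples k R = {rs. length rs = k \<and> set rs \<subseteq> hcarrier R}"

definition power_kernel :: "nat \<Rightarrow> 'r hspace \<Rightarrow> 'r list \<Rightarrow> 'r list \<Rightarrow> complex" where
  "power_kernel k R = (\<lambda>ss rs. \<Prod>i<k. hinner R (rs ! i) (ss ! i))"

definition htensor_power :: "nat \<Rightarrow> 'r hspace \<Rightarrow> ('r list \<Rightarrow> complex) hspace" where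
  "htensor_power k R = rk_space (tuples k R) (power_kernel k R)"

definition elem_power :: "nat \<Rightarrow> 'r hspace \<Rightarrow> 'r list \<Rightarrow> ('r list \<Rightarrow> complex)" where
  "elem_power k R rs = rk_point (tuples k R) (power_kernel k R) rs"

text \<open>For \<open>T : R\<^sup>n \<rightarrow> \<complex>\<^sup>n\<close>, the operator \<open>T \<otimes> I\<^sub>X : (R \<otimes> X)\<^sup>n \<rightarrow> X\<^sup>n\<close>.\<close>

definition tensor_id ::
  "nat \<Rightarrow> 'r::complex_vector hspace \<Rightarrow> 'x::complex_vector hspace \<Rightarrow> ((nat \<Rightarrow> 'r) \<Rightarrow> (nat \<Rightarrow> complex)) \<Rightarrow>
   (nat \<Rightarrow> 'r \<times> 'x \<Rightarrow> complex) \<Rightarrow> (nat \<Rightarrow> 'x)" where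
  "tensor_id n R X T = (THE G. G \<in> bop (hpow n (htensor R X)) (hpow n X) \<and>
     (\<forall>\<rho>\<in>hcarrier (hpow n R). \<forall>x\<in>hcarrier X.
        G (\<lambda>i. elem_tensor R X (\<rho> i) x) = (\<lambda>i. T \<rho> i *\<^sub>C x)))"

text \<open>For \<open>T : \<complex>\<^sup>m \<rightarrow> R\<^sup>m\<close>, the operator from \<open>\<complex>\<^sup>m \<otimes> R\<^sup>\<otimes>\<^sup>k\<close> to \<open>\<complex>\<^sup>m \<otimes> R\<^sup>\<otimes>\<^sup>(\<^sup>k\<^sup>+\<^sup>1\<^sup>)\<close> obtained by tensoring
  \<open>T\<close> with the identity; the new factor \<open>R\<close> comes first.\<close>

definition tensor_power_id ::
  "nat \<Rightarrow> 'r::complex_vector hspace \<Rightarrow> nat \<Rightarrow> ((nat \<Rightarrow> complex) \<Rightarrow> (nat \<Rightarrow> 'r)) \<Rightarrow>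
   (nat \<Rightarrow> 'r list \<Rightarrow> complex) \<Rightarrow> (nat \<Rightarrow> 'r list \<Rightarrow> complex)" where
  "tensor_power_id m R k T =
     (THE G. G \<in> bop (hpow m (htensor_power k R)) (hpow m (htensor_power (Suc k) R)) \<and>
       (\<forall>c\<in>hcarrier (cpow m). \<forall>rs\<in>tuples k R.
          G (\<lambda>i. c i *\<^sub>C elem_power k R rs) = (\<lambda>i. elem_power (Suc k) R (T c i # rs))))"


section \<open>Noncommutative sets and functions\<close>

definition nc_space :: "'v mat set" where
  "nc_space = {Z. dim_col Z = dim_row Z \<and> 1 \<le> dim_row Z}"

definition lact :: "complex mat \<Rightarrow> 'v::complex_vector mat \<Rightarrow> 'v mat" where
  "lact \<alpha> Z = mat (dim_row \<alpha>) (dim_col Z) (\<lambda>(i, j). \<Sum>k<dim_row Z. \<alpha> $$ (i, k) *\<^sub>C Z $$ (k, j))"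

definition ract :: "'v::complex_vector mat \<Rightarrow> complex mat \<Rightarrow> 'v mat" where
  "ract Z \<alpha> = mat (dim_row Z) (dim_col \<alpha>) (\<lambda>(i, j). \<Sum>k<dim_col Z. \<alpha> $$ (k, j) *\<^sub>C Z $$ (i, k))"

definition dir_sum :: "'v::zero mat \<Rightarrow> 'v mat \<Rightarrow> 'v mat" where
  "dir_sum Z W = four_block_mat Z (0\<^sub>m (dim_row Z) (dim_col W)) (0\<^sub>m (dim_row W) (dim_col Z)) W"

definition full_nc_set :: "'v::complex_vector mat set \<Rightarrow> bool" where
  "full_nc_set \<Xi> \<longleftrightarrow> \<Xi> \<subseteq> nc_space \<and>
     (\<forall>Z\<in>\<Xi>. \<forall>W\<in>\<Xi>. dir_sum Z W \<in> \<Xi>) \<and>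
     (\<forall>Z\<in>\<Xi>. \<forall>Z'\<in>nc_space. \<forall>J\<in>carrier_mat (dim_row Z) (dim_row Z').
        inj_on ((*\<^sub>v) J) (carrier_vec (dim_row Z')) \<and> lact J Z' = ract Z J \<longrightarrow> Z' \<in> \<Xi>)"

definition graded :: "'v mat set \<Rightarrow> 'a::complex_vector hspace \<Rightarrow> 'b::complex_vector hspace \<Rightarrow>
    ('v mat \<Rightarrow> (nat \<Rightarrow> 'a) \<Rightarrow> (nat \<Rightarrow> 'b)) \<Rightarrow> bool" where
  "graded \<Omega> H K f \<longleftrightarrow> (\<forall>Z\<in>\<Omega>. f Z \<in> bop (hpow (dim_row Z) H) (hpow (dim_row Z) K))"

definition nc_function :: "'v::complex_vector mat set \<Rightarrow> 'a::complex_vector hspace \<Rightarrow> 'b::complex_vector hspace \<Rightarrow>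
    ('v mat \<Rightarrow> (nat \<Rightarrow> 'a) \<Rightarrow> (nat \<Rightarrow> 'b)) \<Rightarrow> bool" where
  "nc_function \<Omega> H K f \<longleftrightarrow> graded \<Omega> H K f \<and>
     (\<forall>Z\<in>\<Omega>. \<forall>Z'\<in>\<Omega>. \<forall>\<alpha>\<in>carrier_mat (dim_row Z') (dim_row Z).
        lact \<alpha> Z = ract Z' \<alpha> \<longrightarrow> mat_op \<alpha> K \<circ> f Z = f Z' \<circ> mat_op \<alpha> H)"


section \<open>The kernel and its multipliers\<close>

definition nc_ball :: "'v::complex_vector mat set \<Rightarrow> 'r::complex_vector hspace \<Rightarrow>
    ('v mat \<Rightarrow> (nat \<Rightarrow> 'r) \<Rightarrow> (nat \<Rightarrow> complex)) \<Rightarrow> 'v mat set" where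
  "nc_ball \<Xi> R Q = {Z\<in>\<Xi>. op_norm (hpow (dim_row Z) R) (cpow (dim_row Z)) (Q Z) < 1}"

text \<open>\<open>L_power m R T k\<close> is the \<open>k\<close>-th power of \<open>L\<^sub>T\<close> for \<open>T : \<complex>\<^sup>m \<rightarrow> R\<^sup>m\<close>. For \<open>k = 0\<close> it is
  the identity of \<open>\<complex>\<^sup>m\<close>, the target being written as \<open>\<complex>\<^sup>m \<otimes> R\<^sup>\<otimes>\<^sup>0\<close> with \<open>elem_power 0 R []\<close> the unit
  vector of \<open>R\<^sup>\<otimes>\<^sup>0\<close>.\<close>

primrec L_power ::
  "nat \<Rightarrow> 'r::complex_vector hspace \<Rightarrow> ((nat \<Rightarrow> complex) \<Rightarrow> (nat \<Rightarrow> 'r)) \<Rightarrow> nat \<Rightarrow>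
   (nat \<Rightarrow> complex) \<Rightarrow> (nat \<Rightarrow> 'r list \<Rightarrow> complex)" where
  "L_power m R T 0 = (\<lambda>c. if c \<in> hcarrier (cpow m) then (\<lambda>i. c i *\<^sub>C elem_power 0 R []) else 0)"
| "L_power m R T (Suc k) = tensor_power_id m R k T \<circ> L_power m R T k"

definition L_Q :: "'r::complex_vector hspace \<Rightarrow> ('v mat \<Rightarrow> (nat \<Rightarrow> 'r) \<Rightarrow> (nat \<Rightarrow> complex)) \<Rightarrow>
    'v mat \<Rightarrow> nat \<Rightarrow> (nat \<Rightarrow> complex) \<Rightarrow> (nat \<Rightarrow> 'r list \<Rightarrow> complex)" where
  "L_Q R Q W = L_power (dim_row W) R (op_adjoint (hpow (dim_row W) R) (cpow (dim_row W)) (Q W))"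

definition kernel_term :: "'r::complex_vector hspace \<Rightarrow> ('v mat \<Rightarrow> (nat \<Rightarrow> 'r) \<Rightarrow> (nat \<Rightarrow> complex)) \<Rightarrow>
    'v mat \<Rightarrow> 'v mat \<Rightarrow> complex mat \<Rightarrow> nat \<Rightarrow> complex mat" where
  "kernel_term R Q Z W P k = op_to_mat (dim_row Z) (dim_row W)
     (op_adjoint (cpow (dim_row Z)) (hpow (dim_row Z) (htensor_power k R)) (L_Q R Q Z k)
      \<circ> mat_op P (htensor_power k R) \<circ> L_Q R Q W k)"

definition kernel_Q :: "'r::complex_vector hspace \<Rightarrow> ('v mat \<Rightarrow> (nat \<Rightarrow> 'r) \<Rightarrow> (nat \<Rightarrow> complex)) \<Rightarrow>
    'v mat \<Rightarrow> 'v mat \<Rightarrow> complex mat \<Rightarrow> complex mat" where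
  "kernel_Q R Q Z W P = mat (dim_row Z) (dim_row W) (\<lambda>(i, j). \<Sum>k. kernel_term R Q Z W P k $$ (i, j))"

definition kernel_Q_id :: "'r::complex_vector hspace \<Rightarrow> ('v mat \<Rightarrow> (nat \<Rightarrow> 'r) \<Rightarrow> (nat \<Rightarrow> complex)) \<Rightarrow>
    'e::complex_vector hspace \<Rightarrow> 'v mat \<Rightarrow> 'v mat \<Rightarrow> complex mat \<Rightarrow> (nat \<Rightarrow> 'e) \<Rightarrow> (nat \<Rightarrow> 'e)" where
  "kernel_Q_id R Q E Z W P = mat_op (kernel_Q R Q Z W P) E"

text \<open>For a kernel \<open>K\<close> with values \<open>K Z W P\<close> in \<open>bop (hpow m E) (hpow n E)\<close>: the function
  \<open>K\<^sub>W\<^sub>,\<^sub>v\<^sub>,\<^sub>y\<close>, where the row vector \<open>v\<close> is an element of \<open>cpow m\<close>, and the Hilbert space \<open>H(K)\<close>, whose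
  elements are functions on \<open>\<Delta>\<close> extended by \<open>0\<close>. As before, the space is unique up to the irrelevant
  values of the inner product off the carrier.\<close>

definition kernel_element :: "'v mat set \<Rightarrow>
    ('v mat \<Rightarrow> 'v mat \<Rightarrow> complex mat \<Rightarrow> (nat \<Rightarrow> 'e::complex_vector) \<Rightarrow> (nat \<Rightarrow> 'e)) \<Rightarrow>
    'v mat \<Rightarrow> (nat \<Rightarrow> complex) \<Rightarrow> (nat \<Rightarrow> 'e) \<Rightarrow> 'v mat \<Rightarrow> (nat \<Rightarrow> complex) \<Rightarrow> (nat \<Rightarrow> 'e)" where
  "kernel_element \<Delta> K W v y = (\<lambda>Z. if Z \<in> \<Delta> then
     (\<lambda>u. if u \<in> hcarrier (cpow (dim_row Z))
       then K Z W (mat (dim_row Z) (dim_row W) (\<lambda>(i, j). u i * v j)) y else 0) else 0)"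

definition is_nc_rkhs :: "'v::complex_vector mat set \<Rightarrow> 'e::complex_vector hspace \<Rightarrow>
    ('v mat \<Rightarrow> 'v mat \<Rightarrow> complex mat \<Rightarrow> (nat \<Rightarrow> 'e) \<Rightarrow> (nat \<Rightarrow> 'e)) \<Rightarrow>
    ('v mat \<Rightarrow> (nat \<Rightarrow> complex) \<Rightarrow> (nat \<Rightarrow> 'e)) hspace \<Rightarrow> bool" where
  "is_nc_rkhs \<Delta> E K H \<longleftrightarrow> hilbert_space H \<and>
     (\<forall>f\<in>hcarrier H. nc_function \<Delta> complex_hspace E f \<and> (\<forall>Z. Z \<notin> \<Delta> \<longrightarrow> f Z = 0)) \<and>
     (\<forall>W\<in>\<Delta>. \<forall>v\<in>hcarrier (cpow (dim_row W)). \<forall>y\<in>hcarrier (hpow (dim_row W) E).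
        kernel_element \<Delta> K W v y \<in> hcarrier H \<and>
        (\<forall>f\<in>hcarrier H. hinner (hpow (dim_row W) E) (f W (\<lambda>i. cnj (v i))) y
                          = hinner H f (kernel_element \<Delta> K W v y)))"

definition nc_rkhs :: "'v::complex_vector mat set \<Rightarrow> 'e::complex_vector hspace \<Rightarrow>
    ('v mat \<Rightarrow> 'v mat \<Rightarrow> complex mat \<Rightarrow> (nat \<Rightarrow> 'e) \<Rightarrow> (nat \<Rightarrow> 'e)) \<Rightarrow>
    ('v mat \<Rightarrow> (nat \<Rightarrow> complex) \<Rightarrow> (nat \<Rightarrow> 'e)) hspace" where
  "nc_rkhs \<Delta> E K = (SOME H. is_nc_rkhs \<Delta> E K H)"

definition mult_op :: "'v mat set \<Rightarrow> ('v mat \<Rightarrow> (nat \<Rightarrow> complex) \<Rightarrow> (nat \<Rightarrow> 'u)) hspace \<Rightarrow>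
    ('v mat \<Rightarrow> (nat \<Rightarrow> 'u) \<Rightarrow> (nat \<Rightarrow> 'y)) \<Rightarrow>
    ('v mat \<Rightarrow> (nat \<Rightarrow> complex) \<Rightarrow> (nat \<Rightarrow> 'u)) \<Rightarrow> 'v mat \<Rightarrow> (nat \<Rightarrow> complex) \<Rightarrow> (nat \<Rightarrow> 'y::zero)" where
  "mult_op \<Delta> H S = (\<lambda>f. if f \<in> hcarrier H then (\<lambda>W. if W \<in> \<Delta> then S W \<circ> f W else 0) else 0)"

definition contractive_multipliers :: "'v::complex_vector mat set \<Rightarrow>
    'u::complex_vector hspace \<Rightarrow> 'y::complex_vector hspace \<Rightarrow>
    ('v mat \<Rightarrow> 'v mat \<Rightarrow> complex mat \<Rightarrow> (nat \<Rightarrow> 'u) \<Rightarrow> (nat \<Rightarrow> 'u)) \<Rightarrow>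
    ('v mat \<Rightarrow> 'v mat \<Rightarrow> complex mat \<Rightarrow> (nat \<Rightarrow> 'y) \<Rightarrow> (nat \<Rightarrow> 'y)) \<Rightarrow>
    ('v mat \<Rightarrow> (nat \<Rightarrow> 'u) \<Rightarrow> (nat \<Rightarrow> 'y)) set" where
  "contractive_multipliers \<Delta> U Y K' K = {S. nc_function \<Delta> U Y S \<and>
     contractive_op (nc_rkhs \<Delta> U K') (nc_rkhs \<Delta> Y K) (mult_op \<Delta> (nc_rkhs \<Delta> U K') S)}"


section \<open>Transfer functions\<close>

definition transfer_function ::
  "'r::complex_vector hspace \<Rightarrow> 'x::complex_vector hspace \<Rightarrow> 'u::complex_vector hspace \<Rightarrow>
   ('v mat \<Rightarrow> (nat \<Rightarrow> 'r) \<Rightarrow> (nat \<Rightarrow> complex)) \<Rightarrow>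
   ('x \<Rightarrow> 'r \<times> 'x \<Rightarrow> complex) \<Rightarrow> ('u \<Rightarrow> 'r \<times> 'x \<Rightarrow> complex) \<Rightarrow> ('x \<Rightarrow> 'y::complex_vector) \<Rightarrow> ('u \<Rightarrow> 'y) \<Rightarrow>
   'v mat \<Rightarrow> (nat \<Rightarrow> 'u) \<Rightarrow> (nat \<Rightarrow> 'y)" where
  "transfer_function R X U Q A B C D Z =
     (let n = dim_row Z; QX = tensor_id n R X (Q Z) in
        ampliation n U D +
        (ampliation n X C \<circ> op_inverse (hpow n X) (id_op (hpow n X) - (QX \<circ> ampliation n X A))
          \<circ> QX \<circ> ampliation n U B))"

text \<open>HOL cannot quantify existentially over types, so the existential quantifier over state spaces
  needs a fixed ambient type. The space \<open>\<ell>\<^sup>2(I)\<close> over the infinite set \<open>I\<close> of all lists below is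
  contained in it; \<open>I\<close> is at least as large as the sets underlying all spaces involved and the set of
  all matrices over \<open>'v\<close>, which leaves room for the state space of a unitary realization.\<close>

type_synonym ('v, 'r, 'u, 'y) state_ambient = "('v + 'r + 'u + 'y + nat) list \<Rightarrow> complex"

end

theory Submission
  imports Defs "HOL-Library.Countable_Set_Type"
begin

text \<open>
  Let \<open>q\<^sub>i\<^sub>j\<close> be the \<open>j\<close>-th entry of \<open>Q(W)\<^sup>* e\<^sub>i\<close>. Entrywise, the scalar kernel is the series \<open>kker p = \<Sum>\<^sub>k \<phi>\<^sup>k p\<close>,
  where \<open>(\<phi> p)\<^sub>i\<^sub>l = \<Sum>\<^sub>a\<^sub>b p\<^sub>a\<^sub>b \<langle>q\<^sub>l\<^sub>b, q\<^sub>i\<^sub>a\<rangle>\<close>, so that \<open>kker p = p + kker (\<phi> p) = p + \<phi> (kker p)\<close>.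
  The adjoint of \<open>M\<^sub>S\<close> sends the kernel element of \<open>(W, v, y)\<close> to that of \<open>(W, v, S(W)\<^sup>* y)\<close>; hence an nc
  function \<open>S\<close> is a contractive multiplier if and only if the difference \<open>KS\<close> of the two Gram kernels
  is positive semidefinite.

  If \<open>S\<close> is the transfer function of a contraction \<open>T\<close>, then the fixed point \<open>F\<close> of
  \<open>T\<^sup>* ((Q\<^sup>* \<otimes> I) F, y) = (F, s)\<close> satisfies \<open>s = S(W)\<^sup>* y\<close>, and \<open>KS\<close> is the sum of a Gram kernel and a
  Schur product of the scalar kernel with the defect kernel of \<open>T\<^sup>*\<close>. Conversely, if \<open>KS\<close> is the Gram kernel
  of a family \<open>f\<close>, the identity for \<open>kker\<close> shows that
  \<open>(f\<^sub>p, (S(W)\<^sup>* y)\<^sub>p) \<mapsto> (\<Sum>\<^sub>l q\<^sub>l\<^sub>p \<otimes> f\<^sub>l, y\<^sub>p)\<close> preserves inner products. Once a sufficiently large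
  \<open>l\<^sup>2\<close> space is added to the state space, the orthogonal complements of the two families have the same
  dimension, and the isometry extends to a unitary operator, whose blocks realize \<open>S\<close>.
\<close>

section \<open>Inner products\<close>

text \<open>\<open>rk_space\<close> and \<open>nc_rkhs\<close> are values of the choice operator,
  and \<open>tensor_id\<close>, \<open>tensor_power_id\<close>, \<open>op_adjoint\<close>,
  \<open>op_inverse\<close> are definite descriptions. Nothing can be computed with them before
  existence (for descriptions also uniqueness) is established, which is why completion, Riesz
  representation and extension from total families are built up at length. Positivity is handled
  through finite sums of kernel values, with the Schur product theorem in place of operator
  inequalities.

  The obstacle in the converse direction is the type of the state space: it has to consist of
  functions on lists. The abstract space of \<open>KS\<close> is therefore indexed by triples of a
  matrix, a coordinate and a vector, which a list can encode, and is embedded by pairing with a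
  total family indexed by lists. The added \<open>l^2\<close> space bounds both orthogonal
  complements from below in dimension, small total sets bound them from above. In
  \<open>R \<otimes> X\<close> the lower bound comes from the vectors
  \<open>r \<otimes> \<eta> i\<close> with a unit vector \<open>r\<close>, which exists because
  \<open>R\<close> is nonzero.\<close>

definition pre_hilbert :: "'a::complex_vector hspace \<Rightarrow> bool" where
  "pre_hilbert H \<longleftrightarrow>
     complex_vector.subspace (hcarrier H) \<and>
     (\<forall>x\<in>hcarrier H. \<forall>y\<in>hcarrier H. hinner H y x = cnj (hinner H x y)) \<and>
     (\<forall>x\<in>hcarrier H. \<forall>y\<in>hcarrier H. \<forall>z\<in>hcarrier H.
        hinner H (x + y) z = hinner H x z + hinner H y z) \<and>
     (\<forall>x\<in>hcarrier H. \<forall>y\<in>hcarrier H. \<forall>a. hinner H (a *\<^sub>C x) y = a * hinner H x y) \<and>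
     (\<forall>x\<in>hcarrier H. 0 \<le> Re (hinner H x x))"

text \<open>The calculus below is developed for \<open>pre_hilbert\<close>, without definiteness and
  completeness: the finitely supported functions that are later completed to a reproducing kernel
  space carry a form that may be degenerate.\<close>

lemma hilbert_pre_hilbert [simp]: "hilbert_space H \<Longrightarrow> pre_hilbert H"
  unfolding hilbert_space_def pre_hilbert_def by (elim conjE) (intro conjI)

lemma scaleC_0_left [simp]: "0 *\<^sub>C (x::'a::complex_vector) = 0"
  by (rule complex_vector.scale_zero_left)

declare scaleC_one [simp]

lemma scaleC_sum_right: "a *\<^sub>C (\<Sum>i\<in>F. f i) = (\<Sum>i\<in>F. a *\<^sub>C (f i::'a::complex_vector))"
  by (rule complex_vector.scale_sum_right)

lemma scaleC_diff_right: "a *\<^sub>C (x - y) = a *\<^sub>C x - a *\<^sub>C (y::'a::complex_vector)"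
  by (rule complex_vector.scale_right_diff_distrib)

lemma null_le:
  fixes f :: "nat \<Rightarrow> 'b::real_normed_vector"
  assumes "\<And>n. norm (f n) \<le> g n" "g \<longlonglongrightarrow> 0"
  shows "f \<longlonglongrightarrow> 0"
  by (rule tendsto_norm_zero_cancel, rule tendsto_sandwich[OF _ _ tendsto_const assms(2)])
    (simp_all add: assms(1))

context
  fixes H :: "'a::complex_vector hspace"
  assumes H: "pre_hilbert H"
begin

lemma hsubspace: "complex_vector.subspace (hcarrier H)"
  using H unfolding pre_hilbert_def by blast

lemma zero_in [simp]: "0 \<in> hcarrier H"
  using hsubspace by (rule complex_vector.subspace_0)

lemma add_in [simp]: "x \<in> hcarrier H \<Longrightarrow> y \<in> hcarrier H \<Longrightarrow> x + y \<in> hcarrier H"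
  using hsubspace by (rule complex_vector.subspace_add)

lemma scale_in [simp]: "x \<in> hcarrier H \<Longrightarrow> a *\<^sub>C x \<in> hcarrier H"
  using hsubspace by (rule complex_vector.subspace_scale)

lemma diff_in [simp]: "x \<in> hcarrier H \<Longrightarrow> y \<in> hcarrier H \<Longrightarrow> x - y \<in> hcarrier H"
  using hsubspace by (rule complex_vector.subspace_diff)

lemma minus_in [simp]: "x \<in> hcarrier H \<Longrightarrow> - x \<in> hcarrier H"
  using hsubspace by (rule complex_vector.subspace_neg)

lemma sum_in [simp]: "(\<And>i. i \<in> F \<Longrightarrow> f i \<in> hcarrier H) \<Longrightarrow> (\<Sum>i\<in>F. f i) \<in> hcarrier H"
  using hsubspace by (rule complex_vector.subspace_sum)

lemma inner_commute:
  "x \<in> hcarrier H \<Longrightarrow> y \<in> hcarrier H \<Longrightarrow> hinner H y x = cnj (hinner H x y)"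
  using H unfolding pre_hilbert_def by blast

lemma inner_add_left [simp]:
  "x \<in> hcarrier H \<Longrightarrow> y \<in> hcarrier H \<Longrightarrow> z \<in> hcarrier H \<Longrightarrow>
   hinner H (x + y) z = hinner H x z + hinner H y z"
  using H unfolding pre_hilbert_def by blast

lemma inner_scale_left [simp]:
  "x \<in> hcarrier H \<Longrightarrow> y \<in> hcarrier H \<Longrightarrow> hinner H (a *\<^sub>C x) y = a * hinner H x y"
  using H unfolding pre_hilbert_def by blast

lemma inner_self_nonneg: "x \<in> hcarrier H \<Longrightarrow> 0 \<le> Re (hinner H x x)"
  using H unfolding pre_hilbert_def by blast

lemma inner_zero_left [simp]: "y \<in> hcarrier H \<Longrightarrow> hinner H 0 y = 0"
  using inner_scale_left[of 0 y 0] by simp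

lemma inner_zero_right [simp]: "y \<in> hcarrier H \<Longrightarrow> hinner H y 0 = 0"
  using inner_commute[of 0 y] by simp

lemma inner_add_right [simp]:
  "x \<in> hcarrier H \<Longrightarrow> y \<in> hcarrier H \<Longrightarrow> z \<in> hcarrier H \<Longrightarrow>
   hinner H z (x + y) = hinner H z x + hinner H z y"
  using inner_commute[of "x + y" z] inner_commute[of x z] inner_commute[of y z] by simp

lemma inner_scale_right [simp]:
  "x \<in> hcarrier H \<Longrightarrow> y \<in> hcarrier H \<Longrightarrow> hinner H y (a *\<^sub>C x) = cnj a * hinner H y x"
  using inner_commute[of "a *\<^sub>C x" y] inner_commute[of x y] by simp

lemma inner_minus_left [simp]:
  "x \<in> hcarrier H \<Longrightarrow> y \<in> hcarrier H \<Longrightarrow> hinner H (- x) y = - hinner H x y"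
  using inner_scale_left[of x y "-1"] by simp

lemma inner_minus_right [simp]:
  "x \<in> hcarrier H \<Longrightarrow> y \<in> hcarrier H \<Longrightarrow> hinner H y (- x) = - hinner H y x"
  using inner_scale_right[of x y "-1"] by simp

lemma inner_diff_left [simp]:
  "x \<in> hcarrier H \<Longrightarrow> y \<in> hcarrier H \<Longrightarrow> z \<in> hcarrier H \<Longrightarrow>
   hinner H (x - y) z = hinner H x z - hinner H y z"
  using inner_add_left[of x "- y" z] by simp

lemma inner_diff_right [simp]:
  "x \<in> hcarrier H \<Longrightarrow> y \<in> hcarrier H \<Longrightarrow> z \<in> hcarrier H \<Longrightarrow>
   hinner H z (x - y) = hinner H z x - hinner H z y"
  using inner_add_right[of x "- y" z] by simp

lemma inner_sum_left:
  assumes "\<And>i. i \<in> F \<Longrightarrow> f i \<in> hcarrier H" "z \<in> hcarrier H"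
  shows "hinner H (\<Sum>i\<in>F. f i) z = (\<Sum>i\<in>F. hinner H (f i) z)"
  using assms(1) by (induction F rule: infinite_finite_induct) (simp_all add: assms(2))

lemma inner_sum_right:
  assumes "\<And>i. i \<in> F \<Longrightarrow> f i \<in> hcarrier H" "z \<in> hcarrier H"
  shows "hinner H z (\<Sum>i\<in>F. f i) = (\<Sum>i\<in>F. hinner H z (f i))"
  using assms(1) by (induction F rule: infinite_finite_induct) (simp_all add: assms(2))

lemma inner_lincomb_left:
  assumes "\<And>i. i \<in> F \<Longrightarrow> f i \<in> hcarrier H" "z \<in> hcarrier H"
  shows "hinner H (\<Sum>i\<in>F. c i *\<^sub>C f i) z = (\<Sum>i\<in>F. c i * hinner H (f i) z)"
  using assms by (subst inner_sum_left) simp_all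

lemma inner_lincomb_right:
  assumes "\<And>i. i \<in> F \<Longrightarrow> f i \<in> hcarrier H" "z \<in> hcarrier H"
  shows "hinner H z (\<Sum>i\<in>F. c i *\<^sub>C f i) = (\<Sum>i\<in>F. cnj (c i) * hinner H z (f i))"
  using assms by (subst inner_sum_right) simp_all

lemma inner_lincomb:
  assumes "\<And>i. i \<in> F \<Longrightarrow> f i \<in> hcarrier H" "\<And>j. j \<in> G \<Longrightarrow> g j \<in> hcarrier H"
  shows "hinner H (\<Sum>i\<in>F. c i *\<^sub>C f i) (\<Sum>j\<in>G. d j *\<^sub>C g j)
       = (\<Sum>i\<in>F. \<Sum>j\<in>G. c i * cnj (d j) * hinner H (f i) (g j))"
  using assms
  by (subst inner_lincomb_left) (simp_all add: inner_lincomb_right sum_distrib_left mult.assoc)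

lemma inner_self: "x \<in> hcarrier H \<Longrightarrow> hinner H x x = of_real ((hnorm H x)\<^sup>2)"
proof -
  assume x: "x \<in> hcarrier H"
  have "cnj (hinner H x x) = hinner H x x" using inner_commute[OF x x] by simp
  then have "Im (hinner H x x) = 0" by (metis cnj.simps(2) equal_neg_zero)
  then show ?thesis using inner_self_nonneg[OF x] by (simp add: hnorm_def complex_eq_iff)
qed

lemma hnorm_sq: "x \<in> hcarrier H \<Longrightarrow> (hnorm H x)\<^sup>2 = Re (hinner H x x)"
  by (simp add: inner_self)

lemma hnorm_nonneg [simp]: "x \<in> hcarrier H \<Longrightarrow> 0 \<le> hnorm H x"
  by (simp add: hnorm_def inner_self_nonneg)

lemma hnorm_zero [simp]: "hnorm H 0 = 0"
  by (simp add: hnorm_def)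

lemma hnorm_scale [simp]: "x \<in> hcarrier H \<Longrightarrow> hnorm H (a *\<^sub>C x) = cmod a * hnorm H x"
proof -
  assume x: "x \<in> hcarrier H"
  have "hinner H (a *\<^sub>C x) (a *\<^sub>C x) = of_real ((cmod a)\<^sup>2) * hinner H x x"
    using x by (simp add: complex_norm_square mult.assoc[symmetric] del: of_real_power)
  then show ?thesis unfolding hnorm_def by (simp add: real_sqrt_mult)
qed

lemma hnorm_minus [simp]: "x \<in> hcarrier H \<Longrightarrow> hnorm H (- x) = hnorm H x"
  using hnorm_scale[of x "-1"] by simp

lemma hnorm_diff_commute: "x \<in> hcarrier H \<Longrightarrow> y \<in> hcarrier H \<Longrightarrow> hnorm H (x - y) = hnorm H (y - x)"
  using hnorm_minus[of "x - y"] by simp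

lemma hnorm_add_sq: "x \<in> hcarrier H \<Longrightarrow> y \<in> hcarrier H \<Longrightarrow>
   (hnorm H (x + y))\<^sup>2 = (hnorm H x)\<^sup>2 + (hnorm H y)\<^sup>2 + 2 * Re (hinner H x y)"
  using inner_commute[of x y] by (simp add: hnorm_sq)

lemma hnorm_diff_sq: "x \<in> hcarrier H \<Longrightarrow> y \<in> hcarrier H \<Longrightarrow>
   (hnorm H (x - y))\<^sup>2 = (hnorm H x)\<^sup>2 + (hnorm H y)\<^sup>2 - 2 * Re (hinner H x y)"
  using inner_commute[of x y] by (simp add: hnorm_sq)

text \<open>A unimodular \<open>a\<close> turns the inner product into its modulus, and the square
  of the norm of \<open>s a x - t y\<close> is nonnegative. In a degenerate space a nonzero vector
  may have norm 0, so the usual division by norms is replaced by \<open>s = hnorm H y + e\<close>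
  and \<open>t = hnorm H x + e\<close>, with \<open>e\<close> tending to 0.\<close>

lemma cauchy_schwarz:
  assumes x: "x \<in> hcarrier H" and y: "y \<in> hcarrier H"
  shows "cmod (hinner H x y) \<le> hnorm H x * hnorm H y"
proof -
  obtain a where a: "cmod a = 1" "a * hinner H x y = of_real (cmod (hinner H x y))"
  proof (cases "hinner H x y = 0")
    case True
    then show thesis using that[of 1] by simp
  next
    case False
    let ?z = "hinner H x y"
    have "cmod (cnj ?z / of_real (cmod ?z)) = 1" using False by (simp add: norm_divide)
    moreover have "cnj ?z / of_real (cmod ?z) * ?z = of_real (cmod ?z)"
      using False complex_norm_square[of ?z] by (simp add: field_simps power2_eq_square)
    ultimately show thesis by (rule that)
  qed
  have key: "2 * s * cmod (hinner H x y) * t \<le> s\<^sup>2 * (hnorm H x)\<^sup>2 + t\<^sup>2 * (hnorm H y)\<^sup>2" for s t :: real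
  proof -
    let ?u = "(of_real s * a) *\<^sub>C x" and ?v = "(of_real t :: complex) *\<^sub>C y"
    have "hinner H ?u ?v = of_real (s * t) * (a * hinner H x y)" using x y by simp
    then have "Re (hinner H ?u ?v) = s * t * cmod (hinner H x y)"
      unfolding a(2) by simp
    moreover have "0 \<le> (hnorm H (?u - ?v))\<^sup>2" by simp
    moreover have "(hnorm H ?u)\<^sup>2 = s\<^sup>2 * (hnorm H x)\<^sup>2" "(hnorm H ?v)\<^sup>2 = t\<^sup>2 * (hnorm H y)\<^sup>2"
      using x y by (simp_all add: norm_mult a(1) power_mult_distrib)
    ultimately show ?thesis
      using hnorm_diff_sq[of ?u ?v] scale_in[OF x] scale_in[OF y] by (simp only:) (simp add: mult.commute mult.left_commute mult.assoc)
  qed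
  have "cmod (hinner H x y) \<le> (hnorm H x + e) * (hnorm H y + e)" if e: "e > 0" for e
  proof -
    define X where "X = hnorm H x + e"
    define Y where "Y = hnorm H y + e"
    have pos: "0 < X" "0 < Y"
      using e hnorm_nonneg[OF x] hnorm_nonneg[OF y] unfolding X_def Y_def by auto
    have "(hnorm H x)\<^sup>2 \<le> X\<^sup>2" "(hnorm H y)\<^sup>2 \<le> Y\<^sup>2"
      using e hnorm_nonneg[OF x] hnorm_nonneg[OF y] unfolding X_def Y_def by (auto intro!: power_mono)
    then have "2 * Y * cmod (hinner H x y) * X \<le> Y\<^sup>2 * X\<^sup>2 + X\<^sup>2 * Y\<^sup>2"
      using key[of Y X] by (smt (verit) mult_left_mono zero_le_power2)
    then have "(2 * X * Y) * cmod (hinner H x y) \<le> (2 * X * Y) * (X * Y)"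
      by (simp add: power2_eq_square mult.assoc mult.left_commute mult.commute)
    then show ?thesis unfolding X_def[symmetric] Y_def[symmetric] using pos by simp
  qed
  then have "\<forall>\<^sub>F e in at_right 0. cmod (hinner H x y) \<le> (hnorm H x + e) * (hnorm H y + e)"
    unfolding eventually_at_right_field by (auto intro!: exI[of _ 1])
  moreover have "((\<lambda>e. (hnorm H x + e) * (hnorm H y + e)) \<longlongrightarrow> (hnorm H x + 0) * (hnorm H y + 0)) (at_right 0)"
    by (intro tendsto_intros)
  ultimately show ?thesis using tendsto_lowerbound by force
qed

lemma hnorm_triangle:
  assumes x: "x \<in> hcarrier H" and y: "y \<in> hcarrier H"
  shows "hnorm H (x + y) \<le> hnorm H x + hnorm H y"
proof -
  have "Re (hinner H x y) \<le> hnorm H x * hnorm H y"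
    using cauchy_schwarz[OF x y] complex_Re_le_cmod order_trans by blast
  then have "(hnorm H (x + y))\<^sup>2 \<le> (hnorm H x + hnorm H y)\<^sup>2"
    using x y by (simp add: hnorm_add_sq power2_sum)
  then show ?thesis using x y by (meson add_nonneg_nonneg hnorm_nonneg power2_le_imp_le)
qed

lemma hnorm_triangle3:
  assumes "x \<in> hcarrier H" "y \<in> hcarrier H" "z \<in> hcarrier H"
  shows "hnorm H (x - z) \<le> hnorm H (x - y) + hnorm H (y - z)"
  using hnorm_triangle[of "x - y" "y - z"] assms by simp

lemma hnorm_diff_ge:
  assumes "x \<in> hcarrier H" "y \<in> hcarrier H"
  shows "\<bar>hnorm H x - hnorm H y\<bar> \<le> hnorm H (x - y)"
  using hnorm_triangle[of "x - y" y] hnorm_triangle[of "y - x" x] hnorm_diff_commute[of x y] assms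
  by simp

lemma hnorm_sum_le:
  assumes "\<And>i. i \<in> F \<Longrightarrow> f i \<in> hcarrier H"
  shows "hnorm H (\<Sum>i\<in>F. f i) \<le> (\<Sum>i\<in>F. hnorm H (f i))"
  using assms
proof (induction F rule: infinite_finite_induct)
  case (insert a F)
  then have "hnorm H (f a + (\<Sum>i\<in>F. f i)) \<le> hnorm H (f a) + hnorm H (\<Sum>i\<in>F. f i)"
    by (intro hnorm_triangle) auto
  then show ?case using insert by force
qed simp_all

lemma inner_le: "x \<in> hcarrier H \<Longrightarrow> y \<in> hcarrier H \<Longrightarrow> Re (hinner H x y) \<le> hnorm H x * hnorm H y"
  using cauchy_schwarz complex_Re_le_cmod order_trans by blast

section \<open>Limits in norm\<close>

lemma hlim_inner:
  assumes s: "\<And>n. s n \<in> hcarrier H" and x: "x \<in> hcarrier H" and y: "y \<in> hcarrier H"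
    and l: "(\<lambda>n. hnorm H (s n - x)) \<longlonglongrightarrow> 0"
  shows "(\<lambda>n. hinner H (s n) y) \<longlonglongrightarrow> hinner H x y"
proof -
  have "(\<lambda>n. hinner H (s n) y - hinner H x y) \<longlonglongrightarrow> 0"
  proof (rule null_le)
    show "norm (hinner H (s n) y - hinner H x y) \<le> hnorm H (s n - x) * hnorm H y" for n
      using cauchy_schwarz[of "s n - x" y] s x y by simp
    show "(\<lambda>n. hnorm H (s n - x) * hnorm H y) \<longlonglongrightarrow> 0"
      using tendsto_mult_left_zero[OF l] by simp
  qed
  then show ?thesis by (simp add: LIM_zero_iff)
qed

lemma hlim_norm:
  assumes s: "\<And>n. s n \<in> hcarrier H" and x: "x \<in> hcarrier H"
    and l: "(\<lambda>n. hnorm H (s n - x)) \<longlonglongrightarrow> 0"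
  shows "(\<lambda>n. hnorm H (s n)) \<longlonglongrightarrow> hnorm H x"
proof -
  have "(\<lambda>n. hnorm H (s n) - hnorm H x) \<longlonglongrightarrow> 0"
    by (rule null_le[OF _ l]) (use hnorm_diff_ge s x in auto)
  then show ?thesis by (simp add: LIM_zero_iff)
qed

end

lemma inner_eq_zero: "hilbert_space H \<Longrightarrow> x \<in> hcarrier H \<Longrightarrow> hinner H x x = 0 \<Longrightarrow> x = 0"
  unfolding hilbert_space_def by blast

lemma hnorm_eq_zero: "hilbert_space H \<Longrightarrow> x \<in> hcarrier H \<Longrightarrow> hnorm H x = 0 \<Longrightarrow> x = 0"
  by (rule inner_eq_zero, assumption, assumption) (subst inner_self, simp_all)

lemma hilbert_complete:
  fixes H :: "'a::complex_vector hspace"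
  assumes "hilbert_space H" "\<And>n. s n \<in> hcarrier H"
    "\<And>e. e > 0 \<Longrightarrow> \<exists>N. \<forall>m\<ge>N. \<forall>n\<ge>N. hnorm H (s m - s n) < e"
  obtains x where "x \<in> hcarrier H" "(\<lambda>n. hnorm H (s n - x)) \<longlonglongrightarrow> 0"
proof -
  have "\<forall>s::nat \<Rightarrow> 'a. (\<forall>n. s n \<in> hcarrier H) \<longrightarrow>
        (\<forall>e>0. \<exists>N. \<forall>m\<ge>N. \<forall>n\<ge>N. hnorm H (s m - s n) < e) \<longrightarrow>
        (\<exists>x\<in>hcarrier H. (\<lambda>n. hnorm H (s n - x)) \<longlonglongrightarrow> 0)"
    using assms(1) unfolding hilbert_space_def by (elim conjE)
  from this[rule_format, of s] assms(2,3) that show thesis by blast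
qed

lemma hilbert_spaceI:
  assumes "pre_hilbert H"
    "\<And>x. x \<in> hcarrier H \<Longrightarrow> hinner H x x = 0 \<Longrightarrow> x = 0"
    "\<And>s. (\<And>n. s n \<in> hcarrier H) \<Longrightarrow>
       (\<And>e. e > 0 \<Longrightarrow> \<exists>N. \<forall>m\<ge>N. \<forall>n\<ge>N. hnorm H (s m - s n) < e) \<Longrightarrow>
       \<exists>x\<in>hcarrier H. (\<lambda>n. hnorm H (s n - x)) \<longlonglongrightarrow> 0"
  shows "hilbert_space H"
  unfolding hilbert_space_def
proof (intro conjI)
  show "\<forall>s. (\<forall>n. s n \<in> hcarrier H) \<longrightarrow> (\<forall>e>0. \<exists>N. \<forall>m\<ge>N. \<forall>n\<ge>N. hnorm H (s m - s n) < e) \<longrightarrow>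
        (\<exists>x\<in>hcarrier H. (\<lambda>n. hnorm H (s n - x)) \<longlonglongrightarrow> 0)"
    using assms(3) by (intro allI impI) blast
  show "\<forall>x\<in>hcarrier H. hinner H x x = 0 \<longrightarrow> x = 0"
    using assms(2) by blast
qed (insert assms(1), unfold pre_hilbert_def, (elim conjE, assumption)+)

lemma inner_ext:
  assumes "hilbert_space H" "x \<in> hcarrier H" "y \<in> hcarrier H"
    "\<And>z. z \<in> hcarrier H \<Longrightarrow> hinner H x z = hinner H y z"
  shows "x = y"
proof -
  have "hinner H (x - y) (x - y) = 0" using assms by simp
  moreover have "x - y \<in> hcarrier H" using assms by simp
  ultimately have "x - y = 0" by (rule inner_eq_zero[OF assms(1), rotated])
  then show ?thesis by simp
qed

lemma hlim_unique:
  assumes H: "hilbert_space H" and s: "\<And>n. s n \<in> hcarrier H" and x: "x \<in> hcarrier H" "y \<in> hcarrier H"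
    and l: "(\<lambda>n. hnorm H (s n - x)) \<longlonglongrightarrow> 0" "(\<lambda>n. hnorm H (s n - y)) \<longlonglongrightarrow> 0"
  shows "x = y"
proof (rule inner_ext[OF H x])
  fix z assume "z \<in> hcarrier H"
  then show "hinner H x z = hinner H y z"
    using hlim_inner[of H s x z] hlim_inner[of H s y z] LIMSEQ_unique assms by auto
qed

lemma hlim_Cauchy:
  assumes H: "pre_hilbert H" and s: "\<And>n. s n \<in> hcarrier H" and x: "x \<in> hcarrier H"
    and l: "(\<lambda>n. hnorm H (s n - x)) \<longlonglongrightarrow> 0" and e: "e > 0"
  shows "\<exists>N. \<forall>m\<ge>N. \<forall>n\<ge>N. hnorm H (s m - s n) < e"
proof -
  obtain N where N: "\<And>n. n \<ge> N \<Longrightarrow> hnorm H (s n - x) < e/2"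
    using LIMSEQ_D[OF l, of "e/2"] e by (metis abs_ge_self diff_zero half_gt_zero order_le_less_trans real_norm_def)
  have "hnorm H (s m - s n) < e" if "m \<ge> N" "n \<ge> N" for m n
    using hnorm_triangle3[OF H s x s, of m n] N[OF that(1)] N[OF that(2)]
      hnorm_diff_commute[OF H x s, of n] by simp
  then show ?thesis by blast
qed

section \<open>Orthogonal projections\<close>

definition hclosed :: "'a::complex_vector hspace \<Rightarrow> 'a set \<Rightarrow> bool" where
  "hclosed H M \<longleftrightarrow> M \<subseteq> hcarrier H \<and> complex_vector.subspace M \<and>
     (\<forall>s x. (\<forall>n::nat. s n \<in> M) \<longrightarrow> x \<in> hcarrier H \<longrightarrow> (\<lambda>n. hnorm H (s n - x)) \<longlonglongrightarrow> 0 \<longrightarrow> x \<in> M)"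

lemma hclosed_limit:
  assumes "hclosed H M" "\<And>n::nat. s n \<in> M" "x \<in> hcarrier H" "(\<lambda>n. hnorm H (s n - x)) \<longlonglongrightarrow> 0"
  shows "x \<in> M"
  using assms unfolding hclosed_def by blast

lemma hnorm_parallelogram:
  assumes H: "pre_hilbert H" and x: "x \<in> hcarrier H" and y: "y \<in> hcarrier H"
  shows "(hnorm H (x + y))\<^sup>2 + (hnorm H (x - y))\<^sup>2 = 2 * (hnorm H x)\<^sup>2 + 2 * (hnorm H y)\<^sup>2"
  using hnorm_add_sq[OF assms] hnorm_diff_sq[OF assms] by simp

text \<open>A minimizing sequence is Cauchy by the parallelogram law: the midpoint of two of its
  members stays in \<open>M\<close> and so has distance at least \<open>d\<close> from
  \<open>x\<close>. Completeness of \<open>H\<close> and closedness of \<open>M\<close> supply the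
  limit.\<close>

lemma closest_point:
  assumes H: "hilbert_space H" and M: "hclosed H M" and x: "x \<in> hcarrier H"
  obtains m where "m \<in> M" "\<And>z. z \<in> M \<Longrightarrow> hnorm H (x - m) \<le> hnorm H (x - z)"
proof -
  have Hp: "pre_hilbert H" using H by simp
  have sub: "complex_vector.subspace M" and MH: "M \<subseteq> hcarrier H" using M unfolding hclosed_def by auto
  have M0: "0 \<in> M" using sub by (rule complex_vector.subspace_0)
  define d where "d = Inf ((\<lambda>z. hnorm H (x - z)) ` M)"
  have bdd: "bdd_below ((\<lambda>z. hnorm H (x - z)) ` M)"
    using MH x Hp by (intro bdd_belowI[of _ 0]) (auto intro!: hnorm_nonneg diff_in)
  have d_le: "d \<le> hnorm H (x - z)" if "z \<in> M" for z
    unfolding d_def using that bdd by (auto intro: cInf_lower)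
  have "\<exists>z\<in>M. hnorm H (x - z) < d + 1 / real (Suc n)" for n
  proof -
    have "Inf ((\<lambda>z. hnorm H (x - z)) ` M) < d + 1 / real (Suc n)" unfolding d_def[symmetric] by simp
    then show ?thesis using cInf_lessD[of "(\<lambda>z. hnorm H (x - z)) ` M"] M0 by blast
  qed
  then obtain s where sM: "\<And>n. s n \<in> M" and s: "\<And>n. hnorm H (x - s n) < d + 1 / real (Suc n)"
    by metis
  have sH: "s n \<in> hcarrier H" for n using sM MH by auto
  have d0: "0 \<le> d" unfolding d_def using M0 MH x Hp by (intro cInf_greatest) (auto intro!: hnorm_nonneg diff_in)
  have est: "(hnorm H (s m - s n))\<^sup>2 \<le> 2 * (hnorm H (x - s m))\<^sup>2 + 2 * (hnorm H (x - s n))\<^sup>2 - 4 * d\<^sup>2" for m n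
  proof -
    let ?a = "x - s m" and ?b = "x - s n"
    have ab: "?a \<in> hcarrier H" "?b \<in> hcarrier H" using Hp x sH by simp_all
    let ?h = "(1/2 :: complex)"
    have mid: "?h *\<^sub>C (s m + s n) \<in> M"
      using sub sM by (meson complex_vector.subspace_add complex_vector.subspace_scale)
    have "?a + ?b = (2::complex) *\<^sub>C (x - ?h *\<^sub>C (s m + s n))"
    proof -
      have "(2::complex) *\<^sub>C x = x + x" using scaleC_add_left[of 1 1 x] by simp
      then show ?thesis by (simp add: scaleC_diff_right scaleC_scaleC)
    qed
    then have "hnorm H (?a + ?b) = 2 * hnorm H (x - ?h *\<^sub>C (s m + s n))"
      using mid MH x Hp by (simp add: subset_eq)
    moreover have "d \<le> hnorm H (x - ?h *\<^sub>C (s m + s n))" using mid by (rule d_le)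
    ultimately have "(2 * d)\<^sup>2 \<le> (hnorm H (?a + ?b))\<^sup>2" using d0 by (intro power_mono) auto
    moreover have "hnorm H (?a - ?b) = hnorm H (s m - s n)"
      using hnorm_diff_commute[OF Hp sH sH, of n m] by simp
    ultimately show ?thesis using hnorm_parallelogram[OF Hp ab] by (simp add: power_mult_distrib)
  qed
  have "\<exists>N. \<forall>m\<ge>N. \<forall>n\<ge>N. hnorm H (s m - s n) < e" if e: "e > 0" for e
  proof -
    \<comment> \<open>Beyond index \<open>N\<close> the estimate \<open>est\<close> is at most
      \<open>4 * (D - d^2)\<close>, where \<open>D\<close> is the square of
      \<open>d + 1 / (N + 1)\<close>; it suffices that this quantity falls below
      \<open>e^2\<close>.\<close>
    have "(\<lambda>n. 4 * ((d + 1 / real (Suc n))\<^sup>2 - d\<^sup>2)) \<longlonglongrightarrow> 4 * ((d + 0)\<^sup>2 - d\<^sup>2)"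
      by (intro tendsto_intros LIMSEQ_Suc[OF lim_1_over_n])
    then have "\<forall>\<^sub>F n in sequentially. 4 * ((d + 1 / real (Suc n))\<^sup>2 - d\<^sup>2) < e\<^sup>2"
      using e by (intro order_tendstoD) auto
    then obtain N where N: "4 * ((d + 1 / real (Suc N))\<^sup>2 - d\<^sup>2) < e\<^sup>2"
      unfolding eventually_sequentially by blast
    define D where "D = (d + 1 / real (Suc N))\<^sup>2"
    have bnd: "(hnorm H (x - s n))\<^sup>2 \<le> D" if "n \<ge> N" for n
    proof -
      have "1 / real (Suc n) \<le> 1 / real (Suc N)" using that by (simp add: field_simps)
      then show ?thesis using s[of n] Hp x sH unfolding D_def by (intro power_mono) auto
    qed
    have "hnorm H (s m - s n) < e" if "m \<ge> N" "n \<ge> N" for m n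
    proof -
      have "(hnorm H (s m - s n))\<^sup>2 < e\<^sup>2" 
        using est[of m n] bnd[OF that(1)] bnd[OF that(2)] N[folded D_def] by argo
      then show ?thesis by (rule power2_less_imp_less) (use e in simp)
    qed
    then show ?thesis by blast
  qed
  from hilbert_complete[OF H sH this] obtain m where m: "m \<in> hcarrier H" "(\<lambda>n. hnorm H (s n - m)) \<longlonglongrightarrow> 0"
    by blast
  have mM: "m \<in> M" by (rule hclosed_limit[OF M sM m])
  have "hnorm H (x - m) \<le> d"
  proof (rule LIMSEQ_le)
    have eq: "hnorm H (x - s n - (x - m)) = hnorm H (s n - m)" for n
      using hnorm_diff_commute[OF Hp m(1) sH, of n] by simp
    show "(\<lambda>n. hnorm H (x - s n)) \<longlonglongrightarrow> hnorm H (x - m)"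
      by (rule hlim_norm[OF Hp]) (use m Hp x sH in \<open>simp_all only: eq diff_in\<close>)
    have "(\<lambda>n. d + 1 / real (Suc n)) \<longlonglongrightarrow> d + 0"
      by (intro tendsto_intros LIMSEQ_Suc[OF lim_1_over_n])
    then show "(\<lambda>n. d + 1 / real (Suc n)) \<longlonglongrightarrow> d" by simp
    show "\<exists>N. \<forall>n\<ge>N. hnorm H (x - s n) \<le> d + 1 / real (Suc n)" using s by (meson less_imp_le)
  qed
  then show thesis using that[OF mM] d_le order_trans by blast
qed

text \<open>For \<open>c\<close> the inner product of \<open>x - m\<close> with \<open>z\<close>,
  moving the closest point \<open>m\<close> by \<open>t c z\<close> cannot decrease the distance,
  whence \<open>2 t |c|^2\<close> is at most \<open>t^2 |c|^2\<close> times the squared norm of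
  \<open>z\<close>. For small positive \<open>t\<close> this forces \<open>c = 0\<close>.\<close>

lemma orthogonal_projection:
  assumes H: "hilbert_space H" and M: "hclosed H M" and x: "x \<in> hcarrier H"
  obtains m where "m \<in> M" "\<And>z. z \<in> M \<Longrightarrow> hinner H (x - m) z = 0"
proof -
  have Hp: "pre_hilbert H" using H by simp
  have sub: "complex_vector.subspace M" and MH: "M \<subseteq> hcarrier H" using M unfolding hclosed_def by auto
  obtain m where m: "m \<in> M" and min: "\<And>z. z \<in> M \<Longrightarrow> hnorm H (x - m) \<le> hnorm H (x - z)"
    using closest_point[OF assms] by blast
  have "hinner H (x - m) z = 0" if z: "z \<in> M" for z
  proof -
    let ?w = "x - m" and ?c = "hinner H (x - m) z"
    have w: "?w \<in> hcarrier H" "z \<in> hcarrier H" using x m z MH Hp by auto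
    have ineq: "0 \<le> t\<^sup>2 * ((cmod ?c)\<^sup>2 * (hnorm H z)\<^sup>2) - 2 * t * (cmod ?c)\<^sup>2" for t :: real
    proof -
      let ?a = "of_real t * ?c"
      have "m + ?a *\<^sub>C z \<in> M" using sub m z
        by (meson complex_vector.subspace_add complex_vector.subspace_scale)
      then have "hnorm H ?w \<le> hnorm H (?w - ?a *\<^sub>C z)" using min by (simp add: diff_diff_add)
      then have "(hnorm H ?w)\<^sup>2 \<le> (hnorm H (?w - ?a *\<^sub>C z))\<^sup>2"
        using w Hp by (intro power_mono hnorm_nonneg) auto
      also have "\<dots> = (hnorm H ?w)\<^sup>2 + (cmod ?a * hnorm H z)\<^sup>2 - 2 * Re (cnj ?a * ?c)"
      proof -
        have "hinner H ?w (?a *\<^sub>C z) = cnj ?a * ?c" by (rule inner_scale_right[OF Hp w(2,1)])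
        moreover have "hnorm H (?a *\<^sub>C z) = cmod ?a * hnorm H z" by (rule hnorm_scale[OF Hp w(2)])
        ultimately show ?thesis using hnorm_diff_sq[OF Hp w(1) scale_in[OF Hp w(2)], of ?a] by (simp only:)
      qed
      also have "cnj ?a * ?c = of_real (t * (cmod ?c)\<^sup>2)"
        by (simp only: complex_cnj_mult complex_cnj_complex_of_real of_real_mult complex_norm_square ac_simps)
      finally show ?thesis by (simp add: norm_mult power_mult_distrib algebra_simps)
    qed
    have "?c = 0"
    proof (rule ccontr)
      assume "?c \<noteq> 0"
      then have c: "0 < (cmod ?c)\<^sup>2" by simp
      \<comment> \<open>The added 1 keeps \<open>t\<close> meaningful when \<open>z\<close> has norm
        0, and makes \<open>t\<close> times the squared norm of \<open>z\<close> smaller than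
        2.\<close>
      define t where "t = 1 / ((hnorm H z)\<^sup>2 + 1)"
      have h: "(hnorm H z)\<^sup>2 + 1 > 0" by (simp add: add_nonneg_pos)
      have t: "t > 0" "t * (hnorm H z)\<^sup>2 < 1" unfolding t_def using h by (simp_all add: field_simps)
      have "0 \<le> (t * (cmod ?c)\<^sup>2) * (t * (hnorm H z)\<^sup>2 - 2)" using ineq[of t]
        by (simp add: power2_eq_square algebra_simps)
      moreover have "(t * (cmod ?c)\<^sup>2) * (t * (hnorm H z)\<^sup>2 - 2) < 0"
        using t c by (intro mult_pos_neg) auto
      ultimately show False by linarith
    qed
    then show ?thesis .
  qed
  then show thesis using that m by blast
qed

text \<open>\<open>M\<close> is the closure of the span. The remainder of \<open>x\<close> after
  projection onto \<open>M\<close> is orthogonal to \<open>A\<close>, hence 0 by totality, so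
  \<open>x\<close> itself lies in \<open>M\<close>. Totality in the sense of orthogonality is
  thereby converted into density.\<close>

lemma total_dense:
  assumes H: "hilbert_space H" and A: "A \<subseteq> hcarrier H"
    and tot: "\<And>z. z \<in> hcarrier H \<Longrightarrow> (\<And>a. a \<in> A \<Longrightarrow> hinner H z a = 0) \<Longrightarrow> z = 0"
    and x: "x \<in> hcarrier H" and e: "e > 0"
  obtains s where "s \<in> complex_vector.span A" "hnorm H (x - s) < e"
proof -
  have Hp: "pre_hilbert H" using H by simp
  define M where "M = {x\<in>hcarrier H. \<forall>e>0. \<exists>s\<in>complex_vector.span A. hnorm H (x - s) < e}"
  have MD: "\<exists>s\<in>complex_vector.span A. hnorm H (x - s) < e" if "x \<in> M" "e > 0" for x e
    using that unfolding M_def by blast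
  have spH: "complex_vector.span A \<subseteq> hcarrier H"
    using A hsubspace[OF Hp] by (rule complex_vector.span_minimal)
  have "hclosed H M"
    unfolding hclosed_def
  proof (intro conjI allI impI)
    show "M \<subseteq> hcarrier H" unfolding M_def by auto
    show "complex_vector.subspace M"
      unfolding complex_vector.subspace_def
    proof (intro conjI ballI allI)
      show "0 \<in> M" unfolding M_def using Hp complex_vector.span_zero by (auto intro!: bexI[of _ 0])
    next
      fix x y assume xy: "x \<in> M" "y \<in> M"
      have xyH: "x \<in> hcarrier H" "y \<in> hcarrier H" using xy unfolding M_def by auto
      have "\<exists>s\<in>complex_vector.span A. hnorm H (x + y - s) < e" if e: "e > 0" for e
      proof -
        obtain s t where st: "s \<in> complex_vector.span A" "t \<in> complex_vector.span A"
          "hnorm H (x - s) < e/2" "hnorm H (y - t) < e/2"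
          using MD[OF xy(1) half_gt_zero[OF e]] MD[OF xy(2) half_gt_zero[OF e]] by blast
        have "hnorm H ((x - s) + (y - t)) \<le> hnorm H (x - s) + hnorm H (y - t)"
          using st xyH spH Hp by (intro hnorm_triangle) auto
        then have "hnorm H (x + y - (s + t)) < e" using st by (simp add: algebra_simps)
        then show ?thesis using complex_vector.span_add[OF st(1,2)] by blast
      qed
      then show "x + y \<in> M" unfolding M_def using xyH Hp by auto
    next
      fix c x assume xM: "x \<in> M"
      have xH: "x \<in> hcarrier H" using xM unfolding M_def by auto
      have "\<exists>s\<in>complex_vector.span A. hnorm H (c *\<^sub>C x - s) < e" if "e > 0" for e
      proof -
        have pos: "e / (cmod c + 1) > 0" using that by (simp add: add_nonneg_pos)
        then obtain s where s: "s \<in> complex_vector.span A" "hnorm H (x - s) < e / (cmod c + 1)"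
          using xM unfolding M_def by blast
        have sH: "x - s \<in> hcarrier H" using s xH spH Hp by auto
        have "hnorm H (c *\<^sub>C x - c *\<^sub>C s) = cmod c * hnorm H (x - s)"
          using hnorm_scale[OF Hp sH, of c] by (simp add: scaleC_diff_right)
        also have "\<dots> \<le> (cmod c + 1) * hnorm H (x - s)" using hnorm_nonneg[OF Hp sH] by (simp add: mult_right_mono)
        also have "\<dots> < e"
        proof -
          have "0 < cmod c + 1" by (simp add: add_nonneg_pos)
          then show ?thesis using s(2) by (simp add: field_simps)
        qed
        finally show ?thesis using complex_vector.span_scale[OF s(1)] by blast
      qed
      then show "c *\<^sub>C x \<in> M" unfolding M_def using xH Hp by auto
    qed
    fix s x assume s: "\<forall>n::nat. s n \<in> M" and x: "x \<in> hcarrier H" and l: "(\<lambda>n. hnorm H (s n - x)) \<longlonglongrightarrow> 0"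
    have sH: "s n \<in> hcarrier H" for n using s unfolding M_def by auto
    have "\<exists>t\<in>complex_vector.span A. hnorm H (x - t) < e" if e: "e > 0" for e
    proof -
      obtain n where n: "hnorm H (s n - x) < e/2"
        using LIMSEQ_D[OF l, of "e/2"] e by (metis abs_ge_self diff_zero half_gt_zero order_le_less_trans order_refl real_norm_def)
      obtain t where t: "t \<in> complex_vector.span A" "hnorm H (s n - t) < e/2"
        using MD[of "s n", OF _ half_gt_zero[OF e]] s by blast
      have "hnorm H (x - t) \<le> hnorm H (x - s n) + hnorm H (s n - t)"
        using x sH t spH Hp by (intro hnorm_triangle3) auto
      then have "hnorm H (x - t) < e" using n t hnorm_diff_commute[OF Hp x sH, of n] by simp
      then show ?thesis using t by blast
    qed
    then show "x \<in> M" unfolding M_def using x by blast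
  qed
  then obtain m where m: "m \<in> M" "\<And>z. z \<in> M \<Longrightarrow> hinner H (x - m) z = 0"
    using orthogonal_projection[OF H _ x] by blast
  have mH: "m \<in> hcarrier H" using m unfolding M_def by auto
  have "x - m = 0"
  proof (rule tot)
    show "x - m \<in> hcarrier H" using x mH Hp by simp
    fix a assume a: "a \<in> A"
    have "a \<in> M" unfolding M_def using a A complex_vector.span_base[OF a]
      by (auto intro!: bexI[of _ a] simp: hnorm_zero[OF Hp])
    then show "hinner H (x - m) a = 0" by (rule m)
  qed
  then have "x \<in> M" using m by simp
  then show thesis using that e unfolding M_def by blast
qed

section \<open>Bounded operators and adjoints\<close>

lemma bop_in [simp]: "T \<in> bop H K \<Longrightarrow> x \<in> hcarrier H \<Longrightarrow> T x \<in> hcarrier K"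
  unfolding bop_def by blast

lemma bop_add [simp]: "T \<in> bop H K \<Longrightarrow> x \<in> hcarrier H \<Longrightarrow> y \<in> hcarrier H \<Longrightarrow> T (x + y) = T x + T y"
  unfolding bop_def by blast

lemma bop_scale [simp]: "T \<in> bop H K \<Longrightarrow> x \<in> hcarrier H \<Longrightarrow> T (a *\<^sub>C x) = a *\<^sub>C T x"
  unfolding bop_def by blast

lemma bop_off [simp]: "T \<in> bop H K \<Longrightarrow> x \<notin> hcarrier H \<Longrightarrow> T x = 0"
  unfolding bop_def by blast

lemma bop_zero [simp]: "T \<in> bop H K \<Longrightarrow> T 0 = 0"
  using bop_scale[of T H K 0 0] bop_off[of T H K 0] by (cases "0 \<in> hcarrier H") auto

lemma bop_minus: "T \<in> bop H K \<Longrightarrow> x \<in> hcarrier H \<Longrightarrow> T (- x) = - T x"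
  using bop_scale[of T H K x "-1"] by simp

lemma bop_diff: "pre_hilbert H \<Longrightarrow> T \<in> bop H K \<Longrightarrow> x \<in> hcarrier H \<Longrightarrow> y \<in> hcarrier H \<Longrightarrow> T (x - y) = T x - T y"
  using bop_add[of T H K x "- y"] bop_minus[of T H K y] minus_in[of H y] by simp

lemma bop_sum:
  assumes "pre_hilbert H" "T \<in> bop H K" "\<And>i. i \<in> F \<Longrightarrow> f i \<in> hcarrier H"
  shows "T (\<Sum>i\<in>F. f i) = (\<Sum>i\<in>F. T (f i))"
  using assms(3) by (induction F rule: infinite_finite_induct) (simp_all add: assms(1) bop_zero[OF assms(2)] bop_add[OF assms(2)])

lemma bop_lincomb:
  assumes "pre_hilbert H" "T \<in> bop H K" "\<And>i. i \<in> F \<Longrightarrow> f i \<in> hcarrier H"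
  shows "T (\<Sum>i\<in>F. c i *\<^sub>C f i) = (\<Sum>i\<in>F. c i *\<^sub>C T (f i))"
  using assms by (subst bop_sum[OF assms(1,2)]) simp_all

lemma bop_bound:
  assumes "T \<in> bop H K" "pre_hilbert H"
  obtains c where "c \<ge> 0" "\<And>x. x \<in> hcarrier H \<Longrightarrow> hnorm K (T x) \<le> c * hnorm H x"
proof -
  obtain c where c: "\<And>x. x \<in> hcarrier H \<Longrightarrow> hnorm K (T x) \<le> c * hnorm H x"
    using assms unfolding bop_def by blast
  have "hnorm K (T x) \<le> \<bar>c\<bar> * hnorm H x" if "x \<in> hcarrier H" for x
    using c[OF that] mult_right_mono[OF abs_ge_self[of c] hnorm_nonneg[OF assms(2) that]] by linarith
  then show thesis using that[of "\<bar>c\<bar>"] by simp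
qed

lemma bopI:
  assumes "\<And>x. x \<in> hcarrier H \<Longrightarrow> T x \<in> hcarrier K"
    "\<And>x y. x \<in> hcarrier H \<Longrightarrow> y \<in> hcarrier H \<Longrightarrow> T (x + y) = T x + T y"
    "\<And>x a. x \<in> hcarrier H \<Longrightarrow> T (a *\<^sub>C x) = a *\<^sub>C T x"
    "\<And>x. x \<in> hcarrier H \<Longrightarrow> hnorm K (T x) \<le> c * hnorm H x"
    "\<And>x. x \<notin> hcarrier H \<Longrightarrow> T x = 0"
  shows "T \<in> bop H K"
  using assms unfolding bop_def by blast

lemma bop_compose:
  assumes "T \<in> bop H K" "S \<in> bop K L" "pre_hilbert H" "pre_hilbert K"
  shows "S \<circ> T \<in> bop H L"
proof -
  obtain a where a: "a \<ge> 0" "\<And>x. x \<in> hcarrier H \<Longrightarrow> hnorm K (T x) \<le> a * hnorm H x"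
    using bop_bound assms by metis
  obtain b where b: "b \<ge> 0" "\<And>x. x \<in> hcarrier K \<Longrightarrow> hnorm L (S x) \<le> b * hnorm K x"
    using bop_bound assms by metis
  show ?thesis
  proof (rule bopI[where c = "b * a"])
    fix x assume x: "x \<in> hcarrier H"
    have "hnorm L (S (T x)) \<le> b * hnorm K (T x)" using b assms x by simp
    also have "\<dots> \<le> b * (a * hnorm H x)" using a b x by (intro mult_left_mono) auto
    finally show "hnorm L ((S \<circ> T) x) \<le> b * a * hnorm H x" by (simp add: mult.assoc)
  qed (use assms in \<open>simp_all add: bop_zero\<close>)
qed

lemma op_norm_le:
  assumes "pre_hilbert H" "\<And>x. x \<in> hcarrier H \<Longrightarrow> hnorm K (T x) \<le> c * hnorm H x" "0 \<le> c"
  shows "op_norm H K T \<le> c"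
  unfolding op_norm_def
proof (rule cSup_least)
  show "{hnorm K (T x) |x. x \<in> hcarrier H \<and> hnorm H x \<le> 1} \<noteq> {}"
    using assms(1) by (auto intro!: exI[of _ 0])
  fix r assume "r \<in> {hnorm K (T x) |x. x \<in> hcarrier H \<and> hnorm H x \<le> 1}"
  then obtain x where x: "x \<in> hcarrier H" "hnorm H x \<le> 1" "r = hnorm K (T x)" by blast
  have "r \<le> c * hnorm H x" using assms(2) x by simp
  also have "\<dots> \<le> c * 1" using x assms(3) by (intro mult_left_mono)
  finally show "r \<le> c" by simp
qed

lemma op_norm_ge:
  assumes H: "hilbert_space H" and T: "T \<in> bop H K" and K: "pre_hilbert K" and x: "x \<in> hcarrier H"
  shows "hnorm K (T x) \<le> op_norm H K T * hnorm H x"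
proof (cases "hnorm H x = 0")
  case True
  then have "x = 0" using hnorm_eq_zero[OF H x] by simp
  then show ?thesis using T H K by simp
next
  case False
  have Hp: "pre_hilbert H" using H by simp
  have pos: "hnorm H x > 0" using False hnorm_nonneg[OF Hp x] by simp
  obtain c where c: "c \<ge> 0" "\<And>x. x \<in> hcarrier H \<Longrightarrow> hnorm K (T x) \<le> c * hnorm H x"
    using bop_bound[OF T Hp] by blast
  have bdd: "bdd_above {hnorm K (T x) |x. x \<in> hcarrier H \<and> hnorm H x \<le> 1}"
  proof (rule bdd_aboveI[of _ c])
    fix r assume "r \<in> {hnorm K (T x) |x. x \<in> hcarrier H \<and> hnorm H x \<le> 1}"
    then obtain x where x: "x \<in> hcarrier H" "hnorm H x \<le> 1" "r = hnorm K (T x)" by blast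
    have "r \<le> c * hnorm H x" using c x by simp
    also have "\<dots> \<le> c * 1" using x c by (intro mult_left_mono)
    finally show "r \<le> c" by simp
  qed
  let ?y = "(of_real (1 / hnorm H x) :: complex) *\<^sub>C x"
  have "hnorm H ?y \<le> 1" using pos hnorm_scale[OF Hp x, of "of_real (1 / hnorm H x)"] by (simp add: norm_divide)
  then have "hnorm K (T ?y) \<le> op_norm H K T"
    unfolding op_norm_def using bdd scale_in[OF Hp x] by (intro cSup_upper) blast
  moreover have "hnorm K (T ?y) = hnorm K (T x) / hnorm H x"
    using T x K pos by (simp add: norm_divide)
  ultimately have "hnorm K (T x) / hnorm H x \<le> op_norm H K T" by (simp only:)
  then show ?thesis using pos by (simp add: pos_divide_le_eq)
qed

text \<open>The kernel of \<open>\<phi>\<close> is closed. The component \<open>w\<close> orthogonal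
  to it of a vector with nonzero value spans its complement, and the representing vector is the
  multiple of \<open>w\<close> with the right value at \<open>w\<close>.\<close>

lemma riesz_representation:
  assumes H: "hilbert_space H"
    and add: "\<And>x y. x \<in> hcarrier H \<Longrightarrow> y \<in> hcarrier H \<Longrightarrow> \<phi> (x + y) = \<phi> x + \<phi> y"
    and scale: "\<And>x a. x \<in> hcarrier H \<Longrightarrow> \<phi> (a *\<^sub>C x) = a * \<phi> x"
    and bound: "\<And>x. x \<in> hcarrier H \<Longrightarrow> cmod (\<phi> x) \<le> c * hnorm H x"
  obtains z where "z \<in> hcarrier H" "\<And>x. x \<in> hcarrier H \<Longrightarrow> \<phi> x = hinner H x z"
proof (cases "\<forall>x\<in>hcarrier H. \<phi> x = 0")
  case True
  then show thesis using that[of 0] H by simp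
next
  case False
  have Hp: "pre_hilbert H" using H by simp
  then obtain x0 where x0: "x0 \<in> hcarrier H" "\<phi> x0 \<noteq> 0" using False by blast
  have diff: "\<phi> (x - y) = \<phi> x - \<phi> y" if "x \<in> hcarrier H" "y \<in> hcarrier H" for x y
    using add[of x "- y"] scale[of y "-1"] that Hp by simp
  define M where "M = {x\<in>hcarrier H. \<phi> x = 0}"
  have "hclosed H M"
    unfolding hclosed_def
  proof (intro conjI allI impI)
    show "M \<subseteq> hcarrier H" unfolding M_def by auto
    show "complex_vector.subspace M"
      unfolding complex_vector.subspace_def M_def using Hp add scale[of 0 0] scale by auto
    fix s x assume s: "\<forall>n::nat. s n \<in> M" and x: "x \<in> hcarrier H" and l: "(\<lambda>n. hnorm H (s n - x)) \<longlonglongrightarrow> 0"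
    have sH: "s n \<in> hcarrier H" "\<phi> (s n) = 0" for n using s unfolding M_def by auto
    have "(\<lambda>n. \<phi> (s n - x)) \<longlonglongrightarrow> 0"
    proof (rule null_le)
      show "cmod (\<phi> (s n - x)) \<le> c * hnorm H (s n - x)" for n using bound sH x Hp by simp
      show "(\<lambda>n. c * hnorm H (s n - x)) \<longlonglongrightarrow> 0" using tendsto_mult_right_zero[OF l] by simp
    qed
    then have "(\<lambda>n::nat. - \<phi> x) \<longlonglongrightarrow> 0" using diff sH x by simp
    then have "- \<phi> x = 0" by (rule LIMSEQ_unique[OF tendsto_const])
    then have "\<phi> x = 0" by simp
    then show "x \<in> M" unfolding M_def using x by simp
  qed
  then obtain m where m: "m \<in> M" "\<And>z. z \<in> M \<Longrightarrow> hinner H (x0 - m) z = 0"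
    using orthogonal_projection[OF H _ x0(1)] by blast
  define w where "w = x0 - m"
  have mH: "m \<in> hcarrier H" "\<phi> m = 0" using m unfolding M_def by auto
  have w: "w \<in> hcarrier H" "\<phi> w \<noteq> 0" unfolding w_def using x0 mH Hp diff by auto
  have ww: "hinner H w w \<noteq> 0"
  proof
    assume "hinner H w w = 0"
    then have "w = 0" by (rule inner_eq_zero[OF H w(1)])
    then show False using w(2) scale[of 0 0] zero_in[OF Hp] by simp
  qed
  define z where "z = cnj (\<phi> w / hinner H w w) *\<^sub>C w"
  have zH: "z \<in> hcarrier H" unfolding z_def using w Hp by simp
  have "\<phi> x = hinner H x z" if x: "x \<in> hcarrier H" for x
  proof -
    let ?a = "\<phi> x / \<phi> w"
    have "x - ?a *\<^sub>C w \<in> M" unfolding M_def using x w Hp by (simp add: diff scale)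
    then have "hinner H w (x - ?a *\<^sub>C w) = 0" unfolding w_def by (rule m)
    then have "hinner H (x - ?a *\<^sub>C w) w = 0"
      using inner_commute[OF Hp w(1), of "x - ?a *\<^sub>C w"] x w Hp by simp
    then have "hinner H x w = ?a * hinner H w w" using x w Hp by simp
    then show ?thesis unfolding z_def using x w Hp ww by (simp add: field_simps)
  qed
  then show thesis using that zH by blast
qed

text \<open>The constant \<open>c\<close> is an arbitrary bound for \<open>T\<close> instead of its
  operator norm, so the adjoint inherits every explicit bound; this is how contractivity and the
  constants \<open>cQ\<close> pass to adjoints.\<close>

lemma adjoint_exists:
  assumes H: "hilbert_space H" and K: "hilbert_space K" and T: "T \<in> bop H K"
    and c: "0 \<le> c" "\<And>x. x \<in> hcarrier H \<Longrightarrow> hnorm K (T x) \<le> c * hnorm H x"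
  obtains T' where "T' \<in> bop K H"
    "\<And>x y. x \<in> hcarrier H \<Longrightarrow> y \<in> hcarrier K \<Longrightarrow> hinner K (T x) y = hinner H x (T' y)"
    "\<And>y. y \<in> hcarrier K \<Longrightarrow> hnorm H (T' y) \<le> c * hnorm K y"
proof -
  have Hp: "pre_hilbert H" "pre_hilbert K" using H K by simp_all
  have "\<exists>z\<in>hcarrier H. \<forall>x\<in>hcarrier H. hinner K (T x) y = hinner H x z" if y: "y \<in> hcarrier K" for y
  proof (rule riesz_representation[OF H, of "\<lambda>x. hinner K (T x) y" "c * hnorm K y"])
    fix x assume x: "x \<in> hcarrier H"
    have "cmod (hinner K (T x) y) \<le> hnorm K (T x) * hnorm K y"
      using cauchy_schwarz[OF Hp(2)] x y T by simp
    also have "\<dots> \<le> c * hnorm H x * hnorm K y" using c x y Hp by (intro mult_right_mono) auto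
    finally show "cmod (hinner K (T x) y) \<le> c * hnorm K y * hnorm H x" by (simp add: ac_simps)
  qed (use T y Hp in \<open>auto simp del: bop_zero\<close>)
  then obtain t where t: "\<And>y. y \<in> hcarrier K \<Longrightarrow> t y \<in> hcarrier H"
    "\<And>x y. x \<in> hcarrier H \<Longrightarrow> y \<in> hcarrier K \<Longrightarrow> hinner K (T x) y = hinner H x (t y)"
    by metis
  define T' where "T' y = (if y \<in> hcarrier K then t y else 0)" for y
  have T'H: "T' y \<in> hcarrier H" if "y \<in> hcarrier K" for y using that t unfolding T'_def by simp
  have T'a: "hinner K (T x) y = hinner H x (T' y)" if "x \<in> hcarrier H" "y \<in> hcarrier K" for x y
    using that t unfolding T'_def by simp
  have T'a': "hinner H (T' y) x = hinner K y (T x)" if "x \<in> hcarrier H" "y \<in> hcarrier K" for x y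
    using T'a[OF that] inner_commute[OF Hp(1) that(1) T'H[OF that(2)]]
      inner_commute[OF Hp(2) bop_in[OF T that(1)] that(2)] by simp
  have bnd: "hnorm H (T' y) \<le> c * hnorm K y" if y: "y \<in> hcarrier K" for y
  proof -
    have "(hnorm H (T' y))\<^sup>2 = Re (hinner K (T (T' y)) y)" using T'a T'H y Hp by (simp add: hnorm_sq)
    also have "\<dots> \<le> hnorm K (T (T' y)) * hnorm K y" using inner_le[OF Hp(2)] T'H y T by simp
    also have "\<dots> \<le> c * hnorm H (T' y) * hnorm K y" using c T'H y Hp by (intro mult_right_mono) auto
    finally have "hnorm H (T' y) * hnorm H (T' y) \<le> hnorm H (T' y) * (c * hnorm K y)"
      by (simp add: power2_eq_square ac_simps)
    then show ?thesis using hnorm_nonneg[OF Hp(1) T'H[OF y]] hnorm_nonneg[OF Hp(2) y] c(1)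
      by (cases "hnorm H (T' y) = 0") (auto simp: mult_le_cancel_left)
  qed
  have "T' \<in> bop K H"
  proof (rule bopI[where c = c])
    fix x y assume xy: "x \<in> hcarrier K" "y \<in> hcarrier K"
    show "T' (x + y) = T' x + T' y"
      using xy Hp T by (intro inner_ext[OF H]) (simp_all add: T'H T'a')
  next
    fix x a assume x: "x \<in> hcarrier K"
    show "T' (a *\<^sub>C x) = a *\<^sub>C T' x"
      using x Hp T by (intro inner_ext[OF H]) (simp_all add: T'H T'a')
  qed (use T'H bnd in \<open>simp_all add: T'_def\<close>)
  then show thesis using that T'a bnd by blast
qed

text \<open>\<open>op_adjoint\<close> is a definite description. Uniqueness holds because members of
  \<open>bop\<close> vanish off the carrier, so that agreement on the carrier is equality of
  functions.\<close>

lemma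
  assumes H: "hilbert_space H" and K: "hilbert_space K" and T: "T \<in> bop H K"
  shows op_adjoint_bop: "op_adjoint H K T \<in> bop K H"
    and op_adjoint_inner: "x \<in> hcarrier H \<Longrightarrow> y \<in> hcarrier K \<Longrightarrow> hinner K (T x) y = hinner H x (op_adjoint H K T y)"
    and op_adjoint_bound: "0 \<le> c \<Longrightarrow> (\<And>x. x \<in> hcarrier H \<Longrightarrow> hnorm K (T x) \<le> c * hnorm H x) \<Longrightarrow>
      y \<in> hcarrier K \<Longrightarrow> hnorm H (op_adjoint H K T y) \<le> c * hnorm K y"
proof -
  have Hp: "pre_hilbert H" "pre_hilbert K" using H K by simp_all
  let ?P = "\<lambda>T'. T' \<in> bop K H \<and> (\<forall>x\<in>hcarrier H. \<forall>y\<in>hcarrier K. hinner K (T x) y = hinner H x (T' y))"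
  have uniq: "T1 = T2" if 1: "?P T1" and 2: "?P T2" for T1 T2
  proof
    fix y
    show "T1 y = T2 y"
    proof (cases "y \<in> hcarrier K")
      case True
      show ?thesis
      proof (rule inner_ext[OF H])
        fix z assume z: "z \<in> hcarrier H"
        have "hinner H z (T1 y) = hinner H z (T2 y)" using 1 2 True z by metis
        then show "hinner H (T1 y) z = hinner H (T2 y) z"
          using inner_commute[OF Hp(1) z, of "T1 y"] inner_commute[OF Hp(1) z, of "T2 y"]
            bop_in[OF conjunct1[OF 1] True] bop_in[OF conjunct1[OF 2] True] by metis
      qed (use 1 2 True in auto)
    next
      case False
      then show ?thesis using 1 2 bop_off by metis
    qed
  qed
  obtain c0 where c0: "c0 \<ge> 0" "\<And>x. x \<in> hcarrier H \<Longrightarrow> hnorm K (T x) \<le> c0 * hnorm H x"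
    using bop_bound[OF T Hp(1)] by blast
  obtain T0 where "T0 \<in> bop K H"
    "\<And>x y. x \<in> hcarrier H \<Longrightarrow> y \<in> hcarrier K \<Longrightarrow> hinner K (T x) y = hinner H x (T0 y)"
    using adjoint_exists[OF H K T c0] by metis
  then have P0: "?P T0" by blast
  have P: "?P (op_adjoint H K T)"
    using theI[of ?P, OF P0 uniq[OF _ P0]] unfolding op_adjoint_def by blast
  then show "op_adjoint H K T \<in> bop K H" by blast
  show "x \<in> hcarrier H \<Longrightarrow> y \<in> hcarrier K \<Longrightarrow> hinner K (T x) y = hinner H x (op_adjoint H K T y)"
    using P by blast
  show "0 \<le> c \<Longrightarrow> (\<And>x. x \<in> hcarrier H \<Longrightarrow> hnorm K (T x) \<le> c * hnorm H x) \<Longrightarrow>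
      y \<in> hcarrier K \<Longrightarrow> hnorm H (op_adjoint H K T y) \<le> c * hnorm K y"
  proof -
    assume c: "0 \<le> c" "\<And>x. x \<in> hcarrier H \<Longrightarrow> hnorm K (T x) \<le> c * hnorm H x" and y: "y \<in> hcarrier K"
    obtain T' where T': "T' \<in> bop K H"
      "\<And>x y. x \<in> hcarrier H \<Longrightarrow> y \<in> hcarrier K \<Longrightarrow> hinner K (T x) y = hinner H x (T' y)"
      and b: "\<And>y. y \<in> hcarrier K \<Longrightarrow> hnorm H (T' y) \<le> c * hnorm K y"
      using adjoint_exists[OF H K T c] by metis
    have "?P T'" using T' by blast
    then have "op_adjoint H K T = T'" by (rule uniq[OF P])
    then show ?thesis using b[OF y] by simp
  qed
qed

lemma op_adjoint_inner':
  assumes H: "hilbert_space H" and K: "hilbert_space K" and T: "T \<in> bop H K"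
    and "x \<in> hcarrier H" "y \<in> hcarrier K"
  shows "hinner K y (T x) = hinner H (op_adjoint H K T y) x"
  using op_adjoint_inner[OF assms] inner_commute[of K "T x" y] inner_commute[of H x "op_adjoint H K T y"]
    op_adjoint_bop[OF H K T] assms by simp

text \<open>The argument goes through adjoints: for each \<open>y\<close> the values of the two
  adjoints have the same inner products with the total set and therefore coincide. Approximation by
  linear combinations is thus avoided.\<close>

lemma bop_agree_total:
  assumes H: "hilbert_space H" and K: "hilbert_space K" and S: "S \<in> bop H K" and T: "T \<in> bop H K"
    and A: "A \<subseteq> hcarrier H"
    and tot: "\<And>z. z \<in> hcarrier H \<Longrightarrow> (\<And>a. a \<in> A \<Longrightarrow> hinner H z a = 0) \<Longrightarrow> z = 0"
    and eq: "\<And>a. a \<in> A \<Longrightarrow> S a = T a"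
  shows "S = T"
proof
  fix x
  have Hp: "pre_hilbert H" "pre_hilbert K" using H K by simp_all
  show "S x = T x"
  proof (cases "x \<in> hcarrier H")
    case True
    show ?thesis
    proof (rule inner_ext[OF K])
      fix y assume y: "y \<in> hcarrier K"
      let ?S = "op_adjoint H K S" and ?T = "op_adjoint H K T"
      have b: "?S \<in> bop K H" "?T \<in> bop K H" using op_adjoint_bop[OF H K] S T by auto
      have in1: "?S y \<in> hcarrier H" "?T y \<in> hcarrier H" using b y by simp_all
      have "?S y - ?T y = 0"
      proof (rule tot)
        show "?S y - ?T y \<in> hcarrier H" using in1 Hp by simp
        fix a assume a: "a \<in> A"
        have aH: "a \<in> hcarrier H" using a A by auto
        have "hinner H (?S y) a = hinner H (?T y) a"
          using op_adjoint_inner'[OF H K S aH y] op_adjoint_inner'[OF H K T aH y] eq[OF a] by simp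
        then show "hinner H (?S y - ?T y) a = 0" using in1 aH Hp by simp
      qed
      then show "hinner K (S x) y = hinner K (T x) y"
        using op_adjoint_inner[OF H K S True y] op_adjoint_inner[OF H K T True y] by simp
    qed (use S T True in simp_all)
  qed (use bop_off S T in metis)
qed

section \<open>Extension of operators from total families\<close>

text \<open>Several indices may name the same vector; choosing one index for each vector that occurs
  lets the coefficients be attached to indices.\<close>

lemma span_image_explicit:
  assumes "s \<in> complex_vector.span (a ` E)"
  obtains F c where "finite F" "F \<subseteq> E" "s = (\<Sum>e\<in>F. c e *\<^sub>C a e)"
proof -
  obtain t r where t: "finite t" "t \<subseteq> a ` E" "s = (\<Sum>x\<in>t. r x *\<^sub>C x)"
    using assms unfolding complex_vector.span_explicit by blast
  obtain F where F: "F \<subseteq> E" "inj_on a F" "t = a ` F"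
    using subset_image_inj[of t a E] t(2) by blast
  have "finite F" using F t(1) finite_image_iff by metis
  moreover have "s = (\<Sum>e\<in>F. r (a e) *\<^sub>C a e)" unfolding t(3) F(3) using F(2) by (simp add: sum.reindex)
  ultimately show thesis using that[of F "\<lambda>e. r (a e)"] F(1) by blast
qed

text \<open>The extension is obtained from its graph: \<open>G\<close> is the linear span of the
  pairs \<open>(a e, b e)\<close> and \<open>L\<close> describes its closure. The estimate
  \<open>bnd\<close> makes second components converge whenever first components do, and makes the
  limit value unique.\<close>

lemma bounded_extension:
  assumes H: "hilbert_space H" and K: "hilbert_space K"
    and a: "\<And>e. e \<in> E \<Longrightarrow> a e \<in> hcarrier H" and b: "\<And>e. e \<in> E \<Longrightarrow> b e \<in> hcarrier K"
    and tot: "\<And>z. z \<in> hcarrier H \<Longrightarrow> (\<And>e. e \<in> E \<Longrightarrow> hinner H z (a e) = 0) \<Longrightarrow> z = 0"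
    and C: "0 \<le> C"
    and bnd: "\<And>F c. finite F \<Longrightarrow> F \<subseteq> E \<Longrightarrow>
      hnorm K (\<Sum>e\<in>F. c e *\<^sub>C b e) \<le> C * hnorm H (\<Sum>e\<in>F. c e *\<^sub>C a e)"
  obtains T where "T \<in> bop H K" "\<And>e. e \<in> E \<Longrightarrow> T (a e) = b e"
    "\<And>x. x \<in> hcarrier H \<Longrightarrow> hnorm K (T x) \<le> C * hnorm H x"
proof -
  have Hp: "pre_hilbert H" "pre_hilbert K" using H K by simp_all
  \<comment> \<open>The vectors \<open>a e\<close> may be linearly dependent, so a map on their span
    would first have to be shown well defined; the graph as a span of pairs is a subspace without
    further argument.\<close>
  define G where "G = complex_vector.span ((\<lambda>e. (a e, b e)) ` E)"
  have Gsub: "complex_vector.subspace G" unfolding G_def by (rule complex_vector.subspace_span)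
  have Gex: "\<exists>F c. finite F \<and> F \<subseteq> E \<and> p = (\<Sum>e\<in>F. c e *\<^sub>C a e, \<Sum>e\<in>F. c e *\<^sub>C b e)" if pG: "p \<in> G" for p
  proof -
    obtain F c where F: "finite F" "F \<subseteq> E" "p = (\<Sum>e\<in>F. c e *\<^sub>C (a e, b e))"
      using pG unfolding G_def by (rule span_image_explicit)
    have "p = (\<Sum>e\<in>F. c e *\<^sub>C a e, \<Sum>e\<in>F. c e *\<^sub>C b e)"
      unfolding F(3) by (simp add: prod_eq_iff fst_sum snd_sum scaleC_prod_def)
    then show ?thesis using F by blast
  qed
  have Gin: "fst p \<in> hcarrier H" "snd p \<in> hcarrier K" "hnorm K (snd p) \<le> C * hnorm H (fst p)"
    if pG: "p \<in> G" for p
  proof -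
    obtain F c where F: "finite F" "F \<subseteq> E" "p = (\<Sum>e\<in>F. c e *\<^sub>C a e, \<Sum>e\<in>F. c e *\<^sub>C b e)"
      using Gex[OF pG] by blast
    show "fst p \<in> hcarrier H" unfolding F(3) using F(2) a Hp by (auto intro!: sum_in scale_in)
    show "snd p \<in> hcarrier K" unfolding F(3) using F(2) b Hp by (auto intro!: sum_in scale_in)
    show "hnorm K (snd p) \<le> C * hnorm H (fst p)" unfolding F(3) using bnd[OF F(1,2)] by simp
  qed
  have Gdiff: "p - q \<in> G" if "p \<in> G" "q \<in> G" for p q
    using complex_vector.subspace_diff[OF Gsub that] .
  have dense: "\<exists>p\<in>G. hnorm H (x - fst p) < e" if x: "x \<in> hcarrier H" and e: "e > 0" for x e
  proof -
    obtain s where s: "s \<in> complex_vector.span (a ` E)" "hnorm H (x - s) < e"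
      by (rule total_dense[OF H _ _ x e, of "a ` E"]) (use a tot in auto)
    obtain F c where F: "finite F" "F \<subseteq> E" "s = (\<Sum>e\<in>F. c e *\<^sub>C a e)"
      using s(1) by (rule span_image_explicit)
    have "(\<Sum>e\<in>F. c e *\<^sub>C (a e, b e)) \<in> G" unfolding G_def using F(2)
      by (intro complex_vector.span_sum complex_vector.span_scale complex_vector.span_base) auto
    moreover have "fst (\<Sum>e\<in>F. c e *\<^sub>C (a e, b e)) = s"
      unfolding F(3) by (simp add: fst_sum scaleC_prod_def)
    ultimately show ?thesis using s(2) by metis
  qed
  define L where "L x y \<longleftrightarrow> y \<in> hcarrier K \<and> (\<exists>p. (\<forall>n::nat. p n \<in> G) \<and>
    (\<lambda>n. hnorm H (fst (p n) - x)) \<longlonglongrightarrow> 0 \<and> (\<lambda>n. hnorm K (snd (p n) - y)) \<longlonglongrightarrow> 0)" for x y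
  have Lex: "\<exists>y. L x y" if x: "x \<in> hcarrier H" for x
  proof -
    have "\<exists>p\<in>G. hnorm H (x - fst p) < 1 / real (Suc n)" for n using dense[OF x] by simp
    then obtain p where p: "\<And>n. p n \<in> G" "\<And>n. hnorm H (x - fst (p n)) < 1 / real (Suc n)" by metis
    have l: "(\<lambda>n. hnorm H (fst (p n) - x)) \<longlonglongrightarrow> 0"
    proof (rule null_le)
      show "norm (hnorm H (fst (p n) - x)) \<le> 1 / real (Suc n)" for n
        using p(2)[of n] hnorm_diff_commute[OF Hp(1) x Gin(1)[OF p(1)], of n] Hp(1) x Gin(1)[OF p(1)]
        by simp
      show "(\<lambda>n. 1 / real (Suc n)) \<longlonglongrightarrow> 0" by (rule LIMSEQ_Suc[OF lim_1_over_n])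
    qed
    have "\<exists>N. \<forall>m\<ge>N. \<forall>n\<ge>N. hnorm K (snd (p m) - snd (p n)) < e" if e: "e > 0" for e
    proof -
      have "e / (C + 1) > 0" using e C by simp
      then obtain N where N: "\<And>m n. m \<ge> N \<Longrightarrow> n \<ge> N \<Longrightarrow> hnorm H (fst (p m) - fst (p n)) < e / (C + 1)"
        using hlim_Cauchy[OF Hp(1) Gin(1)[OF p(1)] x l] by blast
      have "hnorm K (snd (p m) - snd (p n)) < e" if "m \<ge> N" "n \<ge> N" for m n
      proof -
        have "hnorm K (snd (p m) - snd (p n)) \<le> C * hnorm H (fst (p m) - fst (p n))"
          using Gin(3)[OF Gdiff[OF p(1) p(1)], of m n] by simp
        also have "\<dots> \<le> (C + 1) * hnorm H (fst (p m) - fst (p n))"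
          using Hp(1) Gin(1)[OF p(1)] by (intro mult_right_mono) simp_all
        also have "\<dots> < e" using N[OF that] C by (simp add: pos_less_divide_eq mult.commute)
        finally show ?thesis .
      qed
      then show ?thesis by blast
    qed
    from hilbert_complete[OF K Gin(2)[OF p(1)] this] obtain y
      where "y \<in> hcarrier K" "(\<lambda>n. hnorm K (snd (p n) - y)) \<longlonglongrightarrow> 0" by blast
    then show ?thesis unfolding L_def using p(1) l by blast
  qed
  have Ladd: "L (x + x') (y + y')" if L: "L x y" "L x' y'" and x: "x \<in> hcarrier H" "x' \<in> hcarrier H" for x y x' y'
  proof -
    obtain p where p: "\<forall>n::nat. p n \<in> G" "(\<lambda>n. hnorm H (fst (p n) - x)) \<longlonglongrightarrow> 0"
      "(\<lambda>n. hnorm K (snd (p n) - y)) \<longlonglongrightarrow> 0" using L(1) unfolding L_def by blast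
    obtain q where q: "\<forall>n::nat. q n \<in> G" "(\<lambda>n. hnorm H (fst (q n) - x')) \<longlonglongrightarrow> 0"
      "(\<lambda>n. hnorm K (snd (q n) - y')) \<longlonglongrightarrow> 0" using L(2) unfolding L_def by blast
    have y: "y \<in> hcarrier K" "y' \<in> hcarrier K" using L unfolding L_def by auto
    note G1 = Gin(1)[OF p(1)[rule_format]] Gin(2)[OF p(1)[rule_format]]
      Gin(1)[OF q(1)[rule_format]] Gin(2)[OF q(1)[rule_format]]
    have "(\<lambda>n. hnorm H (fst (p n + q n) - (x + x'))) \<longlonglongrightarrow> 0"
    proof (rule null_le)
      show "norm (hnorm H (fst (p n + q n) - (x + x'))) \<le> hnorm H (fst (p n) - x) + hnorm H (fst (q n) - x')" for n
        using hnorm_triangle[OF Hp(1), of "fst (p n) - x" "fst (q n) - x'"] G1 x Hp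
        by (simp add: algebra_simps)
      show "(\<lambda>n. hnorm H (fst (p n) - x) + hnorm H (fst (q n) - x')) \<longlonglongrightarrow> 0"
        using tendsto_add[OF p(2) q(2)] by simp
    qed
    moreover have "(\<lambda>n. hnorm K (snd (p n + q n) - (y + y'))) \<longlonglongrightarrow> 0"
    proof (rule null_le)
      show "norm (hnorm K (snd (p n + q n) - (y + y'))) \<le> hnorm K (snd (p n) - y) + hnorm K (snd (q n) - y')" for n
        using hnorm_triangle[OF Hp(2), of "snd (p n) - y" "snd (q n) - y'"] G1 y Hp
        by (simp add: algebra_simps)
      show "(\<lambda>n. hnorm K (snd (p n) - y) + hnorm K (snd (q n) - y')) \<longlonglongrightarrow> 0"
        using tendsto_add[OF p(3) q(3)] by simp
    qed
    moreover have "\<forall>n. p n + q n \<in> G" using p(1) q(1) complex_vector.subspace_add[OF Gsub] by blast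
    ultimately show ?thesis unfolding L_def using y Hp by (intro conjI exI[of _ "\<lambda>n. p n + q n"]) simp_all
  qed
  have Lscale: "L (c *\<^sub>C x) (c *\<^sub>C y)" if L: "L x y" and x: "x \<in> hcarrier H" for c x y
  proof -
    obtain p where p: "\<forall>n::nat. p n \<in> G" "(\<lambda>n. hnorm H (fst (p n) - x)) \<longlonglongrightarrow> 0"
      "(\<lambda>n. hnorm K (snd (p n) - y)) \<longlonglongrightarrow> 0" using L(1) unfolding L_def by blast
    have y: "y \<in> hcarrier K" using L unfolding L_def by auto
    note G1 = Gin(1)[OF p(1)[rule_format]] Gin(2)[OF p(1)[rule_format]]
    have "fst (c *\<^sub>C p n) - c *\<^sub>C x = c *\<^sub>C (fst (p n) - x)" "snd (c *\<^sub>C p n) - c *\<^sub>C y = c *\<^sub>C (snd (p n) - y)" for n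
      by (simp_all add: scaleC_prod_def scaleC_diff_right)
    then have e: "hnorm H (fst (c *\<^sub>C p n) - c *\<^sub>C x) = cmod c * hnorm H (fst (p n) - x)"
      "hnorm K (snd (c *\<^sub>C p n) - c *\<^sub>C y) = cmod c * hnorm K (snd (p n) - y)" for n
      using G1 x y Hp by simp_all
    have "(\<lambda>n. hnorm H (fst (c *\<^sub>C p n) - c *\<^sub>C x)) \<longlonglongrightarrow> 0"
      "(\<lambda>n. hnorm K (snd (c *\<^sub>C p n) - c *\<^sub>C y)) \<longlonglongrightarrow> 0"
      unfolding e using tendsto_mult_right_zero[OF p(2)] tendsto_mult_right_zero[OF p(3)] by simp_all
    moreover have "\<forall>n. c *\<^sub>C p n \<in> G" using p(1) complex_vector.subspace_scale[OF Gsub] by blast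
    ultimately show ?thesis unfolding L_def using y Hp by (intro conjI exI[of _ "\<lambda>n. c *\<^sub>C p n"]) simp_all
  qed
  have Lbnd: "hnorm K y \<le> C * hnorm H x" if L: "L x y" and x: "x \<in> hcarrier H" for x y
  proof -
    obtain p where p: "\<forall>n::nat. p n \<in> G" "(\<lambda>n. hnorm H (fst (p n) - x)) \<longlonglongrightarrow> 0"
      "(\<lambda>n. hnorm K (snd (p n) - y)) \<longlonglongrightarrow> 0" using L(1) unfolding L_def by blast
    have y: "y \<in> hcarrier K" using L unfolding L_def by auto
    note G1 = Gin[OF p(1)[rule_format]]
    show ?thesis
    proof (rule LIMSEQ_le)
      show "(\<lambda>n. hnorm K (snd (p n))) \<longlonglongrightarrow> hnorm K y" using hlim_norm[OF Hp(2) G1(2) y p(3)] .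
      show "(\<lambda>n. C * hnorm H (fst (p n))) \<longlonglongrightarrow> C * hnorm H x"
        by (intro tendsto_intros hlim_norm[OF Hp(1) G1(1) x p(2)])
    qed (use G1(3) in blast)
  qed
  define T where "T x = (if x \<in> hcarrier H then (SOME y. L x y) else 0)" for x
  have TL: "L x (T x)" if "x \<in> hcarrier H" for x
    unfolding T_def using someI_ex[OF Lex[OF that]] that by simp
  have Luniq: "y = y'" if L: "L x y" "L x y'" and x: "x \<in> hcarrier H" for x y y'
  proof -
    have yK: "y \<in> hcarrier K" "y' \<in> hcarrier K" using L unfolding L_def by auto
    \<comment> \<open>The difference of two candidate values is a limit value at 0, where the bound
      \<open>Lbnd\<close> leaves only vectors of norm 0.\<close>
    have "L (x + (-1) *\<^sub>C x) (y + (-1) *\<^sub>C y')" using L x Hp by (intro Ladd Lscale) simp_all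
    then have "L 0 (y - y')" by simp
    then have "hnorm K (y - y') \<le> C * hnorm H 0" using Hp by (intro Lbnd) simp_all
    then have "hnorm K (y - y') = 0"
      using hnorm_zero[OF Hp(1)] hnorm_nonneg[OF Hp(2) diff_in[OF Hp(2) yK]] by simp
    then have "y - y' = 0" by (rule hnorm_eq_zero[OF K diff_in[OF Hp(2) yK]])
    then show ?thesis by simp
  qed
  have TK: "T x \<in> hcarrier K" if "x \<in> hcarrier H" for x using TL[OF that] unfolding L_def by blast
  have Tbnd: "hnorm K (T x) \<le> C * hnorm H x" if "x \<in> hcarrier H" for x using Lbnd[OF TL[OF that] that] .
  have "T \<in> bop H K"
  proof (rule bopI[where c = C])
    fix x y assume xy: "x \<in> hcarrier H" "y \<in> hcarrier H"
    have "L (x + y) (T x + T y)" using TL xy by (intro Ladd) simp_all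
    then show "T (x + y) = T x + T y" using Luniq[OF TL] xy Hp by simp
  next
    fix x c assume x: "x \<in> hcarrier H"
    have "L (c *\<^sub>C x) (c *\<^sub>C T x)" using TL x by (intro Lscale) simp_all
    then show "T (c *\<^sub>C x) = c *\<^sub>C T x" using Luniq[OF TL] x Hp by simp
  next
    fix x assume "x \<notin> hcarrier H" then show "T x = 0" unfolding T_def by simp
  qed (use TK Tbnd in auto)
  moreover have "T (a e) = b e" if e: "e \<in> E" for e
  proof -
    have "(a e, b e) \<in> G" unfolding G_def using e by (intro complex_vector.span_base) simp
    then have "L (a e) (b e)" unfolding L_def using b[OF e] Hp
      by (intro conjI exI[of _ "\<lambda>n. (a e, b e)"]) simp_all
    then show ?thesis using Luniq[OF TL] a[OF e] by blast
  qed
  ultimately show thesis using that Tbnd by blast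
qed

section \<open>Positive semidefinite kernels\<close>

text \<open>The second argument is the one on which the form is linear: \<open>\<kappa> y x\<close>
  stands for the inner product of the vector at \<open>x\<close> with the vector at
  \<open>y\<close>, in agreement with the values of \<open>rk_point\<close>.\<close>

definition psd :: "'e set \<Rightarrow> ('e \<Rightarrow> 'e \<Rightarrow> complex) \<Rightarrow> bool" where
  "psd E \<kappa> \<longleftrightarrow> (\<forall>x\<in>E. \<forall>y\<in>E. \<kappa> y x = cnj (\<kappa> x y)) \<and>
     (\<forall>F c. finite F \<longrightarrow> F \<subseteq> E \<longrightarrow> 0 \<le> Re (\<Sum>x\<in>F. \<Sum>y\<in>F. c x * cnj (c y) * \<kappa> y x))"

lemma psdI:
  assumes "\<And>x y. x \<in> E \<Longrightarrow> y \<in> E \<Longrightarrow> \<kappa> y x = cnj (\<kappa> x y)"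
    "\<And>F c. finite F \<Longrightarrow> F \<subseteq> E \<Longrightarrow> 0 \<le> Re (\<Sum>x\<in>F. \<Sum>y\<in>F. c x * cnj (c y) * \<kappa> y x)"
  shows "psd E \<kappa>"
  using assms unfolding psd_def by blast

lemma psd_herm: "psd E \<kappa> \<Longrightarrow> x \<in> E \<Longrightarrow> y \<in> E \<Longrightarrow> \<kappa> y x = cnj (\<kappa> x y)"
  unfolding psd_def by blast

lemma psd_nonneg: "psd E \<kappa> \<Longrightarrow> finite F \<Longrightarrow> F \<subseteq> E \<Longrightarrow> 0 \<le> Re (\<Sum>x\<in>F. \<Sum>y\<in>F. c x * cnj (c y) * \<kappa> y x)"
  unfolding psd_def by blast

lemma psd_subset: "psd E \<kappa> \<Longrightarrow> F \<subseteq> E \<Longrightarrow> psd F \<kappa>"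
  unfolding psd_def by (meson subset_iff subset_trans)

lemma psd_cong:
  assumes "psd E \<kappa>" "\<And>x y. x \<in> E \<Longrightarrow> y \<in> E \<Longrightarrow> \<kappa>' y x = \<kappa> y x"
  shows "psd E \<kappa>'"
proof (rule psdI)
  fix x y assume "x \<in> E" "y \<in> E" then show "\<kappa>' y x = cnj (\<kappa>' x y)" using assms psd_herm by metis
next
  fix F and c :: "'a \<Rightarrow> complex" assume F: "finite F" "F \<subseteq> E"
  have "(\<Sum>x\<in>F. \<Sum>y\<in>F. c x * cnj (c y) * \<kappa>' y x) = (\<Sum>x\<in>F. \<Sum>y\<in>F. c x * cnj (c y) * \<kappa> y x)"
    using F assms(2) by (intro sum.cong refl) (simp add: subset_iff)
  then show "0 \<le> Re (\<Sum>x\<in>F. \<Sum>y\<in>F. c x * cnj (c y) * \<kappa>' y x)" using psd_nonneg[OF assms(1) F] by simp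
qed

lemma psd_gram:
  assumes H: "pre_hilbert H" and f: "\<And>x. x \<in> E \<Longrightarrow> f x \<in> hcarrier H"
  shows "psd E (\<lambda>y x. hinner H (f x) (f y))"
proof (rule psdI)
  fix x y assume "x \<in> E" "y \<in> E"
  then show "hinner H (f x) (f y) = cnj (hinner H (f y) (f x))" using inner_commute[OF H] f by blast
next
  fix F and c :: "'b \<Rightarrow> complex" assume F: "finite F" "F \<subseteq> E"
  have "(\<Sum>x\<in>F. \<Sum>y\<in>F. c x * cnj (c y) * hinner H (f x) (f y))
    = hinner H (\<Sum>x\<in>F. c x *\<^sub>C f x) (\<Sum>x\<in>F. c x *\<^sub>C f x)"
    using F f by (subst inner_lincomb[OF H]) auto
  moreover have "(\<Sum>x\<in>F. c x *\<^sub>C f x) \<in> hcarrier H" using H F f by (intro sum_in scale_in) auto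
  ultimately show "0 \<le> Re (\<Sum>x\<in>F. \<Sum>y\<in>F. c x * cnj (c y) * hinner H (f x) (f y))"
    using inner_self_nonneg[OF H] by simp
qed

text \<open>The points \<open>x i\<close> may repeat, whereas positivity is defined with sets of
  points. Adding up the coefficients that belong to the same point reduces the family to its
  image.\<close>

lemma psd_family:
  assumes \<kappa>: "psd E \<kappa>" and J: "finite J" and x: "\<And>i. i \<in> J \<Longrightarrow> x i \<in> E"
  shows "0 \<le> Re (\<Sum>i\<in>J. \<Sum>j\<in>J. c i * cnj (c j) * \<kappa> (x j) (x i))"
proof -
  define d where "d e = (\<Sum>i\<in>{i\<in>J. x i = e}. c i)" for e
  have grp: "(\<Sum>i\<in>J. c i * g (x i)) = (\<Sum>e\<in>x ` J. d e * g e)" for g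
  proof -
    have "(\<Sum>i\<in>J. c i * g (x i)) = (\<Sum>e\<in>x ` J. \<Sum>i\<in>{i\<in>J. x i = e}. c i * g (x i))"
      using J by (rule sum.image_gen)
    also have "\<dots> = (\<Sum>e\<in>x ` J. d e * g e)"
      unfolding d_def by (intro sum.cong refl) (simp add: sum_distrib_right)
    finally show ?thesis .
  qed
  have grp': "(\<Sum>i\<in>J. cnj (c i) * g (x i)) = (\<Sum>e\<in>x ` J. cnj (d e) * g e)" for g
    using arg_cong[OF grp[of "\<lambda>e. cnj (g e)"], of cnj] by simp
  have "(\<Sum>i\<in>J. \<Sum>j\<in>J. c i * cnj (c j) * \<kappa> (x j) (x i))
      = (\<Sum>i\<in>J. c i * (\<Sum>j\<in>J. cnj (c j) * \<kappa> (x j) (x i)))"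
    by (simp add: sum_distrib_left mult.assoc)
  also have "\<dots> = (\<Sum>i\<in>J. c i * (\<Sum>f\<in>x ` J. cnj (d f) * \<kappa> f (x i)))"
    by (simp only: grp'[of "\<lambda>e. \<kappa> e _"])
  also have "\<dots> = (\<Sum>e\<in>x ` J. d e * (\<Sum>f\<in>x ` J. cnj (d f) * \<kappa> f e))"
    by (rule grp[of "\<lambda>e. \<Sum>f\<in>x ` J. cnj (d f) * \<kappa> f e"])
  also have "\<dots> = (\<Sum>e\<in>x ` J. \<Sum>f\<in>x ` J. d e * cnj (d f) * \<kappa> f e)"
    by (simp add: sum_distrib_left mult.assoc)
  finally show ?thesis using psd_nonneg[OF \<kappa>, of "x ` J" d] J x by auto
qed

lemma psd_pullback:
  assumes "psd E \<kappa>" "\<And>x. x \<in> E' \<Longrightarrow> h x \<in> E"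
  shows "psd E' (\<lambda>y x. \<kappa> (h y) (h x))"
proof (rule psdI)
  fix x y assume "x \<in> E'" "y \<in> E'"
  then show "\<kappa> (h y) (h x) = cnj (\<kappa> (h x) (h y))" using psd_herm[OF assms(1)] assms(2) by blast
next
  fix F and c :: "'b \<Rightarrow> complex" assume "finite F" "F \<subseteq> E'"
  then show "0 \<le> Re (\<Sum>x\<in>F. \<Sum>y\<in>F. c x * cnj (c y) * \<kappa> (h y) (h x))"
    using psd_family[OF assms(1), of F h c] assms(2) by blast
qed

lemma psd_add:
  assumes "psd E \<kappa>" "psd E \<mu>"
  shows "psd E (\<lambda>y x. \<kappa> y x + \<mu> y x)"
proof (rule psdI)
  fix x y assume "x \<in> E" "y \<in> E"
  then show "\<kappa> y x + \<mu> y x = cnj (\<kappa> x y + \<mu> x y)"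
    using psd_herm[OF assms(1), of x y] psd_herm[OF assms(2), of x y] by simp
next
  fix F and c :: "'a \<Rightarrow> complex" assume F: "finite F" "F \<subseteq> E"
  have "(\<Sum>x\<in>F. \<Sum>y\<in>F. c x * cnj (c y) * (\<kappa> y x + \<mu> y x))
    = (\<Sum>x\<in>F. \<Sum>y\<in>F. c x * cnj (c y) * \<kappa> y x) + (\<Sum>x\<in>F. \<Sum>y\<in>F. c x * cnj (c y) * \<mu> y x)"
    by (simp add: algebra_simps sum.distrib)
  then show "0 \<le> Re (\<Sum>x\<in>F. \<Sum>y\<in>F. c x * cnj (c y) * (\<kappa> y x + \<mu> y x))"
    using psd_nonneg[OF assms(1) F, of c] psd_nonneg[OF assms(2) F, of c] by simp
qed

text \<open>Repeating the coefficient of \<open>e\<close> along the fibre \<open>{..<m e}\<close>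
  turns the form of the summed kernel into the form of \<open>\<beta>\<close>. Together with the
  Schur product this produces all positive kernels built from \<open>kker\<close> later on.\<close>

lemma psd_sum_index:
  fixes m :: "'e \<Rightarrow> nat"
  assumes \<beta>: "psd (SIGMA e:E. {..<m e}) \<beta>"
  shows "psd E (\<lambda>y x. \<Sum>i<m y. \<Sum>l<m x. \<beta> (y, i) (x, l))"
proof (rule psdI)
  fix x y assume xy: "x \<in> E" "y \<in> E"
  have "(\<Sum>i<m y. \<Sum>l<m x. \<beta> (y, i) (x, l)) = (\<Sum>i<m y. \<Sum>l<m x. cnj (\<beta> (x, l) (y, i)))"
    using xy by (intro sum.cong refl psd_herm[OF \<beta>]) auto
  also have "\<dots> = cnj (\<Sum>l<m x. \<Sum>i<m y. \<beta> (x, l) (y, i))"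
    by (subst sum.swap) simp
  finally show "(\<Sum>i<m y. \<Sum>l<m x. \<beta> (y, i) (x, l)) = cnj (\<Sum>i<m x. \<Sum>l<m y. \<beta> (x, i) (y, l))" .
next
  fix F and c :: "'e \<Rightarrow> complex" assume F: "finite F" "F \<subseteq> E"
  let ?S = "SIGMA e:F. {..<m e}"
  have "(\<Sum>x\<in>F. \<Sum>y\<in>F. c x * cnj (c y) * (\<Sum>i<m y. \<Sum>l<m x. \<beta> (y, i) (x, l)))
      = (\<Sum>x\<in>F. \<Sum>y\<in>F. \<Sum>l<m x. \<Sum>i<m y. c x * cnj (c y) * \<beta> (y, i) (x, l))"
    by (simp add: sum_distrib_left) (intro sum.cong refl sum.swap)
  also have "\<dots> = (\<Sum>x\<in>F. \<Sum>l<m x. \<Sum>y\<in>F. \<Sum>i<m y. c x * cnj (c y) * \<beta> (y, i) (x, l))"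
    by (intro sum.cong refl sum.swap)
  also have "\<dots> = (\<Sum>p\<in>?S. \<Sum>q\<in>?S. c (fst p) * cnj (c (fst q)) * \<beta> q p)"
  proof -
    have sig: "(\<Sum>x\<in>F. \<Sum>l<m x. g x l) = (\<Sum>p\<in>?S. g (fst p) (snd p))" for g :: "'e \<Rightarrow> nat \<Rightarrow> complex"
      using F(1) by (subst sum.Sigma) (auto simp: split_def)
    show ?thesis unfolding sig by (simp add: split_def)
  qed
  finally have eq: "(\<Sum>x\<in>F. \<Sum>y\<in>F. c x * cnj (c y) * (\<Sum>i<m y. \<Sum>l<m x. \<beta> (y, i) (x, l)))
      = (\<Sum>p\<in>?S. \<Sum>q\<in>?S. c (fst p) * cnj (c (fst q)) * \<beta> q p)" .
  show "0 \<le> Re (\<Sum>x\<in>F. \<Sum>y\<in>F. c x * cnj (c y) * (\<Sum>i<m y. \<Sum>l<m x. \<beta> (y, i) (x, l)))"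
    unfolding eq by (rule psd_nonneg[OF \<beta>]) (use F in auto)
qed

lemma psd_suminf:
  assumes \<kappa>: "\<And>k. psd E (\<kappa> k)" and s: "\<And>x y. x \<in> E \<Longrightarrow> y \<in> E \<Longrightarrow> summable (\<lambda>k::nat. \<kappa> k y x)"
  shows "psd E (\<lambda>y x. \<Sum>k. \<kappa> k y x)"
proof (rule psdI)
  fix x y assume xy: "x \<in> E" "y \<in> E"
  have "cnj (\<Sum>k. \<kappa> k x y) = (\<Sum>k. cnj (\<kappa> k x y))"
    using bounded_linear.suminf[OF bounded_linear_cnj s[OF xy(2,1)]] by simp
  also have "\<dots> = (\<Sum>k. \<kappa> k y x)" using psd_herm[OF \<kappa> xy] by simp
  finally show "(\<Sum>k. \<kappa> k y x) = cnj (\<Sum>k. \<kappa> k x y)" by simp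
next
  fix F and c :: "'a \<Rightarrow> complex" assume F: "finite F" "F \<subseteq> E"
  have "(\<lambda>k. \<Sum>x\<in>F. \<Sum>y\<in>F. c x * cnj (c y) * \<kappa> k y x) sums
      (\<Sum>x\<in>F. \<Sum>y\<in>F. c x * cnj (c y) * (\<Sum>k. \<kappa> k y x))"
    using F s by (intro sums_sum sums_mult summable_sums) auto
  then have "(\<lambda>k. Re (\<Sum>x\<in>F. \<Sum>y\<in>F. c x * cnj (c y) * \<kappa> k y x)) sums
      Re (\<Sum>x\<in>F. \<Sum>y\<in>F. c x * cnj (c y) * (\<Sum>k. \<kappa> k y x))" by (rule sums_Re)
  then show "0 \<le> Re (\<Sum>x\<in>F. \<Sum>y\<in>F. c x * cnj (c y) * (\<Sum>k. \<kappa> k y x))"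
    by (rule sums_le[rotated 2]) (rule psd_nonneg[OF \<kappa> F], rule sums_zero)
qed

section \<open>Finite Gram decompositions and the Schur product\<close>

lemma psd_diag:
  assumes "psd E \<kappa>" "z \<in> E"
  shows "\<kappa> z z = of_real (Re (\<kappa> z z))" "0 \<le> Re (\<kappa> z z)"
proof -
  show "\<kappa> z z = of_real (Re (\<kappa> z z))"
    using psd_herm[OF assms(1) assms(2) assms(2)] by (simp add: complex_eq_iff)
  show "0 \<le> Re (\<kappa> z z)" using psd_nonneg[OF assms(1), of "{z}" "\<lambda>_. 1"] assms(2) by simp
qed

text \<open>With coefficient 1 at \<open>x\<close> and \<open>- s w\<close> at \<open>z\<close>,
  where \<open>w = \<kappa> z x\<close>, the form equals \<open>\<kappa> x x - 2 s |w|^2\<close>,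
  because the diagonal entry at \<open>z\<close> vanishes. For large \<open>s\<close> this would be
  negative unless \<open>w = 0\<close>.\<close>

lemma psd_zero_row:
  assumes "psd E \<kappa>" "z \<in> E" "x \<in> E" "\<kappa> z z = 0"
  shows "\<kappa> z x = 0"
proof (cases "x = z")
  case False
  let ?w = "\<kappa> z x"
  have ineq: "0 \<le> Re (\<kappa> x x) - 2 * s * (cmod ?w)\<^sup>2" for s :: real
  proof -
    define c where "c e = (if e = x then 1 else - of_real s * ?w)" for e
    have xz: "\<kappa> x z = cnj ?w" using psd_herm[OF assms(1,2,3)] .
    have "0 \<le> Re (\<Sum>e\<in>{x, z}. \<Sum>f\<in>{x, z}. c e * cnj (c f) * \<kappa> f e)"
      using assms by (intro psd_nonneg[OF assms(1)]) auto
    also have "(\<Sum>e\<in>{x, z}. \<Sum>f\<in>{x, z}. c e * cnj (c f) * \<kappa> f e)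
        = \<kappa> x x + (- of_real s * cnj ?w * ?w) + (- of_real s * ?w * cnj ?w)"
      using False assms(4) xz unfolding c_def by simp
    also have "\<dots> = \<kappa> x x - of_real (2 * s * (cmod ?w)\<^sup>2)"
      by (simp add: complex_norm_square del: of_real_power)
    finally show ?thesis by simp
  qed
  show ?thesis
  proof (rule ccontr)
    assume "?w \<noteq> 0"
    then have p: "(cmod ?w)\<^sup>2 > 0" by simp
    \<comment> \<open>The parameter \<open>s\<close> is chosen so that the subtracted term becomes
      twice \<open>\<kappa> x x + 1\<close>.\<close>
    have "0 \<le> Re (\<kappa> x x) - 2 * ((Re (\<kappa> x x) + 1) / (cmod ?w)\<^sup>2) * (cmod ?w)\<^sup>2" by (rule ineq)
    then have "0 \<le> Re (\<kappa> x x) - 2 * (Re (\<kappa> x x) + 1)" using p by simp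
    then show False using psd_diag(2)[OF assms(1,3)] by simp
  qed
qed (use assms in simp)

text \<open>Cholesky factorization by induction on the finite set: a nonzero pivot at
  \<open>z\<close> splits off a rank one kernel and leaves the Schur complement on the remaining
  points; a zero pivot has a zero row and column.\<close>

lemma psd_decompose:
  assumes "finite F" "psd F \<kappa>"
  shows "\<exists>(N::nat) a. \<forall>x\<in>F. \<forall>y\<in>F. \<kappa> y x = (\<Sum>s<N. a s x * cnj (a s y))"
  using assms
proof (induction F arbitrary: \<kappa> rule: finite_induct)
  case empty then show ?case by simp
next
  case (insert z F)
  let ?E = "insert z F"
  have F: "finite F" "z \<notin> F" and \<kappa>: "psd ?E \<kappa>" using insert by auto
  have \<kappa>F: "psd F \<kappa>" using \<kappa> by (rule psd_subset) auto
  show ?case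
  proof (cases "\<kappa> z z = 0")
    case True
    have r0: "\<kappa> z x = 0" "\<kappa> x z = 0" if "x \<in> ?E" for x
      using psd_zero_row[OF \<kappa> _ that True] psd_herm[OF \<kappa> _ that, of z] that by auto
    obtain N :: nat and a where "\<forall>x\<in>F. \<forall>y\<in>F. \<kappa> y x = (\<Sum>s<N. a s x * cnj (a s y))"
      using insert.IH[OF \<kappa>F] by (elim exE)
    then have a: "\<And>x y. x \<in> F \<Longrightarrow> y \<in> F \<Longrightarrow> \<kappa> y x = (\<Sum>s<N. a s x * cnj (a s y))" by blast
    have "\<kappa> y x = (\<Sum>s<N. (if x = z then 0 else a s x) * cnj (if y = z then 0 else a s y))"
      if "x \<in> ?E" "y \<in> ?E" for x y
      using that a r0 by (cases "x = z"; cases "y = z") auto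
    then show ?thesis by (intro exI[of _ N] exI[of _ "\<lambda>s x. if x = z then 0 else a s x"]) blast
  next
    case False
    define r where "r = Re (\<kappa> z z)"
    have r: "\<kappa> z z = of_real r" "0 < r"
      using psd_diag[OF \<kappa>, of z] False unfolding r_def by (auto simp: order_le_less complex_eq_iff)
    \<comment> \<open>The Schur complement of the pivot \<open>\<kappa> z z = r\<close>.\<close>
    define \<kappa>' where "\<kappa>' y x = \<kappa> y x - \<kappa> y z * \<kappa> z x / of_real r" for y x
    have "psd F \<kappa>'"
    proof (rule psdI)
      fix x y assume "x \<in> F" "y \<in> F"
      then show "\<kappa>' y x = cnj (\<kappa>' x y)"
        unfolding \<kappa>'_def using psd_herm[OF \<kappa>, of x y] psd_herm[OF \<kappa>, of x z] psd_herm[OF \<kappa>, of z y] by simp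
    next
      fix G and c :: "'a \<Rightarrow> complex" assume G: "finite G" "G \<subseteq> F"
      have zG: "z \<notin> G" using G F by auto
      define S where "S = (\<Sum>x\<in>G. c x * \<kappa> z x)"
      \<comment> \<open>The value \<open>- S / r\<close> at \<open>z\<close> completes the square:
        with it the form of \<open>\<kappa>\<close> on \<open>insert z G\<close> equals the form of
        \<open>\<kappa>'\<close> on \<open>G\<close>, which is therefore nonnegative.\<close>
      define d where "d x = (if x = z then - S / of_real r else c x)" for x
      have cS: "(\<Sum>y\<in>G. cnj (c y) * \<kappa> y z) = cnj S"
        unfolding S_def cnj_sum using G by (intro sum.cong refl) (use psd_herm[OF \<kappa>, of z] in auto)
      have dG: "d x = c x" if "x \<in> G" for x using that zG unfolding d_def by auto
      have dz: "d z = - S / of_real r" unfolding d_def by simp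
      define Q where "Q = (\<Sum>x\<in>G. \<Sum>y\<in>G. c x * cnj (c y) * \<kappa> y x)"
      have "(\<Sum>x\<in>insert z G. \<Sum>y\<in>insert z G. d x * cnj (d y) * \<kappa> y x)
          = d z * cnj (d z) * \<kappa> z z + d z * (\<Sum>y\<in>G. cnj (c y) * \<kappa> y z) + cnj (d z) * S + Q"
        using G(1) zG unfolding S_def Q_def
        by (simp add: sum.distrib sum_distrib_left dG ac_simps cong: sum.cong)
      also have "\<dots> = Q - S * cnj S / of_real r"
        unfolding cS dz r(1) using r(2) by (simp add: field_simps)
      also have "\<dots> = (\<Sum>x\<in>G. \<Sum>y\<in>G. c x * cnj (c y) * \<kappa>' y x)"
      proof -
        have "S * cnj S = (\<Sum>x\<in>G. \<Sum>y\<in>G. c x * \<kappa> z x * (cnj (c y) * \<kappa> y z))"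
          unfolding cS[symmetric] unfolding S_def by (rule sum_product)
        then show ?thesis unfolding Q_def \<kappa>'_def
          by (simp add: sum_subtractf[symmetric] sum_divide_distrib algebra_simps)
      qed
      finally show "0 \<le> Re (\<Sum>x\<in>G. \<Sum>y\<in>G. c x * cnj (c y) * \<kappa>' y x)"
        using psd_nonneg[OF \<kappa>, of "insert z G" d] G by auto
    qed
    then obtain a and N :: nat where "\<forall>x\<in>F. \<forall>y\<in>F. \<kappa>' y x = (\<Sum>s<N. a s x * cnj (a s y))"
      using insert.IH[of \<kappa>'] by (elim exE meta_impE) blast+
    then have a: "\<And>x y. x \<in> F \<Longrightarrow> y \<in> F \<Longrightarrow> \<kappa>' y x = (\<Sum>s<N. a s x * cnj (a s y))" by blast
    define b where "b s x = (if s < N then (if x = z then 0 else a s x) else \<kappa> z x / of_real (sqrt r))" for s x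
    have sq: "complex_of_real (sqrt r) * complex_of_real (sqrt r) = of_real r"
      using r(2) by (simp flip: of_real_mult)
    have "\<kappa> y x = (\<Sum>s<Suc N. b s x * cnj (b s y))" if xy: "x \<in> ?E" "y \<in> ?E" for x y
    proof -
      have "(\<Sum>s<N. b s x * cnj (b s y)) = (if x = z \<or> y = z then 0 else \<kappa>' y x)"
        using xy a unfolding b_def by auto
      moreover have "b N x * cnj (b N y) = \<kappa> z x * \<kappa> y z / of_real r"
        unfolding b_def using psd_herm[OF \<kappa>, of z y] xy sq by (simp add: field_simps)
      moreover have "\<kappa> z x * \<kappa> y z / of_real r = \<kappa> y x" if "x = z \<or> y = z"
        using that r by auto
      ultimately show ?thesis unfolding \<kappa>'_def by (auto simp: mult.commute)
    qed
    then show ?thesis by (intro exI[of _ "Suc N"] exI[of _ b]) blast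
  qed
qed

text \<open>The Schur product theorem. On a finite set \<open>\<kappa>\<close> is a sum of rank one
  kernels, and each of them only multiplies the coefficients \<open>c\<close> in the form of
  \<open>\<mu>\<close> by \<open>a s\<close>.\<close>

lemma psd_mult:
  assumes \<kappa>: "psd E \<kappa>" and \<mu>: "psd E \<mu>"
  shows "psd E (\<lambda>y x. \<kappa> y x * \<mu> y x)"
proof (rule psdI)
  fix x y assume "x \<in> E" "y \<in> E"
  then show "\<kappa> y x * \<mu> y x = cnj (\<kappa> x y * \<mu> x y)"
    using psd_herm[OF \<kappa>, of x y] psd_herm[OF \<mu>, of x y] by simp
next
  fix F and c :: "'a \<Rightarrow> complex" assume F: "finite F" "F \<subseteq> E"
  obtain N :: nat and a where "\<forall>x\<in>F. \<forall>y\<in>F. \<kappa> y x = (\<Sum>s<N. a s x * cnj (a s y))"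
    using psd_decompose[OF F(1) psd_subset[OF \<kappa> F(2)]] by (elim exE)
  then have a: "\<And>x y. x \<in> F \<Longrightarrow> y \<in> F \<Longrightarrow> \<kappa> y x = (\<Sum>s<N. a s x * cnj (a s y))" by blast
  have "(\<Sum>x\<in>F. \<Sum>y\<in>F. c x * cnj (c y) * (\<kappa> y x * \<mu> y x))
      = (\<Sum>x\<in>F. \<Sum>y\<in>F. \<Sum>s<N. (c x * a s x) * cnj (c y * a s y) * \<mu> y x)"
    by (intro sum.cong refl) (simp add: a sum_distrib_left sum_distrib_right ac_simps)
  also have "\<dots> = (\<Sum>s<N. \<Sum>x\<in>F. \<Sum>y\<in>F. (c x * a s x) * cnj (c y * a s y) * \<mu> y x)"
    by (subst sum.swap, subst sum.swap) (intro sum.cong refl sum.swap)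
  finally show "0 \<le> Re (\<Sum>x\<in>F. \<Sum>y\<in>F. c x * cnj (c y) * (\<kappa> y x * \<mu> y x))"
    by (simp only: Re_sum[of _ "{..<N}"]) (intro sum_nonneg psd_nonneg[OF \<mu> F])
qed

section \<open>Reproducing kernel spaces\<close>

definition csq :: "'a::complex_vector hspace \<Rightarrow> (nat \<Rightarrow> 'a) \<Rightarrow> bool" where
  "csq P s \<longleftrightarrow> (\<forall>n. s n \<in> hcarrier P) \<and> (\<forall>e>0. \<exists>N. \<forall>m\<ge>N. \<forall>n\<ge>N. hnorm P (s m - s n) < e)"

context
  fixes P :: "'a::complex_vector hspace"
  assumes P: "pre_hilbert P"
begin

lemma csq_in: "csq P s \<Longrightarrow> s n \<in> hcarrier P"
  unfolding csq_def by blast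

lemma csqD: "csq P s \<Longrightarrow> e > 0 \<Longrightarrow> \<exists>N. \<forall>m\<ge>N. \<forall>n\<ge>N. hnorm P (s m - s n) < e"
  unfolding csq_def by blast

lemma csqE:
  assumes "csq P s" "e > 0"
  obtains N where "\<And>m n. m \<ge> N \<Longrightarrow> n \<ge> N \<Longrightarrow> hnorm P (s m - s n) < e"
  using assms unfolding csq_def by blast

lemma csq_const: "x \<in> hcarrier P \<Longrightarrow> csq P (\<lambda>_. x)"
  unfolding csq_def using hnorm_zero[OF P] by simp

lemma csq_add:
  assumes s: "csq P s" and t: "csq P t"
  shows "csq P (\<lambda>n. s n + t n)"
  unfolding csq_def
proof (intro conjI allI impI)
  show "s n + t n \<in> hcarrier P" for n using csq_in[OF s] csq_in[OF t] P by simp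
  fix e :: real assume e: "e > 0"
  obtain N where N: "\<And>m n. m \<ge> N \<Longrightarrow> n \<ge> N \<Longrightarrow> hnorm P (s m - s n) < e/2"
    using csqE[OF s half_gt_zero[OF e]] by blast
  obtain M where M: "\<And>m n. m \<ge> M \<Longrightarrow> n \<ge> M \<Longrightarrow> hnorm P (t m - t n) < e/2"
    using csqE[OF t half_gt_zero[OF e]] by blast
  have "hnorm P (s m + t m - (s n + t n)) < e" if mn: "m \<ge> max N M" "n \<ge> max N M" for m n
  proof -
    have "hnorm P ((s m - s n) + (t m - t n)) \<le> hnorm P (s m - s n) + hnorm P (t m - t n)"
      using csq_in[OF s] csq_in[OF t] P by (intro hnorm_triangle) simp_all
    then show ?thesis using N[of m n] M[of m n] mn by (simp add: algebra_simps)
  qed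
  then show "\<exists>N. \<forall>m\<ge>N. \<forall>n\<ge>N. hnorm P (s m + t m - (s n + t n)) < e" by blast
qed

lemma csq_scale:
  assumes s: "csq P s"
  shows "csq P (\<lambda>n. c *\<^sub>C s n)"
  unfolding csq_def
proof (intro conjI allI impI)
  show "c *\<^sub>C s n \<in> hcarrier P" for n using csq_in[OF s] P by simp
  fix e :: real assume e: "e > 0"
  have p: "cmod c + 1 > 0" by (simp add: add_nonneg_pos)
  obtain N where N: "\<And>m n. m \<ge> N \<Longrightarrow> n \<ge> N \<Longrightarrow> hnorm P (s m - s n) < e / (cmod c + 1)"
    using csqE[OF s divide_pos_pos[OF e p]] by blast
  have "hnorm P (c *\<^sub>C s m - c *\<^sub>C s n) < e" if mn: "m \<ge> N" "n \<ge> N" for m n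
  proof -
    have in1: "s m - s n \<in> hcarrier P" using csq_in[OF s] P by simp
    have "hnorm P (c *\<^sub>C s m - c *\<^sub>C s n) = cmod c * hnorm P (s m - s n)"
      using hnorm_scale[OF P in1, of c] by (simp add: scaleC_diff_right)
    also have "\<dots> \<le> (cmod c + 1) * hnorm P (s m - s n)" using hnorm_nonneg[OF P in1] by (intro mult_right_mono) auto
    also have "\<dots> < e" using N[OF mn] p by (simp add: pos_less_divide_eq mult.commute)
    finally show ?thesis .
  qed
  then show "\<exists>N. \<forall>m\<ge>N. \<forall>n\<ge>N. hnorm P (c *\<^sub>C s m - c *\<^sub>C s n) < e" by blast
qed

lemma csq_diff:
  assumes "csq P s" "csq P t"
  shows "csq P (\<lambda>n. s n - t n)"
  using csq_add[OF assms(1) csq_scale[OF assms(2), of "-1"]] by simp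

lemma csq_bounded:
  assumes s: "csq P s"
  obtains B where "B > 0" "\<And>n. hnorm P (s n) \<le> B"
proof -
  have "\<exists>N. \<forall>m\<ge>N. \<forall>n\<ge>N. hnorm P (s m - s n) < 1"
    by (rule csqD[OF s]) simp
  then obtain N where N: "\<And>m n. m \<ge> N \<Longrightarrow> n \<ge> N \<Longrightarrow> hnorm P (s m - s n) < 1" by blast
  note in1 = csq_in[OF s]
  define B where "B = (\<Sum>i\<le>N. hnorm P (s i)) + 1"
  have le: "hnorm P (s n) \<le> (\<Sum>i\<le>N. hnorm P (s i))" if "n \<le> N" for n
    using that hnorm_nonneg[OF P in1] by (intro member_le_sum) auto
  have "hnorm P (s n) \<le> B" for n
  proof (cases "n \<le> N")
    case True then show ?thesis using le[OF True] unfolding B_def by simp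
  next
    case False
    have "hnorm P ((s n - s N) + s N) \<le> hnorm P (s n - s N) + hnorm P (s N)"
      using in1 P by (intro hnorm_triangle) simp_all
    then show ?thesis using le[of N] N[of n N] False unfolding B_def by simp
  qed
  moreover have "B > 0" unfolding B_def using hnorm_nonneg[OF P in1] by (intro add_nonneg_pos sum_nonneg) auto
  ultimately show thesis using that by blast
qed

lemma csq_inner_convergent:
  assumes s: "csq P s" and t: "csq P t"
  shows "convergent (\<lambda>n. hinner P (s n) (t n))"
proof -
  obtain B where B: "B > 0" "\<And>n. hnorm P (s n) \<le> B" using csq_bounded[OF s] by metis
  obtain D where D: "D > 0" "\<And>n. hnorm P (t n) \<le> D" using csq_bounded[OF t] by metis
  note in1 = csq_in[OF s] csq_in[OF t]
  have "Cauchy (\<lambda>n. hinner P (s n) (t n))"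
  proof (rule CauchyI)
    fix e :: real assume e: "0 < e"
    define d where "d = e / (B + D)"
    have d: "d > 0" unfolding d_def using e B D by simp
    obtain N where N: "\<And>m n. m \<ge> N \<Longrightarrow> n \<ge> N \<Longrightarrow> hnorm P (s m - s n) < d"
      using csqE[OF s d] by blast
    obtain M where M: "\<And>m n. m \<ge> M \<Longrightarrow> n \<ge> M \<Longrightarrow> hnorm P (t m - t n) < d"
      using csqE[OF t d] by blast
    have "norm (hinner P (s m) (t m) - hinner P (s n) (t n)) < e" if mn: "m \<ge> max N M" "n \<ge> max N M" for m n
    proof -
      have "hinner P (s m) (t m) - hinner P (s n) (t n)
        = hinner P (s m - s n) (t m) + hinner P (s n) (t m - t n)" using in1 P by simp
      then have "norm (hinner P (s m) (t m) - hinner P (s n) (t n))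
        \<le> hnorm P (s m - s n) * hnorm P (t m) + hnorm P (s n) * hnorm P (t m - t n)"
        using cauchy_schwarz[OF P, of "s m - s n" "t m"] cauchy_schwarz[OF P, of "s n" "t m - t n"] in1 P
          norm_triangle_ineq[of "hinner P (s m - s n) (t m)" "hinner P (s n) (t m - t n)"]
        by (simp del: inner_diff_left inner_diff_right)
      also have "\<dots> \<le> hnorm P (s m - s n) * D + B * hnorm P (t m - t n)"
        using B D in1 P by (intro add_mono mult_left_mono mult_right_mono) simp_all
      also have "\<dots> < d * D + B * d"
        using N[of m n] M[of m n] mn B D by (intro add_strict_mono mult_strict_right_mono mult_strict_left_mono) auto
      also have "\<dots> = d * (B + D)" by (simp add: algebra_simps)
      also have "\<dots> = e" unfolding d_def using B D by simp
      finally show ?thesis .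
    qed
    then show "\<exists>M. \<forall>m\<ge>M. \<forall>n\<ge>M. norm (hinner P (s m) (t m) - hinner P (s n) (t n)) < e" by blast
  qed
  then show ?thesis by (simp add: Cauchy_convergent_iff)
qed

lemma csq_null_inner:
  assumes s: "csq P s" and t: "csq P t" and l: "(\<lambda>n. hnorm P (s n)) \<longlonglongrightarrow> 0"
  shows "(\<lambda>n. hinner P (s n) (t n)) \<longlonglongrightarrow> 0"
proof -
  obtain D where D: "D > 0" "\<And>n. hnorm P (t n) \<le> D" using csq_bounded[OF t] by metis
  note in1 = csq_in[OF s] csq_in[OF t]
  show ?thesis
  proof (rule null_le)
    show "norm (hinner P (s n) (t n)) \<le> hnorm P (s n) * D" for n
      using cauchy_schwarz[OF P in1, of n n] D(2)[of n] mult_left_mono[OF D(2) hnorm_nonneg[OF P in1(1)], of n n]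
      by linarith
    show "(\<lambda>n. hnorm P (s n) * D) \<longlonglongrightarrow> 0" using tendsto_mult_left_zero[OF l] .
  qed
qed

end

text \<open>The completion is realized by functions from the start: a Cauchy sequence
  \<open>s\<close> becomes the function \<open>ev s\<close> of the limits of its inner products with
  \<open>k e\<close>. Since the vectors \<open>k e\<close> span \<open>P\<close>, sequences with the
  same function differ by a null sequence, so passing to functions performs the quotient as well as
  the completion.\<close>

lemma rk_completion:
  fixes P :: "'a::complex_vector hspace" and E :: "'e set" and k :: "'e \<Rightarrow> 'a"
  assumes P: "pre_hilbert P" and k: "\<And>e. e \<in> E \<Longrightarrow> k e \<in> hcarrier P"
    and span: "\<And>v. v \<in> hcarrier P \<Longrightarrow> \<exists>F c. finite F \<and> F \<subseteq> E \<and> v = (\<Sum>e\<in>F. c e *\<^sub>C k e)"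
  shows "\<exists>H. is_rk_space E (\<lambda>e' e. hinner P (k e) (k e')) H"
proof -
  define ev where "ev s = (\<lambda>e. if e \<in> E then lim (\<lambda>n. hinner P (s n) (k e)) else 0)" for s
  have ev_lim: "(\<lambda>n. hinner P (s n) (k e)) \<longlonglongrightarrow> ev s e" if "csq P s" "e \<in> E" for s e
    using csq_inner_convergent[OF P that(1) csq_const[OF P k[OF that(2)]]] that(2)
    unfolding ev_def by (simp add: convergent_LIMSEQ_iff)
  have evI: "ev s = f" if s: "csq P s" and l: "\<And>e. e \<in> E \<Longrightarrow> (\<lambda>n. hinner P (s n) (k e)) \<longlonglongrightarrow> f e"
    and off: "\<And>e. e \<notin> E \<Longrightarrow> f e = 0" for s f
  proof
    fix e show "ev s e = f e"
      using LIMSEQ_unique[OF ev_lim[OF s] l, of e] off[of e] by (cases "e \<in> E") (auto simp: ev_def)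
  qed
  have ev_add: "ev (\<lambda>n. s n + t n) = ev s + ev t" if s: "csq P s" and t: "csq P t" for s t
  proof (rule evI[OF csq_add[OF P s t]])
    fix e assume e: "e \<in> E"
    show "(\<lambda>n. hinner P (s n + t n) (k e)) \<longlonglongrightarrow> (ev s + ev t) e"
      using tendsto_add[OF ev_lim[OF s e] ev_lim[OF t e]] csq_in[OF P s] csq_in[OF P t] k[OF e] P by simp
  qed (simp add: ev_def)
  have ev_scale: "ev (\<lambda>n. c *\<^sub>C s n) = c *\<^sub>C ev s" if s: "csq P s" for s c
  proof (rule evI[OF csq_scale[OF P s]])
    fix e assume e: "e \<in> E"
    show "(\<lambda>n. hinner P (c *\<^sub>C s n) (k e)) \<longlonglongrightarrow> (c *\<^sub>C ev s) e"
      using tendsto_mult_left[OF ev_lim[OF s e], of c] csq_in[OF P s] k[OF e] P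
      by (simp add: scaleC_fun_def scaleC_complex_def)
  qed (simp add: ev_def scaleC_fun_def scaleC_complex_def)
  have ev_diff: "ev (\<lambda>n. s n - t n) = ev s - ev t" if s: "csq P s" and t: "csq P t" for s t
    using ev_add[OF s csq_scale[OF P t, of "-1"]] ev_scale[OF t, of "-1"] by simp
  \<comment> \<open>If \<open>ev s = 0\<close> then the inner products of \<open>s n\<close> with
    every fixed vector tend to 0. Taking the fixed vector to be a late member \<open>s N\<close>
    gives norm convergence, since \<open>s n\<close> is then close to \<open>s N\<close> in
    norm.\<close>
  have null: "(\<lambda>n. hnorm P (s n)) \<longlonglongrightarrow> 0" if s: "csq P s" and z: "ev s = 0" for s
  proof -
    note in1 = csq_in[OF P s]
    have v0: "(\<lambda>n. hinner P (s n) v) \<longlonglongrightarrow> 0" if v: "v \<in> hcarrier P" for v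
    proof -
      obtain F c where F: "finite F" "F \<subseteq> E" "v = (\<Sum>e\<in>F. c e *\<^sub>C k e)" using span[OF v] by blast
      have "hinner P (s n) v = (\<Sum>e\<in>F. cnj (c e) * hinner P (s n) (k e))" for n
        unfolding F(3) using F(2) in1 k by (intro inner_lincomb_right[OF P]) auto
      moreover have "(\<lambda>n. \<Sum>e\<in>F. cnj (c e) * hinner P (s n) (k e)) \<longlonglongrightarrow> (\<Sum>e\<in>F. cnj (c e) * 0)"
      proof (intro tendsto_sum tendsto_mult_left)
        fix e assume "e \<in> F"
        then have e: "e \<in> E" using F by auto
        show "(\<lambda>n. hinner P (s n) (k e)) \<longlonglongrightarrow> 0" using ev_lim[OF s e] z by simp
      qed
      ultimately show ?thesis by simp
    qed
    obtain B where B: "B > 0" "\<And>n. hnorm P (s n) \<le> B" using csq_bounded[OF P s] by metis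
    have "(\<lambda>n. (hnorm P (s n))\<^sup>2) \<longlonglongrightarrow> 0"
    proof (rule LIMSEQ_I)
      fix e :: real assume e: "0 < e"
      have "e / (2 * B) > 0" using e B by simp
      then obtain N where N: "\<And>m n. m \<ge> N \<Longrightarrow> n \<ge> N \<Longrightarrow> hnorm P (s m - s n) < e / (2 * B)"
        using csqE[OF P s] by blast
      obtain M where M: "\<And>n. n \<ge> M \<Longrightarrow> cmod (hinner P (s n) (s N)) < e / 2"
        using LIMSEQ_D[OF v0[OF in1[of N]], of "e/2"] e by auto
      have "norm ((hnorm P (s n))\<^sup>2 - 0) < e" if n: "n \<ge> max N M" for n
      proof -
        have "(hnorm P (s n))\<^sup>2 = Re (hinner P (s n) (s n - s N)) + Re (hinner P (s n) (s N))"
          using in1 P by (simp add: hnorm_sq)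
        also have "\<dots> \<le> hnorm P (s n) * hnorm P (s n - s N) + cmod (hinner P (s n) (s N))"
          using in1 P by (intro add_mono inner_le complex_Re_le_cmod) simp_all
        also have "\<dots> \<le> B * hnorm P (s n - s N) + cmod (hinner P (s n) (s N))"
          using B in1 P by (intro add_mono mult_right_mono) simp_all
        also have "\<dots> < B * (e / (2 * B)) + e / 2"
          using N[of n N] M[of n] n B by (intro add_strict_mono mult_strict_left_mono) auto
        also have "\<dots> = e" using B by simp
        finally show ?thesis by simp
      qed
      then show "\<exists>no. \<forall>n\<ge>no. norm ((hnorm P (s n))\<^sup>2 - 0) < e" by blast
    qed
    then have "(\<lambda>n. sqrt ((hnorm P (s n))\<^sup>2)) \<longlonglongrightarrow> sqrt 0" by (rule tendsto_real_sqrt)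
    then show ?thesis using hnorm_nonneg[OF P in1] by simp
  qed
  \<comment> \<open>The inner product is defined through chosen representatives;
    \<open>ip_lim\<close> removes the dependence on the choice, because \<open>s\<close> and its
    representative differ by a null sequence.\<close>
  define rep where "rep f = (SOME s. csq P s \<and> ev s = f)" for f
  define ip where "ip f g = lim (\<lambda>n. hinner P (rep f n) (rep g n))" for f g
  have rep: "csq P (rep (ev s))" "ev (rep (ev s)) = ev s" if "csq P s" for s
    using someI[of "\<lambda>t. csq P t \<and> ev t = ev s" s] that unfolding rep_def by auto
  have ip_lim: "(\<lambda>n. hinner P (s n) (t n)) \<longlonglongrightarrow> ip (ev s) (ev t)" if s: "csq P s" and t: "csq P t" for s t
  proof -
    let ?s = "rep (ev s)" and ?t = "rep (ev t)"
    have l: "(\<lambda>n. hinner P (?s n) (?t n)) \<longlonglongrightarrow> ip (ev s) (ev t)"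
      unfolding ip_def using csq_inner_convergent[OF P rep(1)[OF s] rep(1)[OF t]]
      by (simp add: convergent_LIMSEQ_iff)
    have d: "csq P (\<lambda>n. s n - ?s n)" "csq P (\<lambda>n. t n - ?t n)"
      using csq_diff[OF P] s t rep by auto
    have "ev (\<lambda>n. s n - ?s n) = 0" "ev (\<lambda>n. t n - ?t n) = 0"
      using ev_diff s t rep by simp_all
    then have n: "(\<lambda>n. hnorm P (s n - ?s n)) \<longlonglongrightarrow> 0" "(\<lambda>n. hnorm P (t n - ?t n)) \<longlonglongrightarrow> 0"
      using null d by auto
    note in1 = csq_in[OF P s] csq_in[OF P t] csq_in[OF P rep(1)[OF s]] csq_in[OF P rep(1)[OF t]]
    have "(\<lambda>n. hinner P (s n - ?s n) (t n)) \<longlonglongrightarrow> 0" by (rule csq_null_inner[OF P d(1) t n(1)])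
    moreover have "(\<lambda>n. hinner P (t n - ?t n) (?s n)) \<longlonglongrightarrow> 0"
      by (rule csq_null_inner[OF P d(2) rep(1)[OF s] n(2)])
    then have "(\<lambda>n. cnj (hinner P (t n - ?t n) (?s n))) \<longlonglongrightarrow> 0" using tendsto_cnj by force
    ultimately have "(\<lambda>n. hinner P (s n - ?s n) (t n) + cnj (hinner P (t n - ?t n) (?s n))
        + hinner P (?s n) (?t n)) \<longlonglongrightarrow> 0 + 0 + ip (ev s) (ev t)"
      by (intro tendsto_add l)
    moreover have "hinner P (s n - ?s n) (t n) + cnj (hinner P (t n - ?t n) (?s n)) + hinner P (?s n) (?t n)
        = hinner P (s n) (t n)" for n
      using in1 P inner_commute[OF P in1(2)[of n] in1(3)[of n]] inner_commute[OF P in1(4)[of n] in1(3)[of n]] by simp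
    ultimately show ?thesis by simp
  qed
  have ipI: "ip (ev s) (ev t) = c" if "csq P s" "csq P t" "(\<lambda>n. hinner P (s n) (t n)) \<longlonglongrightarrow> c" for s t c
    using LIMSEQ_unique[OF ip_lim[OF that(1,2)] that(3)] .
  define H where "H = \<lparr>hcarrier = {ev s | s. csq P s}, hinner = ip\<rparr>"
  have Hc: "f \<in> hcarrier H \<longleftrightarrow> (\<exists>s. csq P s \<and> f = ev s)" for f unfolding H_def by auto
  have Hi: "hinner H = ip" unfolding H_def by simp
  have HE: "ev s \<in> hcarrier H" if "csq P s" for s using that Hc by blast
  have pre: "pre_hilbert H"
    unfolding pre_hilbert_def
  proof (intro conjI ballI allI)
    show "complex_vector.subspace (hcarrier H)"
      unfolding complex_vector.subspace_def
    proof (intro conjI ballI allI)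
      have c0: "csq P (\<lambda>_. 0)" using csq_const[OF P zero_in[OF P]] .
      have "ev (\<lambda>_. 0) = 0" using ev_scale[OF c0, of 0] by simp
      then show "0 \<in> hcarrier H" using HE[OF c0] by simp
    next
      fix f g assume "f \<in> hcarrier H" "g \<in> hcarrier H"
      then obtain s t where "csq P s" "f = ev s" "csq P t" "g = ev t" using Hc by blast
      then show "f + g \<in> hcarrier H" using HE[OF csq_add[OF P, of s t]] ev_add by simp
    next
      fix c f assume "f \<in> hcarrier H"
      then obtain s where "csq P s" "f = ev s" using Hc by blast
      then show "c *\<^sub>C f \<in> hcarrier H" using HE[OF csq_scale[OF P, of s c]] ev_scale by simp
    qed
    fix f assume "f \<in> hcarrier H"
    then obtain s where s: "csq P s" "f = ev s" using Hc by blast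
    have "(\<lambda>n. Re (hinner P (s n) (s n))) \<longlonglongrightarrow> Re (ip f f)"
      unfolding s(2) by (intro tendsto_Re ip_lim s)
    then show "0 \<le> Re (hinner H f f)" unfolding Hi
      by (rule LIMSEQ_le_const) (use inner_self_nonneg[OF P csq_in[OF P s(1)]] in blast)
    fix g assume "g \<in> hcarrier H"
    then obtain t where t: "csq P t" "g = ev t" using Hc by blast
    show "hinner H g f = cnj (hinner H f g)"
      unfolding Hi s(2) t(2)
    proof (rule ipI[OF t(1) s(1)])
      have "hinner P (t n) (s n) = cnj (hinner P (s n) (t n))" for n
        using inner_commute[OF P csq_in[OF P s(1)] csq_in[OF P t(1)]] .
      then show "(\<lambda>n. hinner P (t n) (s n)) \<longlonglongrightarrow> cnj (ip (ev s) (ev t))"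
        using tendsto_cnj[OF ip_lim[OF s(1) t(1)]] by simp
    qed
    show "hinner H (a *\<^sub>C f) g = a * hinner H f g" for a
      unfolding Hi s(2) t(2) ev_scale[OF s(1), symmetric]
    proof (rule ipI[OF csq_scale[OF P s(1)] t(1)])
      show "(\<lambda>n. hinner P (a *\<^sub>C s n) (t n)) \<longlonglongrightarrow> a * ip (ev s) (ev t)"
        using tendsto_mult_left[OF ip_lim[OF s(1) t(1)], of a] csq_in[OF P s(1)] csq_in[OF P t(1)] P by simp
    qed
    fix h assume "h \<in> hcarrier H"
    then obtain u where u: "csq P u" "h = ev u" using Hc by blast
    show "hinner H (f + g) h = hinner H f h + hinner H g h"
      unfolding Hi s(2) t(2) u(2) ev_add[OF s(1) t(1), symmetric]
    proof (rule ipI[OF csq_add[OF P s(1) t(1)] u(1)])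
      show "(\<lambda>n. hinner P (s n + t n) (u n)) \<longlonglongrightarrow> ip (ev s) (ev u) + ip (ev t) (ev u)"
        using tendsto_add[OF ip_lim[OF s(1) u(1)] ip_lim[OF t(1) u(1)]]
          csq_in[OF P s(1)] csq_in[OF P t(1)] csq_in[OF P u(1)] P by simp
    qed
  qed
  have norm_lim: "(\<lambda>n. hnorm P (s n)) \<longlonglongrightarrow> hnorm H (ev s)" if s: "csq P s" for s
    unfolding hnorm_def Hi by (intro tendsto_real_sqrt tendsto_Re ip_lim s)
  have hil: "hilbert_space H"
  proof (rule hilbert_spaceI[OF pre])
    fix f assume "f \<in> hcarrier H" and z: "hinner H f f = 0"
    then obtain s where s: "csq P s" "f = ev s" using Hc by blast
    have "hnorm H (ev s) = 0" using z unfolding s(2) hnorm_def by simp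
    then have l: "(\<lambda>n. hnorm P (s n)) \<longlonglongrightarrow> 0" using norm_lim[OF s(1)] by simp
    have "ev s = 0"
    proof (rule evI[OF s(1)])
      fix e assume e: "e \<in> E"
      show "(\<lambda>n. hinner P (s n) (k e)) \<longlonglongrightarrow> 0 e"
        using csq_null_inner[OF P s(1) csq_const[OF P k[OF e]] l] by simp
    qed simp
    then show "f = 0" using s by simp
  next
    fix f :: "nat \<Rightarrow> 'e \<Rightarrow> complex" assume fH: "\<And>n. f n \<in> hcarrier H"
      and cau: "\<And>e. e > 0 \<Longrightarrow> \<exists>N. \<forall>m\<ge>N. \<forall>n\<ge>N. hnorm H (f m - f n) < e"
    \<comment> \<open>Constant sequences embed \<open>P\<close> isometrically. Approximating each
      \<open>f n\<close> by a constant \<open>d n\<close> up to \<open>1 / (n + 1)\<close> makes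
      \<open>d\<close> a Cauchy sequence in \<open>P\<close>, and \<open>ev d\<close> is the limit
      sought.\<close>
    let ?c = "\<lambda>x. ev (\<lambda>_. x)"
    have "\<exists>x\<in>hcarrier P. hnorm H (f n - ?c x) < 1 / real (Suc n)" for n
    proof -
      obtain s where s: "csq P s" "f n = ev s" using fH Hc by blast
      have p: "1 / (2 * real (Suc n)) > 0" by simp
      obtain N where N: "\<And>j m. j \<ge> N \<Longrightarrow> m \<ge> N \<Longrightarrow> hnorm P (s j - s m) < 1 / (2 * real (Suc n))"
        using csqE[OF P s(1) p] by blast
      note cst = csq_const[OF P csq_in[OF P s(1)], of N]
      have "hnorm H (ev (\<lambda>j. s j - s N)) \<le> 1 / (2 * real (Suc n))"
        by (rule LIMSEQ_le_const2[OF norm_lim[OF csq_diff[OF P s(1) cst]]]) (use N in \<open>auto intro: less_imp_le\<close>)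
      also have "\<dots> < 1 / real (Suc n)" by (simp add: field_simps)
      finally show ?thesis unfolding s(2) using ev_diff[OF s(1) cst] csq_in[OF P s(1)] by auto
    qed
    then obtain d where d: "\<And>n. d n \<in> hcarrier P" "\<And>n. hnorm H (f n - ?c (d n)) < 1 / real (Suc n)" by metis
    have cH: "?c (d n) \<in> hcarrier H" for n using HE[OF csq_const[OF P d(1)]] .
    have cnorm: "hnorm H (?c x) = hnorm P x" if "x \<in> hcarrier P" for x
      using LIMSEQ_unique[OF norm_lim[OF csq_const[OF P that]] tendsto_const] .
    have dd: "hnorm P (d m - d n) = hnorm H (?c (d m) - ?c (d n))" for m n
      using cnorm[of "d m - d n"] d(1) P ev_diff[OF csq_const[OF P d(1)] csq_const[OF P d(1)], of m n] by simp
    have cd: "csq P d"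
      unfolding csq_def
    proof (intro conjI allI impI)
      fix e :: real assume e: "e > 0"
      then have e3: "e / 3 > 0" by simp
      obtain N where N: "\<And>m n. m \<ge> N \<Longrightarrow> n \<ge> N \<Longrightarrow> hnorm H (f m - f n) < e / 3" using cau[OF e3] by blast
      obtain M where M: "1 / real (Suc M) < e / 3" using reals_Archimedean[OF e3] by (auto simp: inverse_eq_divide)
      have "hnorm P (d m - d n) < e" if mn: "m \<ge> max N M" "n \<ge> max N M" for m n
      proof -
        have b: "hnorm H (f j - ?c (d j)) < e / 3" if "j \<ge> M" for j
        proof -
          have "1 / real (Suc j) \<le> 1 / real (Suc M)" using that by (simp add: field_simps)
          then show ?thesis using d(2)[of j] M by linarith
        qed
        have "hnorm H (?c (d m) - ?c (d n)) \<le> hnorm H (?c (d m) - f m) + hnorm H (f m - ?c (d n))"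
          by (rule hnorm_triangle3[OF pre cH fH cH])
        also have "\<dots> \<le> hnorm H (?c (d m) - f m) + (hnorm H (f m - f n) + hnorm H (f n - ?c (d n)))"
          by (intro add_left_mono hnorm_triangle3[OF pre fH fH cH])
        also have "\<dots> < e"
          using N[of m n] b[of m] b[of n] mn hnorm_diff_commute[OF pre cH fH, of m m] by simp
        finally show ?thesis unfolding dd .
      qed
      then show "\<exists>N. \<forall>m\<ge>N. \<forall>n\<ge>N. hnorm P (d m - d n) < e" by blast
    qed (use d in blast)
    have "(\<lambda>n. hnorm H (f n - ev d)) \<longlonglongrightarrow> 0"
    proof (rule LIMSEQ_I)
      fix e :: real assume e: "0 < e"
      then have e3: "e / 3 > 0" by simp
      obtain N where N: "\<And>m n. m \<ge> N \<Longrightarrow> n \<ge> N \<Longrightarrow> hnorm P (d m - d n) < e / 3" using csqE[OF P cd e3] by blast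
      obtain M where M: "1 / real (Suc M) < e / 3" using reals_Archimedean[OF e3] by (auto simp: inverse_eq_divide)
      have "norm (hnorm H (f n - ev d) - 0) < e" if n: "n \<ge> max N M" for n
      proof -
        have "1 / real (Suc n) \<le> 1 / real (Suc M)" using n by (simp add: field_simps)
        then have b: "hnorm H (f n - ?c (d n)) < e / 3" using d(2)[of n] M by linarith
        have "hnorm H (ev (\<lambda>j. d n - d j)) \<le> e / 3"
          by (rule LIMSEQ_le_const2[OF norm_lim[OF csq_diff[OF P csq_const[OF P d(1)] cd]]])
            (use N n in \<open>auto intro!: exI[of _ N] less_imp_le\<close>)
        then have "hnorm H (?c (d n) - ev d) \<le> e / 3" using ev_diff[OF csq_const[OF P d(1)] cd] by simp
        moreover have "hnorm H (f n - ev d) \<le> hnorm H (f n - ?c (d n)) + hnorm H (?c (d n) - ev d)"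
          by (rule hnorm_triangle3[OF pre fH cH HE[OF cd]])
        moreover have "0 \<le> hnorm H (f n - ev d)"
          by (rule hnorm_nonneg[OF pre diff_in[OF pre fH HE[OF cd]]])
        ultimately show ?thesis using b e by simp
      qed
      then show "\<exists>no. \<forall>n\<ge>no. norm (hnorm H (f n - ev d) - 0) < e" by blast
    qed
    then show "\<exists>x\<in>hcarrier H. (\<lambda>n. hnorm H (f n - x)) \<longlonglongrightarrow> 0" using HE[OF cd] by blast
  qed
  have rkp: "rk_point E (\<lambda>e' e. hinner P (k e) (k e')) e = ev (\<lambda>_. k e)" if e: "e \<in> E" for e
  proof (rule evI[OF csq_const[OF P k[OF e]], symmetric])
    fix e' assume "e' \<in> E"
    then show "(\<lambda>n. hinner P (k e) (k e')) \<longlonglongrightarrow> rk_point E (\<lambda>e' e. hinner P (k e) (k e')) e e'"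
      unfolding rk_point_def by simp
  qed (simp add: rk_point_def)
  have "is_rk_space E (\<lambda>e' e. hinner P (k e) (k e')) H"
    unfolding is_rk_space_def
  proof (intro conjI ballI allI impI hil)
    fix f e assume "f \<in> hcarrier H" "e \<notin> E"
    then show "f e = 0" using Hc by (auto simp: ev_def)
  next
    fix e assume e: "e \<in> E"
    show "rk_point E (\<lambda>e' e. hinner P (k e) (k e')) e \<in> hcarrier H"
      unfolding rkp[OF e] by (rule HE[OF csq_const[OF P k[OF e]]])
    fix f assume "f \<in> hcarrier H"
    then obtain s where s: "csq P s" "f = ev s" using Hc by blast
    show "f e = hinner H f (rk_point E (\<lambda>e' e. hinner P (k e) (k e')) e)"
      unfolding Hi rkp[OF e] s(2) by (rule ipI[OF s(1) csq_const[OF P k[OF e]] ev_lim[OF s(1) e], symmetric])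
  qed
  then show ?thesis by blast
qed

lemma fun_sum_apply: "(\<Sum>i\<in>F. f i) x = (\<Sum>i\<in>F. (f i x :: 'b::ab_group_add))"
  by (induction F rule: infinite_finite_induct) simp_all

text \<open>The free construction: finitely supported coefficient functions on \<open>E\<close> with
  the form given by \<open>\<kappa>\<close>, in which the unit functions \<open>k e\<close> have the
  prescribed Gram matrix. Vectors of norm 0 may occur; \<open>rk_completion\<close> identifies them
  with 0.\<close>

lemma rk_space_exists:
  assumes \<kappa>: "psd E \<kappa>"
  shows "\<exists>H. is_rk_space E \<kappa> H"
proof -
  define V :: "('a \<Rightarrow> complex) set" where "V = {c. finite {e. c e \<noteq> 0} \<and> {e. c e \<noteq> 0} \<subseteq> E}"
  define B where "B c d = (\<Sum>x | c x \<noteq> 0. \<Sum>y | d y \<noteq> 0. c x * cnj (d y) * \<kappa> y x)" for c d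
  define P where "P = \<lparr>hcarrier = V, hinner = B\<rparr>"
  \<comment> \<open>Both sums may run over any finite set containing the supports, which gives
    vectors with different supports a common range of summation.\<close>
  have B: "B c d = (\<Sum>x\<in>F. \<Sum>y\<in>F. c x * cnj (d y) * \<kappa> y x)"
    if F: "finite F" "{e. c e \<noteq> 0} \<subseteq> F" "{e. d e \<noteq> 0} \<subseteq> F" for c d F
  proof -
    have "(\<Sum>x\<in>F. \<Sum>y\<in>F. c x * cnj (d y) * \<kappa> y x) = (\<Sum>x\<in>F. \<Sum>y | d y \<noteq> 0. c x * cnj (d y) * \<kappa> y x)"
      using F by (intro sum.cong refl sum.mono_neutral_right) auto
    also have "\<dots> = B c d" unfolding B_def using F by (intro sum.mono_neutral_right) auto
    finally show ?thesis by simp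
  qed
  have Vadd: "c + d \<in> V" if "c \<in> V" "d \<in> V" for c d
  proof -
    have "{e. (c + d) e \<noteq> 0} \<subseteq> {e. c e \<noteq> 0} \<union> {e. d e \<noteq> 0}" by auto
    then show ?thesis using that unfolding V_def by (auto intro: finite_subset)
  qed
  have Vscale: "a *\<^sub>C c \<in> V" if "c \<in> V" for a c
  proof -
    have "{e. (a *\<^sub>C c) e \<noteq> 0} \<subseteq> {e. c e \<noteq> 0}" by (auto simp: scaleC_fun_def scaleC_complex_def)
    then show ?thesis using that unfolding V_def by (auto intro: finite_subset)
  qed
  have pre: "pre_hilbert P"
    unfolding pre_hilbert_def P_def hspace.simps
  proof (intro conjI ballI allI)
    show "complex_vector.subspace V"
      unfolding complex_vector.subspace_def using Vadd Vscale by (auto simp: V_def)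
    fix c assume c: "c \<in> V"
    show "0 \<le> Re (B c c)" unfolding B_def using c psd_nonneg[OF \<kappa>] unfolding V_def by blast
    fix d assume d: "d \<in> V"
    let ?F = "{e. c e \<noteq> 0} \<union> {e. d e \<noteq> 0}"
    have F: "finite ?F" "?F \<subseteq> E" using c d unfolding V_def by auto
    have "B d c = (\<Sum>x\<in>?F. \<Sum>y\<in>?F. d x * cnj (c y) * \<kappa> y x)" using F by (intro B) auto
    also have "\<dots> = (\<Sum>y\<in>?F. \<Sum>x\<in>?F. d x * cnj (c y) * \<kappa> y x)" by (rule sum.swap)
    also have "\<dots> = (\<Sum>y\<in>?F. \<Sum>x\<in>?F. cnj (c y * cnj (d x) * \<kappa> x y))"
    proof (intro sum.cong refl)
      fix y x assume "y \<in> ?F" "x \<in> ?F"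
      then have "\<kappa> y x = cnj (\<kappa> x y)" using F(2) by (intro psd_herm[OF \<kappa>]) auto
      then show "d x * cnj (c y) * \<kappa> y x = cnj (c y * cnj (d x) * \<kappa> x y)" by simp
    qed
    also have "\<dots> = cnj (\<Sum>y\<in>?F. \<Sum>x\<in>?F. c y * cnj (d x) * \<kappa> x y)" by simp
    also have "(\<Sum>y\<in>?F. \<Sum>x\<in>?F. c y * cnj (d x) * \<kappa> x y) = B c d" using F by (intro B[symmetric]) auto
    finally show "B d c = cnj (B c d)" .
    show "B (a *\<^sub>C c) d = a * B c d" for a
    proof -
      have "B (a *\<^sub>C c) d = (\<Sum>x\<in>?F. \<Sum>y\<in>?F. (a *\<^sub>C c) x * cnj (d y) * \<kappa> y x)"
        using F by (intro B) (auto simp: scaleC_fun_def scaleC_complex_def)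
      also have "\<dots> = a * (\<Sum>x\<in>?F. \<Sum>y\<in>?F. c x * cnj (d y) * \<kappa> y x)"
        by (simp add: scaleC_fun_def scaleC_complex_def sum_distrib_left mult.assoc)
      also have "(\<Sum>x\<in>?F. \<Sum>y\<in>?F. c x * cnj (d y) * \<kappa> y x) = B c d" using F by (intro B[symmetric]) auto
      finally show ?thesis .
    qed
    fix g assume g: "g \<in> V"
    let ?G = "?F \<union> {e. g e \<noteq> 0}"
    have G: "finite ?G" using F g unfolding V_def by auto
    have "B (c + d) g = (\<Sum>x\<in>?G. \<Sum>y\<in>?G. (c + d) x * cnj (g y) * \<kappa> y x)"
      using G by (intro B) auto
    also have "\<dots> = (\<Sum>x\<in>?G. \<Sum>y\<in>?G. c x * cnj (g y) * \<kappa> y x) + (\<Sum>x\<in>?G. \<Sum>y\<in>?G. d x * cnj (g y) * \<kappa> y x)"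
      by (simp add: algebra_simps sum.distrib)
    also have "(\<Sum>x\<in>?G. \<Sum>y\<in>?G. c x * cnj (g y) * \<kappa> y x) = B c g" using G by (intro B[symmetric]) auto
    also have "(\<Sum>x\<in>?G. \<Sum>y\<in>?G. d x * cnj (g y) * \<kappa> y x) = B d g" using G by (intro B[symmetric]) auto
    finally show "B (c + d) g = B c g + B d g" .
  qed
  define k :: "'a \<Rightarrow> 'a \<Rightarrow> complex" where "k e = (\<lambda>x. if x = e then 1 else 0)" for e
  have supp: "{x. k e x \<noteq> 0} = {e}" for e unfolding k_def by auto
  have kV: "k e \<in> hcarrier P" if "e \<in> E" for e unfolding P_def V_def using that supp by simp
  have kk: "hinner P (k e) (k e') = \<kappa> e' e" for e e'
    unfolding P_def hspace.simps B_def supp by (simp add: k_def)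
  have sp: "\<exists>F c. finite F \<and> F \<subseteq> E \<and> v = (\<Sum>e\<in>F. c e *\<^sub>C k e)" if v: "v \<in> hcarrier P" for v
  proof (intro exI conjI)
    let ?F = "{e. v e \<noteq> 0}"
    show f: "finite ?F" "?F \<subseteq> E" using v unfolding P_def V_def by auto
    show "v = (\<Sum>e\<in>?F. v e *\<^sub>C k e)"
    proof
      fix x
      have "(\<Sum>e\<in>?F. v e *\<^sub>C k e) x = (\<Sum>e\<in>?F. v e * k e x)"
        by (simp add: fun_sum_apply scaleC_fun_def scaleC_complex_def)
      also have "\<dots> = v x" unfolding k_def using f by (simp add: if_distrib[of "\<lambda>t. _ * t"] cong: if_cong)
      finally show "v x = (\<Sum>e\<in>?F. v e *\<^sub>C k e) x" by simp
    qed
  qed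
  show ?thesis using rk_completion[OF pre kV sp] unfolding kk by simp
qed

lemma rk_space_is: "psd E \<kappa> \<Longrightarrow> is_rk_space E \<kappa> (rk_space E \<kappa>)"
  unfolding rk_space_def using someI_ex[OF rk_space_exists] by blast

lemma
  assumes "psd E \<kappa>"
  shows rk_hilbert: "hilbert_space (rk_space E \<kappa>)"
    and rk_point_in: "e \<in> E \<Longrightarrow> rk_point E \<kappa> e \<in> hcarrier (rk_space E \<kappa>)"
    and rk_eval: "f \<in> hcarrier (rk_space E \<kappa>) \<Longrightarrow> e \<in> E \<Longrightarrow> hinner (rk_space E \<kappa>) f (rk_point E \<kappa> e) = f e"
    and rk_off: "f \<in> hcarrier (rk_space E \<kappa>) \<Longrightarrow> e \<notin> E \<Longrightarrow> f e = 0"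
  using rk_space_is[OF assms] unfolding is_rk_space_def by metis+

lemma rk_inner:
  assumes "psd E \<kappa>" "e \<in> E" "e' \<in> E"
  shows "hinner (rk_space E \<kappa>) (rk_point E \<kappa> e) (rk_point E \<kappa> e') = \<kappa> e' e"
  using rk_eval[OF assms(1) rk_point_in[OF assms(1,2)] assms(3)] assms(3) by (simp add: rk_point_def)

lemma rk_total:
  assumes "psd E \<kappa>" "f \<in> hcarrier (rk_space E \<kappa>)"
    "\<And>e. e \<in> E \<Longrightarrow> hinner (rk_space E \<kappa>) f (rk_point E \<kappa> e) = 0"
  shows "f = 0"
proof
  fix e show "f e = 0 e"
    using rk_eval[OF assms(1,2), of e] rk_off[OF assms(1,2), of e] assms(3)[of e] by (cases "e \<in> E") auto
qed

section \<open>Transport of structure\<close>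

text \<open>Serves to replace a Hilbert space by a copy whose elements are of a required type: nc
  functions in the case of \<open>nc_rkhs\<close>, functions on lists in the case of the state
  space. The inner product is meaningful on the image of the carrier.\<close>

definition htransport :: "'a::complex_vector hspace \<Rightarrow> ('a \<Rightarrow> 'b::complex_vector) \<Rightarrow> 'b hspace" where
  "htransport H \<phi> = \<lparr>hcarrier = \<phi> ` hcarrier H,
     hinner = (\<lambda>f g. hinner H (inv_into (hcarrier H) \<phi> f) (inv_into (hcarrier H) \<phi> g))\<rparr>"

lemma htransport:
  assumes H: "hilbert_space H"
    and add: "\<And>x y. x \<in> hcarrier H \<Longrightarrow> y \<in> hcarrier H \<Longrightarrow> \<phi> (x + y) = \<phi> x + \<phi> y"
    and scale: "\<And>x a. x \<in> hcarrier H \<Longrightarrow> \<phi> (a *\<^sub>C x) = a *\<^sub>C \<phi> x"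
    and inj: "\<And>x. x \<in> hcarrier H \<Longrightarrow> \<phi> x = 0 \<Longrightarrow> x = 0"
  shows "hilbert_space (htransport H \<phi>)"
    and "x \<in> hcarrier H \<Longrightarrow> y \<in> hcarrier H \<Longrightarrow> hinner (htransport H \<phi>) (\<phi> x) (\<phi> y) = hinner H x y"
    and "hcarrier (htransport H \<phi>) = \<phi> ` hcarrier H"
proof -
  let ?K = "htransport H \<phi>"
  have Hp: "pre_hilbert H" using H by simp
  have dif: "\<phi> (x - y) = \<phi> x - \<phi> y" if "x \<in> hcarrier H" "y \<in> hcarrier H" for x y
    using add[of x "- y"] scale[of y "-1"] that Hp by simp
  have inj': "inj_on \<phi> (hcarrier H)"
  proof (rule inj_onI)
    fix x y assume xy: "x \<in> hcarrier H" "y \<in> hcarrier H" "\<phi> x = \<phi> y"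
    have "x - y = 0" by (rule inj) (use xy Hp dif in simp_all)
    then show "x = y" by simp
  qed
  show c: "hcarrier ?K = \<phi> ` hcarrier H" unfolding htransport_def by simp
  have i: "hinner ?K (\<phi> x) (\<phi> y) = hinner H x y" if "x \<in> hcarrier H" "y \<in> hcarrier H" for x y
    unfolding htransport_def using that inj' by simp
  then show "x \<in> hcarrier H \<Longrightarrow> y \<in> hcarrier H \<Longrightarrow> hinner ?K (\<phi> x) (\<phi> y) = hinner H x y" .
  have add': "\<phi> x + \<phi> y = \<phi> (x + y)" if "x \<in> hcarrier H" "y \<in> hcarrier H" for x y using add that by simp
  have scale': "a *\<^sub>C \<phi> x = \<phi> (a *\<^sub>C x)" if "x \<in> hcarrier H" for x a using scale that by simp
  have z: "\<phi> 0 = 0" using scale[of 0 0] Hp by simp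
  have pre: "pre_hilbert ?K"
    unfolding pre_hilbert_def c complex_vector.subspace_def
  proof (intro conjI ballI allI)
    show "0 \<in> \<phi> ` hcarrier H" using z zero_in[OF Hp] by (metis image_eqI)
  next
    fix f g assume "f \<in> \<phi> ` hcarrier H" "g \<in> \<phi> ` hcarrier H"
    then obtain x y where "x \<in> hcarrier H" "f = \<phi> x" "y \<in> hcarrier H" "g = \<phi> y" by blast
    then show "hinner ?K g f = cnj (hinner ?K f g)"
      using inner_commute[OF Hp, of x y] i by simp
  qed (use Hp in \<open>auto simp: add' scale' i inner_self_nonneg intro!: imageI\<close>)
  have n: "hnorm ?K (\<phi> x) = hnorm H x" if "x \<in> hcarrier H" for x unfolding hnorm_def using i that by simp
  show "hilbert_space ?K"
  proof (rule hilbert_spaceI[OF pre])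
    fix f assume "f \<in> hcarrier ?K" and f0: "hinner ?K f f = 0"
    then obtain x where x: "x \<in> hcarrier H" "f = \<phi> x" unfolding c by blast
    have "hinner H x x = 0" using f0 i x by simp
    then have "x = 0" by (rule inner_eq_zero[OF H x(1)])
    then show "f = 0" using x z by simp
  next
    fix f :: "nat \<Rightarrow> 'b" assume f: "\<And>n. f n \<in> hcarrier ?K"
      and cau: "\<And>e. e > 0 \<Longrightarrow> \<exists>N. \<forall>m\<ge>N. \<forall>n\<ge>N. hnorm ?K (f m - f n) < e"
    have "\<exists>x. x \<in> hcarrier H \<and> f n = \<phi> x" for n using f unfolding c by blast
    then obtain s where s: "\<And>n. s n \<in> hcarrier H" "\<And>n. f n = \<phi> (s n)" by metis
    have nd: "hnorm ?K (\<phi> x - \<phi> y) = hnorm H (x - y)" if "x \<in> hcarrier H" "y \<in> hcarrier H" for x y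
      using n[of "x - y"] dif that Hp by simp
    have "\<exists>N. \<forall>m\<ge>N. \<forall>n\<ge>N. hnorm H (s m - s n) < e" if "e > 0" for e
      using cau[OF that] s nd by simp
    from hilbert_complete[OF H s(1) this] obtain x
      where x: "x \<in> hcarrier H" "(\<lambda>n. hnorm H (s n - x)) \<longlonglongrightarrow> 0" by blast
    have "(\<lambda>n. hnorm ?K (f n - \<phi> x)) \<longlonglongrightarrow> 0" using x s nd by simp
    then show "\<exists>x\<in>hcarrier ?K. (\<lambda>n. hnorm ?K (f n - x)) \<longlonglongrightarrow> 0" unfolding c using x by blast
  qed
qed

section \<open>Direct sums\<close>

lemma complex_hspace_simps [simp]:
  "hcarrier complex_hspace = UNIV" "hinner complex_hspace x y = x * cnj y"
  unfolding complex_hspace_def by simp_all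

lemma hnorm_complex [simp]: "hnorm complex_hspace x = cmod x"
  unfolding hnorm_def by (simp add: cmod_def power2_eq_square)

lemma hilbert_complex [simp]: "hilbert_space complex_hspace"
proof (rule hilbert_spaceI)
  show "pre_hilbert complex_hspace"
    unfolding pre_hilbert_def by (auto simp: complex_vector.subspace_def algebra_simps scaleC_complex_def)
next
  fix s :: "nat \<Rightarrow> complex"
  assume c: "\<And>e. e > 0 \<Longrightarrow> \<exists>N. \<forall>m\<ge>N. \<forall>n\<ge>N. hnorm complex_hspace (s m - s n) < e"
  have "Cauchy s" by (rule CauchyI) (use c in simp)
  then obtain x where "s \<longlonglongrightarrow> x" by (auto simp: Cauchy_convergent_iff convergent_def)
  then have "(\<lambda>n. cmod (s n - x)) \<longlonglongrightarrow> 0" by (intro tendsto_norm_zero) (simp add: LIM_zero)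
  then show "\<exists>x\<in>hcarrier complex_hspace. (\<lambda>n. hnorm complex_hspace (s n - x)) \<longlonglongrightarrow> 0" by auto
qed simp

lemma hsum_carrier [simp]: "p \<in> hcarrier (hsum H K) \<longleftrightarrow> fst p \<in> hcarrier H \<and> snd p \<in> hcarrier K"
  unfolding hsum_def by (auto simp: mem_Times_iff)

lemma hsum_inner [simp]: "hinner (hsum H K) p q = hinner H (fst p) (fst q) + hinner K (snd p) (snd q)"
  unfolding hsum_def by simp

lemma hsum_norm_sq:
  assumes "pre_hilbert H" "pre_hilbert K" "fst p \<in> hcarrier H" "snd p \<in> hcarrier K"
  shows "(hnorm (hsum H K) p)\<^sup>2 = (hnorm H (fst p))\<^sup>2 + (hnorm K (snd p))\<^sup>2"
  using assms inner_self_nonneg[OF assms(1,3)] inner_self_nonneg[OF assms(2,4)]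
  unfolding hnorm_def by simp

lemma le_of_sq_le: "a\<^sup>2 \<le> b\<^sup>2 \<Longrightarrow> 0 \<le> b \<Longrightarrow> a \<le> (b::real)"
  by (rule power2_le_imp_le)

lemma pre_hilbert_hsum:
  assumes H: "pre_hilbert H" and K: "pre_hilbert K"
  shows "pre_hilbert (hsum H K)"
  unfolding pre_hilbert_def complex_vector.subspace_def
proof (intro conjI ballI allI)
  fix x y assume "x \<in> hcarrier (hsum H K)" "y \<in> hcarrier (hsum H K)"
  then show "hinner (hsum H K) y x = cnj (hinner (hsum H K) x y)"
    using inner_commute[OF H, of "fst x" "fst y"] inner_commute[OF K, of "snd x" "snd y"] by simp
qed (use H K in \<open>simp_all add: scaleC_prod_def distrib_left inner_self_nonneg\<close>)

lemma hilbert_hsum [simp]: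
  assumes H: "hilbert_space H" and K: "hilbert_space K"
  shows "hilbert_space (hsum H K)"
proof (rule hilbert_spaceI)
  have Hp: "pre_hilbert H" "pre_hilbert K" using H K by simp_all
  show pre: "pre_hilbert (hsum H K)" using pre_hilbert_hsum[OF Hp] .
  fix x assume x: "x \<in> hcarrier (hsum H K)" and z: "hinner (hsum H K) x x = 0"
  have "Re (hinner H (fst x) (fst x)) + Re (hinner K (snd x) (snd x)) = 0"
    using z by (metis hsum_inner plus_complex.simps(1) zero_complex.simps(1))
  then have "hnorm H (fst x) = 0" "hnorm K (snd x) = 0"
    using inner_self_nonneg[OF Hp(1), of "fst x"] inner_self_nonneg[OF Hp(2), of "snd x"] x
    unfolding hnorm_def by auto
  then have "fst x = 0" "snd x = 0"
    using hnorm_eq_zero[OF H, of "fst x"] hnorm_eq_zero[OF K, of "snd x"] x by auto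
  then show "x = 0" by (simp add: prod_eq_iff)
next
  have Hp: "pre_hilbert H" "pre_hilbert K" using H K by simp_all
  note pre = pre_hilbert_hsum[OF Hp]
  fix s :: "nat \<Rightarrow> 'a \<times> 'b" assume s: "\<And>n. s n \<in> hcarrier (hsum H K)"
    and c: "\<And>e. e > 0 \<Longrightarrow> \<exists>N. \<forall>m\<ge>N. \<forall>n\<ge>N. hnorm (hsum H K) (s m - s n) < e"
  have in1: "fst (s n) \<in> hcarrier H" "snd (s n) \<in> hcarrier K" for n using s by auto
  have le: "hnorm H (fst p) \<le> hnorm (hsum H K) p" "hnorm K (snd p) \<le> hnorm (hsum H K) p"
    if p: "p \<in> hcarrier (hsum H K)" for p
  proof -
    have "fst p \<in> hcarrier H" "snd p \<in> hcarrier K" using p by auto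
    note sq = hsum_norm_sq[OF Hp this]
    show "hnorm H (fst p) \<le> hnorm (hsum H K) p"
      by (rule le_of_sq_le[OF _ hnorm_nonneg[OF pre p]]) (simp add: sq)
    show "hnorm K (snd p) \<le> hnorm (hsum H K) p"
      by (rule le_of_sq_le[OF _ hnorm_nonneg[OF pre p]]) (simp add: sq)
  qed
  have c1: "\<exists>N. \<forall>m\<ge>N. \<forall>n\<ge>N. hnorm H (fst (s m) - fst (s n)) < e"
    and c2: "\<exists>N. \<forall>m\<ge>N. \<forall>n\<ge>N. hnorm K (snd (s m) - snd (s n)) < e" if e: "e > 0" for e
  proof -
    obtain N where N: "\<And>m n. m \<ge> N \<Longrightarrow> n \<ge> N \<Longrightarrow> hnorm (hsum H K) (s m - s n) < e" using c[OF e] by blast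
    have "hnorm H (fst (s m) - fst (s n)) < e" "hnorm K (snd (s m) - snd (s n)) < e" if "m \<ge> N" "n \<ge> N" for m n
      using le[OF diff_in[OF pre s s], of m n] N[OF that] by auto
    then show "\<exists>N. \<forall>m\<ge>N. \<forall>n\<ge>N. hnorm H (fst (s m) - fst (s n)) < e"
      "\<exists>N. \<forall>m\<ge>N. \<forall>n\<ge>N. hnorm K (snd (s m) - snd (s n)) < e" by blast+
  qed
  from hilbert_complete[OF H in1(1) c1] obtain x where x: "x \<in> hcarrier H" "(\<lambda>n. hnorm H (fst (s n) - x)) \<longlonglongrightarrow> 0" by blast
  from hilbert_complete[OF K in1(2) c2] obtain y where y: "y \<in> hcarrier K" "(\<lambda>n. hnorm K (snd (s n) - y)) \<longlonglongrightarrow> 0" by blast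
  have "(\<lambda>n. sqrt ((hnorm H (fst (s n) - x))\<^sup>2 + (hnorm K (snd (s n) - y))\<^sup>2)) \<longlonglongrightarrow> sqrt (0\<^sup>2 + 0\<^sup>2)"
    by (intro tendsto_intros x y)
  moreover have "hnorm (hsum H K) (s n - (x, y)) = sqrt ((hnorm H (fst (s n) - x))\<^sup>2 + (hnorm K (snd (s n) - y))\<^sup>2)" for n
  proof -
    have p: "s n - (x, y) \<in> hcarrier (hsum H K)" using in1 x y Hp by simp
    then have "fst (s n - (x, y)) \<in> hcarrier H" "snd (s n - (x, y)) \<in> hcarrier K" by (simp_all only: hsum_carrier)
    note sq = hsum_norm_sq[OF Hp this]
    show ?thesis using real_sqrt_unique[OF sq hnorm_nonneg[OF pre p]] by simp
  qed
  ultimately have "(\<lambda>n. hnorm (hsum H K) (s n - (x, y))) \<longlonglongrightarrow> 0" by simp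
  then show "\<exists>x\<in>hcarrier (hsum H K). (\<lambda>n. hnorm (hsum H K) (s n - x)) \<longlonglongrightarrow> 0"
    using x y by (intro bexI[of _ "(x, y)"]) auto
qed

section \<open>Finite powers of a space\<close>

lemma hpow_carrier: "x \<in> hcarrier (hpow n H) \<longleftrightarrow> (\<forall>i<n. x i \<in> hcarrier H) \<and> (\<forall>i\<ge>n. x i = 0)"
  unfolding hpow_def by simp

lemma hpow_in [simp]: "x \<in> hcarrier (hpow n H) \<Longrightarrow> i < n \<Longrightarrow> x i \<in> hcarrier H"
  unfolding hpow_def by simp

lemma hpow_off: "x \<in> hcarrier (hpow n H) \<Longrightarrow> n \<le> i \<Longrightarrow> x i = 0"
  unfolding hpow_def by simp

lemma hpow_in': "pre_hilbert H \<Longrightarrow> x \<in> hcarrier (hpow n H) \<Longrightarrow> x i \<in> hcarrier H"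
  by (cases "i < n") (auto simp: hpow_off)

lemma hpow_inner: "hinner (hpow n H) x y = (\<Sum>i<n. hinner H (x i) (y i))"
  unfolding hpow_def by simp

lemma hpow_norm_sq:
  assumes H: "pre_hilbert H" and x: "x \<in> hcarrier (hpow n H)"
  shows "(hnorm (hpow n H) x)\<^sup>2 = (\<Sum>i<n. (hnorm H (x i))\<^sup>2)"
proof -
  have "Re (hinner (hpow n H) x x) = (\<Sum>i<n. (hnorm H (x i))\<^sup>2)"
    unfolding hpow_inner using x H by (simp add: hnorm_sq)
  then show ?thesis unfolding hnorm_def[of "hpow n H"] by (simp add: sum_nonneg)
qed

lemma pre_hilbert_hpow:
  assumes H: "pre_hilbert H"
  shows "pre_hilbert (hpow n H)"
  unfolding pre_hilbert_def complex_vector.subspace_def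
proof (intro conjI ballI allI)
  fix x y assume "x \<in> hcarrier (hpow n H)" "y \<in> hcarrier (hpow n H)"
  then have "hinner H (y i) (x i) = cnj (hinner H (x i) (y i))" if "i < n" for i
    using inner_commute[OF H, of "x i" "y i"] that by simp
  then show "hinner (hpow n H) y x = cnj (hinner (hpow n H) x y)"
    unfolding hpow_inner by simp
next
  fix x assume "x \<in> hcarrier (hpow n H)"
  then show "0 \<le> Re (hinner (hpow n H) x x)"
    unfolding hpow_inner using inner_self_nonneg[OF H] by (auto intro!: sum_nonneg)
next
  fix x y z assume "x \<in> hcarrier (hpow n H)" "y \<in> hcarrier (hpow n H)" "z \<in> hcarrier (hpow n H)"
  then show "hinner (hpow n H) (x + y) z = hinner (hpow n H) x z + hinner (hpow n H) y z"
    unfolding hpow_inner sum.distrib[symmetric] using H by (intro sum.cong refl) (simp add: hpow_carrier)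
next
  fix x y a assume "x \<in> hcarrier (hpow n H)" "y \<in> hcarrier (hpow n H)"
  then show "hinner (hpow n H) (a *\<^sub>C x) y = a * hinner (hpow n H) x y"
    unfolding hpow_inner sum_distrib_left using H by (intro sum.cong refl) (simp add: hpow_carrier scaleC_fun_def)
qed (use H in \<open>simp_all add: hpow_carrier scaleC_fun_def\<close>)

lemma hpow_component_le:
  assumes H: "pre_hilbert H" and x: "x \<in> hcarrier (hpow n H)" and i: "i < n"
  shows "hnorm H (x i) \<le> hnorm (hpow n H) x"
proof (rule le_of_sq_le)
  have "(hnorm H (x i))\<^sup>2 \<le> (\<Sum>i<n. (hnorm H (x i))\<^sup>2)" using i by (intro member_le_sum) auto
  then show "(hnorm H (x i))\<^sup>2 \<le> (hnorm (hpow n H) x)\<^sup>2" using hpow_norm_sq[OF H x] by simp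
  show "0 \<le> hnorm (hpow n H) x" using hnorm_nonneg[OF pre_hilbert_hpow[OF H] x] .
qed

lemma hilbert_hpow [simp]:
  assumes H: "hilbert_space H"
  shows "hilbert_space (hpow n H)"
proof (rule hilbert_spaceI)
  have Hp: "pre_hilbert H" using H by simp
  show pre: "pre_hilbert (hpow n H)" using pre_hilbert_hpow[OF Hp] .
  fix x assume x: "x \<in> hcarrier (hpow n H)" and z: "hinner (hpow n H) x x = 0"
  have n0: "hnorm (hpow n H) x = 0" using z unfolding hnorm_def by simp
  show "x = 0"
  proof
    fix i show "x i = 0 i"
    proof (cases "i < n")
      case True
      have "hnorm H (x i) = 0"
        using hpow_component_le[OF Hp x True] n0 hnorm_nonneg[OF Hp hpow_in[OF x True]] by simp
      then have "x i = 0" by (rule hnorm_eq_zero[OF H hpow_in[OF x True]])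
      then show ?thesis by simp
    qed (use hpow_off[OF x] in auto)
  qed
next
  have Hp: "pre_hilbert H" using H by simp
  note pre = pre_hilbert_hpow[OF Hp, of n]
  fix s :: "nat \<Rightarrow> nat \<Rightarrow> 'a" assume s: "\<And>k. s k \<in> hcarrier (hpow n H)"
    and c: "\<And>e. e > 0 \<Longrightarrow> \<exists>N. \<forall>m\<ge>N. \<forall>k\<ge>N. hnorm (hpow n H) (s m - s k) < e"
  have "\<exists>x\<in>hcarrier H. (\<lambda>k. hnorm H (s k i - x)) \<longlonglongrightarrow> 0" if i: "i < n" for i
  proof -
    have "\<exists>N. \<forall>m\<ge>N. \<forall>k\<ge>N. hnorm H (s m i - s k i) < e" if e: "e > 0" for e
    proof -
      obtain N where N: "\<And>m k. m \<ge> N \<Longrightarrow> k \<ge> N \<Longrightarrow> hnorm (hpow n H) (s m - s k) < e" using c[OF e] by blast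
      have "hnorm H (s m i - s k i) < e" if "m \<ge> N" "k \<ge> N" for m k
        using hpow_component_le[OF Hp diff_in[OF pre s s] i, of m k] N[OF that] by simp
      then show ?thesis by blast
    qed
    from hilbert_complete[OF H hpow_in[OF s i] this] show ?thesis by blast
  qed
  then obtain x where x: "\<And>i. i < n \<Longrightarrow> x i \<in> hcarrier H" "\<And>i. i < n \<Longrightarrow> (\<lambda>k. hnorm H (s k i - x i)) \<longlonglongrightarrow> 0"
    by metis
  define y where "y i = (if i < n then x i else 0)" for i
  have y: "y \<in> hcarrier (hpow n H)" unfolding hpow_carrier y_def using x by simp
  have "(\<lambda>k. \<Sum>i<n. (hnorm H ((s k - y) i))\<^sup>2) \<longlonglongrightarrow> (\<Sum>i<n. 0\<^sup>2)"
  proof (intro tendsto_sum tendsto_power)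
    fix i assume "i \<in> {..<n}"
    then show "(\<lambda>k. hnorm H ((s k - y) i)) \<longlonglongrightarrow> 0" using x(2)[of i] by (simp add: y_def)
  qed
  then have "(\<lambda>k. (hnorm (hpow n H) (s k - y))\<^sup>2) \<longlonglongrightarrow> 0"
    using hpow_norm_sq[OF Hp diff_in[OF pre s y]] by simp
  then have "(\<lambda>k. sqrt ((hnorm (hpow n H) (s k - y))\<^sup>2)) \<longlonglongrightarrow> sqrt 0" by (rule tendsto_real_sqrt)
  then have "(\<lambda>k. hnorm (hpow n H) (s k - y)) \<longlonglongrightarrow> 0"
    using hnorm_nonneg[OF pre diff_in[OF pre s y]] by simp
  then show "\<exists>x\<in>hcarrier (hpow n H). (\<lambda>k. hnorm (hpow n H) (s k - x)) \<longlonglongrightarrow> 0" using y by blast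
qed

section \<open>Unitary operators from Gram matrices\<close>

text \<open>Equal Gram matrices give an isometric extension \<open>T\<close> with constant 1.
  Surjectivity comes from the adjoint, which sends \<open>b e\<close> back to \<open>a e\<close>:
  both composites are the identity on a total set and hence everywhere.\<close>

lemma gram_unitary:
  assumes H: "hilbert_space H" and K: "hilbert_space K"
    and a: "\<And>e. e \<in> E \<Longrightarrow> a e \<in> hcarrier H" and b: "\<And>e. e \<in> E \<Longrightarrow> b e \<in> hcarrier K"
    and tota: "\<And>z. z \<in> hcarrier H \<Longrightarrow> (\<And>e. e \<in> E \<Longrightarrow> hinner H z (a e) = 0) \<Longrightarrow> z = 0"
    and totb: "\<And>z. z \<in> hcarrier K \<Longrightarrow> (\<And>e. e \<in> E \<Longrightarrow> hinner K z (b e) = 0) \<Longrightarrow> z = 0"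
    and gram: "\<And>e e'. e \<in> E \<Longrightarrow> e' \<in> E \<Longrightarrow> hinner K (b e) (b e') = hinner H (a e) (a e')"
  obtains T where "unitary_op H K T" "\<And>e. e \<in> E \<Longrightarrow> T (a e) = b e"
proof -
  have Hp: "pre_hilbert H" "pre_hilbert K" using H K by simp_all
  have bnd: "hnorm K (\<Sum>e\<in>F. c e *\<^sub>C b e) \<le> 1 * hnorm H (\<Sum>e\<in>F. c e *\<^sub>C a e)"
    if F: "finite F" "F \<subseteq> E" for F c
  proof -
    have in1: "\<And>e. e \<in> F \<Longrightarrow> a e \<in> hcarrier H" "\<And>e. e \<in> F \<Longrightarrow> b e \<in> hcarrier K" using F a b by auto
    have "hinner K (\<Sum>e\<in>F. c e *\<^sub>C b e) (\<Sum>e\<in>F. c e *\<^sub>C b e)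
        = (\<Sum>e\<in>F. \<Sum>e'\<in>F. c e * cnj (c e') * hinner K (b e) (b e'))"
      by (rule inner_lincomb[OF Hp(2) in1(2) in1(2)])
    also have "\<dots> = (\<Sum>e\<in>F. \<Sum>e'\<in>F. c e * cnj (c e') * hinner H (a e) (a e'))"
      using F gram by (intro sum.cong refl) (simp add: subset_iff)
    also have "\<dots> = hinner H (\<Sum>e\<in>F. c e *\<^sub>C a e) (\<Sum>e\<in>F. c e *\<^sub>C a e)"
      by (rule inner_lincomb[OF Hp(1) in1(1) in1(1), symmetric])
    finally show ?thesis unfolding hnorm_def by simp
  qed
  obtain T where T: "T \<in> bop H K" "\<And>e. e \<in> E \<Longrightarrow> T (a e) = b e"
    by (rule bounded_extension[of H K E a b 1]) (use H K a b tota bnd in auto)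
  let ?T = "op_adjoint H K T"
  have T': "?T \<in> bop K H" using op_adjoint_bop[OF H K T(1)] .
  \<comment> \<open>The inner products of both sides with every \<open>a e'\<close> are Gram entries
    and agree by \<open>gram\<close>; totality of the family \<open>a\<close> gives equality of the
    vectors.\<close>
  have Tb: "?T (b e) = a e" if e: "e \<in> E" for e
  proof -
    have in2: "?T (b e) \<in> hcarrier H" using T' b[OF e] by simp
    have "?T (b e) - a e = 0"
    proof (rule tota)
      show "?T (b e) - a e \<in> hcarrier H" using in2 a[OF e] Hp by simp
      fix e' assume e': "e' \<in> E"
      have "hinner H (?T (b e)) (a e') = hinner K (b e) (b e')"
        using op_adjoint_inner'[OF H K T(1) a[OF e'] b[OF e]] T(2)[OF e'] by simp
      then show "hinner H (?T (b e) - a e) (a e') = 0"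
        using in2 a[OF e] a[OF e'] Hp gram[OF e e'] by simp
    qed
    then show ?thesis by simp
  qed
  have idH: "id_op H \<in> bop H H" and idK: "id_op K \<in> bop K K"
    using Hp by (auto intro!: bopI[where c = 1] simp: id_op_def)
  have c1: "?T \<circ> T = id_op H"
    by (rule bop_agree_total[OF H H bop_compose[OF T(1) T' Hp] idH, of "a ` E"])
      (use a tota T(2) Tb in \<open>auto simp: id_op_def\<close>)
  have c2: "T \<circ> ?T = id_op K"
    by (rule bop_agree_total[OF K K bop_compose[OF T' T(1) Hp(2,1)] idK, of "b ` E"])
      (use b totb T(2) Tb in \<open>auto simp: id_op_def\<close>)
  have u: "unitary_op H K T"
    unfolding unitary_op_def
  proof (intro conjI ballI)
    show "T ` hcarrier H = hcarrier K"
    proof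
      show "T ` hcarrier H \<subseteq> hcarrier K" using T by auto
      show "hcarrier K \<subseteq> T ` hcarrier H"
      proof
        fix y assume y: "y \<in> hcarrier K"
        have "T (?T y) = y" using fun_cong[OF c2, of y] y by (simp add: id_op_def)
        moreover have "?T y \<in> hcarrier H" using T' y by simp
        ultimately show "y \<in> T ` hcarrier H" by (metis image_eqI)
      qed
    qed
    fix x y assume xy: "x \<in> hcarrier H" "y \<in> hcarrier H"
    have "hinner K (T x) (T y) = hinner H x (?T (T y))"
      using op_adjoint_inner[OF H K T(1) xy(1)] T(1) xy(2) by simp
    also have "?T (T y) = y" using fun_cong[OF c1, of y] xy by (simp add: id_op_def)
    finally show "hinner K (T x) (T y) = hinner H x y" .
  qed (rule T(1))
  show thesis by (rule that[OF u T(2)])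
qed

section \<open>Orthonormal bases\<close>

unbundle cardinal_syntax

lemma bessel:
  assumes H: "pre_hilbert H" and F: "finite F" "F \<subseteq> hcarrier H"
    and on: "\<And>b b'. b \<in> F \<Longrightarrow> b' \<in> F \<Longrightarrow> hinner H b b' = (if b = b' then 1 else 0)" and t: "t \<in> hcarrier H"
  shows "(\<Sum>b\<in>F. (cmod (hinner H t b))\<^sup>2) \<le> (hnorm H t)\<^sup>2"
proof -
  let ?s = "\<Sum>b\<in>F. hinner H t b *\<^sub>C b" and ?q = "\<Sum>b\<in>F. (cmod (hinner H t b))\<^sup>2"
  have in1: "\<And>b. b \<in> F \<Longrightarrow> b \<in> hcarrier H" using F by auto
  have s: "?s \<in> hcarrier H" using in1 H by simp
  have "hinner H t ?s = (\<Sum>b\<in>F. cnj (hinner H t b) * hinner H t b)"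
    by (rule inner_lincomb_right[OF H in1 t])
  also have "\<dots> = of_real ?q" by (simp add: complex_norm_square mult.commute del: of_real_power)
  finally have ts: "hinner H t ?s = of_real ?q" .
  have "hinner H ?s ?s = (\<Sum>b\<in>F. \<Sum>b'\<in>F. hinner H t b * cnj (hinner H t b') * hinner H b b')"
    by (rule inner_lincomb[OF H in1 in1])
  also have "\<dots> = (\<Sum>b\<in>F. \<Sum>b'\<in>F. if b = b' then hinner H t b * cnj (hinner H t b) else 0)"
    by (intro sum.cong refl) (auto simp: on)
  also have "\<dots> = of_real ?q"
    using F(1) by (simp add: complex_norm_square del: of_real_power)
  finally have ss: "(hnorm H ?s)\<^sup>2 = ?q" using hnorm_sq[OF H s] by simp
  have "0 \<le> (hnorm H (t - ?s))\<^sup>2" by simp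
  also have "\<dots> = (hnorm H t)\<^sup>2 - ?q" using hnorm_diff_sq[OF H t s] ts ss by simp
  finally show ?thesis by simp
qed

text \<open>By Bessel's inequality only finitely many members of the orthonormal set have a squared
  coefficient of at least \<open>1 / (n + 1)\<close>; the set in question is the union of these
  finite sets over \<open>n\<close>.\<close>

lemma countable_nonorthogonal:
  assumes H: "pre_hilbert H" and B: "B \<subseteq> hcarrier H"
    and on: "\<And>b b'. b \<in> B \<Longrightarrow> b' \<in> B \<Longrightarrow> hinner H b b' = (if b = b' then 1 else 0)" and t: "t \<in> hcarrier H"
  shows "countable {b\<in>B. hinner H t b \<noteq> 0}"
proof -
  define A where "A n = {b\<in>B. 1 / real (Suc n) \<le> (cmod (hinner H t b))\<^sup>2}" for n
  have "finite (A n)" for n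
  proof -
    have "card G \<le> nat \<lceil>(hnorm H t)\<^sup>2 * real (Suc n)\<rceil>" if G: "G \<subseteq> A n" "finite G" for G
    proof -
      have "real (card G) * (1 / real (Suc n)) = (\<Sum>b\<in>G. 1 / real (Suc n))" by simp
      also have "\<dots> \<le> (\<Sum>b\<in>G. (cmod (hinner H t b))\<^sup>2)" using G unfolding A_def by (intro sum_mono) auto
      also have "\<dots> \<le> (hnorm H t)\<^sup>2"
      proof (rule bessel[OF H G(2) _ _ t])
        have GB: "G \<subseteq> B" using G(1) unfolding A_def by auto
        show "G \<subseteq> hcarrier H" using GB B by auto
        show "hinner H b b' = (if b = b' then 1 else 0)" if "b \<in> G" "b' \<in> G" for b b'
          using that GB by (intro on) auto
      qed
      finally have "real (card G) \<le> (hnorm H t)\<^sup>2 * real (Suc n)" by (simp add: field_simps)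
      then show ?thesis by linarith
    qed
    then show ?thesis using finite_if_finite_subsets_card_bdd by blast
  qed
  moreover have "{b\<in>B. hinner H t b \<noteq> 0} \<subseteq> (\<Union>n. A n)"
  proof
    fix b assume b: "b \<in> {b\<in>B. hinner H t b \<noteq> 0}"
    then have "(cmod (hinner H t b))\<^sup>2 > 0" by simp
    then obtain n where "1 / real (Suc n) < (cmod (hinner H t b))\<^sup>2"
      using reals_Archimedean by (metis inverse_eq_divide)
    then show "b \<in> (\<Union>n. A n)" using b unfolding A_def by (auto intro: less_imp_le)
  qed
  ultimately show ?thesis by (meson countable_UN countable_finite countable_subset uncountable_def countableI_type)
qed

text \<open>Bases of two complements can be matched when both are indexed by the same type. A
  maximal orthonormal set \<open>B\<close> of \<open>N\<close> containing the range of
  \<open>\<eta>\<close> is at least as large as \<open>'i\<close>; it is at most as large, because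
  each of the few vectors of \<open>D\<close> is nonorthogonal to only countably many members of
  \<open>B\<close>.\<close>

lemma orthonormal_basis_indexed:
  fixes \<eta> :: "'i \<Rightarrow> 'a::complex_vector"
  assumes H: "hilbert_space H" and A: "A \<subseteq> hcarrier H"
    and N: "N = {x\<in>hcarrier H. \<forall>a\<in>A. hinner H x a = 0}"
    and \<eta>: "\<And>i. \<eta> i \<in> N" "\<And>i j. hinner H (\<eta> i) (\<eta> j) = (if i = j then 1 else 0)"
    and inf: "infinite (UNIV :: 'i set)"
    and D: "D \<subseteq> hcarrier H" "|D| \<le>o |UNIV :: 'i set|"
    and tot: "\<And>x. x \<in> N \<Longrightarrow> (\<And>t. t \<in> D \<Longrightarrow> hinner H x t = 0) \<Longrightarrow> x = 0"
  obtains c :: "'i \<Rightarrow> 'a" where "\<And>i. c i \<in> N" "\<And>i j. hinner H (c i) (c j) = (if i = j then 1 else 0)"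
    "\<And>x. x \<in> N \<Longrightarrow> (\<And>i. hinner H x (c i) = 0) \<Longrightarrow> x = 0"
proof -
  have Hp: "pre_hilbert H" using H by simp
  have NH: "N \<subseteq> hcarrier H" unfolding N by auto
  define on where "on B \<longleftrightarrow> (\<forall>b\<in>B. \<forall>b'\<in>B. hinner H b b' = (if b = b' then 1 else 0))" for B
  define \<O> where "\<O> = {B. range \<eta> \<subseteq> B \<and> B \<subseteq> N \<and> on B}"
  have inj\<eta>: "inj \<eta>"
  proof (rule injI)
    fix i j assume "\<eta> i = \<eta> j"
    then show "i = j" using \<eta>(2)[of i j] \<eta>(2)[of j j] by (metis zero_neq_one)
  qed
  have "\<exists>M\<in>\<O>. \<forall>X\<in>\<O>. M \<subseteq> X \<longrightarrow> X = M"
  proof (rule subset_Zorn_nonempty)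
    have "range \<eta> \<in> \<O>" unfolding \<O>_def on_def using \<eta> inj\<eta> by (auto simp: inj_eq)
    then show "\<O> \<noteq> {}" by blast
    fix \<C> assume ne: "\<C> \<noteq> {}" and ch: "subset.chain \<O> \<C>"
    have sub: "\<C> \<subseteq> \<O>" using ch unfolding subset.chain_def by blast
    have lin: "X \<subseteq> Y \<or> Y \<subseteq> X" if "X \<in> \<C>" "Y \<in> \<C>" for X Y
      using ch that unfolding subset.chain_def by blast
    have "on (\<Union>\<C>)"
      unfolding on_def
    proof (intro ballI)
      fix b b' assume "b \<in> \<Union>\<C>" "b' \<in> \<Union>\<C>"
      then obtain X Y where XY: "X \<in> \<C>" "Y \<in> \<C>" "b \<in> X" "b' \<in> Y" by blast
      obtain Z where Z: "Z \<in> \<C>" "b \<in> Z" "b' \<in> Z" using lin[OF XY(1,2)] XY by blast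
      then have "on Z" using sub unfolding \<O>_def by blast
      then show "hinner H b b' = (if b = b' then 1 else 0)" using Z unfolding on_def by blast
    qed
    then show "\<Union>\<C> \<in> \<O>" using sub ne unfolding \<O>_def by blast
  qed
  then obtain B where B: "B \<in> \<O>" and max: "\<And>X. X \<in> \<O> \<Longrightarrow> B \<subseteq> X \<Longrightarrow> X = B" by blast
  have BN: "B \<subseteq> N" and \<eta>B: "range \<eta> \<subseteq> B" and onB: "\<And>b b'. b \<in> B \<Longrightarrow> b' \<in> B \<Longrightarrow> hinner H b b' = (if b = b' then 1 else 0)"
    using B unfolding \<O>_def on_def by auto
  have BH: "B \<subseteq> hcarrier H" using BN NH by auto
  have totB: "x = 0" if x: "x \<in> N" and orth: "\<And>b. b \<in> B \<Longrightarrow> hinner H x b = 0" for x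
  proof (rule ccontr)
    assume "x \<noteq> 0"
    have xH: "x \<in> hcarrier H" using x NH by auto
    have nz: "hnorm H x \<noteq> 0" using \<open>x \<noteq> 0\<close> hnorm_eq_zero[OF H xH] by blast
    let ?b = "(of_real (1 / hnorm H x) :: complex) *\<^sub>C x"
    have bH: "?b \<in> hcarrier H" using xH Hp by simp
    have bN: "?b \<in> N" unfolding N using x A Hp unfolding N by (auto simp: subset_iff)
    have bb: "hinner H ?b ?b = 1" using xH Hp nz inner_self[OF Hp xH] by (simp add: power2_eq_square)
    have o1: "hinner H ?b b = 0" if "b \<in> B" for b using that orth xH BH Hp by (auto simp: subset_iff)
    have o2: "hinner H b ?b = 0" if "b \<in> B" for b
      using o1[OF that] inner_commute[OF Hp bH, of b] that BH by (auto simp: subset_iff)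
    have nB: "?b \<notin> B" using o1 bb by force
    have "insert ?b B \<in> \<O>"
      unfolding \<O>_def on_def using \<eta>B BN bN onB bb o1 o2 nB by auto
    then have "insert ?b B = B" by (rule max) auto
    then show False using nB by auto
  qed
  have le1: "|UNIV :: 'i set| \<le>o |B|"
    by (rule card_of_ordLeqI[of \<eta>]) (use inj\<eta> \<eta>B in auto)
  \<comment> \<open>A member of \<open>B\<close> orthogonal to all of \<open>D\<close> would be 0 by
    \<open>tot\<close>, contradicting its norm 1.\<close>
  have cov: "B \<subseteq> (\<Union>t\<in>D. {b\<in>B. hinner H t b \<noteq> 0})"
  proof
    fix b assume b: "b \<in> B"
    have "\<exists>t\<in>D. hinner H b t \<noteq> 0"
    proof (rule ccontr)
      assume "\<not> ?thesis"
      then have "b = 0" using tot b BN by blast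
      then show False using onB[OF b b] Hp by simp
    qed
    then obtain t where t: "t \<in> D" "hinner H b t \<noteq> 0" by blast
    have "hinner H t b = cnj (hinner H b t)" using inner_commute[OF Hp, of b t] b BH t D by auto
    then have "hinner H t b \<noteq> 0" using t(2) by simp
    then show "b \<in> (\<Union>t\<in>D. {b\<in>B. hinner H t b \<noteq> 0})" using t(1) b by blast
  qed
  have "|\<Union>t\<in>D. {b\<in>B. hinner H t b \<noteq> 0}| \<le>o |UNIV :: 'i set|"
  proof (rule card_of_UNION_ordLeq_infinite[OF inf D(2)], rule ballI)
    fix t assume t: "t \<in> D"
    have "countable {b\<in>B. hinner H t b \<noteq> 0}"
      by (rule countable_nonorthogonal[OF Hp BH onB]) (use t D in auto)
    then have "|{b\<in>B. hinner H t b \<noteq> 0}| \<le>o |UNIV :: nat set|" by (simp add: countable_card_of_nat)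
    also have "|UNIV :: nat set| \<le>o |UNIV :: 'i set|" using inf infinite_iff_card_of_nat by blast
    finally show "|{b\<in>B. hinner H t b \<noteq> 0}| \<le>o |UNIV :: 'i set|" .
  qed
  then have "|B| \<le>o |UNIV :: 'i set|" using card_of_mono1[OF cov] ordLeq_transitive by blast
  then have "|UNIV :: 'i set| =o |B|" using le1 by (simp add: ordIso_iff_ordLeq)
  then obtain c :: "'i \<Rightarrow> 'a" where c: "bij_betw c UNIV B" using card_of_ordIso by blast
  have cB: "c i \<in> B" for i using c bij_betwE by blast
  show thesis
  proof (rule that[of c])
    show "c i \<in> N" for i using cB BN by blast
    show "hinner H (c i) (c j) = (if i = j then 1 else 0)" for i j
      using onB[OF cB cB, of i j] c by (auto simp: bij_betw_def inj_eq)
    fix x assume x: "x \<in> N" "\<And>i. hinner H x (c i) = 0"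
    show "x = 0"
    proof (rule totB[OF x(1)])
      fix b assume "b \<in> B"
      then obtain i where "b = c i" using c unfolding bij_betw_def by blast
      then show "hinner H x b = 0" using x(2) by simp
    qed
  qed
qed

unbundle no cardinal_syntax

section \<open>Operator matrices\<close>

definition uvec :: "nat \<Rightarrow> nat \<Rightarrow> complex" where
  "uvec i = (\<lambda>l. if l = i then 1 else 0)"

definition slot :: "nat \<Rightarrow> 'a::zero \<Rightarrow> nat \<Rightarrow> 'a" where
  "slot i x = (\<lambda>l. if l = i then x else 0)"

lemma uvec_in [simp]: "i < n \<Longrightarrow> uvec i \<in> hcarrier (cpow n)"
  by (auto simp: hpow_carrier uvec_def)

lemma slot_in [simp]: "pre_hilbert H \<Longrightarrow> x \<in> hcarrier H \<Longrightarrow> i < n \<Longrightarrow> slot i x \<in> hcarrier (hpow n H)"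
  by (auto simp: hpow_carrier slot_def)

lemma slot_inner_right:
  assumes H: "pre_hilbert H" and y: "y \<in> hcarrier (hpow n H)" and i: "i < n"
  shows "hinner (hpow n H) y (slot i x) = hinner H (y i) x"
proof -
  have "hinner (hpow n H) y (slot i x) = (\<Sum>l<n. if l = i then hinner H (y l) x else 0)"
    unfolding hpow_inner slot_def using H hpow_in[OF y] by (intro sum.cong refl) auto
  then show ?thesis using i by simp
qed

lemma uvec_inner: "i < n \<Longrightarrow> c \<in> hcarrier (cpow n) \<Longrightarrow> hinner (cpow n) c (uvec i) = c i"
proof -
  assume i: "i < n"
  have "hinner (cpow n) c (uvec i) = (\<Sum>l<n. if l = i then c l else 0)"
    unfolding hpow_inner uvec_def by (intro sum.cong refl) auto
  then show ?thesis using i by simp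
qed

lemma hpow_decompose:
  assumes "x \<in> hcarrier (hpow n H)"
  shows "x = (\<Sum>i<n. slot i (x i))"
proof
  fix l
  have "(\<Sum>i<n. slot i (x i)) l = (\<Sum>i<n. if l = i then x i else 0)"
    unfolding slot_def fun_sum_apply by simp
  also have "\<dots> = x l" using hpow_off[OF assms, of l] by auto
  finally show "x l = (\<Sum>i<n. slot i (x i)) l" by simp
qed

lemma cpow_decompose:
  assumes "c \<in> hcarrier (cpow n)"
  shows "c = (\<Sum>i<n. c i *\<^sub>C uvec i)"
proof -
  have "slot i (c i) = c i *\<^sub>C uvec i" for i
    by (auto simp: slot_def uvec_def scaleC_fun_def scaleC_complex_def fun_eq_iff)
  then show ?thesis using hpow_decompose[OF assms] by simp
qed

lemma hpow_total:
  assumes H: "pre_hilbert H" and z: "z \<in> hcarrier (hpow n H)"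
    and tot: "\<And>z. z \<in> hcarrier H \<Longrightarrow> (\<And>e. e \<in> E \<Longrightarrow> hinner H z (a e) = 0) \<Longrightarrow> z = 0"
    and orth: "\<And>i e. i < n \<Longrightarrow> e \<in> E \<Longrightarrow> hinner (hpow n H) z (slot i (a e)) = 0"
  shows "z = 0"
proof
  fix i
  show "z i = 0 i"
  proof (cases "i < n")
    case True
    have "z i = 0" by (rule tot) (use z True orth[OF True] slot_inner_right[OF H z True] in auto)
    then show ?thesis by simp
  qed (use hpow_off[OF z, of i] in auto)
qed

lemma hnorm_le_sum:
  assumes H: "pre_hilbert H" and x: "x \<in> hcarrier (hpow n H)"
  shows "hnorm (hpow n H) x \<le> (\<Sum>i<n. hnorm H (x i))"
proof -
  have n0: "\<And>i. i < n \<Longrightarrow> 0 \<le> hnorm H (x i)" using x H by simp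
  have sq: "(\<Sum>i<m. (hnorm H (x i))\<^sup>2) \<le> (\<Sum>i<m. hnorm H (x i))\<^sup>2" if "m \<le> n" for m
    using that
  proof (induction m)
    case (Suc m)
    have "0 \<le> 2 * (\<Sum>i<m. hnorm H (x i)) * hnorm H (x m)"
      using Suc.prems n0 by (intro mult_nonneg_nonneg sum_nonneg) auto
    moreover have "(\<Sum>i<m. (hnorm H (x i))\<^sup>2) \<le> (\<Sum>i<m. hnorm H (x i))\<^sup>2" using Suc by simp
    ultimately show ?case unfolding sum.lessThan_Suc power2_sum by linarith
  qed simp
  show ?thesis
    by (rule le_of_sq_le) (use sq[of n] hpow_norm_sq[OF H x] n0 in \<open>auto intro: sum_nonneg\<close>)
qed

text \<open>Scalar matrices, ampliations and the tensored row operators are all operator matrices,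
  so membership in \<open>bop\<close> is proved once for this form.\<close>

definition mat_bop :: "nat \<Rightarrow> nat \<Rightarrow> 'a::complex_vector hspace \<Rightarrow> (nat \<Rightarrow> nat \<Rightarrow> 'a \<Rightarrow> 'b::complex_vector) \<Rightarrow>
    (nat \<Rightarrow> 'a) \<Rightarrow> nat \<Rightarrow> 'b" where
  "mat_bop n m H A = (\<lambda>x. if x \<in> hcarrier (hpow m H)
     then (\<lambda>i. if i < n then (\<Sum>j<m. A i j (x j)) else 0) else 0)"

lemma mat_bop_apply: "x \<in> hcarrier (hpow m H) \<Longrightarrow> i < n \<Longrightarrow> mat_bop n m H A x i = (\<Sum>j<m. A i j (x j))"
  unfolding mat_bop_def by simp

lemma mat_bop:
  assumes H: "pre_hilbert H" and K: "pre_hilbert K" and A: "\<And>i j. i < n \<Longrightarrow> j < m \<Longrightarrow> A i j \<in> bop H K"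
  shows "mat_bop n m H A \<in> bop (hpow m H) (hpow n K)"
proof -
  have "\<exists>c\<ge>0. \<forall>x\<in>hcarrier H. hnorm K (A i j x) \<le> c * hnorm H x" if "i < n" "j < m" for i j
    using bop_bound[OF A[OF that] H] by metis
  then obtain c where c: "\<And>i j. i < n \<Longrightarrow> j < m \<Longrightarrow> c i j \<ge> 0"
    "\<And>i j x. i < n \<Longrightarrow> j < m \<Longrightarrow> x \<in> hcarrier H \<Longrightarrow> hnorm K (A i j x) \<le> c i j * hnorm H x" by metis
  have mb: "mat_bop n m H A x i = (if i < n then (\<Sum>j<m. A i j (x j)) else 0)" if "x \<in> hcarrier (hpow m H)" for x i
    using that unfolding mat_bop_def by simp
  have Hm: "pre_hilbert (hpow m H)" using H by (rule pre_hilbert_hpow)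
  have inK: "mat_bop n m H A x \<in> hcarrier (hpow n K)" if x: "x \<in> hcarrier (hpow m H)" for x
    unfolding hpow_carrier mb[OF x] using x K by (auto intro!: sum_in bop_in[OF A])
  show ?thesis
  proof (rule bopI[where c = "\<Sum>i<n. \<Sum>j<m. c i j"])
    fix x assume x: "x \<in> hcarrier (hpow m H)"
    show "mat_bop n m H A x \<in> hcarrier (hpow n K)" using inK[OF x] .
    have "hnorm (hpow n K) (mat_bop n m H A x) \<le> (\<Sum>i<n. hnorm K (mat_bop n m H A x i))"
      by (rule hnorm_le_sum[OF K inK[OF x]])
    also have "\<dots> \<le> (\<Sum>i<n. \<Sum>j<m. c i j * hnorm (hpow m H) x)"
    proof (rule sum_mono)
      fix i assume i: "i \<in> {..<n}"
      have "hnorm K (\<Sum>j<m. A i j (x j)) \<le> (\<Sum>j<m. hnorm K (A i j (x j)))"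
        using i x by (intro hnorm_sum_le[OF K] bop_in[OF A]) auto
      also have "\<dots> \<le> (\<Sum>j<m. c i j * hnorm (hpow m H) x)"
      proof (rule sum_mono)
        fix j assume j: "j \<in> {..<m}"
        have "hnorm K (A i j (x j)) \<le> c i j * hnorm H (x j)" using c(2) i j x by simp
        also have "\<dots> \<le> c i j * hnorm (hpow m H) x"
          using c(1)[of i j] i j hpow_component_le[OF H x] by (intro mult_left_mono) auto
        finally show "hnorm K (A i j (x j)) \<le> c i j * hnorm (hpow m H) x" .
      qed
      finally show "hnorm K (mat_bop n m H A x i) \<le> (\<Sum>j<m. c i j * hnorm (hpow m H) x)"
        using mb[OF x, of i] i by simp
    qed
    also have "\<dots> = (\<Sum>i<n. \<Sum>j<m. c i j) * hnorm (hpow m H) x" by (simp add: sum_distrib_right)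
    finally show "hnorm (hpow n K) (mat_bop n m H A x) \<le> (\<Sum>i<n. \<Sum>j<m. c i j) * hnorm (hpow m H) x" .
    fix a
    show "mat_bop n m H A (a *\<^sub>C x) = a *\<^sub>C mat_bop n m H A x"
    proof
      fix i
      have "(\<Sum>j<m. A i j ((a *\<^sub>C x) j)) = (\<Sum>j<m. a *\<^sub>C A i j (x j))" if "i < n"
        using that x by (intro sum.cong refl) (simp add: scaleC_fun_def bop_scale[OF A])
      then show "mat_bop n m H A (a *\<^sub>C x) i = (a *\<^sub>C mat_bop n m H A x) i"
        using mb[OF x, of i] mb[OF scale_in[OF Hm x], of a i] by (simp add: scaleC_fun_def scaleC_sum_right)
    qed
    fix y assume y: "y \<in> hcarrier (hpow m H)"
    show "mat_bop n m H A (x + y) = mat_bop n m H A x + mat_bop n m H A y"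
    proof
      fix i
      have "(\<Sum>j<m. A i j ((x + y) j)) = (\<Sum>j<m. A i j (x j) + A i j (y j))" if "i < n"
        using that x y by (intro sum.cong refl) (simp add: bop_add[OF A])
      then show "mat_bop n m H A (x + y) i = (mat_bop n m H A x + mat_bop n m H A y) i"
        using mb[OF x, of i] mb[OF y, of i] mb[OF add_in[OF Hm x y], of i] by (simp add: sum.distrib)
    qed
  qed (simp add: mat_bop_def)
qed

lemma id_op_bop: "pre_hilbert H \<Longrightarrow> id_op H \<in> bop H H"
  by (rule bopI[where c = 1]) (simp_all add: id_op_def)

lemma scale_op_bop: "pre_hilbert H \<Longrightarrow> pre_hilbert K \<Longrightarrow> T \<in> bop H K \<Longrightarrow> (\<lambda>x. a *\<^sub>C T x) \<in> bop H K"
proof -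
  assume Hp: "pre_hilbert H" "pre_hilbert K" and T: "T \<in> bop H K"
  obtain c where c: "c \<ge> 0" "\<And>x. x \<in> hcarrier H \<Longrightarrow> hnorm K (T x) \<le> c * hnorm H x"
    using bop_bound[OF T Hp(1)] by blast
  show ?thesis
  proof (rule bopI[where c = "cmod a * c"])
    fix x assume x: "x \<in> hcarrier H"
    show "hnorm K (a *\<^sub>C T x) \<le> cmod a * c * hnorm H x"
      using mult_left_mono[OF c(2)[OF x], of "cmod a"] Hp T x by (simp add: mult.assoc)
  qed (use Hp T in \<open>simp_all add: scaleC_add_right scaleC_scaleC mult.commute\<close>)
qed

lemma mat_op_mat_bop: "pre_hilbert H \<Longrightarrow> mat_op P H = mat_bop (dim_row P) (dim_col P) H (\<lambda>i j x. P $$ (i, j) *\<^sub>C id_op H x)"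
  unfolding mat_op_def mat_bop_def id_op_def by (intro ext) (auto simp: fun_eq_iff intro!: sum.cong)

lemma mat_op_bop: "pre_hilbert H \<Longrightarrow> P \<in> carrier_mat n m \<Longrightarrow> mat_op P H \<in> bop (hpow m H) (hpow n H)"
  unfolding mat_op_mat_bop carrier_mat_def by (auto intro!: mat_bop scale_op_bop id_op_bop)

lemma mat_op_apply: "P \<in> carrier_mat n m \<Longrightarrow> x \<in> hcarrier (hpow m H) \<Longrightarrow> i < n \<Longrightarrow>
    mat_op P H x i = (\<Sum>j<m. P $$ (i, j) *\<^sub>C x j)"
  unfolding mat_op_def by simp

lemma ampliation_mat_bop:
  assumes A: "A \<in> bop H K"
  shows "ampliation n H A = mat_bop n n H (\<lambda>i j. if i = j then A else (\<lambda>_. 0))"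
proof (intro ext)
  fix x i
  have "(\<Sum>j<n. (if i = j then A else (\<lambda>_. 0)) (x j)) = (\<Sum>j<n. if i = j then A (x j) else 0)"
    by (intro sum.cong refl) auto
  then show "ampliation n H A x i = mat_bop n n H (\<lambda>i j. if i = j then A else (\<lambda>_. 0)) x i"
    unfolding ampliation_def mat_bop_def by simp
qed

lemma zero_op_bop: "pre_hilbert H \<Longrightarrow> pre_hilbert K \<Longrightarrow> (\<lambda>_. 0) \<in> bop H K"
  by (rule bopI[where c = 0]) simp_all

lemma ampliation_bop:
  assumes "pre_hilbert H" "pre_hilbert K" "A \<in> bop H K"
  shows "ampliation n H A \<in> bop (hpow n H) (hpow n K)"
  unfolding ampliation_mat_bop[OF assms(3)] using assms zero_op_bop by (intro mat_bop) auto

lemma ampliation_apply: "x \<in> hcarrier (hpow n H) \<Longrightarrow> i < n \<Longrightarrow> ampliation n H A x i = A (x i)"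
  unfolding ampliation_def by simp

text \<open>Boundedness is automatic on a finite dimensional domain: the images of the unit vectors
  bound everything. It spares an explicit estimate for evaluations of nc functions and for the
  starting operator \<open>L_Q R Q W 0\<close>.\<close>

lemma linear_cpow_bop:
  assumes K: "pre_hilbert K"
    and in1: "\<And>x. x \<in> hcarrier (cpow n) \<Longrightarrow> T x \<in> hcarrier K"
    and add: "\<And>x y. x \<in> hcarrier (cpow n) \<Longrightarrow> y \<in> hcarrier (cpow n) \<Longrightarrow> T (x + y) = T x + T y"
    and sc: "\<And>x a. x \<in> hcarrier (cpow n) \<Longrightarrow> T (a *\<^sub>C x) = a *\<^sub>C T x"
    and off: "\<And>x. x \<notin> hcarrier (cpow n) \<Longrightarrow> T x = 0"
  shows "T \<in> bop (cpow n) K"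
proof (rule bopI[where c = "\<Sum>i<n. hnorm K (T (uvec i))"])
  fix x assume x: "x \<in> hcarrier (cpow n)"
  have Cp: "pre_hilbert (cpow n)" by simp
  have lin: "T (\<Sum>i\<in>F. x i *\<^sub>C uvec i) = (\<Sum>i\<in>F. x i *\<^sub>C T (uvec i))" if "F \<subseteq> {..<n}" for F
  proof -
    have "finite F" using that finite_subset by blast
    then show ?thesis using that
    proof (induction F)
      case empty
      have "T (0 *\<^sub>C 0) = 0 *\<^sub>C T 0" by (rule sc[OF zero_in[OF Cp]])
      then show ?case unfolding sum.empty scaleC_0_left .
    next
      case (insert i F)
      have "T (x i *\<^sub>C uvec i + (\<Sum>i\<in>F. x i *\<^sub>C uvec i)) = T (x i *\<^sub>C uvec i) + T (\<Sum>i\<in>F. x i *\<^sub>C uvec i)"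
        using insert.prems Cp by (intro add scale_in sum_in) auto
      then show ?case unfolding sum.insert[OF insert.hyps]
        using insert sc[of "uvec i" "x i"] by (simp only: insert_subset lessThan_iff uvec_in simp_thms)
    qed
  qed
  have "T x = (\<Sum>i<n. x i *\<^sub>C T (uvec i))" using lin[of "{..<n}"] cpow_decompose[OF x] by simp
  then have "hnorm K (T x) \<le> (\<Sum>i<n. hnorm K (x i *\<^sub>C T (uvec i)))"
    using hnorm_sum_le[OF K, of "{..<n}" "\<lambda>i. x i *\<^sub>C T (uvec i)"] in1 K by simp
  also have "\<dots> \<le> (\<Sum>i<n. hnorm (cpow n) x * hnorm K (T (uvec i)))"
  proof (rule sum_mono)
    fix i assume i: "i \<in> {..<n}"
    have "cmod (x i) \<le> hnorm (cpow n) x" using hpow_component_le[of complex_hspace x n i] x i by simp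
    then show "hnorm K (x i *\<^sub>C T (uvec i)) \<le> hnorm (cpow n) x * hnorm K (T (uvec i))"
      using i in1 K by (simp add: mult_right_mono)
  qed
  finally show "hnorm K (T x) \<le> (\<Sum>i<n. hnorm K (T (uvec i))) * hnorm (cpow n) x"
    by (simp add: sum_distrib_left mult.commute)
qed (use assms in auto)

section \<open>Hilbert tensor products\<close>

lemma psd_tensor:
  assumes "pre_hilbert R" "pre_hilbert X"
  shows "psd (hcarrier R \<times> hcarrier X) (tensor_kernel R X)"
  unfolding tensor_kernel_def
  by (intro psd_mult psd_gram assms) auto

context
  fixes R :: "'r::complex_vector hspace" and X :: "'x::complex_vector hspace"
  assumes R: "pre_hilbert R" and X: "pre_hilbert X"
begin

lemma hilbert_htensor: "hilbert_space (htensor R X)"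
  unfolding htensor_def by (rule rk_hilbert[OF psd_tensor[OF R X]])

lemma et_in [simp]: "r \<in> hcarrier R \<Longrightarrow> x \<in> hcarrier X \<Longrightarrow> elem_tensor R X r x \<in> hcarrier (htensor R X)"
  unfolding htensor_def elem_tensor_def by (rule rk_point_in[OF psd_tensor[OF R X]]) simp

lemma et_inner:
  assumes "r \<in> hcarrier R" "x \<in> hcarrier X" "r' \<in> hcarrier R" "x' \<in> hcarrier X"
  shows "hinner (htensor R X) (elem_tensor R X r x) (elem_tensor R X r' x') = hinner R r r' * hinner X x x'"
  unfolding htensor_def elem_tensor_def using assms
  by (subst rk_inner[OF psd_tensor[OF R X]]) (auto simp: tensor_kernel_def)

lemma et_total:
  assumes "z \<in> hcarrier (htensor R X)"
    "\<And>r x. r \<in> hcarrier R \<Longrightarrow> x \<in> hcarrier X \<Longrightarrow> hinner (htensor R X) z (elem_tensor R X r x) = 0"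
  shows "z = 0"
  by (rule rk_total[OF psd_tensor[OF R X]]) (use assms in \<open>auto simp: htensor_def elem_tensor_def\<close>)

lemma et_apply: "elem_tensor R X r x p = (if p \<in> hcarrier R \<times> hcarrier X then hinner R r (fst p) * hinner X x (snd p) else 0)"
  unfolding elem_tensor_def rk_point_def tensor_kernel_def by simp

text \<open>Elementary tensors are concrete functions, so linearity in each factor is checked value
  by value; outside the carriers both sides are 0.\<close>

lemma et_sum_left:
  assumes "\<And>i. i \<in> F \<Longrightarrow> f i \<in> hcarrier R"
  shows "elem_tensor R X (\<Sum>i\<in>F. c i *\<^sub>C f i) x = (\<Sum>i\<in>F. c i *\<^sub>C elem_tensor R X (f i) x)"
  by (rule ext) (auto simp: et_apply fun_sum_apply scaleC_fun_def scaleC_complex_def sum_distrib_right mult.assoc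
      inner_lincomb_left[OF R assms])

lemma et_add_right: "x \<in> hcarrier X \<Longrightarrow> y \<in> hcarrier X \<Longrightarrow> elem_tensor R X r (x + y) = elem_tensor R X r x + elem_tensor R X r y"
  using X by (intro ext) (auto simp: et_apply algebra_simps)

lemma et_scale_right: "x \<in> hcarrier X \<Longrightarrow> elem_tensor R X r (a *\<^sub>C x) = a *\<^sub>C elem_tensor R X r x"
  using X by (intro ext) (auto simp: et_apply scaleC_fun_def scaleC_complex_def)

lemma et_zero_left [simp]: "elem_tensor R X 0 x = 0"
  using R by (intro ext) (auto simp: et_apply)

definition tensor_left :: "'r \<Rightarrow> 'x \<Rightarrow> 'r \<times> 'x \<Rightarrow> complex" where
  "tensor_left r = (\<lambda>x. if x \<in> hcarrier X then elem_tensor R X r x else 0)"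

lemma tensor_left_bop:
  assumes r: "r \<in> hcarrier R"
  shows "tensor_left r \<in> bop X (htensor R X)"
proof (rule bopI[where c = "hnorm R r"])
  fix x assume x: "x \<in> hcarrier X"
  have "hinner (htensor R X) (elem_tensor R X r x) (elem_tensor R X r x) = of_real ((hnorm R r * hnorm X x)\<^sup>2)"
    using et_inner[OF r x r x] inner_self[OF R r] inner_self[OF X x] by (simp add: power_mult_distrib)
  then show "hnorm (htensor R X) (tensor_left r x) \<le> hnorm R r * hnorm X x"
    unfolding tensor_left_def hnorm_def[of "htensor R X"] using x r R X by simp
qed (use X r in \<open>simp_all add: tensor_left_def et_add_right et_scale_right\<close>)

end

section \<open>Tensor powers\<close>

lemma psd_const_one: "psd E (\<lambda>y x. 1)"
  using psd_gram[of complex_hspace E "\<lambda>_. 1"] by simp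

lemma psd_power:
  assumes R: "pre_hilbert R"
  shows "psd (tuples k R) (power_kernel k R)"
proof -
  have "psd (tuples k R) (\<lambda>ss rs. \<Prod>i<j. hinner R (rs ! i) (ss ! i))" if "j \<le> k" for j
    using that
  proof (induction j)
    case (Suc j)
    have "psd (tuples k R) (\<lambda>ss rs. hinner R (rs ! j) (ss ! j))"
      by (rule psd_gram[OF R]) (use Suc.prems in \<open>auto simp: tuples_def subset_iff\<close>)
    then show ?case using psd_mult[OF Suc.IH[OF Suc_leD[OF Suc.prems]]] by simp
  qed (simp add: psd_const_one)
  then show ?thesis unfolding power_kernel_def by blast
qed

context
  fixes R :: "'r::complex_vector hspace"
  assumes R: "pre_hilbert R"
begin

lemma hilbert_htensor_power [simp]: "hilbert_space (htensor_power k R)"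
  unfolding htensor_power_def by (rule rk_hilbert[OF psd_power[OF R]])

lemma ep_in [simp]: "rs \<in> tuples k R \<Longrightarrow> elem_power k R rs \<in> hcarrier (htensor_power k R)"
  unfolding htensor_power_def elem_power_def by (rule rk_point_in[OF psd_power[OF R]])

lemma ep_inner:
  assumes "rs \<in> tuples k R" "ss \<in> tuples k R"
  shows "hinner (htensor_power k R) (elem_power k R rs) (elem_power k R ss) = power_kernel k R ss rs"
  unfolding htensor_power_def elem_power_def by (rule rk_inner[OF psd_power[OF R] assms])

lemma ep_total:
  assumes "z \<in> hcarrier (htensor_power k R)"
    "\<And>rs. rs \<in> tuples k R \<Longrightarrow> hinner (htensor_power k R) z (elem_power k R rs) = 0"
  shows "z = 0"
  by (rule rk_total[OF psd_power[OF R]]) (use assms in \<open>auto simp: htensor_power_def elem_power_def\<close>)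

lemma power_kernel_Cons:
  "power_kernel (Suc k) R (s # ss) (r # rs) = hinner R r s * power_kernel k R ss rs"
  unfolding power_kernel_def by (simp add: prod.lessThan_Suc_shift del: prod.lessThan_Suc)

lemma tuples_Cons: "r # rs \<in> tuples (Suc k) R \<longleftrightarrow> r \<in> hcarrier R \<and> rs \<in> tuples k R"
  unfolding tuples_def by auto

lemma ep_sum_Cons:
  assumes f: "\<And>i. i \<in> F \<Longrightarrow> f i \<in> hcarrier R"
  shows "elem_power (Suc k) R ((\<Sum>i\<in>F. c i *\<^sub>C f i) # rs) = (\<Sum>i\<in>F. c i *\<^sub>C elem_power (Suc k) R (f i # rs))"
proof
  fix ss
  show "elem_power (Suc k) R ((\<Sum>i\<in>F. c i *\<^sub>C f i) # rs) ss = (\<Sum>i\<in>F. c i *\<^sub>C elem_power (Suc k) R (f i # rs)) ss"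
  proof (cases "ss \<in> tuples (Suc k) R")
    case True
    then obtain s ss' where ss: "ss = s # ss'" unfolding tuples_def by (cases ss) auto
    have s: "s \<in> hcarrier R" using True unfolding ss tuples_Cons by simp
    show ?thesis
      using True unfolding elem_power_def rk_point_def fun_sum_apply scaleC_fun_def scaleC_complex_def ss
      by (simp add: power_kernel_Cons inner_lincomb_left[OF R f s] sum_distrib_right mult.assoc)
  qed (simp add: elem_power_def rk_point_def fun_sum_apply scaleC_fun_def scaleC_complex_def)
qed

text \<open>Putting \<open>r\<close> in front of the tuples multiplies the Gram matrix of the
  elementary tensors by the squared norm of \<open>r\<close>; hence the extension from elementary
  tensors exists with bound \<open>hnorm R r\<close>.\<close>

lemma left_tensor_exists:
  assumes r: "r \<in> hcarrier R"
  shows "\<exists>T. T \<in> bop (htensor_power k R) (htensor_power (Suc k) R) \<and>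
    (\<forall>rs\<in>tuples k R. T (elem_power k R rs) = elem_power (Suc k) R (r # rs))"
proof -
  let ?H = "htensor_power k R" and ?K = "htensor_power (Suc k) R"
  have HK: "pre_hilbert ?H" "pre_hilbert ?K" by simp_all
  have bnd: "hnorm ?K (\<Sum>e\<in>F. c e *\<^sub>C elem_power (Suc k) R (r # e)) \<le> hnorm R r * hnorm ?H (\<Sum>e\<in>F. c e *\<^sub>C elem_power k R e)"
    if F: "finite F" "F \<subseteq> tuples k R" for F c
  proof -
    have in1: "\<And>e. e \<in> F \<Longrightarrow> elem_power k R e \<in> hcarrier ?H" "\<And>e. e \<in> F \<Longrightarrow> elem_power (Suc k) R (r # e) \<in> hcarrier ?K"
      using F r by (auto simp: tuples_Cons subset_iff)
    let ?x = "\<Sum>e\<in>F. c e *\<^sub>C elem_power k R e" and ?y = "\<Sum>e\<in>F. c e *\<^sub>C elem_power (Suc k) R (r # e)"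
    have xH: "?x \<in> hcarrier ?H" using in1 HK by simp
    have "hinner ?K ?y ?y
        = (\<Sum>e\<in>F. \<Sum>f\<in>F. c e * cnj (c f) * hinner ?K (elem_power (Suc k) R (r # e)) (elem_power (Suc k) R (r # f)))"
      by (rule inner_lincomb[OF HK(2) in1(2) in1(2)])
    also have "\<dots> = (\<Sum>e\<in>F. \<Sum>f\<in>F. hinner R r r * (c e * cnj (c f) * hinner ?H (elem_power k R e) (elem_power k R f)))"
      using F r by (intro sum.cong refl) (simp add: ep_inner tuples_Cons power_kernel_Cons subset_iff)
    also have "\<dots> = hinner R r r * hinner ?H ?x ?x"
      by (subst inner_lincomb[OF HK(1) in1(1) in1(1)]) (simp_all add: sum_distrib_left)
    also have "\<dots> = of_real ((hnorm R r * hnorm ?H ?x)\<^sup>2)"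
      using inner_self[OF R r] inner_self[OF HK(1) xH] by (simp add: power_mult_distrib)
    finally have "hnorm ?K ?y = sqrt ((hnorm R r * hnorm ?H ?x)\<^sup>2)" unfolding hnorm_def[of ?K] by simp
    also have "\<dots> = hnorm R r * hnorm ?H ?x" using r R xH HK by simp
    finally show ?thesis by simp
  qed
  show ?thesis
    by (rule bounded_extension[of ?H ?K "tuples k R" "elem_power k R" "\<lambda>rs. elem_power (Suc k) R (r # rs)" "hnorm R r"])
      (use ep_total r R bnd in \<open>auto simp: tuples_Cons\<close>)
qed

definition left_tensor :: "nat \<Rightarrow> 'r \<Rightarrow> ('r list \<Rightarrow> complex) \<Rightarrow> 'r list \<Rightarrow> complex" where
  "left_tensor k r = (SOME T. T \<in> bop (htensor_power k R) (htensor_power (Suc k) R) \<and>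
    (\<forall>rs\<in>tuples k R. T (elem_power k R rs) = elem_power (Suc k) R (r # rs)))"

lemma left_tensor:
  assumes "r \<in> hcarrier R"
  shows "left_tensor k r \<in> bop (htensor_power k R) (htensor_power (Suc k) R)"
    and "rs \<in> tuples k R \<Longrightarrow> left_tensor k r (elem_power k R rs) = elem_power (Suc k) R (r # rs)"
  using someI_ex[OF left_tensor_exists[OF assms]] unfolding left_tensor_def by blast+

text \<open>Stated for arbitrary vectors but proved as an operator identity: the adjoint of
  tensoring with \<open>s\<close>, composed with tensoring with \<open>r\<close>, is a scalar
  multiple of the identity, which is verified on elementary tensors.\<close>

lemma left_tensor_inner:
  assumes r: "r \<in> hcarrier R" and s: "s \<in> hcarrier R"
    and x: "x \<in> hcarrier (htensor_power k R)" and y: "y \<in> hcarrier (htensor_power k R)"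
  shows "hinner (htensor_power (Suc k) R) (left_tensor k r x) (left_tensor k s y) = hinner R r s * hinner (htensor_power k R) x y"
proof -
  let ?H = "htensor_power k R" and ?K = "htensor_power (Suc k) R"
  have HK: "pre_hilbert ?H" "pre_hilbert ?K" by simp_all
  have hil: "hilbert_space ?H" "hilbert_space ?K" by simp_all
  note A = left_tensor(1)[OF r, of k] and B = left_tensor(1)[OF s, of k]
  let ?B = "op_adjoint ?H ?K (left_tensor k s)"
  have B': "?B \<in> bop ?K ?H" by (rule op_adjoint_bop[OF hil B])
  have eq: "?B \<circ> left_tensor k r = (\<lambda>x. hinner R r s *\<^sub>C id_op ?H x)"
  proof (rule bop_agree_total[OF hil(1) hil(1) bop_compose[OF A B' HK] scale_op_bop[OF HK(1) HK(1) id_op_bop[OF HK(1)]],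
        of "elem_power k R ` tuples k R"])
    fix a assume "a \<in> elem_power k R ` tuples k R"
    then obtain rs where rs: "rs \<in> tuples k R" "a = elem_power k R rs" by blast
    have aH: "a \<in> hcarrier ?H" using rs by simp
    have BA: "?B (left_tensor k r a) \<in> hcarrier ?H" using A B' aH by simp
    have "?B (left_tensor k r a) - hinner R r s *\<^sub>C a = 0"
    proof (rule ep_total)
      show "?B (left_tensor k r a) - hinner R r s *\<^sub>C a \<in> hcarrier ?H" using BA aH HK by simp
      fix ss assume ss: "ss \<in> tuples k R"
      have "hinner ?H (?B (left_tensor k r a)) (elem_power k R ss) = hinner ?K (left_tensor k r a) (left_tensor k s (elem_power k R ss))"
        using op_adjoint_inner'[OF hil B ep_in[OF ss] bop_in[OF A aH]] by simp
      also have "\<dots> = hinner R r s * power_kernel k R ss rs"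
        unfolding rs(2) left_tensor(2)[OF r rs(1)] left_tensor(2)[OF s ss]
        using rs ss r s by (simp add: ep_inner tuples_Cons power_kernel_Cons)
      finally show "hinner ?H (?B (left_tensor k r a) - hinner R r s *\<^sub>C a) (elem_power k R ss) = 0"
        using BA aH ss HK rs by (simp add: ep_inner)
    qed
    then show "(?B \<circ> left_tensor k r) a = hinner R r s *\<^sub>C id_op ?H a" using aH by (simp add: id_op_def)
  next
    fix z assume z: "z \<in> hcarrier ?H" and o: "\<And>a. a \<in> elem_power k R ` tuples k R \<Longrightarrow> hinner ?H z a = 0"
    show "z = 0" by (rule ep_total[OF z]) (rule o, blast)
  qed auto
  have "hinner ?K (left_tensor k r x) (left_tensor k s y) = hinner ?H (?B (left_tensor k r x)) y"
    by (rule op_adjoint_inner'[OF hil B y bop_in[OF A x]])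
  also have "?B (left_tensor k r x) = hinner R r s *\<^sub>C x" using fun_cong[OF eq, of x] x by (simp add: id_op_def)
  finally show ?thesis using x y HK by simp
qed

end

lemma inner_sums:
  assumes H: "pre_hilbert H" and f: "\<And>i. i \<in> F \<Longrightarrow> f i \<in> hcarrier H" and g: "\<And>j. j \<in> G \<Longrightarrow> g j \<in> hcarrier H"
  shows "hinner H (\<Sum>i\<in>F. f i) (\<Sum>j\<in>G. g j) = (\<Sum>i\<in>F. \<Sum>j\<in>G. hinner H (f i) (g j))"
proof -
  have "hinner H (\<Sum>i\<in>F. f i) (\<Sum>j\<in>G. g j) = (\<Sum>i\<in>F. hinner H (f i) (\<Sum>j\<in>G. g j))"
    by (rule inner_sum_left[OF H f sum_in[OF H g]])
  also have "\<dots> = (\<Sum>i\<in>F. \<Sum>j\<in>G. hinner H (f i) (g j))"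
    by (intro sum.cong refl inner_sum_right[OF H g f])
  finally show ?thesis .
qed

section \<open>Row operators and their ampliations\<close>

definition qv :: "nat \<Rightarrow> 'r::complex_vector hspace \<Rightarrow> ((nat \<Rightarrow> 'r) \<Rightarrow> (nat \<Rightarrow> complex)) \<Rightarrow> nat \<Rightarrow> nat \<Rightarrow> 'r" where
  "qv n R T i j = op_adjoint (hpow n R) (cpow n) T (uvec i) j"

context
  fixes R :: "'r::complex_vector hspace" and n :: nat and T :: "(nat \<Rightarrow> 'r) \<Rightarrow> (nat \<Rightarrow> complex)" and c :: real
  assumes R: "hilbert_space R" and T: "T \<in> bop (hpow n R) (cpow n)"
    and c: "0 \<le> c" "\<And>x. x \<in> hcarrier (hpow n R) \<Longrightarrow> hnorm (cpow n) (T x) \<le> c * hnorm (hpow n R) x"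
begin

lemma Tstar_bop: "op_adjoint (hpow n R) (cpow n) T \<in> bop (cpow n) (hpow n R)"
  by (rule op_adjoint_bop) (use R T in simp_all)

lemma qv_in: "i < n \<Longrightarrow> qv n R T i j \<in> hcarrier R"
  unfolding qv_def by (rule hpow_in'[OF hilbert_pre_hilbert[OF R] bop_in[OF Tstar_bop uvec_in]])

lemma row_apply:
  assumes x: "x \<in> hcarrier (hpow n R)" and i: "i < n"
  shows "T x i = (\<Sum>j<n. hinner R (x j) (qv n R T i j))"
proof -
  have "T x i = hinner (cpow n) (T x) (uvec i)" using uvec_inner[OF i bop_in[OF T x]] by simp
  also have "\<dots> = hinner (hpow n R) x (op_adjoint (hpow n R) (cpow n) T (uvec i))"
    by (rule op_adjoint_inner) (use R T x i in simp_all)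
  finally show ?thesis unfolding hpow_inner qv_def .
qed

lemma Tstar_apply:
  assumes d: "d \<in> hcarrier (cpow n)"
  shows "op_adjoint (hpow n R) (cpow n) T d = (\<Sum>i<n. d i *\<^sub>C op_adjoint (hpow n R) (cpow n) T (uvec i))"
proof -
  have "op_adjoint (hpow n R) (cpow n) T (\<Sum>i<n. d i *\<^sub>C uvec i)
      = (\<Sum>i<n. d i *\<^sub>C op_adjoint (hpow n R) (cpow n) T (uvec i))"
    by (rule bop_lincomb[OF _ Tstar_bop]) auto
  then show ?thesis using cpow_decompose[OF d] by simp
qed

lemma Tstar_apply': "d \<in> hcarrier (cpow n) \<Longrightarrow> op_adjoint (hpow n R) (cpow n) T d j = (\<Sum>i<n. d i *\<^sub>C qv n R T i j)"
  unfolding qv_def by (subst Tstar_apply) (simp_all add: fun_sum_apply scaleC_fun_def)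

text \<open>The real part on the left is the squared norm of the adjoint of \<open>T\<close>,
  tensored with an identity, at \<open>F\<close>. The bound \<open>c\<close> survives tensoring
  because the Schur product of two positive kernels, namely the defect of the adjoint of
  \<open>T\<close> and the Gram kernel of \<open>F\<close>, is positive.\<close>

lemma schur_bound:
  assumes X: "pre_hilbert X" and F: "\<And>l. l < n \<Longrightarrow> F l \<in> hcarrier X"
  shows "Re (\<Sum>p<n. \<Sum>l<n. \<Sum>l'<n. hinner R (qv n R T l p) (qv n R T l' p) * hinner X (F l) (F l'))
    \<le> c\<^sup>2 * (\<Sum>l<n. (hnorm X (F l))\<^sup>2)"
proof -
  have Rp: "pre_hilbert R" using R by simp
  let ?q = "qv n R T"
  \<comment> \<open>The matrix of \<open>c^2\<close> times the identity minus \<open>T\<close>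
    composed with its adjoint, up to the order of the indices; its form at \<open>d\<close> is
    nonnegative because the adjoint has the same bound as \<open>T\<close>.\<close>
  define M where "M y x = (if x = y then of_real (c\<^sup>2) else 0) - (\<Sum>p<n. hinner R (?q x p) (?q y p))" for y x :: nat
  have psdM: "psd {..<n} M"
  proof (rule psdI)
    fix x y assume xy: "x \<in> {..<n}" "y \<in> {..<n}"
    have "(\<Sum>p<n. hinner R (?q x p) (?q y p)) = (\<Sum>p<n. cnj (hinner R (?q y p) (?q x p)))"
      using xy by (intro sum.cong refl inner_commute[OF Rp] qv_in) auto
    then show "M y x = cnj (M x y)" unfolding M_def by simp
  next
    fix G and d :: "nat \<Rightarrow> complex" assume G: "finite G" "G \<subseteq> {..<n}"
    \<comment> \<open>The coefficients \<open>d\<close> are arbitrary outside \<open>G\<close>;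
      cutting them off gives a vector of \<open>cpow n\<close> to which the adjoint can be
      applied.\<close>
    define D where "D l = (if l \<in> G then d l else 0)" for l
    have D: "D \<in> hcarrier (cpow n)" unfolding hpow_carrier D_def using G by auto
    let ?S = "op_adjoint (hpow n R) (cpow n) T D"
    have SD: "?S p = (\<Sum>l\<in>G. d l *\<^sub>C ?q l p)" for p
    proof -
      have "?S p = (\<Sum>l<n. if l \<in> G then d l *\<^sub>C ?q l p else 0)"
        unfolding Tstar_apply'[OF D] by (intro sum.cong refl) (simp add: D_def)
      also have "\<dots> = (\<Sum>l\<in>G. d l *\<^sub>C ?q l p)" using G(2) by (simp add: sum.If_cases Int_absorb1)
      finally show ?thesis .
    qed
    have in1: "\<And>l p. l \<in> G \<Longrightarrow> ?q l p \<in> hcarrier R" using G(2) by (auto intro: qv_in)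
    have S2: "(hnorm (hpow n R) ?S)\<^sup>2 = Re (\<Sum>p<n. \<Sum>x\<in>G. \<Sum>y\<in>G. d x * cnj (d y) * hinner R (?q x p) (?q y p))"
    proof -
      have "hinner (hpow n R) ?S ?S = (\<Sum>p<n. \<Sum>x\<in>G. \<Sum>y\<in>G. d x * cnj (d y) * hinner R (?q x p) (?q y p))"
        unfolding hpow_inner SD by (intro sum.cong refl inner_lincomb[OF Rp] in1)
      then show ?thesis using hnorm_sq[OF pre_hilbert_hpow[OF Rp] bop_in[OF Tstar_bop D]] by simp
    qed
    have D2: "(hnorm (cpow n) D)\<^sup>2 = (\<Sum>x\<in>G. (cmod (d x))\<^sup>2)"
    proof -
      have "(hnorm (cpow n) D)\<^sup>2 = (\<Sum>l<n. if l \<in> G then (cmod (d l))\<^sup>2 else 0)"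
        using hpow_norm_sq[OF _ D] unfolding D_def by (simp add: if_distrib[of cmod] if_distrib[of "\<lambda>t. t\<^sup>2"] cong: if_cong)
      then show ?thesis using G(2) by (simp add: sum.If_cases Int_absorb1)
    qed
    have "hnorm (hpow n R) ?S \<le> c * hnorm (cpow n) D"
      by (rule op_adjoint_bound) (use R T c D in simp_all)
    then have "(hnorm (hpow n R) ?S)\<^sup>2 \<le> (c * hnorm (cpow n) D)\<^sup>2"
      by (intro power_mono) (use hnorm_nonneg[OF pre_hilbert_hpow[OF Rp] bop_in[OF Tstar_bop D]] in auto)
    then have le: "Re (\<Sum>p<n. \<Sum>x\<in>G. \<Sum>y\<in>G. d x * cnj (d y) * hinner R (?q x p) (?q y p)) \<le> c\<^sup>2 * (\<Sum>x\<in>G. (cmod (d x))\<^sup>2)"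
      unfolding S2 power_mult_distrib D2 .
    have "(\<Sum>x\<in>G. \<Sum>y\<in>G. d x * cnj (d y) * M y x)
      = (\<Sum>x\<in>G. \<Sum>y\<in>G. if x = y then of_real (c\<^sup>2) * (d x * cnj (d x)) else 0)
        - (\<Sum>x\<in>G. \<Sum>y\<in>G. \<Sum>p<n. d x * cnj (d y) * hinner R (?q x p) (?q y p))"
      unfolding sum_subtractf[symmetric]
      by (intro sum.cong refl) (simp add: M_def right_diff_distrib sum_distrib_left)
    also have "(\<Sum>x\<in>G. \<Sum>y\<in>G. if x = y then of_real (c\<^sup>2) * (d x * cnj (d x)) else 0) = of_real (c\<^sup>2 * (\<Sum>x\<in>G. (cmod (d x))\<^sup>2))"
      using G(1) by (simp add: complex_norm_square sum_distrib_left del: of_real_power)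
    also have "(\<Sum>x\<in>G. \<Sum>y\<in>G. \<Sum>p<n. d x * cnj (d y) * hinner R (?q x p) (?q y p))
        = (\<Sum>p<n. \<Sum>x\<in>G. \<Sum>y\<in>G. d x * cnj (d y) * hinner R (?q x p) (?q y p))"
    proof -
      have "(\<Sum>x\<in>G. \<Sum>y\<in>G. \<Sum>p<n. d x * cnj (d y) * hinner R (?q x p) (?q y p))
        = (\<Sum>x\<in>G. \<Sum>p<n. \<Sum>y\<in>G. d x * cnj (d y) * hinner R (?q x p) (?q y p))"
        by (intro sum.cong refl sum.swap)
      also have "\<dots> = (\<Sum>p<n. \<Sum>x\<in>G. \<Sum>y\<in>G. d x * cnj (d y) * hinner R (?q x p) (?q y p))" by (rule sum.swap)
      finally show ?thesis .
    qed
    finally show "0 \<le> Re (\<Sum>x\<in>G. \<Sum>y\<in>G. d x * cnj (d y) * M y x)" using le by simp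
  qed
  have "psd {..<n} (\<lambda>y x. M y x * hinner X (F x) (F y))"
    by (intro psd_mult psdM psd_gram[OF X]) (use F in auto)
  from psd_nonneg[OF this, of "{..<n}" "\<lambda>_. 1"]
  have "0 \<le> Re (\<Sum>x<n. \<Sum>y<n. M y x * hinner X (F x) (F y))" by simp
  also have "(\<Sum>x<n. \<Sum>y<n. M y x * hinner X (F x) (F y))
      = (\<Sum>x<n. \<Sum>y<n. if x = y then of_real (c\<^sup>2) * hinner X (F x) (F x) else 0)
        - (\<Sum>x<n. \<Sum>y<n. \<Sum>p<n. hinner R (?q x p) (?q y p) * hinner X (F x) (F y))"
    unfolding sum_subtractf[symmetric]
    by (intro sum.cong refl) (simp add: M_def left_diff_distrib sum_distrib_right)
  also have "(\<Sum>x<n. \<Sum>y<n. if x = y then of_real (c\<^sup>2) * hinner X (F x) (F x) else 0)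
      = of_real (c\<^sup>2 * (\<Sum>l<n. (hnorm X (F l))\<^sup>2))"
    using inner_self[OF X F] by (simp add: sum_distrib_left)
  also have "(\<Sum>x<n. \<Sum>y<n. \<Sum>p<n. hinner R (?q x p) (?q y p) * hinner X (F x) (F y))
      = (\<Sum>p<n. \<Sum>x<n. \<Sum>y<n. hinner R (?q x p) (?q y p) * hinner X (F x) (F y))"
  proof -
    have "(\<Sum>x<n. \<Sum>y<n. \<Sum>p<n. hinner R (?q x p) (?q y p) * hinner X (F x) (F y))
      = (\<Sum>x<n. \<Sum>p<n. \<Sum>y<n. hinner R (?q x p) (?q y p) * hinner X (F x) (F y))"
      by (intro sum.cong refl sum.swap)
    also have "\<dots> = (\<Sum>p<n. \<Sum>x<n. \<Sum>y<n. hinner R (?q x p) (?q y p) * hinner X (F x) (F y))" by (rule sum.swap)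
    finally show ?thesis .
  qed
  finally show ?thesis by simp
qed

text \<open>The adjoint of \<open>T \<otimes> I\<close> is easier to write down than
  \<open>T \<otimes> I\<close>: its entries are the operators that tensor with the vectors
  \<open>qv n R T l p\<close>. The operator \<open>tensor_id\<close> is afterwards recovered as its
  adjoint.\<close>

definition tid_adj :: "'x::complex_vector hspace \<Rightarrow> (nat \<Rightarrow> 'x) \<Rightarrow> nat \<Rightarrow> 'r \<times> 'x \<Rightarrow> complex" where
  "tid_adj X = mat_bop n n X (\<lambda>p l. tensor_left R X (qv n R T l p))"

lemma tid_adj_apply:
  assumes X: "pre_hilbert X" and F: "F \<in> hcarrier (hpow n X)" and p: "p < n"
  shows "tid_adj X F p = (\<Sum>l<n. elem_tensor R X (qv n R T l p) (F l))"
  unfolding tid_adj_def mat_bop_apply[OF F p]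
proof (intro sum.cong refl)
  fix l assume "l \<in> {..<n}"
  then have "F l \<in> hcarrier X" using F by simp
  then show "tensor_left R X (qv n R T l p) (F l) = elem_tensor R X (qv n R T l p) (F l)"
    using tensor_left_def[OF hilbert_pre_hilbert[OF R] X] by simp
qed

lemma tid_adj_bop:
  assumes X: "pre_hilbert X"
  shows "tid_adj X \<in> bop (hpow n X) (hpow n (htensor R X))"
proof -
  have Rp: "pre_hilbert R" using R by simp
  show ?thesis
    unfolding tid_adj_def
    by (rule mat_bop[OF X hilbert_pre_hilbert[OF hilbert_htensor[OF Rp X]] tensor_left_bop[OF Rp X qv_in]])
qed

lemma tid_adj_bound:
  assumes X: "pre_hilbert X" and F: "F \<in> hcarrier (hpow n X)"
  shows "hnorm (hpow n (htensor R X)) (tid_adj X F) \<le> c * hnorm (hpow n X) F"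
proof -
  have Rp: "pre_hilbert R" using R by simp
  let ?H = "htensor R X" and ?q = "qv n R T"
  have Hp: "pre_hilbert ?H" using hilbert_htensor[OF Rp X] by simp
  have in1: "l < n \<Longrightarrow> elem_tensor R X (?q l p) (F l) \<in> hcarrier ?H" for l p
    using F by (intro et_in[OF Rp X] qv_in) auto
  have "hinner (hpow n ?H) (tid_adj X F) (tid_adj X F)
      = (\<Sum>p<n. \<Sum>l<n. \<Sum>l'<n. hinner R (?q l p) (?q l' p) * hinner X (F l) (F l'))"
    unfolding hpow_inner
  proof (intro sum.cong refl)
    fix p assume "p \<in> {..<n}"
    then have p: "p < n" by simp
    have "hinner ?H (tid_adj X F p) (tid_adj X F p)
        = (\<Sum>l<n. \<Sum>l'<n. hinner ?H (elem_tensor R X (?q l p) (F l)) (elem_tensor R X (?q l' p) (F l')))"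
      unfolding tid_adj_apply[OF X F p] by (rule inner_sums[OF Hp in1 in1]) simp_all
    also have "\<dots> = (\<Sum>l<n. \<Sum>l'<n. hinner R (?q l p) (?q l' p) * hinner X (F l) (F l'))"
      using F by (intro sum.cong refl et_inner[OF Rp X] qv_in) auto
    finally show "hinner ?H (tid_adj X F p) (tid_adj X F p)
        = (\<Sum>l<n. \<Sum>l'<n. hinner R (?q l p) (?q l' p) * hinner X (F l) (F l'))" .
  qed
  then have "(hnorm (hpow n ?H) (tid_adj X F))\<^sup>2 \<le> c\<^sup>2 * (\<Sum>l<n. (hnorm X (F l))\<^sup>2)"
    using schur_bound[OF X, of F] F hnorm_sq[OF pre_hilbert_hpow[OF Hp] bop_in[OF tid_adj_bop[OF X] F]] by simp
  then have "(hnorm (hpow n ?H) (tid_adj X F))\<^sup>2 \<le> (c * hnorm (hpow n X) F)\<^sup>2"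
    using hpow_norm_sq[OF X F] by (simp add: power_mult_distrib)
  then show ?thesis
    by (rule le_of_sq_le) (rule mult_nonneg_nonneg[OF c(1) hnorm_nonneg[OF pre_hilbert_hpow[OF X] F]])
qed

text \<open>The defining condition of \<open>tensor_id\<close> speaks only of columns of elementary
  tensors with one common factor \<open>x\<close>. These include columns with a single nonzero
  entry, hence are total, and so at most one bounded operator satisfies the condition; the adjoint
  of \<open>tid_adj X\<close> does.\<close>

lemma tensor_id_eq:
  assumes X: "hilbert_space X"
  shows "tensor_id n R X T = op_adjoint (hpow n X) (hpow n (htensor R X)) (tid_adj X)"
proof -
  have Rp: "pre_hilbert R" and Xp: "pre_hilbert X" using R X by simp_all
  let ?H = "htensor R X"
  let ?G = "op_adjoint (hpow n X) (hpow n ?H) (tid_adj X)"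
  have hil: "hilbert_space ?H" by (rule hilbert_htensor[OF Rp Xp])
  then have Hp: "pre_hilbert ?H" by simp
  have hn: "hilbert_space (hpow n X)" "hilbert_space (hpow n ?H)" using hil X by simp_all
  note TA = tid_adj_bop[OF Xp]
  have G: "?G \<in> bop (hpow n ?H) (hpow n X)" by (rule op_adjoint_bop[OF hn TA])
  let ?P = "\<lambda>G. G \<in> bop (hpow n ?H) (hpow n X) \<and>
     (\<forall>\<rho>\<in>hcarrier (hpow n R). \<forall>x\<in>hcarrier X. G (\<lambda>i. elem_tensor R X (\<rho> i) x) = (\<lambda>i. T \<rho> i *\<^sub>C x))"
  have zin: "(\<lambda>i. elem_tensor R X (\<rho> i) x) \<in> hcarrier (hpow n ?H)"
    if "\<rho> \<in> hcarrier (hpow n R)" "x \<in> hcarrier X" for \<rho> x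
    using that et_in[OF Rp Xp] et_zero_left[OF Rp Xp] unfolding hpow_carrier by auto
  have PG: "?P ?G"
  proof (intro conjI G ballI)
    fix \<rho> x assume \<rho>: "\<rho> \<in> hcarrier (hpow n R)" and x: "x \<in> hcarrier X"
    let ?z = "\<lambda>i. elem_tensor R X (\<rho> i) x" and ?y = "\<lambda>i. T \<rho> i *\<^sub>C x"
    have y: "?y \<in> hcarrier (hpow n X)"
      using x Xp bop_in[OF T \<rho>] unfolding hpow_carrier by auto
    show "?G ?z = ?y"
    proof (rule inner_ext[OF hn(1) bop_in[OF G zin[OF \<rho> x]] y])
      fix F assume F: "F \<in> hcarrier (hpow n X)"
      have "hinner (hpow n X) (?G ?z) F = hinner (hpow n ?H) ?z (tid_adj X F)"
        by (rule op_adjoint_inner'[OF hn TA F zin[OF \<rho> x], symmetric])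
      also have "\<dots> = (\<Sum>p<n. \<Sum>l<n. hinner R (\<rho> p) (qv n R T l p) * hinner X x (F l))"
        unfolding hpow_inner
      proof (intro sum.cong refl)
        fix p assume "p \<in> {..<n}"
        then have p: "p < n" by simp
        have "hinner ?H (?z p) (tid_adj X F p) = (\<Sum>l<n. hinner ?H (elem_tensor R X (\<rho> p) x) (elem_tensor R X (qv n R T l p) (F l)))"
          unfolding tid_adj_apply[OF Xp F p] using \<rho> x F p
          by (intro inner_sum_right[OF Hp] et_in[OF Rp Xp] qv_in) auto
        also have "\<dots> = (\<Sum>l<n. hinner R (\<rho> p) (qv n R T l p) * hinner X x (F l))"
          using \<rho> x F p by (intro sum.cong refl et_inner[OF Rp Xp] qv_in) auto
        finally show "hinner ?H (?z p) (tid_adj X F p) = (\<Sum>l<n. hinner R (\<rho> p) (qv n R T l p) * hinner X x (F l))" .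
      qed
      also have "\<dots> = (\<Sum>l<n. \<Sum>p<n. hinner R (\<rho> p) (qv n R T l p) * hinner X x (F l))" by (rule sum.swap)
      also have "\<dots> = (\<Sum>l<n. T \<rho> l * hinner X x (F l))"
        by (intro sum.cong refl) (simp add: row_apply[OF \<rho>] sum_distrib_right)
      also have "\<dots> = hinner (hpow n X) ?y F"
        unfolding hpow_inner using x F Xp by (intro sum.cong refl) simp
      finally show "hinner (hpow n X) (?G ?z) F = hinner (hpow n X) ?y F" .
    qed
  qed
  have uniq: "G' = ?G" if P': "?P G'" for G'
  proof (rule bop_agree_total[OF hn(2,1) conjunct1[OF P'] G, of "{\<lambda>i. elem_tensor R X (\<rho> i) x | \<rho> x. \<rho> \<in> hcarrier (hpow n R) \<and> x \<in> hcarrier X}"])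
    show "{\<lambda>i. elem_tensor R X (\<rho> i) x | \<rho> x. \<rho> \<in> hcarrier (hpow n R) \<and> x \<in> hcarrier X} \<subseteq> hcarrier (hpow n ?H)"
      using zin by blast
    fix z assume z: "z \<in> hcarrier (hpow n ?H)"
      and o: "\<And>a. a \<in> {\<lambda>i. elem_tensor R X (\<rho> i) x | \<rho> x. \<rho> \<in> hcarrier (hpow n R) \<and> x \<in> hcarrier X} \<Longrightarrow> hinner (hpow n ?H) z a = 0"
    show "z = 0"
    proof (rule hpow_total[OF Hp z, of "hcarrier R \<times> hcarrier X" "\<lambda>(r, x). elem_tensor R X r x"])
      fix w assume w: "w \<in> hcarrier ?H" "\<And>e. e \<in> hcarrier R \<times> hcarrier X \<Longrightarrow> hinner ?H w (case e of (r, x) \<Rightarrow> elem_tensor R X r x) = 0"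
      show "w = 0" by (rule et_total[OF Rp Xp w(1)]) (use w(2) in force)
    next
      fix i and e :: "'r \<times> 'a" assume i: "i < n" and e: "e \<in> hcarrier R \<times> hcarrier X"
      obtain r x where rx: "e = (r, x)" by (cases e)
      have "slot i (elem_tensor R X r x) = (\<lambda>l. elem_tensor R X (slot i r l) x)"
        unfolding slot_def using et_zero_left[OF Rp Xp, of x] by (auto simp: fun_eq_iff)
      moreover have "slot i r \<in> hcarrier (hpow n R)" using e rx i Rp by simp
      ultimately have "slot i (case e of (r, x) \<Rightarrow> elem_tensor R X r x) \<in> {\<lambda>i. elem_tensor R X (\<rho> i) x | \<rho> x. \<rho> \<in> hcarrier (hpow n R) \<and> x \<in> hcarrier X}"
        using e rx by auto
      then show "hinner (hpow n ?H) z (slot i (case e of (r, x) \<Rightarrow> elem_tensor R X r x)) = 0" by (rule o)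
    qed
  next
    fix a assume "a \<in> {\<lambda>i. elem_tensor R X (\<rho> i) x | \<rho> x. \<rho> \<in> hcarrier (hpow n R) \<and> x \<in> hcarrier X}"
    then show "G' a = ?G a" using P' PG by auto
  qed
  show ?thesis unfolding tensor_id_def
    by (rule the_equality[where P = ?P, OF PG uniq])
qed

lemma tensor_id:
  assumes X: "hilbert_space X"
  shows tensor_id_bop: "tensor_id n R X T \<in> bop (hpow n (htensor R X)) (hpow n X)"
    and tensor_id_inner: "z \<in> hcarrier (hpow n (htensor R X)) \<Longrightarrow> F \<in> hcarrier (hpow n X) \<Longrightarrow>
      hinner (hpow n X) (tensor_id n R X T z) F = hinner (hpow n (htensor R X)) z (tid_adj X F)"
    and tensor_id_bound: "z \<in> hcarrier (hpow n (htensor R X)) \<Longrightarrow>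
      hnorm (hpow n X) (tensor_id n R X T z) \<le> c * hnorm (hpow n (htensor R X)) z"
proof -
  have Xp: "pre_hilbert X" and Rp: "pre_hilbert R" using X R by simp_all
  have hn: "hilbert_space (hpow n X)" "hilbert_space (hpow n (htensor R X))"
    using hilbert_htensor[OF Rp Xp] X by simp_all
  note TA = tid_adj_bop[OF Xp]
  show "tensor_id n R X T \<in> bop (hpow n (htensor R X)) (hpow n X)"
    unfolding tensor_id_eq[OF X] by (rule op_adjoint_bop[OF hn TA])
  show "z \<in> hcarrier (hpow n (htensor R X)) \<Longrightarrow> F \<in> hcarrier (hpow n X) \<Longrightarrow>
      hinner (hpow n X) (tensor_id n R X T z) F = hinner (hpow n (htensor R X)) z (tid_adj X F)"
    unfolding tensor_id_eq[OF X] by (rule op_adjoint_inner'[OF hn TA, symmetric])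
  show "z \<in> hcarrier (hpow n (htensor R X)) \<Longrightarrow>
      hnorm (hpow n X) (tensor_id n R X T z) \<le> c * hnorm (hpow n (htensor R X)) z"
    unfolding tensor_id_eq[OF X] by (rule op_adjoint_bound[OF hn TA c(1) tid_adj_bound[OF Xp]])
qed

end

text \<open>As for \<open>tensor_id\<close>, uniqueness rests on totality: unit vectors in place of
  \<open>c\<close> give elementary tensors in a single slot. The matrix form makes inner products of
  the powers computable through \<open>left_tensor_inner\<close>.\<close>

lemma tensor_power_id_eq:
  assumes R: "hilbert_space R" and T: "T \<in> bop (cpow m) (hpow m R)"
  shows "tensor_power_id m R k T = mat_bop m m (htensor_power k R) (\<lambda>i j. left_tensor R k (T (uvec j) i))"
    (is "_ = ?G")
proof -
  have Rp: "pre_hilbert R" using R by simp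
  let ?H = "htensor_power k R" and ?K = "htensor_power (Suc k) R"
  have hil: "hilbert_space (hpow m ?H)" "hilbert_space (hpow m ?K)" using Rp by simp_all
  have Hp: "pre_hilbert ?H" "pre_hilbert ?K" using Rp by simp_all
  have t: "T (uvec j) i \<in> hcarrier R" if "j < m" for i j
    by (rule hpow_in'[OF Rp bop_in[OF T]]) (use that in simp)
  have G: "?G \<in> bop (hpow m ?H) (hpow m ?K)" by (intro mat_bop Hp left_tensor(1)[OF Rp] t)
  let ?P = "\<lambda>G. G \<in> bop (hpow m ?H) (hpow m ?K) \<and>
       (\<forall>c\<in>hcarrier (cpow m). \<forall>rs\<in>tuples k R.
          G (\<lambda>i. c i *\<^sub>C elem_power k R rs) = (\<lambda>i. elem_power (Suc k) R (T c i # rs)))"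
  have zin: "(\<lambda>i. c i *\<^sub>C elem_power k R rs) \<in> hcarrier (hpow m ?H)"
    if "c \<in> hcarrier (cpow m)" "rs \<in> tuples k R" for c rs
    using that(1) scale_in[OF Hp(1) ep_in[OF Rp that(2)]] by (simp add: hpow_carrier)
  \<comment> \<open>Needed beyond index \<open>m\<close>, where \<open>T c i\<close> is 0 while the
    description still asks for the elementary tensor of \<open>T c i # rs\<close>.\<close>
  have zero: "elem_power (Suc k) R (0 # rs) = 0" for rs
    using ep_sum_Cons[OF Rp, of "{}" "\<lambda>_::nat. 0" k "\<lambda>_. 0" rs] by simp
  have PG: "?P ?G"
  proof (intro conjI G ballI)
    fix c rs assume c: "c \<in> hcarrier (cpow m)" and rs: "rs \<in> tuples k R"
    let ?z = "\<lambda>i. c i *\<^sub>C elem_power k R rs"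
    show "?G ?z = (\<lambda>i. elem_power (Suc k) R (T c i # rs))"
    proof
      fix i
      show "?G ?z i = elem_power (Suc k) R (T c i # rs)"
      proof (cases "i < m")
        case True
        have "?G ?z i = (\<Sum>j<m. left_tensor R k (T (uvec j) i) (c j *\<^sub>C elem_power k R rs))"
          by (rule mat_bop_apply[OF zin[OF c rs] True])
        also have "\<dots> = (\<Sum>j<m. c j *\<^sub>C elem_power (Suc k) R (T (uvec j) i # rs))"
          using left_tensor[OF Rp t] rs ep_in[OF Rp rs] by (intro sum.cong refl) (simp add: bop_scale[OF left_tensor(1)[OF Rp t]])
        also have "\<dots> = elem_power (Suc k) R ((\<Sum>j<m. c j *\<^sub>C T (uvec j) i) # rs)"
          by (rule ep_sum_Cons[OF Rp, symmetric]) (use t in auto)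
        also have "(\<Sum>j<m. c j *\<^sub>C T (uvec j) i) = T c i"
        proof -
          have "T (\<Sum>j<m. c j *\<^sub>C uvec j) = (\<Sum>j<m. c j *\<^sub>C T (uvec j))"
            by (rule bop_lincomb[OF _ T]) auto
          then show ?thesis using cpow_decompose[OF c] by (simp add: fun_sum_apply scaleC_fun_def)
        qed
        finally show ?thesis .
      next
        case False
        have "?G ?z i = 0" using hpow_off[OF bop_in[OF G zin[OF c rs]], of i] False by simp
        moreover have "T c i = 0" using hpow_off[OF bop_in[OF T c], of i] False by simp
        ultimately show ?thesis using zero by simp
      qed
    qed
  qed
  have uniq: "G' = ?G" if P': "?P G'" for G'
  proof (rule bop_agree_total[OF hil conjunct1[OF P'] G, of "{\<lambda>i. c i *\<^sub>C elem_power k R rs | c rs. c \<in> hcarrier (cpow m) \<and> rs \<in> tuples k R}"])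
    show "{\<lambda>i. c i *\<^sub>C elem_power k R rs | c rs. c \<in> hcarrier (cpow m) \<and> rs \<in> tuples k R} \<subseteq> hcarrier (hpow m ?H)"
      using zin by blast
    fix z assume z: "z \<in> hcarrier (hpow m ?H)"
      and o: "\<And>a. a \<in> {\<lambda>i. c i *\<^sub>C elem_power k R rs | c rs. c \<in> hcarrier (cpow m) \<and> rs \<in> tuples k R} \<Longrightarrow> hinner (hpow m ?H) z a = 0"
    show "z = 0"
    proof (rule hpow_total[OF Hp(1) z ep_total[OF Rp]])
      fix i rs assume i: "i < m" and rs: "rs \<in> tuples k R"
      have "slot i (elem_power k R rs) = (\<lambda>l. uvec i l *\<^sub>C elem_power k R rs)"
        unfolding slot_def uvec_def by (auto simp: fun_eq_iff)
      then have "slot i (elem_power k R rs) \<in> {\<lambda>i. c i *\<^sub>C elem_power k R rs | c rs. c \<in> hcarrier (cpow m) \<and> rs \<in> tuples k R}"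
        using i rs by (auto intro!: exI[of _ "uvec i"] exI[of _ rs])
      then show "hinner (hpow m ?H) z (slot i (elem_power k R rs)) = 0" by (rule o)
    qed
  next
    fix a assume "a \<in> {\<lambda>i. c i *\<^sub>C elem_power k R rs | c rs. c \<in> hcarrier (cpow m) \<and> rs \<in> tuples k R}"
    then show "G' a = ?G a" using P' PG by auto
  qed
  show ?thesis unfolding tensor_power_id_def
    by (rule the_equality[where P = ?P, OF PG uniq])
qed

section \<open>The scalar kernel\<close>

definition phi :: "'r::complex_vector hspace \<Rightarrow> ('v mat \<Rightarrow> (nat \<Rightarrow> 'r) \<Rightarrow> (nat \<Rightarrow> complex)) \<Rightarrow>
    'v mat \<Rightarrow> 'v mat \<Rightarrow> (nat \<Rightarrow> nat \<Rightarrow> complex) \<Rightarrow> nat \<Rightarrow> nat \<Rightarrow> complex" where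
  "phi R Q Z W p = (\<lambda>i l. \<Sum>a<dim_row Z. \<Sum>b<dim_row W.
     p a b * hinner R (qv (dim_row W) R (Q W) l b) (qv (dim_row Z) R (Q Z) i a))"

definition kker :: "'r::complex_vector hspace \<Rightarrow> ('v mat \<Rightarrow> (nat \<Rightarrow> 'r) \<Rightarrow> (nat \<Rightarrow> complex)) \<Rightarrow>
    'v mat \<Rightarrow> 'v mat \<Rightarrow> (nat \<Rightarrow> nat \<Rightarrow> complex) \<Rightarrow> nat \<Rightarrow> nat \<Rightarrow> complex" where
  "kker R Q Z W p = (\<lambda>i l. \<Sum>k. (phi R Q Z W ^^ k) p i l)"

lemma phi_cong:
  assumes "\<And>a b. a < dim_row Z \<Longrightarrow> b < dim_row W \<Longrightarrow> p a b = p' a b"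
  shows "phi R Q Z W p = phi R Q Z W p'"
  unfolding phi_def using assms by (intro ext sum.cong refl) simp

text \<open>The entries \<open>p\<close> are a function on all pairs of indices, of which
  \<open>phi\<close> reads only those within the matrix sizes. After one step two such functions
  agree everywhere; for \<open>k = 0\<close> the bounds on \<open>i\<close> and \<open>l\<close> are
  what gives equality.\<close>

lemma phi_pow_cong:
  assumes "\<And>a b. a < dim_row Z \<Longrightarrow> b < dim_row W \<Longrightarrow> p a b = p' a b"
    and "i < dim_row Z" "l < dim_row W"
  shows "(phi R Q Z W ^^ k) p i l = (phi R Q Z W ^^ k) p' i l"
proof (cases k)
  case 0
  then show ?thesis using assms by simp
next
  case (Suc j)
  have "phi R Q Z W p = phi R Q Z W p'" by (rule phi_cong[OF assms(1)])
  then show ?thesis unfolding Suc funpow_Suc_right o_apply by simp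
qed

lemma phi_Suc: "(phi R Q Z W ^^ Suc k) p i l = (\<Sum>a<dim_row Z. \<Sum>b<dim_row W.
    (phi R Q Z W ^^ k) p a b * hinner R (qv (dim_row W) R (Q W) l b) (qv (dim_row Z) R (Q Z) i a))"
  unfolding funpow.simps o_apply by (subst phi_def) (rule refl)

lemma kker_cong:
  assumes "\<And>a b. a < dim_row Z \<Longrightarrow> b < dim_row W \<Longrightarrow> p a b = p' a b"
    and "i < dim_row Z" "l < dim_row W"
  shows "kker R Q Z W p i l = kker R Q Z W p' i l"
  unfolding kker_def by (rule arg_cong[where f = suminf], rule ext, rule phi_pow_cong[OF assms])

lemma sum4_swap:
  "(\<Sum>a\<in>A. \<Sum>b\<in>B. \<Sum>c\<in>C. \<Sum>d\<in>D. f a b c d) = (\<Sum>c\<in>C. \<Sum>d\<in>D. \<Sum>a\<in>A. \<Sum>b\<in>B. (f a b c d :: 'z::comm_monoid_add))"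
proof -
  have "(\<Sum>a\<in>A. \<Sum>b\<in>B. \<Sum>c\<in>C. \<Sum>d\<in>D. f a b c d) = (\<Sum>a\<in>A. \<Sum>c\<in>C. \<Sum>b\<in>B. \<Sum>d\<in>D. f a b c d)"
    by (intro sum.cong refl sum.swap)
  also have "\<dots> = (\<Sum>c\<in>C. \<Sum>a\<in>A. \<Sum>b\<in>B. \<Sum>d\<in>D. f a b c d)" by (rule sum.swap)
  also have "\<dots> = (\<Sum>c\<in>C. \<Sum>a\<in>A. \<Sum>d\<in>D. \<Sum>b\<in>B. f a b c d)" by (intro sum.cong refl sum.swap)
  also have "\<dots> = (\<Sum>c\<in>C. \<Sum>d\<in>D. \<Sum>a\<in>A. \<Sum>b\<in>B. f a b c d)" by (intro sum.cong refl sum.swap)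
  finally show ?thesis .
qed

lemma inner_ext_right:
  assumes H: "hilbert_space H" "x \<in> hcarrier H" "y \<in> hcarrier H"
    and eq: "\<And>z. z \<in> hcarrier H \<Longrightarrow> hinner H z x = hinner H z y"
  shows "x = y"
proof (rule inner_ext[OF H])
  fix z assume z: "z \<in> hcarrier H"
  have Hp: "pre_hilbert H" using H by simp
  show "hinner H x z = hinner H y z"
    using inner_commute[OF Hp z H(2)] inner_commute[OF Hp z H(3)] eq[OF z] by simp
qed

locale row_ball =
  fixes R :: "'r::complex_vector hspace" and Q :: "'v::complex_vector mat \<Rightarrow> (nat \<Rightarrow> 'r) \<Rightarrow> (nat \<Rightarrow> complex)"
    and \<Delta> :: "'v mat set"
  assumes R: "hilbert_space R"
    and QT: "\<And>W. W \<in> \<Delta> \<Longrightarrow> Q W \<in> bop (hpow (dim_row W) R) (cpow (dim_row W))"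
    and Q1: "\<And>W. W \<in> \<Delta> \<Longrightarrow> op_norm (hpow (dim_row W) R) (cpow (dim_row W)) (Q W) < 1"
    and Qnc: "\<And>Z Z' \<alpha>. Z \<in> \<Delta> \<Longrightarrow> Z' \<in> \<Delta> \<Longrightarrow> \<alpha> \<in> carrier_mat (dim_row Z') (dim_row Z) \<Longrightarrow>
      lact \<alpha> Z = ract Z' \<alpha> \<Longrightarrow> mat_op \<alpha> complex_hspace \<circ> Q Z = Q Z' \<circ> mat_op \<alpha> R"
begin

abbreviation q :: "'v mat \<Rightarrow> nat \<Rightarrow> nat \<Rightarrow> 'r" where
  "q W i j \<equiv> qv (dim_row W) R (Q W) i j"

text \<open>The maximum with 0 makes nonnegativity immediate; powers of this constant dominate the
  kernel series, and the Neumann inverses need it to lie in the interval from 0 to 1, with 1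
  excluded.\<close>

definition cQ :: "'v mat \<Rightarrow> real" where
  "cQ W = max 0 (op_norm (hpow (dim_row W) R) (cpow (dim_row W)) (Q W))"

lemma cQ: "0 \<le> cQ W" "W \<in> \<Delta> \<Longrightarrow> cQ W < 1"
  "W \<in> \<Delta> \<Longrightarrow> x \<in> hcarrier (hpow (dim_row W) R) \<Longrightarrow>
    hnorm (cpow (dim_row W)) (Q W x) \<le> cQ W * hnorm (hpow (dim_row W) R) x"
proof -
  show "0 \<le> cQ W" unfolding cQ_def by simp
  show "W \<in> \<Delta> \<Longrightarrow> cQ W < 1" using Q1 unfolding cQ_def by simp
  show "W \<in> \<Delta> \<Longrightarrow> x \<in> hcarrier (hpow (dim_row W) R) \<Longrightarrow>
    hnorm (cpow (dim_row W)) (Q W x) \<le> cQ W * hnorm (hpow (dim_row W) R) x"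
  proof -
    assume W: "W \<in> \<Delta>" and x: "x \<in> hcarrier (hpow (dim_row W) R)"
    have hR: "hilbert_space (hpow (dim_row W) R)" using R by simp
    have "hnorm (cpow (dim_row W)) (Q W x) \<le> op_norm (hpow (dim_row W) R) (cpow (dim_row W)) (Q W) * hnorm (hpow (dim_row W) R) x"
      by (rule op_norm_ge[OF hR QT[OF W] _ x]) simp
    also have "\<dots> \<le> cQ W * hnorm (hpow (dim_row W) R) x"
      unfolding cQ_def by (rule mult_right_mono) (use hnorm_nonneg[OF hilbert_pre_hilbert[OF hR] x] in auto)
    finally show ?thesis .
  qed
qed

lemma Rp: "pre_hilbert R" using R by simp

lemma q_in: "W \<in> \<Delta> \<Longrightarrow> i < dim_row W \<Longrightarrow> q W i j \<in> hcarrier R"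
  by (rule qv_in[OF R QT cQ(1) cQ(3)])

section \<open>Powers of the row operators and convergence of the kernel series\<close>

abbreviation pw :: "nat \<Rightarrow> ('r list \<Rightarrow> complex) hspace" where
  "pw k \<equiv> htensor_power k R"

lemma pwp: "pre_hilbert (pw k)" using hilbert_htensor_power[OF Rp] by simp

lemma L_step:
  assumes W: "W \<in> \<Delta>"
  shows "tensor_power_id (dim_row W) R k (op_adjoint (hpow (dim_row W) R) (cpow (dim_row W)) (Q W))
    = mat_bop (dim_row W) (dim_row W) (pw k) (\<lambda>i j. left_tensor R k (q W j i))"
  unfolding qv_def by (rule tensor_power_id_eq[OF R Tstar_bop[OF R QT[OF W] cQ(1) cQ(3)[OF W]]])

lemma L_step_bop:
  assumes W: "W \<in> \<Delta>"
  shows "mat_bop (dim_row W) (dim_row W) (pw k) (\<lambda>i j. left_tensor R k (q W j i))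
    \<in> bop (hpow (dim_row W) (pw k)) (hpow (dim_row W) (pw (Suc k)))"
proof (rule mat_bop[OF pwp pwp])
  fix i j assume "j < dim_row W"
  then show "left_tensor R k (q W j i) \<in> bop (pw k) (pw (Suc k))"
    by (rule left_tensor(1)[OF Rp q_in[OF W]])
qed

lemma L_Q_0: "L_Q R Q W 0 = (\<lambda>c. if c \<in> hcarrier (cpow (dim_row W)) then (\<lambda>i. c i *\<^sub>C elem_power 0 R []) else 0)"
  unfolding L_Q_def by simp

lemma L_Q_Suc: "W \<in> \<Delta> \<Longrightarrow>
  L_Q R Q W (Suc k) = mat_bop (dim_row W) (dim_row W) (pw k) (\<lambda>i j. left_tensor R k (q W j i)) \<circ> L_Q R Q W k"
  unfolding L_Q_def L_power.simps by (subst L_step) (rule refl | assumption)+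

lemma ep_Nil: "elem_power 0 R [] \<in> hcarrier (pw 0)" "hinner (pw 0) (elem_power 0 R []) (elem_power 0 R []) = 1"
proof -
  have t: "[] \<in> tuples 0 R" unfolding tuples_def by simp
  show "elem_power 0 R [] \<in> hcarrier (pw 0)" using ep_in[OF Rp t] .
  show "hinner (pw 0) (elem_power 0 R []) (elem_power 0 R []) = 1"
    using ep_inner[OF Rp t t] by (simp add: power_kernel_def)
qed

lemma L_Q_bop:
  assumes W: "W \<in> \<Delta>"
  shows "L_Q R Q W k \<in> bop (cpow (dim_row W)) (hpow (dim_row W) (pw k))"
proof (induction k)
  case 0
  show ?case
  proof (rule linear_cpow_bop)
    show "pre_hilbert (hpow (dim_row W) (pw 0))" by (rule pre_hilbert_hpow[OF pwp])
    fix x assume x: "x \<in> hcarrier (cpow (dim_row W))"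
    show "L_Q R Q W 0 x \<in> hcarrier (hpow (dim_row W) (pw 0))"
      unfolding L_Q_0 using x scale_in[OF pwp ep_Nil(1)] by (simp add: hpow_carrier)
    have Cp: "pre_hilbert (cpow (dim_row W))" by simp
    show "L_Q R Q W 0 (a *\<^sub>C x) = a *\<^sub>C L_Q R Q W 0 x" for a
      unfolding L_Q_0 using x scale_in[OF Cp x, of a] by (simp add: scaleC_fun_def scaleC_complex_def mult.assoc)
    fix y assume y: "y \<in> hcarrier (cpow (dim_row W))"
    show "L_Q R Q W 0 (x + y) = L_Q R Q W 0 x + L_Q R Q W 0 y"
      unfolding L_Q_0 using x y add_in[OF Cp x y] by (simp add: scaleC_add_left fun_eq_iff)
  qed (simp add: L_Q_0 zero_fun_def)
next
  case (Suc k)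
  show ?case unfolding L_Q_Suc[OF W]
    by (rule bop_compose[OF Suc L_step_bop[OF W] _ pre_hilbert_hpow[OF pwp]]) simp
qed

lemma L_step_inner:
  assumes W: "W \<in> \<Delta>" and Z: "Z \<in> \<Delta>"
    and x: "x \<in> hcarrier (hpow (dim_row W) (pw k))" and y: "y \<in> hcarrier (hpow (dim_row Z) (pw k))"
    and b: "b < dim_row W" and a: "a < dim_row Z"
  shows "hinner (pw (Suc k)) (mat_bop (dim_row W) (dim_row W) (pw k) (\<lambda>i j. left_tensor R k (q W j i)) x b)
      (mat_bop (dim_row Z) (dim_row Z) (pw k) (\<lambda>i j. left_tensor R k (q Z j i)) y a)
    = (\<Sum>j<dim_row W. \<Sum>j'<dim_row Z. hinner R (q W j b) (q Z j' a) * hinner (pw k) (x j) (y j'))"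
proof -
  have "hinner (pw (Suc k)) (\<Sum>j<dim_row W. left_tensor R k (q W j b) (x j)) (\<Sum>j'<dim_row Z. left_tensor R k (q Z j' a) (y j'))
    = (\<Sum>j<dim_row W. \<Sum>j'<dim_row Z. hinner (pw (Suc k)) (left_tensor R k (q W j b) (x j)) (left_tensor R k (q Z j' a) (y j')))"
    by (rule inner_sums[OF pwp]; rule bop_in[OF left_tensor(1)[OF Rp q_in]]) (use W Z x y in auto)
  also have "\<dots> = (\<Sum>j<dim_row W. \<Sum>j'<dim_row Z. hinner R (q W j b) (q Z j' a) * hinner (pw k) (x j) (y j'))"
    by (intro sum.cong refl left_tensor_inner[OF Rp] q_in) (use W Z x y in auto)
  finally show ?thesis unfolding mat_bop_apply[OF x b] mat_bop_apply[OF y a] .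
qed

text \<open>Each step is the adjoint row operator tensored with an identity, so
  \<open>schur_bound\<close>, applied to the components of the previous power, contributes one
  factor \<open>cQ W\<close>.\<close>

lemma L_Q_bound:
  assumes W: "W \<in> \<Delta>" and x: "x \<in> hcarrier (cpow (dim_row W))"
  shows "hnorm (hpow (dim_row W) (pw k)) (L_Q R Q W k x) \<le> cQ W ^ k * hnorm (cpow (dim_row W)) x"
proof (induction k)
  case 0
  let ?n = "dim_row W"
  have in0: "L_Q R Q W 0 x \<in> hcarrier (hpow ?n (pw 0))" using bop_in[OF L_Q_bop[OF W] x] .
  have "(hnorm (hpow ?n (pw 0)) (L_Q R Q W 0 x))\<^sup>2 = (\<Sum>i<?n. (hnorm (pw 0) (x i *\<^sub>C elem_power 0 R []))\<^sup>2)"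
    using hpow_norm_sq[OF pwp in0] x by (simp add: L_Q_0)
  also have "\<dots> = (\<Sum>i<?n. (cmod (x i))\<^sup>2)"
  proof -
    have "hnorm (pw 0) (elem_power 0 R []) = 1" unfolding hnorm_def ep_Nil(2) by simp
    then show ?thesis using hnorm_scale[OF pwp ep_Nil(1)] by simp
  qed
  also have "\<dots> = (hnorm (cpow ?n) x)\<^sup>2" using hpow_norm_sq[of complex_hspace x ?n] x by simp
  finally have sq: "(hnorm (hpow ?n (pw 0)) (L_Q R Q W 0 x))\<^sup>2 = (hnorm (cpow ?n) x)\<^sup>2" .
  have "hnorm (hpow ?n (pw 0)) (L_Q R Q W 0 x) \<le> hnorm (cpow ?n) x"
    by (rule le_of_sq_le) (use sq x in \<open>auto intro: hnorm_nonneg\<close>)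
  then show ?case by simp
next
  case (Suc k)
  let ?n = "dim_row W"
  let ?y = "L_Q R Q W k x" and ?z = "L_Q R Q W (Suc k) x"
  let ?N = "hnorm (hpow ?n (pw k)) ?y"
  have y: "?y \<in> hcarrier (hpow ?n (pw k))" using bop_in[OF L_Q_bop[OF W] x] .
  have z: "?z \<in> hcarrier (hpow ?n (pw (Suc k)))" using bop_in[OF L_Q_bop[OF W] x] .
  have "hinner (hpow ?n (pw (Suc k))) ?z ?z = (\<Sum>p<?n. \<Sum>j<?n. \<Sum>j'<?n. hinner R (q W j p) (q W j' p) * hinner (pw k) (?y j) (?y j'))"
    unfolding hpow_inner L_Q_Suc[OF W] o_apply by (intro sum.cong refl L_step_inner[OF W W y y]) auto
  then have "(hnorm (hpow ?n (pw (Suc k))) ?z)\<^sup>2 \<le> (cQ W)\<^sup>2 * (\<Sum>l<?n. (hnorm (pw k) (?y l))\<^sup>2)"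
    using schur_bound[OF R QT[OF W] cQ(1) cQ(3)[OF W] pwp, of ?y] y hnorm_sq[OF pre_hilbert_hpow[OF pwp] z] by simp
  then have "(hnorm (hpow ?n (pw (Suc k))) ?z)\<^sup>2 \<le> (cQ W * ?N)\<^sup>2"
    using hpow_norm_sq[OF pwp y] by (simp add: power_mult_distrib)
  then have "hnorm (hpow ?n (pw (Suc k))) ?z \<le> cQ W * ?N"
    by (rule le_of_sq_le) (rule mult_nonneg_nonneg[OF cQ(1) hnorm_nonneg[OF pre_hilbert_hpow[OF pwp] y]])
  also have "\<dots> \<le> cQ W * (cQ W ^ k * hnorm (cpow ?n) x)" using Suc cQ(1) by (rule mult_left_mono)
  finally show ?case by (simp add: mult.assoc)
qed

text \<open>The coefficient with which \<open>p a b\<close> enters entry \<open>(i, l)\<close> of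
  the \<open>k\<close>-th term of the kernel series: the inner product of component \<open>b\<close>
  of the \<open>k\<close>-th power at unit vector \<open>l\<close> with component \<open>a\<close>
  of the one at unit vector \<open>i\<close>.\<close>

definition kgram :: "'v mat \<Rightarrow> 'v mat \<Rightarrow> nat \<Rightarrow> nat \<Rightarrow> nat \<Rightarrow> nat \<Rightarrow> nat \<Rightarrow> complex" where
  "kgram Z W k i a l b = hinner (pw k) (L_Q R Q W k (uvec l) b) (L_Q R Q Z k (uvec i) a)"

text \<open>Connects the two descriptions of the kernel terms, by iteration of \<open>phi\<close>
  and by powers of \<open>L_Q\<close>. The induction must vary \<open>p\<close>: the last tensor
  step yields the sums that define \<open>phi p\<close>, to which the hypothesis for
  \<open>k\<close> is applied.\<close>

lemma phi_pow_gram: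
  assumes Z: "Z \<in> \<Delta>" and W: "W \<in> \<Delta>" and i: "i < dim_row Z" and l: "l < dim_row W"
  shows "(phi R Q Z W ^^ k) p i l = (\<Sum>a<dim_row Z. \<Sum>b<dim_row W. p a b * kgram Z W k i a l b)"
proof (induction k arbitrary: p)
  case 0
  let ?n = "dim_row Z" and ?m = "dim_row W"
  have g0: "kgram Z W 0 i a l b = (if a = i then if b = l then 1 else 0 else 0)" for a b
    unfolding kgram_def L_Q_0 using i l ep_Nil pwp by (simp add: uvec_def[of _] uvec_in[unfolded uvec_def])
  have "(\<Sum>a<?n. \<Sum>b<?m. p a b * kgram Z W 0 i a l b) = (\<Sum>a<?n. if a = i then p a l else 0)"
    unfolding g0 using l by (intro sum.cong refl) (auto simp: if_distrib[of "\<lambda>t. _ * t"] cong: if_cong)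
  then show ?case using i by simp
next
  case (Suc k)
  let ?n = "dim_row Z" and ?m = "dim_row W"
  have gs: "kgram Z W (Suc k) i a l b = (\<Sum>j<?m. \<Sum>j'<?n. hinner R (q W j b) (q Z j' a) * kgram Z W k i j' l j)"
    if "a < ?n" "b < ?m" for a b
    unfolding kgram_def L_Q_Suc[OF W] L_Q_Suc[OF Z] o_apply
    by (rule L_step_inner[OF W Z bop_in[OF L_Q_bop[OF W] uvec_in[OF l]] bop_in[OF L_Q_bop[OF Z] uvec_in[OF i]] that(2,1)])
  have "(phi R Q Z W ^^ Suc k) p i l = (phi R Q Z W ^^ k) (phi R Q Z W p) i l"
    by (simp add: funpow_swap1)
  also have "\<dots> = (\<Sum>j'<?n. \<Sum>j<?m. phi R Q Z W p j' j * kgram Z W k i j' l j)" by (rule Suc)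
  also have "\<dots> = (\<Sum>j'<?n. \<Sum>j<?m. \<Sum>a<?n. \<Sum>b<?m. p a b * (hinner R (q W j b) (q Z j' a) * kgram Z W k i j' l j))"
    unfolding phi_def by (simp add: sum_distrib_right mult.assoc)
  also have "\<dots> = (\<Sum>a<?n. \<Sum>b<?m. \<Sum>j'<?n. \<Sum>j<?m. p a b * (hinner R (q W j b) (q Z j' a) * kgram Z W k i j' l j))"
    by (rule sum4_swap)
  also have "\<dots> = (\<Sum>a<?n. \<Sum>b<?m. p a b * kgram Z W (Suc k) i a l b)"
  proof (intro sum.cong refl)
    fix a b assume "a \<in> {..<?n}" "b \<in> {..<?m}"
    then have "kgram Z W (Suc k) i a l b = (\<Sum>j'<?n. \<Sum>j<?m. hinner R (q W j b) (q Z j' a) * kgram Z W k i j' l j)"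
      using gs[of a b] by (subst sum.swap) simp
    then show "(\<Sum>j'<?n. \<Sum>j<?m. p a b * (hinner R (q W j b) (q Z j' a) * kgram Z W k i j' l j)) = p a b * kgram Z W (Suc k) i a l b"
      by (simp add: sum_distrib_left)
  qed
  finally show ?case .
qed

lemma kgram_bound:
  assumes Z: "Z \<in> \<Delta>" and W: "W \<in> \<Delta>" and i: "i < dim_row Z" and l: "l < dim_row W" and a: "a < dim_row Z" and b: "b < dim_row W"
  shows "cmod (kgram Z W k i a l b) \<le> (cQ Z * cQ W) ^ k"
proof -
  have bnd: "L_Q R Q V k (uvec j) c \<in> hcarrier (pw k)" "hnorm (pw k) (L_Q R Q V k (uvec j) c) \<le> cQ V ^ k"
    if V: "V \<in> \<Delta>" "j < dim_row V" "c < dim_row V" for V j c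
  proof -
    have in1: "L_Q R Q V k (uvec j) \<in> hcarrier (hpow (dim_row V) (pw k))" using bop_in[OF L_Q_bop[OF V(1)] uvec_in[OF V(2)]] .
    show "L_Q R Q V k (uvec j) c \<in> hcarrier (pw k)" using hpow_in[OF in1 V(3)] .
    have u: "hnorm (cpow (dim_row V)) (uvec j) = 1"
      unfolding hnorm_def uvec_inner[OF V(2) uvec_in[OF V(2)]] by (simp add: uvec_def)
    have "hnorm (pw k) (L_Q R Q V k (uvec j) c) \<le> hnorm (hpow (dim_row V) (pw k)) (L_Q R Q V k (uvec j))"
      by (rule hpow_component_le[OF pwp in1 V(3)])
    also have "\<dots> \<le> cQ V ^ k * hnorm (cpow (dim_row V)) (uvec j)" by (rule L_Q_bound[OF V(1) uvec_in[OF V(2)]])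
    finally show "hnorm (pw k) (L_Q R Q V k (uvec j) c) \<le> cQ V ^ k" using u by simp
  qed
  have "cmod (kgram Z W k i a l b) \<le> hnorm (pw k) (L_Q R Q W k (uvec l) b) * hnorm (pw k) (L_Q R Q Z k (uvec i) a)"
    unfolding kgram_def by (rule cauchy_schwarz[OF pwp bnd(1)[OF W l b] bnd(1)[OF Z i a]])
  also have "\<dots> \<le> cQ W ^ k * cQ Z ^ k"
    by (rule mult_mono[OF bnd(2)[OF W l b] bnd(2)[OF Z i a]]) (use cQ(1) hnorm_nonneg[OF pwp bnd(1)[OF Z i a]] in auto)
  finally show ?thesis by (simp add: power_mult_distrib mult.commute)
qed

text \<open>Strict contractivity at both points makes the terms decay like powers of
  \<open>cQ Z * cQ W\<close>, which is less than 1.\<close>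

lemma phi_pow_sums:
  assumes Z: "Z \<in> \<Delta>" and W: "W \<in> \<Delta>" and i: "i < dim_row Z" and l: "l < dim_row W"
  shows "(\<lambda>k. (phi R Q Z W ^^ k) p i l) sums kker R Q Z W p i l"
proof -
  let ?M = "\<Sum>a<dim_row Z. \<Sum>b<dim_row W. cmod (p a b)"
  have bnd: "cmod ((phi R Q Z W ^^ k) p i l) \<le> ?M * (cQ Z * cQ W) ^ k" for k
  proof -
    have "cmod ((phi R Q Z W ^^ k) p i l) \<le> (\<Sum>a<dim_row Z. \<Sum>b<dim_row W. cmod (p a b * kgram Z W k i a l b))"
      unfolding phi_pow_gram[OF assms] by (intro order_trans[OF norm_sum] sum_mono norm_sum)
    also have "\<dots> \<le> (\<Sum>a<dim_row Z. \<Sum>b<dim_row W. cmod (p a b) * (cQ Z * cQ W) ^ k)"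
      unfolding norm_mult by (intro sum_mono mult_left_mono kgram_bound[OF Z W i l]) auto
    finally show ?thesis by (simp add: sum_distrib_right)
  qed
  have "cQ Z * cQ W < 1"
  proof -
    have "cQ Z * cQ W \<le> cQ Z * 1" using cQ(1) cQ(2)[OF W] by (intro mult_left_mono) auto
    then show ?thesis using cQ(2)[OF Z] by simp
  qed
  then have "summable (\<lambda>k. ?M * (cQ Z * cQ W) ^ k)"
    using cQ(1) by (intro summable_mult summable_geometric) (simp add: abs_mult)
  then have "summable (\<lambda>k. (phi R Q Z W ^^ k) p i l)"
    by (rule summable_comparison_test'[where N = 0]) (use bnd in simp)
  then show ?thesis unfolding kker_def by (rule summable_sums)
qed

lemma kker_sum:
  assumes Z: "Z \<in> \<Delta>" and W: "W \<in> \<Delta>" and i: "i < dim_row Z" and l: "l < dim_row W"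
  shows "kker R Q Z W (\<lambda>a b. \<Sum>s\<in>F. c s * p s a b) i l = (\<Sum>s\<in>F. c s * kker R Q Z W (p s) i l)"
proof -
  have lin: "(phi R Q Z W ^^ k) (\<lambda>a b. \<Sum>s\<in>F. c s * p s a b) i l = (\<Sum>s\<in>F. c s * (phi R Q Z W ^^ k) (p s) i l)" for k
  proof -
    have "(\<Sum>a<dim_row Z. \<Sum>b<dim_row W. (\<Sum>s\<in>F. c s * p s a b) * kgram Z W k i a l b)
      = (\<Sum>a<dim_row Z. \<Sum>b<dim_row W. \<Sum>s\<in>F. c s * (p s a b * kgram Z W k i a l b))"
      by (simp add: sum_distrib_right mult.assoc)
    also have "\<dots> = (\<Sum>a<dim_row Z. \<Sum>s\<in>F. \<Sum>b<dim_row W. c s * (p s a b * kgram Z W k i a l b))"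
      by (intro sum.cong refl sum.swap)
    also have "\<dots> = (\<Sum>s\<in>F. \<Sum>a<dim_row Z. \<Sum>b<dim_row W. c s * (p s a b * kgram Z W k i a l b))"
      by (rule sum.swap)
    finally show ?thesis unfolding phi_pow_gram[OF assms] by (simp add: sum_distrib_left)
  qed
  have "(\<lambda>k. (phi R Q Z W ^^ k) (\<lambda>a b. \<Sum>s\<in>F. c s * p s a b) i l) sums (\<Sum>s\<in>F. c s * kker R Q Z W (p s) i l)"
    unfolding lin by (intro sums_sum sums_mult phi_pow_sums[OF assms])
  then show ?thesis using phi_pow_sums[OF assms] sums_unique2 by blast
qed

text \<open>The series for \<open>phi p\<close> is the series for \<open>p\<close> without its first
  term. In \<open>kker_phi_left\<close> the finite sum \<open>phi\<close> is instead applied to the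
  limit. The former is used to build a colligation from a positive kernel, the latter to show that a
  realization gives one.\<close>

lemma kker_phi_right:
  assumes Z: "Z \<in> \<Delta>" and W: "W \<in> \<Delta>" and i: "i < dim_row Z" and l: "l < dim_row W"
  shows "kker R Q Z W p i l = p i l + kker R Q Z W (phi R Q Z W p) i l"
proof -
  have s: "(\<lambda>k. (phi R Q Z W ^^ Suc k) p i l) sums kker R Q Z W (phi R Q Z W p) i l"
    using phi_pow_sums[OF assms, of "phi R Q Z W p"] by (simp add: funpow_swap1)
  have "(\<lambda>k. (phi R Q Z W ^^ k) p i l) sums (kker R Q Z W (phi R Q Z W p) i l + (phi R Q Z W ^^ 0) p i l)"
    by (rule sums_Suc[OF s])
  then have "kker R Q Z W p i l = kker R Q Z W (phi R Q Z W p) i l + p i l"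
    using phi_pow_sums[OF assms, of p] sums_unique2 by fastforce
  then show ?thesis by simp
qed

lemma kker_phi_left:
  assumes Z: "Z \<in> \<Delta>" and W: "W \<in> \<Delta>" and i: "i < dim_row Z" and l: "l < dim_row W"
  shows "kker R Q Z W p i l = p i l + phi R Q Z W (kker R Q Z W p) i l"
proof -
  have s: "(\<lambda>k. (phi R Q Z W ^^ Suc k) p i l) sums phi R Q Z W (kker R Q Z W p) i l"
  proof -
    have "(\<lambda>k. \<Sum>a<dim_row Z. \<Sum>b<dim_row W. (phi R Q Z W ^^ k) p a b * hinner R (q W l b) (q Z i a)) sums
      (\<Sum>a<dim_row Z. \<Sum>b<dim_row W. kker R Q Z W p a b * hinner R (q W l b) (q Z i a))"
      by (intro sums_sum sums_mult2 phi_pow_sums[OF Z W]) auto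
    then show ?thesis by (simp add: phi_def)
  qed
  have "(\<lambda>k. (phi R Q Z W ^^ k) p i l) sums (phi R Q Z W (kker R Q Z W p) i l + (phi R Q Z W ^^ 0) p i l)"
    by (rule sums_Suc[OF s])
  then have "kker R Q Z W p i l = phi R Q Z W (kker R Q Z W p) i l + p i l"
    using phi_pow_sums[OF assms, of p] sums_unique2 by fastforce
  then show ?thesis by simp
qed

lemma kernel_term_entry:
  assumes Z: "Z \<in> \<Delta>" and W: "W \<in> \<Delta>" and i: "i < dim_row Z" and l: "l < dim_row W"
    and P: "P \<in> carrier_mat (dim_row Z) (dim_row W)"
  shows "kernel_term R Q Z W P k $$ (i, l) = (phi R Q Z W ^^ k) (\<lambda>a b. P $$ (a, b)) i l"
proof -
  let ?n = "dim_row Z" and ?m = "dim_row W"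
  let ?LZ = "L_Q R Q Z k" and ?LW = "L_Q R Q W k" and ?H = "hpow ?n (pw k)"
  have hil: "hilbert_space (cpow ?n)" "hilbert_space ?H" using hilbert_htensor_power[OF Rp] by simp_all
  note LZ = L_Q_bop[OF Z, of k]
  have w: "?LW (uvec l) \<in> hcarrier (hpow ?m (pw k))" using bop_in[OF L_Q_bop[OF W] uvec_in[OF l]] .
  have z: "?LZ (uvec i) \<in> hcarrier ?H" using bop_in[OF LZ uvec_in[OF i]] .
  let ?x = "mat_op P (pw k) (?LW (uvec l))"
  have x: "?x \<in> hcarrier ?H" using bop_in[OF mat_op_bop[OF pwp P] w] .
  have "kernel_term R Q Z W P k $$ (i, l) = op_adjoint (cpow ?n) ?H ?LZ ?x i"
    unfolding kernel_term_def op_to_mat_def using i l by (simp add: uvec_def)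
  also have "\<dots> = hinner (cpow ?n) (op_adjoint (cpow ?n) ?H ?LZ ?x) (uvec i)"
    by (rule uvec_inner[OF i bop_in[OF op_adjoint_bop[OF hil LZ] x], symmetric])
  also have "\<dots> = hinner ?H ?x (?LZ (uvec i))"
    by (rule op_adjoint_inner'[OF hil LZ uvec_in[OF i] x, symmetric])
  also have "\<dots> = (\<Sum>a<?n. \<Sum>b<?m. P $$ (a, b) * kgram Z W k i a l b)"
    unfolding hpow_inner
  proof (intro sum.cong refl)
    fix a assume "a \<in> {..<?n}"
    then have a: "a < ?n" by simp
    show "hinner (pw k) (?x a) (?LZ (uvec i) a) = (\<Sum>b<?m. P $$ (a, b) * kgram Z W k i a l b)"
      unfolding mat_op_apply[OF P w a] kgram_def using w z a by (intro inner_lincomb_left[OF pwp]) auto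
  qed
  finally show ?thesis unfolding phi_pow_gram[OF Z W i l] .
qed

lemma kernel_Q_entry:
  assumes "Z \<in> \<Delta>" "W \<in> \<Delta>" "i < dim_row Z" "l < dim_row W" "P \<in> carrier_mat (dim_row Z) (dim_row W)"
  shows "kernel_Q R Q Z W P $$ (i, l) = kker R Q Z W (\<lambda>a b. P $$ (a, b)) i l"
proof -
  have "kernel_Q R Q Z W P $$ (i, l) = (\<Sum>k. kernel_term R Q Z W P k $$ (i, l))"
    unfolding kernel_Q_def using assms(3,4) by (rule index_mat(1)[THEN trans]) (rule prod.case)
  then show ?thesis unfolding kernel_term_entry[OF assms] kker_def .
qed

lemma kernel_Q_carrier: "kernel_Q R Q Z W P \<in> carrier_mat (dim_row Z) (dim_row W)"
  unfolding kernel_Q_def by (rule mat_carrier)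

text \<open>The adjoint form of the relation between \<open>\<alpha>\<close> and the values of
  \<open>Q\<close>: both sides have the same inner product with every \<open>r\<close>, as seen by
  applying the intertwining relation to the vector with \<open>r\<close> in slot
  \<open>s\<close>.\<close>

lemma q_intertwine:
  assumes Z: "Z \<in> \<Delta>" and Z': "Z' \<in> \<Delta>" and \<alpha>: "\<alpha> \<in> carrier_mat (dim_row Z') (dim_row Z)" and eq: "lact \<alpha> Z = ract Z' \<alpha>"
    and i: "i < dim_row Z'" and s: "s < dim_row Z"
  shows "(\<Sum>k<dim_row Z. cnj (\<alpha> $$ (i, k)) *\<^sub>C q Z k s) = (\<Sum>j<dim_row Z'. cnj (\<alpha> $$ (j, s)) *\<^sub>C q Z' i j)"
proof (rule inner_ext_right[OF R])
  let ?n = "dim_row Z" and ?m = "dim_row Z'"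
  have qk: "\<And>k. k \<in> {..<?n} \<Longrightarrow> q Z k s \<in> hcarrier R" and qj: "\<And>j. j \<in> {..<?m} \<Longrightarrow> q Z' i j \<in> hcarrier R"
    using q_in Z Z' i by auto
  show "(\<Sum>k<?n. cnj (\<alpha> $$ (i, k)) *\<^sub>C q Z k s) \<in> hcarrier R" using qk Rp by (intro sum_in scale_in) auto
  show "(\<Sum>j<?m. cnj (\<alpha> $$ (j, s)) *\<^sub>C q Z' i j) \<in> hcarrier R" using qj Rp by (intro sum_in scale_in) auto
  fix r assume r: "r \<in> hcarrier R"
  let ?\<rho> = "slot s r"
  have \<rho>: "?\<rho> \<in> hcarrier (hpow ?n R)" using r s Rp by simp
  have QZ: "Q Z ?\<rho> \<in> hcarrier (cpow ?n)" using bop_in[OF QT[OF Z] \<rho>] .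
  have A\<rho>: "mat_op \<alpha> R ?\<rho> \<in> hcarrier (hpow ?m R)" using bop_in[OF mat_op_bop[OF Rp \<alpha>] \<rho>] .
  have row: "Q Z ?\<rho> k = hinner R r (q Z k s)" if "k < ?n" for k
  proof -
    have "Q Z ?\<rho> k = (\<Sum>j<?n. hinner R (?\<rho> j) (q Z k j))"
      by (rule row_apply[OF R QT[OF Z] cQ(1) cQ(3)[OF Z] \<rho> that])
    also have "\<dots> = (\<Sum>j<?n. if j = s then hinner R r (q Z k j) else 0)"
      using q_in[OF Z that] Rp by (intro sum.cong refl) (auto simp: slot_def)
    finally show ?thesis using s by simp
  qed
  have ma: "mat_op \<alpha> R ?\<rho> j = \<alpha> $$ (j, s) *\<^sub>C r" if "j < ?m" for j
  proof -
    have "mat_op \<alpha> R ?\<rho> j = (\<Sum>k<?n. if k = s then \<alpha> $$ (j, k) *\<^sub>C r else 0)"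
      unfolding mat_op_apply[OF \<alpha> \<rho> that] by (intro sum.cong refl) (auto simp: slot_def)
    then show ?thesis using s by simp
  qed
  have "hinner R r (\<Sum>k<?n. cnj (\<alpha> $$ (i, k)) *\<^sub>C q Z k s) = (\<Sum>k<?n. \<alpha> $$ (i, k) * hinner R r (q Z k s))"
    by (subst inner_lincomb_right[OF Rp qk r]) simp_all
  also have "\<dots> = (\<Sum>k<?n. \<alpha> $$ (i, k) * Q Z ?\<rho> k)" using row by simp
  also have "\<dots> = (mat_op \<alpha> complex_hspace \<circ> Q Z) ?\<rho> i"
    unfolding o_apply mat_op_apply[OF \<alpha> QZ i] by (simp add: scaleC_complex_def)
  also have "\<dots> = Q Z' (mat_op \<alpha> R ?\<rho>) i" using Qnc[OF Z Z' \<alpha> eq] by simp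
  also have "\<dots> = (\<Sum>j<?m. hinner R (mat_op \<alpha> R ?\<rho> j) (q Z' i j))"
    by (rule row_apply[OF R QT[OF Z'] cQ(1) cQ(3)[OF Z'] A\<rho> i])
  also have "\<dots> = (\<Sum>j<?m. \<alpha> $$ (j, s) * hinner R r (q Z' i j))"
    using ma r qj Rp by (intro sum.cong refl) simp
  also have "\<dots> = hinner R r (\<Sum>j<?m. cnj (\<alpha> $$ (j, s)) *\<^sub>C q Z' i j)"
    by (subst inner_lincomb_right[OF Rp qj r]) simp_all
  finally show "hinner R r (\<Sum>k<?n. cnj (\<alpha> $$ (i, k)) *\<^sub>C q Z k s) = hinner R r (\<Sum>j<?m. cnj (\<alpha> $$ (j, s)) *\<^sub>C q Z' i j)" .
qed

lemma phi_intertwine: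
  assumes Z0: "Z0 \<in> \<Delta>" and Z: "Z \<in> \<Delta>" and Z': "Z' \<in> \<Delta>" and \<alpha>: "\<alpha> \<in> carrier_mat (dim_row Z') (dim_row Z)"
    and eq: "lact \<alpha> Z = ract Z' \<alpha>" and a: "a < dim_row Z0" and i: "i < dim_row Z'"
  shows "(\<Sum>l<dim_row Z. phi R Q Z0 Z p a l * cnj (\<alpha> $$ (i, l)))
    = phi R Q Z0 Z' (\<lambda>b j. \<Sum>s<dim_row Z. p b s * cnj (\<alpha> $$ (j, s))) a i"
proof -
  let ?N = "dim_row Z0" and ?n = "dim_row Z" and ?m = "dim_row Z'"
  have "(\<Sum>l<?n. phi R Q Z0 Z p a l * cnj (\<alpha> $$ (i, l)))
      = (\<Sum>l<?n. \<Sum>b<?N. \<Sum>s<?n. p b s * (cnj (\<alpha> $$ (i, l)) * hinner R (q Z l s) (q Z0 a b)))"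
    unfolding phi_def sum_distrib_right by (intro sum.cong refl) simp
  also have "\<dots> = (\<Sum>b<?N. \<Sum>l<?n. \<Sum>s<?n. p b s * (cnj (\<alpha> $$ (i, l)) * hinner R (q Z l s) (q Z0 a b)))" by (rule sum.swap)
  also have "\<dots> = (\<Sum>b<?N. \<Sum>s<?n. \<Sum>l<?n. p b s * (cnj (\<alpha> $$ (i, l)) * hinner R (q Z l s) (q Z0 a b)))"
    by (intro sum.cong refl sum.swap)
  also have "\<dots> = (\<Sum>b<?N. \<Sum>s<?n. \<Sum>j<?m. p b s * (cnj (\<alpha> $$ (j, s)) * hinner R (q Z' i j) (q Z0 a b)))"
  proof (rule sum.cong[OF refl], rule sum.cong[OF refl])
    fix b s assume "b \<in> {..<?N}" "s \<in> {..<?n}"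
    then have s: "s < ?n" by simp
    have z0: "q Z0 a b \<in> hcarrier R" using q_in[OF Z0 a] .
    have "(\<Sum>l<?n. cnj (\<alpha> $$ (i, l)) * hinner R (q Z l s) (q Z0 a b))
        = hinner R (\<Sum>l<?n. cnj (\<alpha> $$ (i, l)) *\<^sub>C q Z l s) (q Z0 a b)"
      by (rule inner_lincomb_left[OF Rp _ z0, symmetric]) (use q_in[OF Z] in auto)
    also have "\<dots> = hinner R (\<Sum>j<?m. cnj (\<alpha> $$ (j, s)) *\<^sub>C q Z' i j) (q Z0 a b)"
      unfolding q_intertwine[OF Z Z' \<alpha> eq i s] ..
    also have "\<dots> = (\<Sum>j<?m. cnj (\<alpha> $$ (j, s)) * hinner R (q Z' i j) (q Z0 a b))"
      by (rule inner_lincomb_left[OF Rp _ z0]) (use q_in[OF Z' i] in auto)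
    finally show "(\<Sum>l<?n. p b s * (cnj (\<alpha> $$ (i, l)) * hinner R (q Z l s) (q Z0 a b)))
        = (\<Sum>j<?m. p b s * (cnj (\<alpha> $$ (j, s)) * hinner R (q Z' i j) (q Z0 a b)))"
      by (simp only: sum_distrib_left[symmetric])
  qed
  also have "\<dots> = (\<Sum>b<?N. \<Sum>j<?m. \<Sum>s<?n. p b s * (cnj (\<alpha> $$ (j, s)) * hinner R (q Z' i j) (q Z0 a b)))"
    by (intro sum.cong refl sum.swap)
  also have "\<dots> = phi R Q Z0 Z' (\<lambda>b j. \<Sum>s<?n. p b s * cnj (\<alpha> $$ (j, s))) a i"
    unfolding phi_def by (simp add: sum_distrib_right mult.assoc)
  finally show ?thesis .
qed

text \<open>The relation passes through every power of \<open>phi\<close> and then to the sum. Only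
  the second point moves; this one-sided form is what the comparison of kernel elements at an
  arbitrary fixed first point calls for.\<close>

lemma kker_intertwine:
  assumes Z0: "Z0 \<in> \<Delta>" and Z: "Z \<in> \<Delta>" and Z': "Z' \<in> \<Delta>" and \<alpha>: "\<alpha> \<in> carrier_mat (dim_row Z') (dim_row Z)"
    and eq: "lact \<alpha> Z = ract Z' \<alpha>" and a: "a < dim_row Z0" and i: "i < dim_row Z'"
  shows "(\<Sum>l<dim_row Z. kker R Q Z0 Z p a l * cnj (\<alpha> $$ (i, l)))
    = kker R Q Z0 Z' (\<lambda>b j. \<Sum>s<dim_row Z. p b s * cnj (\<alpha> $$ (j, s))) a i"
proof -
  let ?p' = "\<lambda>p b j. \<Sum>s<dim_row Z. p b s * cnj (\<alpha> $$ (j, s))"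
  have step: "(\<Sum>l<dim_row Z. (phi R Q Z0 Z ^^ k) p b l * cnj (\<alpha> $$ (j, l))) = (phi R Q Z0 Z' ^^ k) (?p' p) b j"
    if "b < dim_row Z0" "j < dim_row Z'" for k b j
    using that
  proof (induction k arbitrary: b j)
    case (Suc k)
    have "(\<Sum>l<dim_row Z. (phi R Q Z0 Z ^^ Suc k) p b l * cnj (\<alpha> $$ (j, l)))
        = phi R Q Z0 Z' (?p' ((phi R Q Z0 Z ^^ k) p)) b j"
      using phi_intertwine[OF Z0 Z Z' \<alpha> eq Suc.prems] by simp
    also have "\<dots> = phi R Q Z0 Z' ((phi R Q Z0 Z' ^^ k) (?p' p)) b j"
      using Suc.IH by (subst phi_cong) auto
    finally show ?case by simp
  qed simp
  have "(\<lambda>k. \<Sum>l<dim_row Z. (phi R Q Z0 Z ^^ k) p a l * cnj (\<alpha> $$ (i, l))) sums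
      (\<Sum>l<dim_row Z. kker R Q Z0 Z p a l * cnj (\<alpha> $$ (i, l)))"
    by (intro sums_sum sums_mult2 phi_pow_sums[OF Z0 Z a]) auto
  then have "(\<lambda>k. (phi R Q Z0 Z' ^^ k) (?p' p) a i) sums (\<Sum>l<dim_row Z. kker R Q Z0 Z p a l * cnj (\<alpha> $$ (i, l)))"
    unfolding step[OF a i] .
  then show ?thesis using phi_pow_sums[OF Z0 Z' a i] sums_unique2 by blast
qed

text \<open>Positivity is proved for each term by induction: the next term is a sum over inner
  indices of the previous term times a Gram kernel of the vectors \<open>q\<close>, so the Schur
  product and \<open>psd_sum_index\<close> apply. The start of the induction is a rank one
  kernel.\<close>

lemma psd_kker:
  fixes V :: "'e \<Rightarrow> 'v mat" and v :: "'e \<Rightarrow> nat \<Rightarrow> complex"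
  assumes V: "\<And>e. e \<in> E \<Longrightarrow> V e \<in> \<Delta>"
  shows "psd (SIGMA e:E. {..<dim_row (V e)})
    (\<lambda>x y. kker R Q (V (fst x)) (V (fst y)) (\<lambda>a b. cnj (v (fst x) a) * v (fst y) b) (snd x) (snd y))"
proof -
  let ?p = "\<lambda>e' e a b. cnj (v e' a) * v e b"
  let ?S = "SIGMA e:E. {..<dim_row (V e)}"
  have k: "psd ?S (\<lambda>x y. (phi R Q (V (fst x)) (V (fst y)) ^^ k) (?p (fst x) (fst y)) (snd x) (snd y))" for k
  proof (induction k)
    case 0
    have "psd ?S (\<lambda>x y. hinner complex_hspace (v (fst y) (snd y)) (v (fst x) (snd x)))"
      by (rule psd_gram) simp_all
    then show ?case by (simp add: mult.commute)
  next
    case (Suc k)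
    let ?b = "\<lambda>X Y. (phi R Q (V (fst (fst X))) (V (fst (fst Y))) ^^ k) (?p (fst (fst X)) (fst (fst Y))) (snd X) (snd Y)
        * hinner R (q (V (fst (fst Y))) (snd (fst Y)) (snd Y)) (q (V (fst (fst X))) (snd (fst X)) (snd X))"
    have "psd (SIGMA x:?S. {..<dim_row (V (fst x))}) ?b"
    proof (rule psd_mult)
      show "psd (SIGMA x:?S. {..<dim_row (V (fst x))})
        (\<lambda>X Y. (phi R Q (V (fst (fst X))) (V (fst (fst Y))) ^^ k) (?p (fst (fst X)) (fst (fst Y))) (snd X) (snd Y))"
        by (rule psd_pullback[OF Suc, where h = "\<lambda>X. (fst (fst X), snd X)", unfolded fst_conv snd_conv]) auto
      show "psd (SIGMA x:?S. {..<dim_row (V (fst x))})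
        (\<lambda>X Y. hinner R (q (V (fst (fst Y))) (snd (fst Y)) (snd Y)) (q (V (fst (fst X))) (snd (fst X)) (snd X)))"
        by (rule psd_gram[OF Rp]) (use V in \<open>auto intro!: q_in\<close>)
    qed
    from psd_sum_index[OF this] show ?case by (simp only: phi_Suc fst_conv snd_conv)
  qed
  show ?thesis unfolding kker_def
  proof (rule psd_suminf[OF k])
    fix x y assume "x \<in> ?S" "y \<in> ?S"
    then have "V (fst x) \<in> \<Delta>" "V (fst y) \<in> \<Delta>" "snd x < dim_row (V (fst x))" "snd y < dim_row (V (fst y))"
      using V by auto
    then show "summable (\<lambda>k. (phi R Q (V (fst y)) (V (fst x)) ^^ k) (?p (fst y) (fst x)) (snd y) (snd x))"
      by (intro sums_summable[OF phi_pow_sums])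
  qed
qed

end

section \<open>The noncommutative reproducing kernel space\<close>

lemma fun_scale_apply: "(a *\<^sub>C f) x = a *\<^sub>C f x"
  by (simp add: scaleC_fun_def)

lemma scaleC_complex [simp]: "a *\<^sub>C (x::complex) = a * x"
  by (simp add: scaleC_complex_def)

context row_ball
begin

lemma kker_add:
  assumes "Z \<in> \<Delta>" "W \<in> \<Delta>" "i < dim_row Z" "l < dim_row W"
  shows "kker R Q Z W (\<lambda>a b. p a b + p' a b) i l = kker R Q Z W p i l + kker R Q Z W p' i l"
  using kker_sum[OF assms, where F = "UNIV :: bool set" and c = "\<lambda>_. 1" and p = "\<lambda>s. if s then p else p'"]
  by (simp add: UNIV_bool add.commute)

lemma kker_scale:
  assumes "Z \<in> \<Delta>" "W \<in> \<Delta>" "i < dim_row Z" "l < dim_row W"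
  shows "kker R Q Z W (\<lambda>a b. c * p a b) i l = c * kker R Q Z W p i l"
  using kker_sum[OF assms, where F = "{()}" and c = "\<lambda>_. c" and p = "\<lambda>_. p"] by simp

text \<open>The Gram kernel that the kernel elements must have in any space satisfying the
  reproducing identity; \<open>nc_rkhs_gram\<close> confirms it. It is a scalar kernel on the set
  \<open>Ix E\<close> of triples, so the scalar theory already developed applies.\<close>

definition kap :: "'e::complex_vector hspace \<Rightarrow> 'v mat \<times> (nat \<Rightarrow> complex) \<times> (nat \<Rightarrow> 'e) \<Rightarrow>
    'v mat \<times> (nat \<Rightarrow> complex) \<times> (nat \<Rightarrow> 'e) \<Rightarrow> complex" where
  "kap E e' e = (\<Sum>i<dim_row (fst e'). \<Sum>l<dim_row (fst e).
     kker R Q (fst e') (fst e) (\<lambda>a b. cnj (fst (snd e') a) * fst (snd e) b) i l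
       * hinner E (snd (snd e) l) (snd (snd e') i))"

definition Ix :: "'e::complex_vector hspace \<Rightarrow> ('v mat \<times> (nat \<Rightarrow> complex) \<times> (nat \<Rightarrow> 'e)) set" where
  "Ix E = {e. fst e \<in> \<Delta> \<and> fst (snd e) \<in> hcarrier (cpow (dim_row (fst e))) \<and> snd (snd e) \<in> hcarrier (hpow (dim_row (fst e)) E)}"

lemma Ix_iff: "(W, v, y) \<in> Ix E \<longleftrightarrow> W \<in> \<Delta> \<and> v \<in> hcarrier (cpow (dim_row W)) \<and> y \<in> hcarrier (hpow (dim_row W) E)"
  unfolding Ix_def by simp

lemma kap_psd:
  assumes E: "pre_hilbert E"
  shows "psd (Ix E) (kap E)"
proof -
  have "psd (SIGMA e:Ix E. {..<dim_row (fst e)})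
    (\<lambda>x y. kker R Q (fst (fst x)) (fst (fst y)) (\<lambda>a b. cnj (fst (snd (fst x)) a) * fst (snd (fst y)) b) (snd x) (snd y)
      * hinner E (snd (snd (fst y)) (snd y)) (snd (snd (fst x)) (snd x)))"
  proof (rule psd_mult)
    show "psd (SIGMA e:Ix E. {..<dim_row (fst e)})
      (\<lambda>x y. kker R Q (fst (fst x)) (fst (fst y)) (\<lambda>a b. cnj (fst (snd (fst x)) a) * fst (snd (fst y)) b) (snd x) (snd y))"
      by (rule psd_kker[where v = "\<lambda>e. fst (snd e)"]) (simp add: Ix_def)
    show "psd (SIGMA e:Ix E. {..<dim_row (fst e)})
      (\<lambda>x y. hinner E (snd (snd (fst y)) (snd y)) (snd (snd (fst x)) (snd x)))"
      by (rule psd_gram[OF E]) (auto simp: Ix_def)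
  qed
  from psd_sum_index[OF this] show ?thesis
    by (rule psd_cong) (simp add: kap_def)
qed

lemma kap_add_y:
  assumes E: "pre_hilbert E" and e': "e' \<in> Ix E" and y: "(W, v, y) \<in> Ix E" "(W, v, y') \<in> Ix E"
  shows "kap E e' (W, v, y + y') = kap E e' (W, v, y) + kap E e' (W, v, y')"
proof -
  have "hinner E ((y + y') l) (snd (snd e') i) = hinner E (y l) (snd (snd e') i) + hinner E (y' l) (snd (snd e') i)"
    if "i < dim_row (fst e')" "l < dim_row W" for i l
  proof -
    have "y l \<in> hcarrier E" "y' l \<in> hcarrier E" "snd (snd e') i \<in> hcarrier E"
      using that y e' unfolding Ix_def by auto
    then show ?thesis using E by simp
  qed
  then show ?thesis unfolding kap_def by (simp add: distrib_left sum.distrib)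
qed

lemma kap_scale_y:
  assumes E: "pre_hilbert E" and e': "e' \<in> Ix E" and y: "(W, v, y) \<in> Ix E"
  shows "kap E e' (W, v, a *\<^sub>C y) = a * kap E e' (W, v, y)"
proof -
  have "hinner E ((a *\<^sub>C y) l) (snd (snd e') i) = a * hinner E (y l) (snd (snd e') i)"
    if "i < dim_row (fst e')" "l < dim_row W" for i l
  proof -
    have "y l \<in> hcarrier E" "snd (snd e') i \<in> hcarrier E"
      using that y e' unfolding Ix_def by auto
    then show ?thesis using E by (simp add: scaleC_fun_def)
  qed
  then show ?thesis unfolding kap_def by (simp add: sum_distrib_left mult.left_commute)
qed

lemma kap_add_v:
  assumes e': "fst e' \<in> \<Delta>" and W: "W \<in> \<Delta>"
  shows "kap E e' (W, v + v', y) = kap E e' (W, v, y) + kap E e' (W, v', y)"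
proof -
  have "kker R Q (fst e') W (\<lambda>a b. cnj (fst (snd e') a) * (v + v') b) i l
    = kker R Q (fst e') W (\<lambda>a b. cnj (fst (snd e') a) * v b) i l + kker R Q (fst e') W (\<lambda>a b. cnj (fst (snd e') a) * v' b) i l"
    if "i < dim_row (fst e')" "l < dim_row W" for i l
    using kker_add[OF e' W that] by (simp add: distrib_left)
  then show ?thesis unfolding kap_def by (simp add: distrib_right sum.distrib)
qed

lemma kap_scale_v:
  assumes e': "fst e' \<in> \<Delta>" and W: "W \<in> \<Delta>"
  shows "kap E e' (W, c *\<^sub>C v, y) = c * kap E e' (W, v, y)"
proof -
  have "kker R Q (fst e') W (\<lambda>a b. cnj (fst (snd e') a) * (c *\<^sub>C v) b) i l
    = c * kker R Q (fst e') W (\<lambda>a b. cnj (fst (snd e') a) * v b) i l"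
    if "i < dim_row (fst e')" "l < dim_row W" for i l
    using kker_scale[OF e' W that, of c "\<lambda>a b. cnj (fst (snd e') a) * v b"]
    by (simp add: scaleC_fun_def scaleC_complex_def mult.left_commute)
  then show ?thesis unfolding kap_def by (simp add: sum_distrib_left mult.assoc)
qed

text \<open>Applying the adjoint of \<open>\<alpha>\<close> to the vector \<open>y\<close> at
  \<open>Z'\<close> has the same effect as moving the row \<open>v\<close> from \<open>Z\<close> to
  \<open>Z'\<close>. This identification of kernel elements is the source of the intertwining
  property of the functions in the space.\<close>

lemma kap_intertwine:
  assumes E: "pre_hilbert E" and e': "e' \<in> Ix E" and Z: "Z \<in> \<Delta>" and Z': "Z' \<in> \<Delta>"
    and \<alpha>: "\<alpha> \<in> carrier_mat (dim_row Z') (dim_row Z)" and eq: "lact \<alpha> Z = ract Z' \<alpha>"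
    and y: "y \<in> hcarrier (hpow (dim_row Z') E)"
    and y': "\<And>l. l < dim_row Z \<Longrightarrow> y' l = (\<Sum>i<dim_row Z'. cnj (\<alpha> $$ (i, l)) *\<^sub>C y i)"
    and v': "\<And>j. j < dim_row Z' \<Longrightarrow> v' j = (\<Sum>s<dim_row Z. v s * cnj (\<alpha> $$ (j, s)))"
  shows "kap E e' (Z, v, y') = kap E e' (Z', v', y)"
proof -
  let ?n = "dim_row Z" and ?m = "dim_row Z'" and ?p = "\<lambda>a b. cnj (fst (snd e') a) * v b"
  let ?y0 = "snd (snd e')"
  have Z0: "fst e' \<in> \<Delta>" using e' by (simp add: Ix_def)
  have "kap E e' (Z, v, y') = (\<Sum>a<dim_row (fst e'). \<Sum>l<?n. \<Sum>i<?m. kker R Q (fst e') Z ?p a l * (cnj (\<alpha> $$ (i, l)) * hinner E (y i) (?y0 a)))"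
    unfolding kap_def fst_conv snd_conv
  proof (rule sum.cong[OF refl], rule sum.cong[OF refl])
    fix a l assume a: "a \<in> {..<dim_row (fst e')}" and l: "l \<in> {..<?n}"
    have ya: "?y0 a \<in> hcarrier E" using e' a by (auto simp: Ix_def)
    have l': "l < ?n" using l by simp
    have "hinner E (y' l) (?y0 a) = (\<Sum>i<?m. cnj (\<alpha> $$ (i, l)) * hinner E (y i) (?y0 a))"
      unfolding y'[OF l'] by (rule inner_lincomb_left[OF E _ ya]) (use y in auto)
    then show "kker R Q (fst e') Z ?p a l * hinner E (y' l) (?y0 a)
        = (\<Sum>i<?m. kker R Q (fst e') Z ?p a l * (cnj (\<alpha> $$ (i, l)) * hinner E (y i) (?y0 a)))"
      by (simp add: sum_distrib_left)
  qed
  also have "\<dots> = (\<Sum>a<dim_row (fst e'). \<Sum>i<?m. \<Sum>l<?n. kker R Q (fst e') Z ?p a l * (cnj (\<alpha> $$ (i, l)) * hinner E (y i) (?y0 a)))"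
    by (rule sum.cong[OF refl], rule sum.swap)
  also have "\<dots> = (\<Sum>a<dim_row (fst e'). \<Sum>i<?m. kker R Q (fst e') Z' (\<lambda>a b. cnj (fst (snd e') a) * v' b) a i * hinner E (y i) (?y0 a))"
  proof (rule sum.cong[OF refl], rule sum.cong[OF refl])
    fix a i assume "a \<in> {..<dim_row (fst e')}" "i \<in> {..<?m}"
    then have ai: "a < dim_row (fst e')" "i < ?m" by auto
    have "(\<Sum>l<?n. kker R Q (fst e') Z ?p a l * (cnj (\<alpha> $$ (i, l)) * hinner E (y i) (?y0 a)))
        = (\<Sum>l<?n. kker R Q (fst e') Z ?p a l * cnj (\<alpha> $$ (i, l))) * hinner E (y i) (?y0 a)"
      by (simp add: sum_distrib_right mult.assoc)
    also have "(\<Sum>l<?n. kker R Q (fst e') Z ?p a l * cnj (\<alpha> $$ (i, l)))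
        = kker R Q (fst e') Z' (\<lambda>b j. \<Sum>s<?n. ?p b s * cnj (\<alpha> $$ (j, s))) a i"
      by (rule kker_intertwine[OF Z0 Z Z' \<alpha> eq ai])
    also have "\<dots> = kker R Q (fst e') Z' (\<lambda>a b. cnj (fst (snd e') a) * v' b) a i"
      by (rule kker_cong[OF _ ai]) (simp add: v' sum_distrib_left mult.assoc)
    finally show "(\<Sum>l<?n. kker R Q (fst e') Z ?p a l * (cnj (\<alpha> $$ (i, l)) * hinner E (y i) (?y0 a)))
        = kker R Q (fst e') Z' (\<lambda>a b. cnj (fst (snd e') a) * v' b) a i * hinner E (y i) (?y0 a)" .
  qed
  also have "\<dots> = kap E e' (Z', v', y)" unfolding kap_def by simp
  finally show ?thesis .
qed

abbreviation KE :: "'e::complex_vector hspace \<Rightarrow> 'v mat \<Rightarrow> 'v mat \<Rightarrow> complex mat \<Rightarrow> (nat \<Rightarrow> 'e) \<Rightarrow> nat \<Rightarrow> 'e" where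
  "KE E \<equiv> kernel_Q_id R Q E"

abbreviation ke :: "'e::complex_vector hspace \<Rightarrow> 'v mat \<times> (nat \<Rightarrow> complex) \<times> (nat \<Rightarrow> 'e) \<Rightarrow> 'v mat \<Rightarrow> (nat \<Rightarrow> complex) \<Rightarrow> nat \<Rightarrow> 'e" where
  "ke E e \<equiv> kernel_element \<Delta> (KE E) (fst e) (fst (snd e)) (snd (snd e))"

text \<open>Pairing with \<open>y'\<close> moves the argument \<open>u\<close> into the first index
  of \<open>kap\<close>, which enters conjugated; hence the conjugate of \<open>u\<close> in the
  index.\<close>

lemma ke_apply:
  assumes E: "pre_hilbert E" and e: "e \<in> Ix E" and Z: "Z \<in> \<Delta>" and u: "u \<in> hcarrier (cpow (dim_row Z))"
  shows "ke E e Z u \<in> hcarrier (hpow (dim_row Z) E)"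
    and "y' \<in> hcarrier (hpow (dim_row Z) E) \<Longrightarrow> hinner (hpow (dim_row Z) E) (ke E e Z u) y' = kap E (Z, \<lambda>i. cnj (u i), y') e"
proof -
  let ?n = "dim_row Z" and ?m = "dim_row (fst e)"
  let ?P = "mat ?n ?m (\<lambda>(i, j). u i * fst (snd e) j)"
  have W: "fst e \<in> \<Delta>" and y: "snd (snd e) \<in> hcarrier (hpow ?m E)" using e by (simp_all add: Ix_def)
  have P: "?P \<in> carrier_mat ?n ?m" by simp
  have eq: "ke E e Z u = mat_op (kernel_Q R Q Z (fst e) ?P) E (snd (snd e))"
    unfolding kernel_element_def kernel_Q_id_def using Z u by simp
  show "ke E e Z u \<in> hcarrier (hpow ?n E)"
    unfolding eq by (rule bop_in[OF mat_op_bop[OF E kernel_Q_carrier] y])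
  assume y': "y' \<in> hcarrier (hpow ?n E)"
  have "hinner (hpow ?n E) (ke E e Z u) y' = (\<Sum>i<?n. \<Sum>l<?m. kernel_Q R Q Z (fst e) ?P $$ (i, l) * hinner E (snd (snd e) l) (y' i))"
    unfolding hpow_inner eq
  proof (rule sum.cong[OF refl])
    fix i assume "i \<in> {..<?n}"
    then have i: "i < ?n" by simp
    show "hinner E (mat_op (kernel_Q R Q Z (fst e) ?P) E (snd (snd e)) i) (y' i)
      = (\<Sum>l<?m. kernel_Q R Q Z (fst e) ?P $$ (i, l) * hinner E (snd (snd e) l) (y' i))"
      unfolding mat_op_apply[OF kernel_Q_carrier y i]
      by (rule inner_lincomb_left[OF E]) (use y y' i in auto)
  qed
  also have "\<dots> = kap E (Z, \<lambda>i. cnj (u i), y') e"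
    unfolding kap_def fst_conv snd_conv
  proof (rule sum.cong[OF refl], rule sum.cong[OF refl])
    fix i l assume "i \<in> {..<?n}" "l \<in> {..<?m}"
    then have il: "i < ?n" "l < ?m" by auto
    have "kernel_Q R Q Z (fst e) ?P $$ (i, l) = kker R Q Z (fst e) (\<lambda>a b. ?P $$ (a, b)) i l"
      by (rule kernel_Q_entry[OF Z W il P])
    also have "\<dots> = kker R Q Z (fst e) (\<lambda>a b. cnj (cnj (u a)) * fst (snd e) b) i l"
      by (rule kker_cong[OF _ il]) simp
    finally show "kernel_Q R Q Z (fst e) ?P $$ (i, l) * hinner E (snd (snd e) l) (y' i)
      = kker R Q Z (fst e) (\<lambda>a b. cnj (cnj (u a)) * fst (snd e) b) i l * hinner E (snd (snd e) l) (y' i)" by simp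
  qed
  finally show "hinner (hpow ?n E) (ke E e Z u) y' = kap E (Z, \<lambda>i. cnj (u i), y') e" .
qed

lemma cnj_cpow: "v \<in> hcarrier (cpow n) \<Longrightarrow> (\<lambda>i. cnj (v i)) \<in> hcarrier (cpow n)"
  by (simp add: hpow_carrier)

context
  fixes E :: "'e::complex_vector hspace"
  assumes E: "hilbert_space E"
begin

section \<open>From scalar functions on triples to nc functions\<close>

private abbreviation "H0 \<equiv> rk_space (Ix E) (kap E)"
private abbreviation "kp \<equiv> rk_point (Ix E) (kap E)"

private lemma Ep: "pre_hilbert E" using E by simp
private lemma H0: "hilbert_space H0" by (rule rk_hilbert[OF kap_psd[OF Ep]])
private lemma H0p: "pre_hilbert H0" using H0 by simp
private lemma kp_in: "e \<in> Ix E \<Longrightarrow> kp e \<in> hcarrier H0" by (rule rk_point_in[OF kap_psd[OF Ep]])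
private lemma H0_eval: "h \<in> hcarrier H0 \<Longrightarrow> e \<in> Ix E \<Longrightarrow> h e = hinner H0 h (kp e)"
  by (rule rk_eval[OF kap_psd[OF Ep], symmetric])

text \<open>For fixed \<open>Z\<close> and \<open>v\<close> the kernel function depends boundedly on
  \<open>y\<close>, with the square root of the sum of the moduli of the kernel entries as constant;
  Riesz representation in the variable \<open>y\<close> requires such a bound.\<close>

private lemma kp_norm:
  assumes Z: "Z \<in> \<Delta>" and v: "v \<in> hcarrier (cpow (dim_row Z))"
  obtains c where "\<And>y. y \<in> hcarrier (hpow (dim_row Z) E) \<Longrightarrow> hnorm H0 (kp (Z, v, y)) \<le> c * hnorm (hpow (dim_row Z) E) y"
proof -
  let ?n = "dim_row Z"
  let ?k = "\<lambda>i l. kker R Q Z Z (\<lambda>a b. cnj (v a) * v b) i l"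
  let ?M = "\<Sum>i<?n. \<Sum>l<?n. cmod (?k i l)"
  have M: "0 \<le> ?M" by (intro sum_nonneg) simp
  have "hnorm H0 (kp (Z, v, y)) \<le> sqrt ?M * hnorm (hpow ?n E) y" if y: "y \<in> hcarrier (hpow ?n E)" for y
  proof -
    have e: "(Z, v, y) \<in> Ix E" using Z v y by (simp add: Ix_iff)
    let ?N = "hnorm (hpow ?n E) y"
    have "(hnorm H0 (kp (Z, v, y)))\<^sup>2 = Re (kap E (Z, v, y) (Z, v, y))"
      using hnorm_sq[OF H0p kp_in[OF e]] rk_inner[OF kap_psd[OF Ep] e e] by simp
    also have "\<dots> \<le> cmod (kap E (Z, v, y) (Z, v, y))" by (rule complex_Re_le_cmod)
    also have "\<dots> \<le> (\<Sum>i<?n. \<Sum>l<?n. cmod (?k i l * hinner E (y l) (y i)))"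
      unfolding kap_def fst_conv snd_conv by (intro order_trans[OF norm_sum] sum_mono norm_sum)
    also have "\<dots> \<le> (\<Sum>i<?n. \<Sum>l<?n. cmod (?k i l) * (?N * ?N))"
    proof (intro sum_mono)
      fix i l assume il: "i \<in> {..<?n}" "l \<in> {..<?n}"
      have yi: "y i \<in> hcarrier E" "y l \<in> hcarrier E" using y il by auto
      have "cmod (hinner E (y l) (y i)) \<le> hnorm E (y l) * hnorm E (y i)" by (rule cauchy_schwarz[OF Ep yi(2,1)])
      also have "\<dots> \<le> ?N * ?N"
        by (intro mult_mono hpow_component_le[OF Ep y] hnorm_nonneg[OF Ep yi(1)] hnorm_nonneg[OF pre_hilbert_hpow[OF Ep] y])
          (use il in auto)
      finally show "cmod (?k i l * hinner E (y l) (y i)) \<le> cmod (?k i l) * (?N * ?N)"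
        unfolding norm_mult by (rule mult_left_mono) simp
    qed
    also have "\<dots> = (sqrt ?M * ?N)\<^sup>2"
      using M by (simp add: power_mult_distrib power2_eq_square[of ?N] sum_distrib_right)
    finally show ?thesis
      by (rule le_of_sq_le) (use M hnorm_nonneg[OF pre_hilbert_hpow[OF Ep] y] in simp)
  qed
  then show thesis by (rule that)
qed

private lemma kp_add_y: "(W, v, y) \<in> Ix E \<Longrightarrow> (W, v, y') \<in> Ix E \<Longrightarrow> kp (W, v, y + y') = kp (W, v, y) + kp (W, v, y')"
  by (rule ext) (simp add: rk_point_def kap_add_y[OF Ep])
private lemma kp_scale_y: "(W, v, y) \<in> Ix E \<Longrightarrow> kp (W, v, a *\<^sub>C y) = a *\<^sub>C kp (W, v, y)"
  by (rule ext) (simp add: rk_point_def kap_scale_y[OF Ep] fun_scale_apply)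
private lemma kp_add_v: "W \<in> \<Delta> \<Longrightarrow> kp (W, v + v', y) = kp (W, v, y) + kp (W, v', y)"
  by (rule ext) (simp add: rk_point_def kap_add_v Ix_def)
private lemma kp_scale_v: "W \<in> \<Delta> \<Longrightarrow> kp (W, c *\<^sub>C v, y) = c *\<^sub>C kp (W, v, y)"
  by (rule ext) (simp add: rk_point_def kap_scale_v Ix_def fun_scale_apply)

text \<open>An element \<open>h\<close> of the scalar space is conjugate linear in \<open>y\<close>,
  so for fixed \<open>Z\<close> and \<open>u\<close> it is the pairing with one vector of
  \<open>E^n\<close>. This Riesz vector is the value at \<open>u\<close> of the nc function that
  corresponds to \<open>h\<close>.\<close>

private definition "fv h Z u = (SOME x. x \<in> hcarrier (hpow (dim_row Z) E) \<and>
  (\<forall>y\<in>hcarrier (hpow (dim_row Z) E). hinner (hpow (dim_row Z) E) x y = h (Z, \<lambda>i. cnj (u i), y)))"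

private definition "fh h = (\<lambda>Z. if Z \<in> \<Delta> then (\<lambda>u. if u \<in> hcarrier (cpow (dim_row Z)) then fv h Z u else 0) else 0)"

private lemma fv:
  assumes h: "h \<in> hcarrier H0" and Z: "Z \<in> \<Delta>" and u: "u \<in> hcarrier (cpow (dim_row Z))"
  shows "fh h Z u \<in> hcarrier (hpow (dim_row Z) E)"
    and "y \<in> hcarrier (hpow (dim_row Z) E) \<Longrightarrow> hinner (hpow (dim_row Z) E) (fh h Z u) y = h (Z, \<lambda>i. cnj (u i), y)"
proof -
  let ?H = "hpow (dim_row Z) E" and ?v = "\<lambda>i. cnj (u i)"
  have hil: "hilbert_space ?H" using E by simp
  then have Hp: "pre_hilbert ?H" by simp
  have e: "(Z, ?v, y) \<in> Ix E" if "y \<in> hcarrier ?H" for y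
    using Z cnj_cpow[OF u] that by (simp add: Ix_iff)
  obtain c where c: "\<And>y. y \<in> hcarrier ?H \<Longrightarrow> hnorm H0 (kp (Z, ?v, y)) \<le> c * hnorm ?H y"
    using kp_norm[OF Z cnj_cpow[OF u]] by blast
  obtain z where z: "z \<in> hcarrier ?H" "\<And>y. y \<in> hcarrier ?H \<Longrightarrow> cnj (h (Z, ?v, y)) = hinner ?H y z"
  proof (rule riesz_representation[OF hil, of "\<lambda>y. cnj (h (Z, ?v, y))" "hnorm H0 h * c"])
    fix y y' assume y: "y \<in> hcarrier ?H" "y' \<in> hcarrier ?H"
    show "cnj (h (Z, ?v, y + y')) = cnj (h (Z, ?v, y)) + cnj (h (Z, ?v, y'))"
      unfolding H0_eval[OF h e[OF y(1)]] H0_eval[OF h e[OF y(2)]] H0_eval[OF h e[OF add_in[OF Hp y]]]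
        kp_add_y[OF e[OF y(1)] e[OF y(2)]]
      using inner_add_right[OF H0p kp_in[OF e[OF y(1)]] kp_in[OF e[OF y(2)]] h] by simp
  next
    fix y a assume y: "y \<in> hcarrier ?H"
    show "cnj (h (Z, ?v, a *\<^sub>C y)) = a * cnj (h (Z, ?v, y))"
      unfolding H0_eval[OF h e[OF y]] H0_eval[OF h e[OF scale_in[OF Hp y]]] kp_scale_y[OF e[OF y]]
      using inner_scale_right[OF H0p kp_in[OF e[OF y]] h] by simp
  next
    fix y assume y: "y \<in> hcarrier ?H"
    have "cmod (h (Z, ?v, y)) \<le> hnorm H0 h * hnorm H0 (kp (Z, ?v, y))"
      unfolding H0_eval[OF h e[OF y]] by (rule cauchy_schwarz[OF H0p h kp_in[OF e[OF y]]])
    also have "\<dots> \<le> hnorm H0 h * (c * hnorm ?H y)"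
      by (rule mult_left_mono[OF c[OF y] hnorm_nonneg[OF H0p h]])
    finally show "cmod (cnj (h (Z, ?v, y))) \<le> hnorm H0 h * c * hnorm ?H y" by (simp add: mult.assoc)
  qed blast
  have "hinner ?H z y = h (Z, ?v, y)" if y: "y \<in> hcarrier ?H" for y
    using inner_commute[OF Hp y z(1)] z(2)[OF y, symmetric] by simp
  then have "\<exists>x. x \<in> hcarrier ?H \<and> (\<forall>y\<in>hcarrier ?H. hinner ?H x y = h (Z, ?v, y))" using z(1) by blast
  from someI_ex[OF this] have fv: "fv h Z u \<in> hcarrier ?H" "\<And>y. y \<in> hcarrier ?H \<Longrightarrow> hinner ?H (fv h Z u) y = h (Z, ?v, y)"
    unfolding fv_def by auto
  have f: "fh h Z u = fv h Z u" unfolding fh_def using Z u by simp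
  show "fh h Z u \<in> hcarrier ?H" using fv(1) f by simp
  show "y \<in> hcarrier ?H \<Longrightarrow> hinner ?H (fh h Z u) y = h (Z, ?v, y)" using fv(2) f by simp
qed

private lemma fh_off: "Z \<notin> \<Delta> \<Longrightarrow> fh h Z = 0" "u \<notin> hcarrier (cpow (dim_row Z)) \<Longrightarrow> fh h Z u = 0"
  unfolding fh_def by simp_all

private lemma fh_bop:
  assumes h: "h \<in> hcarrier H0" and Z: "Z \<in> \<Delta>"
  shows "fh h Z \<in> bop (cpow (dim_row Z)) (hpow (dim_row Z) E)"
proof (rule linear_cpow_bop)
  let ?H = "hpow (dim_row Z) E"
  have hil: "hilbert_space ?H" using E by simp
  then show Hp: "pre_hilbert ?H" by simp
  have Cp: "pre_hilbert (cpow (dim_row Z))" by simp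
  have e: "(Z, v, y) \<in> Ix E" if "y \<in> hcarrier ?H" "v \<in> hcarrier (cpow (dim_row Z))" for y v
    using Z that by (simp add: Ix_iff)
  fix u assume u: "u \<in> hcarrier (cpow (dim_row Z))"
  show "fh h Z u \<in> hcarrier ?H" by (rule fv[OF h Z u])
  show "fh h Z (a *\<^sub>C u) = a *\<^sub>C fh h Z u" for a
  proof (rule inner_ext[OF hil fv(1)[OF h Z scale_in[OF Cp u]] scale_in[OF Hp fv(1)[OF h Z u]]])
    fix y assume y: "y \<in> hcarrier ?H"
    have au: "(\<lambda>i. cnj ((a *\<^sub>C u) i)) = cnj a *\<^sub>C (\<lambda>i. cnj (u i))" by (simp add: scaleC_fun_def scaleC_complex_def)
    have "h (Z, cnj a *\<^sub>C (\<lambda>i. cnj (u i)), y) = a * h (Z, \<lambda>i. cnj (u i), y)"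
      unfolding H0_eval[OF h e[OF y cnj_cpow[OF u]]] H0_eval[OF h e[OF y scale_in[OF Cp cnj_cpow[OF u]]]] kp_scale_v[OF Z]
      using inner_scale_right[OF H0p kp_in[OF e[OF y cnj_cpow[OF u]]] h] by simp
    then show "hinner ?H (fh h Z (a *\<^sub>C u)) y = hinner ?H (a *\<^sub>C fh h Z u) y"
      using fv(2)[OF h Z scale_in[OF Cp u] y, of a] fv(2)[OF h Z u y] inner_scale_left[OF Hp fv(1)[OF h Z u] y] au by simp
  qed
  fix u' assume u': "u' \<in> hcarrier (cpow (dim_row Z))"
  show "fh h Z (u + u') = fh h Z u + fh h Z u'"
  proof (rule inner_ext[OF hil fv(1)[OF h Z add_in[OF Cp u u']] add_in[OF Hp fv(1)[OF h Z u] fv(1)[OF h Z u']]])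
    fix y assume y: "y \<in> hcarrier ?H"
    have au: "(\<lambda>i. cnj ((u + u') i)) = (\<lambda>i. cnj (u i)) + (\<lambda>i. cnj (u' i))" by (simp add: fun_eq_iff)
    have "h (Z, (\<lambda>i. cnj (u i)) + (\<lambda>i. cnj (u' i)), y) = h (Z, \<lambda>i. cnj (u i), y) + h (Z, \<lambda>i. cnj (u' i), y)"
      unfolding H0_eval[OF h e[OF y cnj_cpow[OF u]]] H0_eval[OF h e[OF y cnj_cpow[OF u']]]
        H0_eval[OF h e[OF y add_in[OF Cp cnj_cpow[OF u] cnj_cpow[OF u']]]] kp_add_v[OF Z]
      by (rule inner_add_right[OF H0p kp_in[OF e[OF y cnj_cpow[OF u]]] kp_in[OF e[OF y cnj_cpow[OF u']]] h])
    then show "hinner ?H (fh h Z (u + u')) y = hinner ?H (fh h Z u + fh h Z u') y"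
      using fv(2)[OF h Z add_in[OF Cp u u'] y] fv(2)[OF h Z u y] fv(2)[OF h Z u' y]
        inner_add_left[OF Hp fv(1)[OF h Z u] fv(1)[OF h Z u'] y] au by simp
  qed
qed (rule fh_off)

text \<open>The matrix \<open>\<alpha>\<close> is moved to the other side of the inner product,
  where its adjoint acts on \<open>y\<close>; by \<open>kap_intertwine\<close> the two resulting
  triples have the same kernel function, hence \<open>h\<close> has the same value at both.\<close>

private lemma fh_nc:
  assumes h: "h \<in> hcarrier H0"
  shows "nc_function \<Delta> complex_hspace E (fh h)"
  unfolding nc_function_def graded_def
proof (intro conjI ballI impI fh_bop[OF h])
  fix Z Z' \<alpha> assume Z: "Z \<in> \<Delta>" and Z': "Z' \<in> \<Delta>" and \<alpha>: "\<alpha> \<in> carrier_mat (dim_row Z') (dim_row Z)"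
    and eq: "lact \<alpha> Z = ract Z' \<alpha>"
  let ?n = "dim_row Z" and ?m = "dim_row Z'"
  have hil: "hilbert_space (hpow ?m E)" using E by simp
  have Cp: "pre_hilbert complex_hspace" by simp
  show "mat_op \<alpha> E \<circ> fh h Z = fh h Z' \<circ> mat_op \<alpha> complex_hspace"
  proof
    fix u
    show "(mat_op \<alpha> E \<circ> fh h Z) u = (fh h Z' \<circ> mat_op \<alpha> complex_hspace) u"
    proof (cases "u \<in> hcarrier (cpow ?n)")
      case True
      have x: "fh h Z u \<in> hcarrier (hpow ?n E)" by (rule fv[OF h Z True])
      have au: "mat_op \<alpha> complex_hspace u \<in> hcarrier (cpow ?m)" by (rule bop_in[OF mat_op_bop[OF Cp \<alpha>] True])
      have ax: "mat_op \<alpha> E (fh h Z u) \<in> hcarrier (hpow ?m E)" by (rule bop_in[OF mat_op_bop[OF Ep \<alpha>] x])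
      have "mat_op \<alpha> E (fh h Z u) = fh h Z' (mat_op \<alpha> complex_hspace u)"
      proof (rule inner_ext[OF hil ax fv(1)[OF h Z' au]])
        fix y assume y: "y \<in> hcarrier (hpow ?m E)"
        define y' where "y' l = (if l < ?n then (\<Sum>i<?m. cnj (\<alpha> $$ (i, l)) *\<^sub>C y i) else 0)" for l
        have y': "y' \<in> hcarrier (hpow ?n E)"
          unfolding hpow_carrier y'_def using y Ep by (auto intro!: sum_in scale_in)
        have "hinner (hpow ?m E) (mat_op \<alpha> E (fh h Z u)) y = (\<Sum>i<?m. \<Sum>l<?n. \<alpha> $$ (i, l) * hinner E (fh h Z u l) (y i))"
          unfolding hpow_inner
        proof (rule sum.cong[OF refl])
          fix i assume "i \<in> {..<?m}"
          then have i: "i < ?m" by simp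
          show "hinner E (mat_op \<alpha> E (fh h Z u) i) (y i) = (\<Sum>l<?n. \<alpha> $$ (i, l) * hinner E (fh h Z u l) (y i))"
            unfolding mat_op_apply[OF \<alpha> x i] by (rule inner_lincomb_left[OF Ep]) (use x y i in auto)
        qed
        also have "\<dots> = (\<Sum>l<?n. \<Sum>i<?m. \<alpha> $$ (i, l) * hinner E (fh h Z u l) (y i))" by (rule sum.swap)
        also have "\<dots> = hinner (hpow ?n E) (fh h Z u) y'"
          unfolding hpow_inner
        proof (rule sum.cong[OF refl])
          fix l assume l: "l \<in> {..<?n}"
          have "hinner E (fh h Z u l) (\<Sum>i<?m. cnj (\<alpha> $$ (i, l)) *\<^sub>C y i) = (\<Sum>i<?m. cnj (cnj (\<alpha> $$ (i, l))) * hinner E (fh h Z u l) (y i))"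
            by (rule inner_lincomb_right[OF Ep]) (use x y l in auto)
          then show "(\<Sum>i<?m. \<alpha> $$ (i, l) * hinner E (fh h Z u l) (y i)) = hinner E (fh h Z u l) (y' l)"
            using l unfolding y'_def by simp
        qed
        also have "\<dots> = h (Z, \<lambda>i. cnj (u i), y')" by (rule fv(2)[OF h Z True y'])
        also have "\<dots> = h (Z', \<lambda>i. cnj (mat_op \<alpha> complex_hspace u i), y)"
        proof -
          have i1: "(Z, \<lambda>i. cnj (u i), y') \<in> Ix E" using Z cnj_cpow[OF True] y' by (simp add: Ix_iff)
          have i2: "(Z', \<lambda>i. cnj (mat_op \<alpha> complex_hspace u i), y) \<in> Ix E" using Z' cnj_cpow[OF au] y by (simp add: Ix_iff)
          have "kp (Z, \<lambda>i. cnj (u i), y') = kp (Z', \<lambda>i. cnj (mat_op \<alpha> complex_hspace u i), y)"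
          proof
            fix e'
            have "kap E e' (Z, \<lambda>i. cnj (u i), y') = kap E e' (Z', \<lambda>i. cnj (mat_op \<alpha> complex_hspace u i), y)" if "e' \<in> Ix E"
              by (rule kap_intertwine[OF Ep that Z Z' \<alpha> eq y])
                (simp_all add: y'_def mat_op_apply[OF \<alpha> True] scaleC_complex_def mult.commute)
            then show "kp (Z, \<lambda>i. cnj (u i), y') e' = kp (Z', \<lambda>i. cnj (mat_op \<alpha> complex_hspace u i), y) e'"
              unfolding rk_point_def by simp
          qed
          then show ?thesis unfolding H0_eval[OF h i1] H0_eval[OF h i2] by simp
        qed
        also have "\<dots> = hinner (hpow ?m E) (fh h Z' (mat_op \<alpha> complex_hspace u)) y" by (rule fv(2)[OF h Z' au y, symmetric])
        finally show "hinner (hpow ?m E) (mat_op \<alpha> E (fh h Z u)) y = hinner (hpow ?m E) (fh h Z' (mat_op \<alpha> complex_hspace u)) y" .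
      qed
      then show ?thesis by simp
    next
      case False
      then show ?thesis
        using fh_off(2)[OF False, of h] bop_off[OF mat_op_bop[OF Cp \<alpha>] False] bop_zero[OF fh_bop[OF h Z']]
          bop_zero[OF mat_op_bop[OF Ep \<alpha>]] by simp
    qed
  qed
qed

private lemma fh_ext:
  assumes h: "h \<in> hcarrier H0"
    and f: "\<And>Z u. Z \<in> \<Delta> \<Longrightarrow> u \<in> hcarrier (cpow (dim_row Z)) \<Longrightarrow> f Z u \<in> hcarrier (hpow (dim_row Z) E)"
    and eq: "\<And>Z u y. Z \<in> \<Delta> \<Longrightarrow> u \<in> hcarrier (cpow (dim_row Z)) \<Longrightarrow> y \<in> hcarrier (hpow (dim_row Z) E) \<Longrightarrow>
      hinner (hpow (dim_row Z) E) (f Z u) y = h (Z, \<lambda>i. cnj (u i), y)"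
    and off: "\<And>Z. Z \<notin> \<Delta> \<Longrightarrow> f Z = 0" "\<And>Z u. u \<notin> hcarrier (cpow (dim_row Z)) \<Longrightarrow> f Z u = 0"
  shows "fh h = f"
proof (rule ext, rule ext)
  fix Z :: "'v mat" and u
  have hil: "hilbert_space (hpow (dim_row Z) E)" using E by simp
  show "fh h Z u = f Z u"
  proof (cases "Z \<in> \<Delta> \<and> u \<in> hcarrier (cpow (dim_row Z))")
    case True
    then have Z: "Z \<in> \<Delta>" and u: "u \<in> hcarrier (cpow (dim_row Z))" by auto
    show ?thesis
      by (rule inner_ext[OF hil fv(1)[OF h Z u] f[OF Z u]]) (simp add: fv(2)[OF h Z u] eq[OF Z u])
  next
    case False
    then show ?thesis using fh_off(1)[of Z h] fh_off(2)[of u Z h] off(1)[of Z] off(2)[of u Z] by (cases "Z \<in> \<Delta>") simp_all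
  qed
qed

text \<open>The passage from \<open>h\<close> to \<open>fh h\<close> is linear and injective,
  because the values of \<open>h\<close> are recovered as pairings with values of
  \<open>fh h\<close>. Transporting the scalar space along it gives a space of nc functions in which
  the kernel elements correspond to the scalar kernel functions.\<close>

lemma nc_rkhs_exists: "\<exists>H. is_nc_rkhs \<Delta> E (KE E) H"
proof -
  have add: "fh (h + h') = fh h + fh h'" if h: "h \<in> hcarrier H0" "h' \<in> hcarrier H0" for h h'
  proof (rule fh_ext[OF add_in[OF H0p h]])
    fix Z u assume Zu: "Z \<in> \<Delta>" "u \<in> hcarrier (cpow (dim_row Z))"
    have Hp: "pre_hilbert (hpow (dim_row Z) E)" by (rule pre_hilbert_hpow[OF Ep])
    show "(fh h + fh h') Z u \<in> hcarrier (hpow (dim_row Z) E)"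
      using add_in[OF Hp fv(1)[OF h(1) Zu] fv(1)[OF h(2) Zu]] by simp
    fix y assume y: "y \<in> hcarrier (hpow (dim_row Z) E)"
    show "hinner (hpow (dim_row Z) E) ((fh h + fh h') Z u) y = (h + h') (Z, \<lambda>i. cnj (u i), y)"
      using inner_add_left[OF Hp fv(1)[OF h(1) Zu] fv(1)[OF h(2) Zu] y] fv(2)[OF h(1) Zu y] fv(2)[OF h(2) Zu y] by simp
  qed (simp_all add: fh_off)
  have scale: "fh (a *\<^sub>C h) = a *\<^sub>C fh h" if h: "h \<in> hcarrier H0" for h a
  proof (rule fh_ext[OF scale_in[OF H0p h]])
    fix Z u assume Zu: "Z \<in> \<Delta>" "u \<in> hcarrier (cpow (dim_row Z))"
    have Hp: "pre_hilbert (hpow (dim_row Z) E)" by (rule pre_hilbert_hpow[OF Ep])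
    have ap: "(a *\<^sub>C fh h) Z u = a *\<^sub>C fh h Z u" by (simp add: scaleC_fun_def)
    show "(a *\<^sub>C fh h) Z u \<in> hcarrier (hpow (dim_row Z) E)"
      unfolding ap by (rule scale_in[OF Hp fv(1)[OF h Zu]])
    fix y assume y: "y \<in> hcarrier (hpow (dim_row Z) E)"
    show "hinner (hpow (dim_row Z) E) ((a *\<^sub>C fh h) Z u) y = (a *\<^sub>C h) (Z, \<lambda>i. cnj (u i), y)"
      unfolding ap using inner_scale_left[OF Hp fv(1)[OF h Zu] y] fv(2)[OF h Zu y]
      by (simp add: scaleC_fun_def scaleC_complex_def)
  qed (simp_all add: fh_off scaleC_fun_def zero_fun_def)
  have inj: "h = 0" if h: "h \<in> hcarrier H0" and z: "fh h = 0" for h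
  proof (rule rk_total[OF kap_psd[OF Ep] h])
    fix e assume e: "e \<in> Ix E"
    obtain Z v y where ze: "e = (Z, v, y)" by (cases e)
    have Zv: "Z \<in> \<Delta>" "v \<in> hcarrier (cpow (dim_row Z))" "y \<in> hcarrier (hpow (dim_row Z) E)" using e unfolding ze by (simp_all add: Ix_iff)
    have "h e = hinner (hpow (dim_row Z) E) (fh h Z (\<lambda>i. cnj (v i))) y"
      using fv(2)[OF h Zv(1) cnj_cpow[OF Zv(2)] Zv(3)] ze by simp
    also have "\<dots> = 0" unfolding z using inner_zero_left[OF pre_hilbert_hpow[OF Ep] Zv(3)] by simp
    finally show "hinner H0 h (kp e) = 0" using H0_eval[OF h e] by simp
  qed
  let ?H = "htransport H0 fh"
  have tr1: "hilbert_space ?H"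
    by (rule htransport(1)[OF H0]) (fact add, fact scale, fact inj)
  have tr2: "hinner ?H (fh x) (fh y) = hinner H0 x y" if xy: "x \<in> hcarrier H0" "y \<in> hcarrier H0" for x y
    by (rule htransport(2)[OF H0 _ _ _ xy]) (fact add, fact scale, fact inj)
  have tr3: "hcarrier ?H = fh ` hcarrier H0" unfolding htransport_def by simp
  have ker: "ke E e = fh (kp e)" if e: "e \<in> Ix E" for e
  proof (rule fh_ext[OF kp_in[OF e], symmetric])
    fix Z u assume Zu: "Z \<in> \<Delta>" "u \<in> hcarrier (cpow (dim_row Z))"
    show "ke E e Z u \<in> hcarrier (hpow (dim_row Z) E)" by (rule ke_apply[OF Ep e Zu])
    fix y assume y: "y \<in> hcarrier (hpow (dim_row Z) E)"
    have "(Z, \<lambda>i. cnj (u i), y) \<in> Ix E" using Zu cnj_cpow[OF Zu(2)] y by (simp add: Ix_iff)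
    then show "hinner (hpow (dim_row Z) E) (ke E e Z u) y = kp e (Z, \<lambda>i. cnj (u i), y)"
      using ke_apply(2)[OF Ep e Zu y] by (simp add: rk_point_def)
  qed (simp_all add: kernel_element_def)
  have "is_nc_rkhs \<Delta> E (KE E) ?H"
    unfolding is_nc_rkhs_def
  proof (intro conjI ballI allI impI tr1)
    fix f assume "f \<in> hcarrier ?H"
    then obtain h where h: "h \<in> hcarrier H0" "f = fh h" unfolding tr3 by blast
    show "nc_function \<Delta> complex_hspace E f" unfolding h(2) by (rule fh_nc[OF h(1)])
    show "f Z = 0" if "Z \<notin> \<Delta>" for Z unfolding h(2) by (rule fh_off(1)[OF that])
  next
    fix W v y assume Wvy: "W \<in> \<Delta>" "v \<in> hcarrier (cpow (dim_row W))" "y \<in> hcarrier (hpow (dim_row W) E)"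
    then have e: "(W, v, y) \<in> Ix E" by (simp add: Ix_iff)
    have k: "kernel_element \<Delta> (KE E) W v y = fh (kp (W, v, y))" using ker[OF e] by simp
    show "kernel_element \<Delta> (KE E) W v y \<in> hcarrier ?H" unfolding k tr3 using kp_in[OF e] by blast
    fix f assume "f \<in> hcarrier ?H"
    then obtain h where h: "h \<in> hcarrier H0" "f = fh h" unfolding tr3 by blast
    show "hinner (hpow (dim_row W) E) (f W (\<lambda>i. cnj (v i))) y = hinner ?H f (kernel_element \<Delta> (KE E) W v y)"
      unfolding k h(2) tr2[OF h(1) kp_in[OF e]] fv(2)[OF h(1) Wvy(1) cnj_cpow[OF Wvy(2)] Wvy(3)]
      using H0_eval[OF h(1) e] by simp
  qed
  then show ?thesis by blast
qed

section \<open>Evaluation, Gram matrix and totality in the chosen space\<close>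

abbreviation "Hk \<equiv> nc_rkhs \<Delta> E (KE E)"

lemma nc_rkhs_is: "is_nc_rkhs \<Delta> E (KE E) Hk"
  unfolding nc_rkhs_def by (rule someI_ex[OF nc_rkhs_exists])

lemma nc_rkhs_hilbert: "hilbert_space Hk"
  using nc_rkhs_is unfolding is_nc_rkhs_def by (elim conjE)

lemma
  assumes "f \<in> hcarrier Hk"
  shows nc_rkhs_nc: "nc_function \<Delta> complex_hspace E f"
    and nc_rkhs_off: "Z \<notin> \<Delta> \<Longrightarrow> f Z = 0"
proof -
  have "\<forall>f\<in>hcarrier Hk. nc_function \<Delta> complex_hspace E f \<and> (\<forall>Z. Z \<notin> \<Delta> \<longrightarrow> f Z = 0)"
    using nc_rkhs_is unfolding is_nc_rkhs_def by (elim conjE)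
  then show "nc_function \<Delta> complex_hspace E f" "Z \<notin> \<Delta> \<Longrightarrow> f Z = 0" using assms by blast+
qed

lemma
  assumes "e \<in> Ix E"
  shows nc_rkhs_ke: "ke E e \<in> hcarrier Hk"
    and nc_rkhs_eval: "f \<in> hcarrier Hk \<Longrightarrow>
      hinner Hk f (ke E e) = hinner (hpow (dim_row (fst e)) E) (f (fst e) (\<lambda>i. cnj (fst (snd e) i))) (snd (snd e))"
proof -
  have "\<forall>W\<in>\<Delta>. \<forall>v\<in>hcarrier (cpow (dim_row W)). \<forall>y\<in>hcarrier (hpow (dim_row W) E).
        kernel_element \<Delta> (KE E) W v y \<in> hcarrier Hk \<and>
        (\<forall>f\<in>hcarrier Hk. hinner (hpow (dim_row W) E) (f W (\<lambda>i. cnj (v i))) y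
                          = hinner Hk f (kernel_element \<Delta> (KE E) W v y))"
    using nc_rkhs_is unfolding is_nc_rkhs_def by (elim conjE)
  then show "ke E e \<in> hcarrier Hk" "f \<in> hcarrier Hk \<Longrightarrow>
      hinner Hk f (ke E e) = hinner (hpow (dim_row (fst e)) E) (f (fst e) (\<lambda>i. cnj (fst (snd e) i))) (snd (snd e))"
    using assms unfolding Ix_def by auto
qed

lemma nc_rkhs_bop: "f \<in> hcarrier Hk \<Longrightarrow> Z \<in> \<Delta> \<Longrightarrow> f Z \<in> bop (cpow (dim_row Z)) (hpow (dim_row Z) E)"
  using nc_rkhs_nc unfolding nc_function_def graded_def by blast

lemma nc_rkhs_gram:
  assumes e: "e \<in> Ix E" and e': "e' \<in> Ix E"
  shows "hinner Hk (ke E e) (ke E e') = kap E e' e"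
proof -
  have W: "fst e' \<in> \<Delta>" "fst (snd e') \<in> hcarrier (cpow (dim_row (fst e')))" "snd (snd e') \<in> hcarrier (hpow (dim_row (fst e')) E)"
    using e' by (simp_all add: Ix_def)
  show ?thesis
    unfolding nc_rkhs_eval[OF e' nc_rkhs_ke[OF e]] ke_apply(2)[OF Ep e W(1) cnj_cpow[OF W(2)] W(3)] by simp
qed

lemma nc_rkhs_total:
  assumes f: "f \<in> hcarrier Hk" and o: "\<And>e. e \<in> Ix E \<Longrightarrow> hinner Hk f (ke E e) = 0"
  shows "f = 0"
proof (rule ext, rule ext)
  fix Z :: "'v mat" and u
  show "f Z u = 0 Z u"
  proof (cases "Z \<in> \<Delta> \<and> u \<in> hcarrier (cpow (dim_row Z))")
    case True
    then have Z: "Z \<in> \<Delta>" and u: "u \<in> hcarrier (cpow (dim_row Z))" by auto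
    have hil: "hilbert_space (hpow (dim_row Z) E)" using E by simp
    have Hp: "pre_hilbert (hpow (dim_row Z) E)" using hil by simp
    have "f Z u = 0"
    proof (rule inner_ext[OF hil bop_in[OF nc_rkhs_bop[OF f Z] u] zero_in[OF Hp]])
      fix y assume y: "y \<in> hcarrier (hpow (dim_row Z) E)"
      have e: "(Z, \<lambda>i. cnj (u i), y) \<in> Ix E" using Z cnj_cpow[OF u] y by (simp add: Ix_iff)
      show "hinner (hpow (dim_row Z) E) (f Z u) y = hinner (hpow (dim_row Z) E) 0 y"
        using o[OF e] nc_rkhs_eval[OF e f] inner_zero_left[OF Hp y] by simp
    qed
    then show ?thesis by simp
  next
    case False
    then show ?thesis using nc_rkhs_off[OF f, of Z] bop_off[OF nc_rkhs_bop[OF f, of Z], of u] by (cases "Z \<in> \<Delta>") auto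
  qed
qed

end

end

section \<open>Neumann inverses\<close>

text \<open>The equation is solved by iterating \<open>g + N x\<close> from 0, which is the Neumann
  series applied to \<open>g\<close>. Solvability for one right side at a time is also what the
  adjoint state equation needs, where no inverse operator has to be named.\<close>

lemma neumann_solution:
  assumes H: "hilbert_space H" and N: "N \<in> bop H H" and c: "0 \<le> c" "c < 1"
    and bnd: "\<And>x. x \<in> hcarrier H \<Longrightarrow> hnorm H (N x) \<le> c * hnorm H x" and g: "g \<in> hcarrier H"
  shows "\<exists>!x. x \<in> hcarrier H \<and> x - N x = g"
proof -
  have Hp: "pre_hilbert H" using H by simp
  define s where "s = rec_nat 0 (\<lambda>_ x. g + N x)"
  have s0: "s 0 = 0" and sS: "s (Suc k) = g + N (s k)" for k unfolding s_def by simp_all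
  have sH: "s k \<in> hcarrier H" for k by (induction k) (use g N Hp in \<open>simp_all add: s0 sS\<close>)
  \<comment> \<open>\<open>K\<close> satisfies \<open>K = hnorm H g + c * K\<close>, so the iterates
    never leave the ball of radius \<open>K\<close>.\<close>
  define K where "K = hnorm H g / (1 - c)"
  have gn: "0 \<le> hnorm H g" using hnorm_nonneg[OF Hp g] .
  have K0: "0 \<le> K" unfolding K_def using c gn by simp
  have sK: "hnorm H (s k) \<le> K" for k
  proof (induction k)
    case (Suc k)
    have "hnorm H (s (Suc k)) \<le> hnorm H g + hnorm H (N (s k))"
      unfolding sS using g N sH by (intro hnorm_triangle[OF Hp]) simp_all
    also have "\<dots> \<le> hnorm H g + c * K"
      using bnd[OF sH, of k] mult_left_mono[OF Suc c(1)] by linarith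
    also have "\<dots> = K" unfolding K_def using c by (simp add: field_simps)
    finally show ?case .
  qed (use K0 Hp in \<open>simp add: s0\<close>)
  have diff: "hnorm H (s (k + j) - s k) \<le> c ^ k * K" for k j
  proof (induction k)
    case (Suc k)
    have "s (Suc k + j) - s (Suc k) = N (s (k + j) - s k)"
      using bop_diff[OF Hp N sH sH, of "k + j" k] by (simp add: sS)
    then have "hnorm H (s (Suc k + j) - s (Suc k)) \<le> c * hnorm H (s (k + j) - s k)"
      using bnd[OF diff_in[OF Hp sH sH]] by simp
    also have "\<dots> \<le> c * (c ^ k * K)" using Suc c(1) by (rule mult_left_mono)
    finally show ?case by (simp add: mult.assoc)
  qed (use sK in \<open>simp add: s0\<close>)
  have lim0: "(\<lambda>k. c ^ k * K) \<longlonglongrightarrow> 0"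
    using tendsto_mult_left_zero[OF LIMSEQ_realpow_zero[OF c]] .
  have "\<exists>M. \<forall>m\<ge>M. \<forall>n\<ge>M. hnorm H (s m - s n) < e" if e: "e > 0" for e
  proof -
    have e2: "e / 2 > 0" using e by simp
    obtain M where M: "\<And>n. n \<ge> M \<Longrightarrow> norm (c ^ n * K - 0) < e / 2" using LIMSEQ_D[OF lim0 e2] by blast
    have le: "hnorm H (s n - s M) < e / 2" if "n \<ge> M" for n
      using diff[of M "n - M"] M[of M] that by simp
    have "hnorm H (s m - s n) < e" if "m \<ge> M" "n \<ge> M" for m n
      using hnorm_triangle3[OF Hp, of "s m" "s M" "s n"] sH le[OF that(1)] le[OF that(2)]
        hnorm_diff_commute[OF Hp sH sH, of M n] by fastforce
    then show ?thesis by blast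
  qed
  from hilbert_complete[OF H sH this] obtain x where x: "x \<in> hcarrier H" "(\<lambda>n. hnorm H (s n - x)) \<longlonglongrightarrow> 0" by blast
  have "(\<lambda>n. hnorm H (s (Suc n) - (g + N x))) \<longlonglongrightarrow> 0"
  proof (rule null_le)
    show "norm (hnorm H (s (Suc n) - (g + N x))) \<le> c * hnorm H (s n - x)" for n
    proof -
      have "s (Suc n) - (g + N x) = N (s n - x)" using bop_diff[OF Hp N sH x(1), of n] by (simp add: sS)
      then show ?thesis using bnd[OF diff_in[OF Hp sH x(1)], of n] hnorm_nonneg[OF Hp bop_in[OF N diff_in[OF Hp sH x(1)]], of n]
        by simp
    qed
    show "(\<lambda>n. c * hnorm H (s n - x)) \<longlonglongrightarrow> 0" by (rule tendsto_mult_right_zero[OF x(2)])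
  qed
  then have "g + N x = x"
    by (rule hlim_unique[OF H sH add_in[OF Hp g bop_in[OF N x(1)]] x(1) _ LIMSEQ_Suc[OF x(2)]])
  then have sol: "x - N x = g" by (metis add_diff_cancel_right')
  have uniq: "x' = x" if x': "x' \<in> hcarrier H" "x' - N x' = g" for x'
  proof -
    let ?d = "x' - x"
    have d: "?d \<in> hcarrier H" using x' x Hp by simp
    have "x' = g + N x'" "x = g + N x" using x'(2) sol by (metis diff_add_cancel add.commute)+
    then have "?d = N x' - N x" by (metis add_diff_cancel_left)
    then have "N ?d = ?d" using bop_diff[OF Hp N x'(1) x(1)] by simp
    then have "hnorm H ?d \<le> c * hnorm H ?d" using bnd[OF d] by simp
    then have "(1 - c) * hnorm H ?d \<le> 0" by (simp add: algebra_simps)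
    then have "hnorm H ?d \<le> 0" using c by (simp add: mult_le_0_iff)
    then have "hnorm H ?d = 0" using hnorm_nonneg[OF Hp d] by simp
    then have "?d = 0" by (rule hnorm_eq_zero[OF H d])
    then show ?thesis by simp
  qed
  show ?thesis using x(1) sol uniq by blast
qed

text \<open>The solution map \<open>J\<close> is bounded by \<open>1 / (1 - c)\<close> and is 0 off
  the carrier, so both composites equal \<open>id_op H\<close> as functions, and \<open>J\<close> is
  the only operator meeting the description \<open>op_inverse\<close>.\<close>

lemma neumann_inverse:
  assumes H: "hilbert_space H" and N: "N \<in> bop H H" and c: "0 \<le> c" "c < 1"
    and bnd: "\<And>x. x \<in> hcarrier H \<Longrightarrow> hnorm H (N x) \<le> c * hnorm H x"
  shows "op_inverse H (id_op H - N) \<in> bop H H"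
    and "g \<in> hcarrier H \<Longrightarrow> op_inverse H (id_op H - N) g - N (op_inverse H (id_op H - N) g) = g"
proof -
  have Hp: "pre_hilbert H" using H by simp
  let ?T = "id_op H - N"
  note ex = neumann_solution[OF H N c bnd]
  define J where "J g = (if g \<in> hcarrier H then (THE x. x \<in> hcarrier H \<and> x - N x = g) else 0)" for g
  have J: "J g \<in> hcarrier H" "J g - N (J g) = g" if "g \<in> hcarrier H" for g
    using theI'[OF ex[OF _ that]] that unfolding J_def by auto
  have Juniq: "J g = x" if "x \<in> hcarrier H" "x - N x = g" for g x
  proof -
    have g: "g \<in> hcarrier H" using that N Hp by auto
    show ?thesis using ex[OF _ g] J[OF g] that by blast
  qed
  have T: "?T x = x - N x" if "x \<in> hcarrier H" for x using that by (simp add: id_op_def)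
  have Toff: "?T x = 0" if "x \<notin> hcarrier H" for x using that N by (simp add: id_op_def)
  have Jb: "J \<in> bop H H"
  proof (rule bopI[where c = "1 / (1 - c)"])
    fix x assume x: "x \<in> hcarrier H"
    show "J x \<in> hcarrier H" using J[OF x] by simp
    have "hnorm H (J x) \<le> hnorm H x + c * hnorm H (J x)"
    proof -
      have "hnorm H (x + N (J x)) \<le> hnorm H x + hnorm H (N (J x))"
        by (rule hnorm_triangle[OF Hp x bop_in[OF N J(1)[OF x]]])
      moreover have "x + N (J x) = J x" using J(2)[OF x] by (metis diff_add_cancel)
      ultimately show ?thesis using bnd[OF J(1)[OF x]] by simp
    qed
    then have "(1 - c) * hnorm H (J x) \<le> hnorm H x" by (simp add: algebra_simps)
    then show "hnorm H (J x) \<le> 1 / (1 - c) * hnorm H x" using c by (simp add: field_simps)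
    show "J (a *\<^sub>C x) = a *\<^sub>C J x" for a
      using J[OF x] N Hp by (intro Juniq) (simp_all add: scaleC_diff_right[symmetric])
    fix y assume y: "y \<in> hcarrier H"
    have "J x + J y - N (J x + J y) = (J x - N (J x)) + (J y - N (J y))"
      using bop_add[OF N J(1)[OF x] J(1)[OF y]] by simp
    then show "J (x + y) = J x + J y" using J[OF x] J[OF y] Hp by (intro Juniq) simp_all
  qed (simp add: J_def)
  have JT: "J \<circ> ?T = id_op H"
  proof
    fix x show "(J \<circ> ?T) x = id_op H x"
    proof (cases "x \<in> hcarrier H")
      case True
      show ?thesis unfolding o_apply T[OF True] using Juniq[OF True refl] True by (simp add: id_op_def)
    next
      case False
      show ?thesis unfolding o_apply Toff[OF False] using bop_zero[OF Jb] False by (simp add: id_op_def)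
    qed
  qed
  have TJ: "?T \<circ> J = id_op H"
  proof
    fix x show "(?T \<circ> J) x = id_op H x"
    proof (cases "x \<in> hcarrier H")
      case True
      show ?thesis unfolding o_apply T[OF J(1)[OF True]] using J(2)[OF True] True by (simp add: id_op_def)
    next
      case False
      have "?T 0 = 0" using T[OF zero_in[OF Hp]] N by simp
      then show ?thesis unfolding o_apply using False by (simp add: J_def id_op_def)
    qed
  qed
  have "op_inverse H ?T = J"
    unfolding op_inverse_def
  proof (rule the_equality)
    show "J \<in> bop H H \<and> J \<circ> ?T = id_op H \<and> ?T \<circ> J = id_op H" using Jb JT TJ by blast
    fix T' assume T': "T' \<in> bop H H \<and> T' \<circ> ?T = id_op H \<and> ?T \<circ> T' = id_op H"
    show "T' = J"
    proof
      fix x show "T' x = J x"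
      proof (cases "x \<in> hcarrier H")
        case True
        have "T' x \<in> hcarrier H" by (rule bop_in[OF conjunct1[OF T'] True])
        moreover have "?T (T' x) = x" using conjunct2[OF conjunct2[OF T']] True by (metis comp_apply id_op_def)
        ultimately show ?thesis using Juniq[of "T' x" x] T[of "T' x"] by simp
      next
        case False
        then show ?thesis using bop_off[OF conjunct1[OF T'] False] by (simp add: J_def)
      qed
    qed
  qed
  then show "op_inverse H ?T \<in> bop H H"
    "g \<in> hcarrier H \<Longrightarrow> op_inverse H ?T g - N (op_inverse H ?T g) = g" using Jb J by simp_all
qed

lemma ampliation_bound:
  assumes H: "pre_hilbert H" and K: "pre_hilbert K" and A: "A \<in> bop H K" and c: "0 \<le> c"
    and bnd: "\<And>x. x \<in> hcarrier H \<Longrightarrow> hnorm K (A x) \<le> c * hnorm H x" and x: "x \<in> hcarrier (hpow n H)"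
  shows "hnorm (hpow n K) (ampliation n H A x) \<le> c * hnorm (hpow n H) x"
proof (rule le_of_sq_le)
  have Ax: "ampliation n H A x \<in> hcarrier (hpow n K)" by (rule bop_in[OF ampliation_bop[OF H K A] x])
  have "(hnorm (hpow n K) (ampliation n H A x))\<^sup>2 = (\<Sum>i<n. (hnorm K (A (x i)))\<^sup>2)"
    unfolding hpow_norm_sq[OF K Ax] by (intro sum.cong refl) (simp add: ampliation_apply[OF x])
  also have "\<dots> \<le> (\<Sum>i<n. (c * hnorm H (x i))\<^sup>2)"
    using bnd x K A by (intro sum_mono power_mono hnorm_nonneg) auto
  also have "\<dots> = (c * hnorm (hpow n H) x)\<^sup>2"
    unfolding power_mult_distrib hpow_norm_sq[OF H x] by (simp add: sum_distrib_left)
  finally show "(hnorm (hpow n K) (ampliation n H A x))\<^sup>2 \<le> (c * hnorm (hpow n H) x)\<^sup>2" .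
  show "0 \<le> c * hnorm (hpow n H) x" using c hnorm_nonneg[OF pre_hilbert_hpow[OF H] x] by simp
qed

section \<open>Realizations\<close>

lemma contractive_bound:
  assumes "hilbert_space H" "pre_hilbert K" "contractive_op H K T" "x \<in> hcarrier H"
  shows "hnorm K (T x) \<le> hnorm H x"
proof -
  have T: "T \<in> bop H K" and n: "op_norm H K T \<le> 1" using assms(3) unfolding contractive_op_def by auto
  have "hnorm K (T x) \<le> op_norm H K T * hnorm H x" by (rule op_norm_ge[OF assms(1) T assms(2,4)])
  also have "\<dots> \<le> 1 * hnorm H x" using n assms by (intro mult_right_mono hnorm_nonneg) simp_all
  finally show ?thesis by simp
qed

lemma block_apply:
  assumes "x \<in> hcarrier X" "u \<in> hcarrier U"
  shows "block_op X U A B C D (x, u) = (A x + B u, C x + D u)"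
  using assms unfolding block_op_def by simp

lemma inl_bop:
  assumes "pre_hilbert H" "pre_hilbert K"
  shows "(\<lambda>x. if x \<in> hcarrier H then (x, 0) else 0) \<in> bop H (hsum H K)"
    and "x \<in> hcarrier H \<Longrightarrow> hnorm (hsum H K) (x, 0) = hnorm H x"
proof -
  show n: "hnorm (hsum H K) (x, 0) = hnorm H x" if "x \<in> hcarrier H" for x
    unfolding hnorm_def using assms by simp
  show "(\<lambda>x. if x \<in> hcarrier H then (x, 0) else 0) \<in> bop H (hsum H K)"
    by (rule bopI[where c = 1]) (use assms n in \<open>simp_all add: scaleC_prod_def\<close>)
qed

lemma inr_bop:
  assumes "pre_hilbert H" "pre_hilbert K"
  shows "(\<lambda>x. if x \<in> hcarrier K then (0, x) else 0) \<in> bop K (hsum H K)"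
    and "x \<in> hcarrier K \<Longrightarrow> hnorm (hsum H K) (0, x) = hnorm K x"
proof -
  show n: "hnorm (hsum H K) (0, x) = hnorm K x" if "x \<in> hcarrier K" for x
    unfolding hnorm_def using assms by simp
  show "(\<lambda>x. if x \<in> hcarrier K then (0, x) else 0) \<in> bop K (hsum H K)"
    by (rule bopI[where c = 1]) (use assms n in \<open>simp_all add: scaleC_prod_def\<close>)
qed

lemma proj_bop:
  assumes H: "pre_hilbert H" and K: "pre_hilbert K"
  shows "(\<lambda>p. if p \<in> hcarrier (hsum H K) then fst p else 0) \<in> bop (hsum H K) H"
    and "(\<lambda>p. if p \<in> hcarrier (hsum H K) then snd p else 0) \<in> bop (hsum H K) K"
    and "p \<in> hcarrier (hsum H K) \<Longrightarrow> hnorm H (fst p) \<le> hnorm (hsum H K) p"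
    and "p \<in> hcarrier (hsum H K) \<Longrightarrow> hnorm K (snd p) \<le> hnorm (hsum H K) p"
proof -
  note S = pre_hilbert_hsum[OF H K]
  have le: "hnorm H (fst p) \<le> hnorm (hsum H K) p" "hnorm K (snd p) \<le> hnorm (hsum H K) p"
    if p: "p \<in> hcarrier (hsum H K)" for p
  proof -
    have "fst p \<in> hcarrier H" "snd p \<in> hcarrier K" using p by auto
    note sq = hsum_norm_sq[OF H K this]
    show "hnorm H (fst p) \<le> hnorm (hsum H K) p"
      by (rule le_of_sq_le[OF _ hnorm_nonneg[OF S p]]) (simp add: sq)
    show "hnorm K (snd p) \<le> hnorm (hsum H K) p"
      by (rule le_of_sq_le[OF _ hnorm_nonneg[OF S p]]) (simp add: sq)
  qed
  show "(\<lambda>p. if p \<in> hcarrier (hsum H K) then fst p else 0) \<in> bop (hsum H K) H"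
    by (rule bopI[where c = 1]) (use H K S le in \<open>simp_all add: scaleC_prod_def, blast?\<close>)
  show "(\<lambda>p. if p \<in> hcarrier (hsum H K) then snd p else 0) \<in> bop (hsum H K) K"
    by (rule bopI[where c = 1]) (use H K S le in \<open>simp_all add: scaleC_prod_def, blast?\<close>)
  show "p \<in> hcarrier (hsum H K) \<Longrightarrow> hnorm H (fst p) \<le> hnorm (hsum H K) p"
    "p \<in> hcarrier (hsum H K) \<Longrightarrow> hnorm K (snd p) \<le> hnorm (hsum H K) p" using le by auto
qed

context row_ball
begin

abbreviation TA :: "'x::complex_vector hspace \<Rightarrow> 'v mat \<Rightarrow> (nat \<Rightarrow> 'x) \<Rightarrow> nat \<Rightarrow> 'r \<times> 'x \<Rightarrow> complex" where
  "TA X W \<equiv> tid_adj R (dim_row W) (Q W) X"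

lemma
  assumes W: "W \<in> \<Delta>"
  shows TA_apply: "\<And>F p. pre_hilbert X \<Longrightarrow> F \<in> hcarrier (hpow (dim_row W) X) \<Longrightarrow> p < dim_row W \<Longrightarrow>
      TA X W F p = (\<Sum>l<dim_row W. elem_tensor R X (q W l p) (F l))"
    and TA_bop: "pre_hilbert X \<Longrightarrow> TA X W \<in> bop (hpow (dim_row W) X) (hpow (dim_row W) (htensor R X))"
    and TA_bound: "\<And>F. pre_hilbert X \<Longrightarrow> F \<in> hcarrier (hpow (dim_row W) X) \<Longrightarrow>
      hnorm (hpow (dim_row W) (htensor R X)) (TA X W F) \<le> cQ W * hnorm (hpow (dim_row W) X) F"
    and QX_bop: "hilbert_space X \<Longrightarrow>
      tensor_id (dim_row W) R X (Q W) \<in> bop (hpow (dim_row W) (htensor R X)) (hpow (dim_row W) X)"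
    and QX_inner: "\<And>z F. hilbert_space X \<Longrightarrow> z \<in> hcarrier (hpow (dim_row W) (htensor R X)) \<Longrightarrow>
      F \<in> hcarrier (hpow (dim_row W) X) \<Longrightarrow>
      hinner (hpow (dim_row W) X) (tensor_id (dim_row W) R X (Q W) z) F = hinner (hpow (dim_row W) (htensor R X)) z (TA X W F)"
    and QX_bound: "\<And>z. hilbert_space X \<Longrightarrow> z \<in> hcarrier (hpow (dim_row W) (htensor R X)) \<Longrightarrow>
      hnorm (hpow (dim_row W) X) (tensor_id (dim_row W) R X (Q W) z) \<le> cQ W * hnorm (hpow (dim_row W) (htensor R X)) z"
proof -
  note h = R QT[OF W] cQ(1)[of W] cQ(3)[OF W]
  show "\<And>F p. pre_hilbert X \<Longrightarrow> F \<in> hcarrier (hpow (dim_row W) X) \<Longrightarrow> p < dim_row W \<Longrightarrow>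
      TA X W F p = (\<Sum>l<dim_row W. elem_tensor R X (q W l p) (F l))" by (rule tid_adj_apply[OF h])
  show "pre_hilbert X \<Longrightarrow> TA X W \<in> bop (hpow (dim_row W) X) (hpow (dim_row W) (htensor R X))" by (rule tid_adj_bop[OF h])
  show "\<And>F. pre_hilbert X \<Longrightarrow> F \<in> hcarrier (hpow (dim_row W) X) \<Longrightarrow>
      hnorm (hpow (dim_row W) (htensor R X)) (TA X W F) \<le> cQ W * hnorm (hpow (dim_row W) X) F" by (rule tid_adj_bound[OF h])
  show "hilbert_space X \<Longrightarrow>
      tensor_id (dim_row W) R X (Q W) \<in> bop (hpow (dim_row W) (htensor R X)) (hpow (dim_row W) X)" by (rule tensor_id_bop[OF h])
  show "\<And>z F. hilbert_space X \<Longrightarrow> z \<in> hcarrier (hpow (dim_row W) (htensor R X)) \<Longrightarrow>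
      F \<in> hcarrier (hpow (dim_row W) X) \<Longrightarrow>
      hinner (hpow (dim_row W) X) (tensor_id (dim_row W) R X (Q W) z) F = hinner (hpow (dim_row W) (htensor R X)) z (TA X W F)"
    by (rule tensor_id_inner[OF h])
  show "\<And>z. hilbert_space X \<Longrightarrow> z \<in> hcarrier (hpow (dim_row W) (htensor R X)) \<Longrightarrow>
      hnorm (hpow (dim_row W) X) (tensor_id (dim_row W) R X (Q W) z) \<le> cQ W * hnorm (hpow (dim_row W) (htensor R X)) z"
    by (rule tensor_id_bound[OF h])
qed

end

locale realization = row_ball R Q \<Delta>
  for R :: "'r::complex_vector hspace" and Q :: "'v::complex_vector mat \<Rightarrow> (nat \<Rightarrow> 'r) \<Rightarrow> (nat \<Rightarrow> complex)" and \<Delta> +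
  fixes X :: "'x::complex_vector hspace" and U :: "'u::complex_vector hspace" and Y :: "'y::complex_vector hspace"
    and A B C D
  assumes X: "hilbert_space X" and U: "hilbert_space U" and Y: "hilbert_space Y"
    and A: "A \<in> bop X (htensor R X)" and B: "B \<in> bop U (htensor R X)" and C: "C \<in> bop X Y" and D: "D \<in> bop U Y"
    and contr: "contractive_op (hsum X U) (hsum (htensor R X) Y) (block_op X U A B C D)"
begin

abbreviation "RX \<equiv> htensor R X"
abbreviation "T \<equiv> block_op X U A B C D"

lemma Xp: "pre_hilbert X" and Up: "pre_hilbert U" and Yp: "pre_hilbert Y"
  using X U Y by simp_all

lemma RX: "hilbert_space RX" by (rule hilbert_htensor[OF Rp Xp])

lemma RXp: "pre_hilbert RX" using RX by simp

lemma T_bop: "T \<in> bop (hsum X U) (hsum RX Y)"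
  using contr unfolding contractive_op_def by simp

lemma T_bound: "p \<in> hcarrier (hsum X U) \<Longrightarrow> hnorm (hsum RX Y) (T p) \<le> 1 * hnorm (hsum X U) p"
  using contractive_bound[OF hilbert_hsum[OF X U] pre_hilbert_hsum[OF RXp Yp] contr] by simp

lemma A_bound: "x \<in> hcarrier X \<Longrightarrow> hnorm RX (A x) \<le> 1 * hnorm X x"
proof -
  assume x: "x \<in> hcarrier X"
  have p: "(x, 0) \<in> hcarrier (hsum X U)" using x Up by simp
  have Tp: "T (x, 0) = (A x, C x)"
    using block_apply[OF x zero_in[OF Up], of A B C D] bop_zero[OF B] bop_zero[OF D] by simp
  have "hnorm RX (fst (T (x, 0))) \<le> hnorm (hsum RX Y) (T (x, 0))"
    by (rule proj_bop(3)[OF RXp Yp bop_in[OF T_bop p]])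
  also have "\<dots> \<le> 1 * hnorm (hsum X U) (x, 0)" by (rule T_bound[OF p])
  also have "hnorm (hsum X U) (x, 0) = hnorm X x" by (rule inl_bop(2)[OF Xp Up x])
  finally show ?thesis unfolding Tp by simp
qed

text \<open>\<open>A\<close> is a compression of a contraction and the tensored row operator has
  bound \<open>cQ W\<close>; the product is thus a strict contraction and its Neumann inverse
  exists.\<close>

lemma N_props:
  assumes W: "W \<in> \<Delta>"
  defines "N \<equiv> tensor_id (dim_row W) R X (Q W) \<circ> ampliation (dim_row W) X A"
  shows "N \<in> bop (hpow (dim_row W) X) (hpow (dim_row W) X)"
    and "x \<in> hcarrier (hpow (dim_row W) X) \<Longrightarrow> hnorm (hpow (dim_row W) X) (N x) \<le> cQ W * hnorm (hpow (dim_row W) X) x"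
proof -
  note aA = ampliation_bop[OF Xp RXp A, of "dim_row W"]
  show "N \<in> bop (hpow (dim_row W) X) (hpow (dim_row W) X)"
    unfolding N_def by (rule bop_compose[OF aA QX_bop[OF W X] pre_hilbert_hpow[OF Xp] pre_hilbert_hpow[OF RXp]])
  assume x: "x \<in> hcarrier (hpow (dim_row W) X)"
  have "hnorm (hpow (dim_row W) X) (N x) \<le> cQ W * hnorm (hpow (dim_row W) RX) (ampliation (dim_row W) X A x)"
    unfolding N_def o_apply by (rule QX_bound[OF W X bop_in[OF aA x]])
  also have "\<dots> \<le> cQ W * (1 * hnorm (hpow (dim_row W) X) x)"
    by (rule mult_left_mono[OF ampliation_bound[OF Xp RXp A _ A_bound x] cQ(1)]) simp_all
  finally show "hnorm (hpow (dim_row W) X) (N x) \<le> cQ W * hnorm (hpow (dim_row W) X) x" by simp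
qed

text \<open>The transfer function is handled through the internal state \<open>h\<close>, the
  solution of the state equation with input \<open>u\<close>, so that no later argument meets the
  inverse operator.\<close>

abbreviation "tf \<equiv> transfer_function R X U Q A B C D"

lemma transfer_apply:
  assumes W: "W \<in> \<Delta>" and u: "u \<in> hcarrier (hpow (dim_row W) U)"
  obtains h where "h \<in> hcarrier (hpow (dim_row W) X)"
    "h = tensor_id (dim_row W) R X (Q W) (ampliation (dim_row W) X A h + ampliation (dim_row W) U B u)"
    "tf W u = ampliation (dim_row W) U D u + ampliation (dim_row W) X C h"
proof -
  let ?n = "dim_row W"
  let ?QX = "tensor_id ?n R X (Q W)"
  let ?N = "?QX \<circ> ampliation ?n X A"
  let ?J = "op_inverse (hpow ?n X) (id_op (hpow ?n X) - ?N)"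
  note aA = ampliation_bop[OF Xp RXp A, of ?n] and aB = ampliation_bop[OF Up RXp B, of ?n]
  note QX = QX_bop[OF W X]
  have hX: "hilbert_space (hpow ?n X)" using X by simp
  note inv = neumann_inverse[OF hX N_props(1)[OF W] cQ(1) cQ(2)[OF W] N_props(2)[OF W]]
  let ?g = "?QX (ampliation ?n U B u)"
  have g: "?g \<in> hcarrier (hpow ?n X)" by (rule bop_in[OF QX bop_in[OF aB u]])
  let ?h = "?J ?g"
  have h: "?h \<in> hcarrier (hpow ?n X)" by (rule bop_in[OF inv(1) g])
  have "?h - ?N ?h = ?g" using inv(2) g by blast
  then have "?h = ?N ?h + ?g" by (metis add.commute diff_add_cancel)
  also have "\<dots> = ?QX (ampliation ?n X A ?h + ampliation ?n U B u)"
    using bop_add[OF QX bop_in[OF aA h] bop_in[OF aB u]] by simp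
  finally have e: "?h = ?QX (ampliation ?n X A ?h + ampliation ?n U B u)" .
  have "tf W u = ampliation ?n U D u + ampliation ?n X C ?h"
    unfolding transfer_function_def Let_def by simp
  with h e show thesis by (rule that)
qed

lemma transfer_off:
  assumes W: "W \<in> \<Delta>" and u: "u \<notin> hcarrier (hpow (dim_row W) U)"
  shows "tf W u = 0"
proof -
  let ?n = "dim_row W"
  have hX: "hilbert_space (hpow ?n X)" using X by simp
  have inv: "op_inverse (hpow ?n X) (id_op (hpow ?n X) - (tensor_id ?n R X (Q W) \<circ> ampliation ?n X A)) \<in> bop (hpow ?n X) (hpow ?n X)"
    by (rule neumann_inverse(1)[OF hX N_props(1)[OF W] cQ(1) cQ(2)[OF W]]) (rule N_props(2)[OF W])
  let ?QX = "tensor_id ?n R X (Q W)"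
  let ?J = "op_inverse (hpow ?n X) (id_op (hpow ?n X) - (?QX \<circ> ampliation ?n X A))"
  have "tf W u = ampliation ?n U D u + ampliation ?n X C (?J (?QX (ampliation ?n U B u)))"
    unfolding transfer_function_def Let_def by simp
  then show ?thesis
    unfolding bop_off[OF ampliation_bop[OF Up RXp B] u] bop_off[OF ampliation_bop[OF Up Yp D] u]
      bop_zero[OF QX_bop[OF W X]] bop_zero[OF inv] bop_zero[OF ampliation_bop[OF Xp Yp C]] by simp
qed

lemma transfer_in:
  assumes W: "W \<in> \<Delta>" and u: "u \<in> hcarrier (hpow (dim_row W) U)"
  shows "tf W u \<in> hcarrier (hpow (dim_row W) Y)"
proof -
  obtain h where h: "h \<in> hcarrier (hpow (dim_row W) X)"
    "tf W u = ampliation (dim_row W) U D u + ampliation (dim_row W) X C h"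
    using transfer_apply[OF W u] by metis
  show ?thesis unfolding h(2)
    by (rule add_in[OF pre_hilbert_hpow[OF Yp] bop_in[OF ampliation_bop[OF Up Yp D] u] bop_in[OF ampliation_bop[OF Xp Yp C] h(1)]])
qed

text \<open>The state \<open>h\<close> drops out of the energy balance because \<open>h = (Q(W) \<otimes> I)(A h + B u)\<close>.\<close>

lemma transfer_adjoint:
  assumes W: "W \<in> \<Delta>" and u: "u \<in> hcarrier (hpow (dim_row W) U)"
    and F: "F \<in> hcarrier (hpow (dim_row W) X)" and y: "y \<in> hcarrier (hpow (dim_row W) Y)"
    and bal: "\<And>p x u. p < dim_row W \<Longrightarrow> x \<in> hcarrier X \<Longrightarrow> u \<in> hcarrier U \<Longrightarrow>
      hinner RX (A x + B u) (TA X W F p) + hinner Y (C x + D u) (y p) = hinner X x (F p) + hinner U u (s p)"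
  shows "hinner (hpow (dim_row W) Y) (tf W u) y = (\<Sum>p<dim_row W. hinner U (u p) (s p))"
proof -
  let ?n = "dim_row W"
  let ?QX = "tensor_id ?n R X (Q W)"
  obtain h where h: "h \<in> hcarrier (hpow ?n X)" "h = ?QX (ampliation ?n X A h + ampliation ?n U B u)"
    "tf W u = ampliation ?n U D u + ampliation ?n X C h"
    using transfer_apply[OF W u] by metis
  let ?z = "ampliation ?n X A h + ampliation ?n U B u"
  have z: "?z \<in> hcarrier (hpow ?n RX)"
    by (rule add_in[OF pre_hilbert_hpow[OF RXp] bop_in[OF ampliation_bop[OF Xp RXp A] h(1)] bop_in[OF ampliation_bop[OF Up RXp B] u]])
  have "(\<Sum>p<?n. hinner X (h p) (F p)) = hinner (hpow ?n X) (?QX ?z) F"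
    unfolding hpow_inner using h(2) by simp
  also have "\<dots> = hinner (hpow ?n RX) ?z (TA X W F)" by (rule QX_inner[OF W X z F])
  also have "\<dots> = (\<Sum>p<?n. hinner RX (A (h p) + B (u p)) (TA X W F p))"
    unfolding hpow_inner by (intro sum.cong refl) (simp add: ampliation_apply[OF h(1)] ampliation_apply[OF u])
  finally have 1: "(\<Sum>p<?n. hinner X (h p) (F p)) = (\<Sum>p<?n. hinner RX (A (h p) + B (u p)) (TA X W F p))" .
  have 2: "hinner (hpow ?n Y) (tf W u) y = (\<Sum>p<?n. hinner Y (C (h p) + D (u p)) (y p))"
    unfolding hpow_inner h(3) by (intro sum.cong refl) (simp add: ampliation_apply[OF h(1)] ampliation_apply[OF u] add.commute)
  have "(\<Sum>p<?n. hinner RX (A (h p) + B (u p)) (TA X W F p)) + (\<Sum>p<?n. hinner Y (C (h p) + D (u p)) (y p))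
      = (\<Sum>p<?n. hinner X (h p) (F p)) + (\<Sum>p<?n. hinner U (u p) (s p))"
    unfolding sum.distrib[symmetric] by (intro sum.cong refl bal) (use h(1) u in auto)
  then show ?thesis unfolding 1 2 by simp
qed

section \<open>The adjoint colligation and its fixed points\<close>

abbreviation "Ts \<equiv> op_adjoint (hsum X U) (hsum RX Y) T"

lemma Ts_bop: "Ts \<in> bop (hsum RX Y) (hsum X U)"
  by (rule op_adjoint_bop[OF hilbert_hsum[OF X U] hilbert_hsum[OF RX Y] T_bop])

lemma Ts_bound: "p \<in> hcarrier (hsum RX Y) \<Longrightarrow> hnorm (hsum X U) (Ts p) \<le> 1 * hnorm (hsum RX Y) p"
  by (rule op_adjoint_bound[OF hilbert_hsum[OF X U] hilbert_hsum[OF RX Y] T_bop _ T_bound]) simp_all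

text \<open>The first component of the equation is a Neumann equation for \<open>F\<close>: the
  adjoint of \<open>A\<close> is a contraction, and \<open>TA X W\<close> has bound
  \<open>cQ W < 1\<close>. Once \<open>F\<close> is found, the second component defines
  \<open>s\<close>.\<close>

lemma state_exists:
  assumes W: "W \<in> \<Delta>" and y: "y \<in> hcarrier (hpow (dim_row W) Y)"
  shows "\<exists>F s. F \<in> hcarrier (hpow (dim_row W) X) \<and> s \<in> hcarrier (hpow (dim_row W) U) \<and>
    (\<forall>p<dim_row W. Ts (TA X W F p, y p) = (F p, s p))"
proof -
  let ?n = "dim_row W"
  let ?i = "\<lambda>x. if x \<in> hcarrier RX then (x, 0) else 0" and ?j = "\<lambda>x. if x \<in> hcarrier Y then (0, x) else 0"
  let ?p = "\<lambda>p. if p \<in> hcarrier (hsum X U) then fst p else 0"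
  have S1: "pre_hilbert (hsum RX Y)" and S2: "pre_hilbert (hsum X U)"
    using pre_hilbert_hsum RXp Yp Xp Up by blast+
  \<comment> \<open>\<open>A'\<close> and \<open>C'\<close> are the adjoints of \<open>A\<close> and
    \<open>C\<close>, extracted from the adjoint colligation as its blocks with values in
    \<open>X\<close>.\<close>
  define A' where "A' = ?p \<circ> (Ts \<circ> ?i)"
  define C' where "C' = ?p \<circ> (Ts \<circ> ?j)"
  have A': "A' \<in> bop RX X" unfolding A'_def
    by (rule bop_compose[OF bop_compose[OF inl_bop(1)[OF RXp Yp] Ts_bop RXp S1] proj_bop(1)[OF Xp Up] RXp S2])
  have C': "C' \<in> bop Y X" unfolding C'_def
    by (rule bop_compose[OF bop_compose[OF inr_bop(1)[OF RXp Yp] Ts_bop Yp S1] proj_bop(1)[OF Xp Up] Yp S2])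
  have A'e: "A' x = fst (Ts (x, 0))" if "x \<in> hcarrier RX" for x
  proof -
    have "(x, 0) \<in> hcarrier (hsum RX Y)" using that Yp by simp
    then have "Ts (x, 0) \<in> hcarrier (hsum X U)" by (rule bop_in[OF Ts_bop])
    then show ?thesis unfolding A'_def o_apply using that by (simp only: if_True)
  qed
  have C'e: "C' x = fst (Ts (0, x))" if "x \<in> hcarrier Y" for x
  proof -
    have "(0, x) \<in> hcarrier (hsum RX Y)" using that RXp by simp
    then have "Ts (0, x) \<in> hcarrier (hsum X U)" by (rule bop_in[OF Ts_bop])
    then show ?thesis unfolding C'_def o_apply using that by (simp only: if_True)
  qed
  have A'b: "hnorm X (A' x) \<le> 1 * hnorm RX x" if x: "x \<in> hcarrier RX" for x
  proof -
    have p: "(x, 0) \<in> hcarrier (hsum RX Y)" using x Yp by simp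
    have "hnorm X (A' x) \<le> hnorm (hsum X U) (Ts (x, 0))"
      unfolding A'e[OF x] by (rule proj_bop(3)[OF Xp Up bop_in[OF Ts_bop p]])
    also have "\<dots> \<le> 1 * hnorm (hsum RX Y) (x, 0)" by (rule Ts_bound[OF p])
    finally show ?thesis unfolding inl_bop(2)[OF RXp Yp x] .
  qed
  let ?N = "ampliation ?n RX A' \<circ> TA X W"
  note TAb = TA_bop[OF W Xp]
  have N: "?N \<in> bop (hpow ?n X) (hpow ?n X)"
    by (rule bop_compose[OF TAb ampliation_bop[OF RXp Xp A'] pre_hilbert_hpow[OF Xp] pre_hilbert_hpow[OF RXp]])
  have Nb: "hnorm (hpow ?n X) (?N x) \<le> cQ W * hnorm (hpow ?n X) x" if x: "x \<in> hcarrier (hpow ?n X)" for x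
  proof -
    have "hnorm (hpow ?n X) (?N x) \<le> 1 * hnorm (hpow ?n RX) (TA X W x)"
      unfolding o_apply by (rule ampliation_bound[OF RXp Xp A' _ A'b bop_in[OF TAb x]]) simp_all
    also have "\<dots> \<le> cQ W * hnorm (hpow ?n X) x" using TA_bound[OF W Xp x] by simp
    finally show ?thesis .
  qed
  have g: "ampliation ?n Y C' y \<in> hcarrier (hpow ?n X)" by (rule bop_in[OF ampliation_bop[OF Yp Xp C'] y])
  obtain F where F: "F \<in> hcarrier (hpow ?n X)" "F - ?N F = ampliation ?n Y C' y"
    using neumann_solution[OF hilbert_hpow[OF X] N cQ(1) cQ(2)[OF W] Nb g] by blast
  define s where "s p = (if p < ?n then snd (Ts (TA X W F p, y p)) else 0)" for p
  have G: "TA X W F p \<in> hcarrier RX" "y p \<in> hcarrier Y" if "p < ?n" for p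
    using bop_in[OF TAb F(1)] y that by auto
  have TsG: "Ts (TA X W F p, y p) \<in> hcarrier (hsum X U)" if "p < ?n" for p
    using G[OF that] by (intro bop_in[OF Ts_bop]) simp
  have "Ts (TA X W F p, y p) = (F p, s p)" if p: "p < ?n" for p
  proof -
    have "F p - ?N F p = ampliation ?n Y C' y p" using fun_cong[OF F(2), of p] unfolding fun_diff_def by (simp only:)
    then have "F p = ?N F p + ampliation ?n Y C' y p" by (simp only: diff_eq_eq add.commute)
    also have "\<dots> = A' (TA X W F p) + C' (y p)"
      by (simp add: ampliation_apply[OF bop_in[OF TAb F(1)] p] ampliation_apply[OF y p])
    also have "\<dots> = fst (Ts (TA X W F p, 0) + Ts (0, y p))" unfolding A'e[OF G(1)[OF p]] C'e[OF G(2)[OF p]] by simp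
    also have "Ts (TA X W F p, 0) + Ts (0, y p) = Ts (TA X W F p, y p)"
    proof -
      have "(TA X W F p, 0) \<in> hcarrier (hsum RX Y)" "(0, y p) \<in> hcarrier (hsum RX Y)" using G[OF p] RXp Yp by simp_all
      from bop_add[OF Ts_bop this] show ?thesis by simp
    qed
    finally show ?thesis unfolding s_def using p by (simp add: prod_eq_iff)
  qed
  moreover have "s \<in> hcarrier (hpow ?n U)" unfolding hpow_carrier s_def using TsG by auto
  ultimately show ?thesis using F(1) by blast
qed

lemma balance:
  assumes W: "W \<in> \<Delta>" and y: "y \<in> hcarrier (hpow (dim_row W) Y)" and F: "F \<in> hcarrier (hpow (dim_row W) X)"
    and p: "p < dim_row W" and e: "Ts (TA X W F p, y p) = (f, s)" and x: "x \<in> hcarrier X" and u: "u \<in> hcarrier U"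
  shows "hinner RX (A x + B u) (TA X W F p) + hinner Y (C x + D u) (y p) = hinner X x f + hinner U u s"
proof -
  have "(TA X W F p, y p) \<in> hcarrier (hsum RX Y)"
    using bop_in[OF TA_bop[OF W Xp] F] y p by auto
  moreover have "(x, u) \<in> hcarrier (hsum X U)" using x u by simp
  ultimately have "hinner (hsum RX Y) (T (x, u)) (TA X W F p, y p) = hinner (hsum X U) (x, u) (Ts (TA X W F p, y p))"
    by (intro op_adjoint_inner[OF hilbert_hsum[OF X U] hilbert_hsum[OF RX Y] T_bop])
  then show ?thesis unfolding e block_apply[OF x u] by simp
qed

end

section \<open>Contractive multipliers\<close>

locale graded_ball = row_ball R Q \<Delta>
  for R :: "'r::complex_vector hspace" and Q :: "'v::complex_vector mat \<Rightarrow> (nat \<Rightarrow> 'r) \<Rightarrow> (nat \<Rightarrow> complex)" and \<Delta> +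
  fixes U :: "'u::complex_vector hspace" and Y :: "'y::complex_vector hspace"
    and S :: "'v mat \<Rightarrow> (nat \<Rightarrow> 'u) \<Rightarrow> (nat \<Rightarrow> 'y)"
  assumes U: "hilbert_space U" and Y: "hilbert_space Y"
    and S: "W \<in> \<Delta> \<Longrightarrow> S W \<in> bop (hpow (dim_row W) U) (hpow (dim_row W) Y)"
begin

lemma Up: "pre_hilbert U" and Yp: "pre_hilbert Y" using U Y by simp_all

definition Sst :: "'v mat \<Rightarrow> (nat \<Rightarrow> 'y) \<Rightarrow> (nat \<Rightarrow> 'u)" where
  "Sst W = op_adjoint (hpow (dim_row W) U) (hpow (dim_row W) Y) (S W)"

lemma
  assumes W: "W \<in> \<Delta>"
  shows Sst_bop: "Sst W \<in> bop (hpow (dim_row W) Y) (hpow (dim_row W) U)"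
    and Sst_inner: "\<And>u y. u \<in> hcarrier (hpow (dim_row W) U) \<Longrightarrow> y \<in> hcarrier (hpow (dim_row W) Y) \<Longrightarrow>
      hinner (hpow (dim_row W) Y) (S W u) y = hinner (hpow (dim_row W) U) u (Sst W y)"
  unfolding Sst_def
  by (rule op_adjoint_bop[OF hilbert_hpow[OF U] hilbert_hpow[OF Y] S[OF W]],
      rule op_adjoint_inner[OF hilbert_hpow[OF U] hilbert_hpow[OF Y] S[OF W]])

definition adj :: "'v mat \<times> (nat \<Rightarrow> complex) \<times> (nat \<Rightarrow> 'y) \<Rightarrow> 'v mat \<times> (nat \<Rightarrow> complex) \<times> (nat \<Rightarrow> 'u)" where
  "adj e = (fst e, fst (snd e), Sst (fst e) (snd (snd e)))"

lemma adj_Ix: "e \<in> Ix Y \<Longrightarrow> adj e \<in> Ix U"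
  unfolding Ix_def adj_def using bop_in[OF Sst_bop] by auto

definition KS :: "'v mat \<times> (nat \<Rightarrow> complex) \<times> (nat \<Rightarrow> 'y) \<Rightarrow> 'v mat \<times> (nat \<Rightarrow> complex) \<times> (nat \<Rightarrow> 'y) \<Rightarrow> complex" where
  "KS e' e = kap Y e' e - kap U (adj e') (adj e)"

abbreviation "HU \<equiv> nc_rkhs \<Delta> U (KE U)"
abbreviation "HY \<equiv> nc_rkhs \<Delta> Y (KE Y)"

lemma HU: "hilbert_space HU" and HY: "hilbert_space HY"
  by (rule nc_rkhs_hilbert[OF U], rule nc_rkhs_hilbert[OF Y])

lemma HUp: "pre_hilbert HU" and HYp: "pre_hilbert HY" using HU HY by simp_all

text \<open>Positivity of \<open>KS\<close> is thereby the statement that sending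
  \<open>ke Y e\<close> to \<open>ke U (adj e)\<close> does not increase the norms of linear
  combinations.\<close>

lemma KS_norm_diff:
  assumes F: "F \<subseteq> Ix Y"
  shows "Re (\<Sum>x\<in>F. \<Sum>y\<in>F. c x * cnj (c y) * KS y x)
    = (hnorm HY (\<Sum>e\<in>F. c e *\<^sub>C ke Y e))\<^sup>2 - (hnorm HU (\<Sum>e\<in>F. c e *\<^sub>C ke U (adj e)))\<^sup>2"
proof -
  have i1: "ke Y e \<in> hcarrier HY" if "e \<in> F" for e using that F by (intro nc_rkhs_ke[OF Y]) auto
  have i2: "ke U (adj e) \<in> hcarrier HU" if "e \<in> F" for e using that F by (intro nc_rkhs_ke[OF U] adj_Ix) auto
  have s1: "(\<Sum>e\<in>F. c e *\<^sub>C ke Y e) \<in> hcarrier HY" using i1 by (intro sum_in[OF HYp] scale_in[OF HYp])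
  have s2: "(\<Sum>e\<in>F. c e *\<^sub>C ke U (adj e)) \<in> hcarrier HU" using i2 by (intro sum_in[OF HUp] scale_in[OF HUp])
  have e1: "hinner HY (\<Sum>e\<in>F. c e *\<^sub>C ke Y e) (\<Sum>e\<in>F. c e *\<^sub>C ke Y e) = (\<Sum>x\<in>F. \<Sum>y\<in>F. c x * cnj (c y) * kap Y y x)"
  proof (rule trans)
    show "hinner HY (\<Sum>e\<in>F. c e *\<^sub>C ke Y e) (\<Sum>e\<in>F. c e *\<^sub>C ke Y e) = (\<Sum>x\<in>F. \<Sum>y\<in>F. c x * cnj (c y) * hinner HY (ke Y x) (ke Y y))"
      by (rule inner_lincomb[OF HYp]) (rule i1, assumption)+
    show "(\<Sum>x\<in>F. \<Sum>y\<in>F. c x * cnj (c y) * hinner HY (ke Y x) (ke Y y)) = (\<Sum>x\<in>F. \<Sum>y\<in>F. c x * cnj (c y) * kap Y y x)"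
      proof (rule sum.cong[OF refl], rule sum.cong[OF refl])
        fix x y assume "x \<in> F" "y \<in> F"
        then have "x \<in> Ix Y" "y \<in> Ix Y" using F by auto
        then show "c x * cnj (c y) * hinner HY (ke Y x) (ke Y y) = c x * cnj (c y) * kap Y y x"
          by (simp only: nc_rkhs_gram[OF Y])
      qed
  qed
  have e2: "hinner HU (\<Sum>e\<in>F. c e *\<^sub>C ke U (adj e)) (\<Sum>e\<in>F. c e *\<^sub>C ke U (adj e))
      = (\<Sum>x\<in>F. \<Sum>y\<in>F. c x * cnj (c y) * kap U (adj y) (adj x))"
  proof (rule trans)
    show "hinner HU (\<Sum>e\<in>F. c e *\<^sub>C ke U (adj e)) (\<Sum>e\<in>F. c e *\<^sub>C ke U (adj e)) = (\<Sum>x\<in>F. \<Sum>y\<in>F. c x * cnj (c y) * hinner HU (ke U (adj x)) (ke U (adj y)))"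
      by (rule inner_lincomb[OF HUp]) (rule i2, assumption)+
    show "(\<Sum>x\<in>F. \<Sum>y\<in>F. c x * cnj (c y) * hinner HU (ke U (adj x)) (ke U (adj y))) = (\<Sum>x\<in>F. \<Sum>y\<in>F. c x * cnj (c y) * kap U (adj y) (adj x))"
      proof (rule sum.cong[OF refl], rule sum.cong[OF refl])
        fix x y assume "x \<in> F" "y \<in> F"
        then have "adj x \<in> Ix U" "adj y \<in> Ix U" using F by (blast intro: adj_Ix)+
        then show "c x * cnj (c y) * hinner HU (ke U (adj x)) (ke U (adj y)) = c x * cnj (c y) * kap U (adj y) (adj x)"
          by (simp only: nc_rkhs_gram[OF U])
      qed
  qed
  show ?thesis
    unfolding hnorm_sq[OF HYp s1] hnorm_sq[OF HUp s2] e1 e2 KS_def right_diff_distrib sum_subtractf by simp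
qed

text \<open>The pairing of the product of \<open>S\<close> and \<open>f\<close> with a kernel
  element is computed from values alone, before it is known whether the product lies in
  \<open>HY\<close>; both directions between multipliers and positivity rest on it.\<close>

lemma multiplier_inner:
  assumes f: "f \<in> hcarrier HU" and e: "e \<in> Ix Y"
  shows "hinner (hpow (dim_row (fst e)) Y) (S (fst e) (f (fst e) (\<lambda>i. cnj (fst (snd e) i)))) (snd (snd e))
    = hinner HU f (ke U (adj e))"
proof -
  have W: "fst e \<in> \<Delta>" and v: "fst (snd e) \<in> hcarrier (cpow (dim_row (fst e)))"
    and y: "snd (snd e) \<in> hcarrier (hpow (dim_row (fst e)) Y)" using e unfolding Ix_def by auto
  have a: "fst (adj e) = fst e" "fst (snd (adj e)) = fst (snd e)" "snd (snd (adj e)) = Sst (fst e) (snd (snd e))"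
    unfolding adj_def by simp_all
  show ?thesis
    unfolding a nc_rkhs_eval[OF U adj_Ix[OF e] f, unfolded a]
    by (rule Sst_inner[OF W bop_in[OF nc_rkhs_bop[OF U f W] cnj_cpow[OF v]] y])
qed

lemma KS_herm:
  assumes "x \<in> Ix Y" "y \<in> Ix Y"
  shows "KS y x = cnj (KS x y)"
  unfolding KS_def
  using psd_herm[OF kap_psd[OF Yp] assms] psd_herm[OF kap_psd[OF Up] adj_Ix[OF assms(1)] adj_Ix[OF assms(2)]]
  by simp

text \<open>With \<open>x\<close> a combination of kernel elements and \<open>z\<close> the same
  combination of their counterparts, the squared norm of \<open>z\<close> equals the inner product
  of \<open>M z\<close> with \<open>x\<close>. Contractivity of \<open>M\<close> bounds it by the
  product of the norms of \<open>z\<close> and \<open>x\<close>, and one factor cancels.\<close>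

lemma multiplier_psd:
  assumes "S \<in> contractive_multipliers \<Delta> U Y (KE U) (KE Y)"
  shows "psd (Ix Y) KS"
proof (rule psdI[OF KS_herm])
  let ?M = "mult_op \<Delta> HU S"
  have c: "contractive_op HU HY ?M" using assms unfolding contractive_multipliers_def by simp
  then have M: "?M \<in> bop HU HY" unfolding contractive_op_def by simp
  fix F c assume F: "finite F" "F \<subseteq> Ix Y"
  let ?x = "\<Sum>e\<in>F. c e *\<^sub>C ke Y e" and ?z = "\<Sum>e\<in>F. c e *\<^sub>C ke U (adj e)"
  have i1: "ke Y e \<in> hcarrier HY" if "e \<in> F" for e using that F by (intro nc_rkhs_ke[OF Y]) auto
  have i2: "ke U (adj e) \<in> hcarrier HU" if "e \<in> F" for e using that F by (intro nc_rkhs_ke[OF U] adj_Ix) auto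
  have s1: "?x \<in> hcarrier HY" using i1 by (intro sum_in[OF HYp] scale_in[OF HYp])
  have s2: "?z \<in> hcarrier HU" using i2 by (intro sum_in[OF HUp] scale_in[OF HUp])
  have "hinner HU ?z ?z = (\<Sum>e\<in>F. cnj (c e) * hinner HU ?z (ke U (adj e)))"
    by (rule inner_lincomb_right[OF HUp _ s2]) (rule i2)
  also have "\<dots> = (\<Sum>e\<in>F. cnj (c e) * hinner HY (?M ?z) (ke Y e))"
  proof (rule sum.cong[OF refl])
    fix e assume "e \<in> F"
    then have e: "e \<in> Ix Y" using F by auto
    then have W: "fst e \<in> \<Delta>" unfolding Ix_def by auto
    have "?M ?z (fst e) = S (fst e) \<circ> ?z (fst e)" unfolding mult_op_def using W s2 by (simp only: if_True)
    then show "cnj (c e) * hinner HU ?z (ke U (adj e)) = cnj (c e) * hinner HY (?M ?z) (ke Y e)"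
      unfolding nc_rkhs_eval[OF Y e bop_in[OF M s2]] multiplier_inner[OF s2 e, symmetric] by (simp only: o_apply)
  qed
  also have "\<dots> = hinner HY (?M ?z) ?x"
    by (rule inner_lincomb_right[OF HYp _ bop_in[OF M s2], symmetric]) (rule i1)
  finally have "(hnorm HU ?z)\<^sup>2 = Re (hinner HY (?M ?z) ?x)" unfolding hnorm_sq[OF HUp s2] by simp
  also have "\<dots> \<le> hnorm HY (?M ?z) * hnorm HY ?x" by (rule inner_le[OF HYp bop_in[OF M s2] s1])
  also have "\<dots> \<le> hnorm HU ?z * hnorm HY ?x"
    by (rule mult_right_mono[OF contractive_bound[OF HU HYp c s2] hnorm_nonneg[OF HYp s1]])
  finally have "hnorm HU ?z \<le> hnorm HY ?x"
    using hnorm_nonneg[OF HUp s2] hnorm_nonneg[OF HYp s1]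
    by (cases "hnorm HU ?z = 0") (simp_all add: power2_eq_square)
  then have "(hnorm HU ?z)\<^sup>2 \<le> (hnorm HY ?x)\<^sup>2" using hnorm_nonneg[OF HUp s2] by (rule power_mono)
  then show "0 \<le> Re (\<Sum>x\<in>F. \<Sum>y\<in>F. c x * cnj (c y) * KS y x)" unfolding KS_norm_diff[OF F(2)] by simp
qed

text \<open>Positivity makes the map from \<open>ke Y e\<close> to \<open>ke U (adj e)\<close>
  extend to a contraction \<open>T\<close>. Its adjoint takes values in \<open>HY\<close> by
  construction, so identifying multiplication by \<open>S\<close> with this adjoint gives membership
  and the norm bound together.\<close>

lemma psd_multiplier:
  assumes nc: "nc_function \<Delta> U Y S" and psd: "psd (Ix Y) KS"
  shows "S \<in> contractive_multipliers \<Delta> U Y (KE U) (KE Y)"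
proof -
  have i1: "ke Y e \<in> hcarrier HY" if "e \<in> Ix Y" for e using that by (rule nc_rkhs_ke[OF Y])
  have i2: "ke U (adj e) \<in> hcarrier HU" if "e \<in> Ix Y" for e using adj_Ix[OF that] by (rule nc_rkhs_ke[OF U])
  have bnd: "hnorm HU (\<Sum>e\<in>F. c e *\<^sub>C ke U (adj e)) \<le> 1 * hnorm HY (\<Sum>e\<in>F. c e *\<^sub>C ke Y e)"
    if F: "finite F" "F \<subseteq> Ix Y" for F c
  proof -
    have s1: "(\<Sum>e\<in>F. c e *\<^sub>C ke Y e) \<in> hcarrier HY" using i1 F by (intro sum_in[OF HYp] scale_in[OF HYp]) auto
    have "(hnorm HU (\<Sum>e\<in>F. c e *\<^sub>C ke U (adj e)))\<^sup>2 \<le> (hnorm HY (\<Sum>e\<in>F. c e *\<^sub>C ke Y e))\<^sup>2"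
      using psd_nonneg[OF psd F, of c] unfolding KS_norm_diff[OF F(2)] by simp
    then have "hnorm HU (\<Sum>e\<in>F. c e *\<^sub>C ke U (adj e)) \<le> hnorm HY (\<Sum>e\<in>F. c e *\<^sub>C ke Y e)"
      by (rule le_of_sq_le[OF _ hnorm_nonneg[OF HYp s1]])
    then show ?thesis by simp
  qed
  obtain T where T: "T \<in> bop HY HU" "\<And>e. e \<in> Ix Y \<Longrightarrow> T (ke Y e) = ke U (adj e)"
    "\<And>x. x \<in> hcarrier HY \<Longrightarrow> hnorm HU (T x) \<le> 1 * hnorm HY x"
  proof (rule bounded_extension[of HY HU "Ix Y" "ke Y" "\<lambda>e. ke U (adj e)" 1])
    show "z = 0" if "z \<in> hcarrier HY" "\<And>e. e \<in> Ix Y \<Longrightarrow> hinner HY z (ke Y e) = 0" for z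
      using that by (rule nc_rkhs_total[OF Y])
  qed (use HY HU i1 i2 bnd in auto)
  let ?T = "op_adjoint HY HU T"
  note Tb = op_adjoint_bop[OF HY HU T(1)]
  \<comment> \<open>Equality is that of HOL functions, so it is also checked off the carrier, off
    \<open>\<Delta>\<close> and off \<open>cpow\<close>, where both sides are 0; elsewhere values
    are compared by pairing with \<open>y\<close>, that is, with kernel elements.\<close>
  have "mult_op \<Delta> HU S = ?T"
  proof
    fix f
    show "mult_op \<Delta> HU S f = ?T f"
    proof (cases "f \<in> hcarrier HU")
      case False
      then show ?thesis unfolding bop_off[OF Tb False] mult_op_def by (simp only: if_False)
    next
      case f: True
      note Tf = bop_in[OF Tb f]
      show ?thesis
      proof (rule ext)
        fix W
        show "mult_op \<Delta> HU S f W = ?T f W"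
        proof (cases "W \<in> \<Delta>")
          case False
          then show ?thesis unfolding nc_rkhs_off[OF Y Tf False] mult_op_def using f by (simp only: if_True if_False)
        next
          case W: True
          have m: "mult_op \<Delta> HU S f W u = S W (f W u)" for u
            unfolding mult_op_def using f W by (simp only: if_True o_apply)
          note fb = nc_rkhs_bop[OF U f W] and Tfb = nc_rkhs_bop[OF Y Tf W]
          show ?thesis
          proof (rule ext)
            fix u
            show "mult_op \<Delta> HU S f W u = ?T f W u"
            proof (cases "u \<in> hcarrier (cpow (dim_row W))")
              case False
              show ?thesis unfolding m bop_off[OF fb False] bop_off[OF Tfb False] by (rule bop_zero[OF S[OF W]])
            next
              case u: True
              show ?thesis unfolding m
              proof (rule inner_ext[OF hilbert_hpow[OF Y] bop_in[OF S[OF W] bop_in[OF fb u]] bop_in[OF Tfb u]])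
                fix y assume y: "y \<in> hcarrier (hpow (dim_row W) Y)"
                let ?e = "(W, \<lambda>i. cnj (u i), y)"
                have e: "?e \<in> Ix Y" unfolding Ix_iff using W cnj_cpow[OF u] y by simp
                have "hinner (hpow (dim_row W) Y) (S W (f W u)) y = hinner HU f (ke U (adj ?e))"
                  using multiplier_inner[OF f e] by simp
                also have "\<dots> = hinner HU f (T (ke Y ?e))" unfolding T(2)[OF e] ..
                also have "\<dots> = hinner HY (?T f) (ke Y ?e)" by (rule op_adjoint_inner'[OF HY HU T(1) i1[OF e] f])
                also have "\<dots> = hinner (hpow (dim_row W) Y) (?T f W u) y"
                  unfolding nc_rkhs_eval[OF Y e Tf] by simp
                finally show "hinner (hpow (dim_row W) Y) (S W (f W u)) y = hinner (hpow (dim_row W) Y) (?T f W u) y" .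
              qed
            qed
          qed
        qed
      qed
    qed
  qed
  moreover have "op_norm HU HY ?T \<le> 1"
  proof (rule op_norm_le[OF HUp])
    fix x assume x: "x \<in> hcarrier HU"
    show "hnorm HY (?T x) \<le> 1 * hnorm HU x"
      by (rule op_adjoint_bound[OF HY HU T(1) _ T(3) x]) simp_all
  qed simp
  ultimately show ?thesis unfolding contractive_multipliers_def contractive_op_def using nc Tb by simp
qed

end

section \<open>Realizations give multipliers\<close>

lemma psd_defect:
  assumes H: "pre_hilbert H" and K: "pre_hilbert K" and T: "T \<in> bop H K"
    and bnd: "\<And>x. x \<in> hcarrier H \<Longrightarrow> hnorm K (T x) \<le> 1 * hnorm H x" and g: "\<And>x. x \<in> E \<Longrightarrow> g x \<in> hcarrier H"
  shows "psd E (\<lambda>y x. hinner H (g x) (g y) - hinner K (T (g x)) (T (g y)))"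
proof (rule psdI)
  show "hinner H (g x) (g y) - hinner K (T (g x)) (T (g y)) = cnj (hinner H (g y) (g x) - hinner K (T (g y)) (T (g x)))"
    if "x \<in> E" "y \<in> E" for x y
    using inner_commute[OF H g[OF that(2)] g[OF that(1)]] inner_commute[OF K bop_in[OF T g[OF that(2)]] bop_in[OF T g[OF that(1)]]]
    by simp
  fix F c assume F: "finite F" "F \<subseteq> E"
  have gF: "g x \<in> hcarrier H" if "x \<in> F" for x using that F g by auto
  have TgF: "T (g x) \<in> hcarrier K" if "x \<in> F" for x using gF[OF that] by (rule bop_in[OF T])
  let ?x = "\<Sum>x\<in>F. c x *\<^sub>C g x"
  have x: "?x \<in> hcarrier H" using gF by (intro sum_in[OF H] scale_in[OF H])
  have 1: "hinner H ?x ?x = (\<Sum>x\<in>F. \<Sum>y\<in>F. c x * cnj (c y) * hinner H (g x) (g y))"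
    by (rule inner_lincomb[OF H]) (rule gF, assumption)+
  have Tx: "T ?x = (\<Sum>x\<in>F. c x *\<^sub>C T (g x))" by (rule bop_lincomb[OF H T]) (rule gF)
  have 2: "hinner K (T ?x) (T ?x) = (\<Sum>x\<in>F. \<Sum>y\<in>F. c x * cnj (c y) * hinner K (T (g x)) (T (g y)))"
    unfolding Tx by (rule inner_lincomb[OF K]) (rule TgF, assumption)+
  have "(hnorm K (T ?x))\<^sup>2 \<le> (hnorm H ?x)\<^sup>2"
    using bnd[OF x] hnorm_nonneg[OF K bop_in[OF T x]] by (intro power_mono) simp_all
  then show "0 \<le> Re (\<Sum>x\<in>F. \<Sum>y\<in>F. c x * cnj (c y) * (hinner H (g x) (g y) - hinner K (T (g x)) (T (g y))))"
    unfolding hnorm_sq[OF H x] hnorm_sq[OF K bop_in[OF T x]] 1 2 right_diff_distrib sum_subtractf by simp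
qed

definition mat_star :: "complex mat \<Rightarrow> complex mat" where
  "mat_star \<alpha> = mat (dim_col \<alpha>) (dim_row \<alpha>) (\<lambda>(j, i). cnj (\<alpha> $$ (i, j)))"

lemma mat_star_carrier: "\<alpha> \<in> carrier_mat n m \<Longrightarrow> mat_star \<alpha> \<in> carrier_mat m n"
  unfolding mat_star_def by auto

lemma mat_star_apply:
  assumes "\<alpha> \<in> carrier_mat n m" "y \<in> hcarrier (hpow n H)" "j < m"
  shows "mat_op (mat_star \<alpha>) H y j = (\<Sum>i<n. cnj (\<alpha> $$ (i, j)) *\<^sub>C y i)"
  unfolding mat_op_apply[OF mat_star_carrier[OF assms(1)] assms(2,3)]
  using assms(1,3) by (intro sum.cong refl) (simp add: mat_star_def)

lemma mat_op_inner:
  assumes H: "pre_hilbert H" and \<alpha>: "\<alpha> \<in> carrier_mat n m" and u: "u \<in> hcarrier (hpow m H)" and y: "y \<in> hcarrier (hpow n H)"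
  shows "hinner (hpow n H) (mat_op \<alpha> H u) y = hinner (hpow m H) u (mat_op (mat_star \<alpha>) H y)"
proof -
  have "hinner (hpow n H) (mat_op \<alpha> H u) y = (\<Sum>i<n. \<Sum>j<m. \<alpha> $$ (i, j) * hinner H (u j) (y i))"
    unfolding hpow_inner
  proof (rule sum.cong[OF refl])
    fix i assume "i \<in> {..<n}"
    then have i: "i < n" by simp
    show "hinner H (mat_op \<alpha> H u i) (y i) = (\<Sum>j<m. \<alpha> $$ (i, j) * hinner H (u j) (y i))"
      unfolding mat_op_apply[OF \<alpha> u i] by (rule inner_lincomb_left[OF H]) (use u y i in auto)
  qed
  also have "\<dots> = (\<Sum>j<m. \<Sum>i<n. \<alpha> $$ (i, j) * hinner H (u j) (y i))" by (rule sum.swap)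
  also have "\<dots> = hinner (hpow m H) u (mat_op (mat_star \<alpha>) H y)"
    unfolding hpow_inner
  proof (rule sum.cong[OF refl])
    fix j assume "j \<in> {..<m}"
    then have j: "j < m" by simp
    have "hinner H (u j) (mat_op (mat_star \<alpha>) H y j) = (\<Sum>i<n. cnj (cnj (\<alpha> $$ (i, j))) * hinner H (u j) (y i))"
      unfolding mat_star_apply[OF \<alpha> y j] by (rule inner_lincomb_right[OF H]) (use u y j in auto)
    then show "(\<Sum>i<n. \<alpha> $$ (i, j) * hinner H (u j) (y i)) = hinner H (u j) (mat_op (mat_star \<alpha>) H y j)" by simp
  qed
  finally show ?thesis .
qed

lemma sum_scale_prod: "(\<Sum>i\<in>F. c i *\<^sub>C (a i, b i)) = (\<Sum>i\<in>F. c i *\<^sub>C a i, \<Sum>i\<in>F. c i *\<^sub>C b i)"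
  by (simp add: prod_eq_iff fst_sum snd_sum scaleC_prod_def)

context row_ball
begin

text \<open>This is \<open>q_intertwine\<close> tensored with the identity of \<open>X\<close> and
  read in component \<open>p\<close>: the operators \<open>TA\<close> intertwine the adjoint of
  \<open>\<alpha>\<close>.\<close>

lemma TA_intertwine:
  assumes X: "pre_hilbert X" and Z: "Z \<in> \<Delta>" and Z': "Z' \<in> \<Delta>" and \<alpha>: "\<alpha> \<in> carrier_mat (dim_row Z') (dim_row Z)"
    and eq: "lact \<alpha> Z = ract Z' \<alpha>" and F: "F \<in> hcarrier (hpow (dim_row Z') X)" and p: "p < dim_row Z"
  shows "TA X Z (mat_op (mat_star \<alpha>) X F) p = (\<Sum>j<dim_row Z'. cnj (\<alpha> $$ (j, p)) *\<^sub>C TA X Z' F j)"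
proof -
  let ?n = "dim_row Z" and ?m = "dim_row Z'" and ?et = "elem_tensor R X"
  have sF: "mat_op (mat_star \<alpha>) X F \<in> hcarrier (hpow ?n X)" by (rule bop_in[OF mat_op_bop[OF X mat_star_carrier[OF \<alpha>]] F])
  have "TA X Z (mat_op (mat_star \<alpha>) X F) p = (\<Sum>l<?n. ?et (q Z l p) (mat_op (mat_star \<alpha>) X F l))"
    by (rule TA_apply[OF Z X sF p])
  also have "\<dots> = (\<Sum>l<?n. \<Sum>i<?m. cnj (\<alpha> $$ (i, l)) *\<^sub>C ?et (q Z l p) (F i))"
  proof (rule sum.cong[OF refl])
    fix l assume "l \<in> {..<?n}"
    then have l: "l < ?n" by simp
    have "tensor_left R X (q Z l p) (\<Sum>i<?m. cnj (\<alpha> $$ (i, l)) *\<^sub>C F i) = (\<Sum>i<?m. cnj (\<alpha> $$ (i, l)) *\<^sub>C tensor_left R X (q Z l p) (F i))"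
      by (rule bop_lincomb[OF X tensor_left_bop[OF Rp X q_in[OF Z l]]]) (use F in auto)
    moreover have "(\<Sum>i<?m. cnj (\<alpha> $$ (i, l)) *\<^sub>C F i) \<in> hcarrier X" by (intro sum_in[OF X] scale_in[OF X]) (use F in auto)
    moreover have "tensor_left R X (q Z l p) (F i) = ?et (q Z l p) (F i)" if "i < ?m" for i
      using F that by (simp add: tensor_left_def[OF Rp X])
    ultimately show "?et (q Z l p) (mat_op (mat_star \<alpha>) X F l) = (\<Sum>i<?m. cnj (\<alpha> $$ (i, l)) *\<^sub>C ?et (q Z l p) (F i))"
      unfolding mat_star_apply[OF \<alpha> F l] by (simp add: tensor_left_def[OF Rp X])
  qed
  also have "\<dots> = (\<Sum>i<?m. \<Sum>l<?n. cnj (\<alpha> $$ (i, l)) *\<^sub>C ?et (q Z l p) (F i))" by (rule sum.swap)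
  also have "\<dots> = (\<Sum>i<?m. \<Sum>j<?m. cnj (\<alpha> $$ (j, p)) *\<^sub>C ?et (q Z' i j) (F i))"
  proof (rule sum.cong[OF refl])
    fix i assume "i \<in> {..<?m}"
    then have i: "i < ?m" by simp
    have "(\<Sum>l<?n. cnj (\<alpha> $$ (i, l)) *\<^sub>C ?et (q Z l p) (F i)) = ?et (\<Sum>l<?n. cnj (\<alpha> $$ (i, l)) *\<^sub>C q Z l p) (F i)"
      by (rule et_sum_left[OF Rp X, symmetric]) (use q_in[OF Z] in auto)
    also have "\<dots> = ?et (\<Sum>j<?m. cnj (\<alpha> $$ (j, p)) *\<^sub>C q Z' i j) (F i)"
      unfolding q_intertwine[OF Z Z' \<alpha> eq i p] ..
    also have "\<dots> = (\<Sum>j<?m. cnj (\<alpha> $$ (j, p)) *\<^sub>C ?et (q Z' i j) (F i))"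
      by (rule et_sum_left[OF Rp X]) (use q_in[OF Z' i] in auto)
    finally show "(\<Sum>l<?n. cnj (\<alpha> $$ (i, l)) *\<^sub>C ?et (q Z l p) (F i)) = (\<Sum>j<?m. cnj (\<alpha> $$ (j, p)) *\<^sub>C ?et (q Z' i j) (F i))" .
  qed
  also have "\<dots> = (\<Sum>j<?m. \<Sum>i<?m. cnj (\<alpha> $$ (j, p)) *\<^sub>C ?et (q Z' i j) (F i))" by (rule sum.swap)
  also have "\<dots> = (\<Sum>j<?m. cnj (\<alpha> $$ (j, p)) *\<^sub>C TA X Z' F j)"
    by (rule sum.cong[OF refl]) (simp add: TA_apply[OF Z' X F] scaleC_sum_right)
  finally show ?thesis .
qed

lemma TA_inner:
  assumes X: "pre_hilbert X" and Z: "Z \<in> \<Delta>" and W: "W \<in> \<Delta>" and G: "G \<in> hcarrier (hpow (dim_row Z) X)"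
    and F: "F \<in> hcarrier (hpow (dim_row W) X)" and i: "i < dim_row Z" and l: "l < dim_row W"
  shows "hinner (htensor R X) (TA X W F l) (TA X Z G i)
    = (\<Sum>a<dim_row Z. \<Sum>b<dim_row W. hinner R (q W b l) (q Z a i) * hinner X (F b) (G a))"
proof -
  have RXp: "pre_hilbert (htensor R X)" using hilbert_htensor[OF Rp X] by simp
  have "hinner (htensor R X) (TA X W F l) (TA X Z G i) = (\<Sum>b<dim_row W. \<Sum>a<dim_row Z.
     hinner (htensor R X) (elem_tensor R X (q W b l) (F b)) (elem_tensor R X (q Z a i) (G a)))"
    unfolding TA_apply[OF W X F l] TA_apply[OF Z X G i]
    by (rule inner_sums[OF RXp]) (use q_in[OF W] q_in[OF Z] F G Rp X in auto)
  also have "\<dots> = (\<Sum>b<dim_row W. \<Sum>a<dim_row Z. hinner R (q W b l) (q Z a i) * hinner X (F b) (G a))"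
    by (rule sum.cong[OF refl], rule sum.cong[OF refl], rule et_inner[OF Rp X]) (use q_in[OF W] q_in[OF Z] F G in auto)
  finally show ?thesis by (simp only: sum.swap[of _ "{..<dim_row W}"])
qed

end

context realization
begin

text \<open>Any solution of the fixed point equation determines the adjoint of the transfer
  function, through \<open>balance\<close> and \<open>transfer_adjoint\<close>. A solution found in
  another way, such as one transported along \<open>\<alpha>\<close>, may therefore be
  inserted.\<close>

lemma state_adjoint:
  assumes S: "graded_ball R Q \<Delta> U Y S" and tf: "S W = tf W" and W: "W \<in> \<Delta>"
    and F: "F \<in> hcarrier (hpow (dim_row W) X)" and y: "y \<in> hcarrier (hpow (dim_row W) Y)"
    and s: "s \<in> hcarrier (hpow (dim_row W) U)"
    and e: "\<And>p. p < dim_row W \<Longrightarrow> Ts (TA X W F p, y p) = (F p, s p)"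
  shows "graded_ball.Sst U Y S W y = s"
proof -
  interpret g: graded_ball R Q \<Delta> U Y S by (rule S)
  show ?thesis
  proof (rule inner_ext_right[OF hilbert_hpow[OF U] bop_in[OF g.Sst_bop[OF W] y] s])
    fix u assume u: "u \<in> hcarrier (hpow (dim_row W) U)"
    have "hinner (hpow (dim_row W) U) u (g.Sst W y) = hinner (hpow (dim_row W) Y) (tf W u) y"
      using g.Sst_inner[OF W u y] tf by simp
    also have "\<dots> = (\<Sum>p<dim_row W. hinner U (u p) (s p))"
      by (rule transfer_adjoint[OF W u F y]) (rule balance[OF W y F _ e])
    finally show "hinner (hpow (dim_row W) U) u (g.Sst W y) = hinner (hpow (dim_row W) U) u s" unfolding hpow_inner .
  qed
qed

text \<open>The nc property is verified on adjoints, where the inverse in the transfer function is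
  hidden in a fixed point equation that intertwines term by term. Contractivity reduces to
  positivity of \<open>KS\<close>, obtained by weighting the defect of the adjoint colligation with
  the scalar kernel.\<close>

lemma realization_multiplier:
  assumes S: "graded_ball R Q \<Delta> U Y S" and tf: "\<And>W. W \<in> \<Delta> \<Longrightarrow> S W = tf W"
  shows "nc_function \<Delta> U Y S" and "S \<in> contractive_multipliers \<Delta> U Y (KE U) (KE Y)"
proof -
  interpret g: graded_ball R Q \<Delta> U Y S by (rule S)
  note RYp = pre_hilbert_hsum[OF RXp Yp] and XUp = pre_hilbert_hsum[OF Xp Up]
  have st: "\<exists>F. F \<in> hcarrier (hpow (dim_row W) X) \<and> (\<forall>p<dim_row W. Ts (TA X W F p, y p) = (F p, g.Sst W y p))"
    if W: "W \<in> \<Delta>" and y: "y \<in> hcarrier (hpow (dim_row W) Y)" for W y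
  proof -
    from state_exists[OF W y] obtain F s where Fs: "F \<in> hcarrier (hpow (dim_row W) X)" "s \<in> hcarrier (hpow (dim_row W) U)"
      and e: "\<forall>p<dim_row W. Ts (TA X W F p, y p) = (F p, s p)" by blast
    have "g.Sst W y = s" by (rule state_adjoint[OF S tf[OF W] W Fs(1) y Fs(2)]) (use e in blast)
    with Fs e show ?thesis by blast
  qed
  show nc: "nc_function \<Delta> U Y S"
    unfolding nc_function_def graded_def
  proof (intro conjI ballI impI)
    show "S Z \<in> bop (hpow (dim_row Z) U) (hpow (dim_row Z) Y)" if "Z \<in> \<Delta>" for Z by (rule g.S[OF that])
    fix Z Z' \<alpha> assume Z: "Z \<in> \<Delta>" and Z': "Z' \<in> \<Delta>" and \<alpha>: "\<alpha> \<in> carrier_mat (dim_row Z') (dim_row Z)"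
      and eq: "lact \<alpha> Z = ract Z' \<alpha>"
    let ?n = "dim_row Z" and ?m = "dim_row Z'"
    note aY = mat_op_bop[OF Yp \<alpha>] and aU = mat_op_bop[OF Up \<alpha>]
    note sY = mat_op_bop[OF Yp mat_star_carrier[OF \<alpha>]] and sU = mat_op_bop[OF Up mat_star_carrier[OF \<alpha>]]
      and sX = mat_op_bop[OF Xp mat_star_carrier[OF \<alpha>]]
    show "mat_op \<alpha> Y \<circ> S Z = S Z' \<circ> mat_op \<alpha> U"
    proof (rule ext)
      fix u
      show "(mat_op \<alpha> Y \<circ> S Z) u = (S Z' \<circ> mat_op \<alpha> U) u"
      proof (cases "u \<in> hcarrier (hpow ?n U)")
        case False
        show ?thesis unfolding o_apply bop_off[OF g.S[OF Z] False] bop_off[OF aU False] bop_zero[OF aY] bop_zero[OF g.S[OF Z']] ..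
      next
        case u: True
        note Su = bop_in[OF g.S[OF Z] u] and au = bop_in[OF aU u]
        show ?thesis unfolding o_apply
        proof (rule inner_ext[OF hilbert_hpow[OF Y] bop_in[OF aY Su] bop_in[OF g.S[OF Z'] au]])
          fix y assume y: "y \<in> hcarrier (hpow ?m Y)"
          from st[OF Z' y] obtain F where F: "F \<in> hcarrier (hpow ?m X)"
            and e: "\<And>p. p < ?m \<Longrightarrow> Ts (TA X Z' F p, y p) = (F p, g.Sst Z' y p)" by blast
          note s = bop_in[OF g.Sst_bop[OF Z'] y]
          have Sst: "g.Sst Z (mat_op (mat_star \<alpha>) Y y) = mat_op (mat_star \<alpha>) U (g.Sst Z' y)"
          \<comment> \<open>The adjoint of \<open>\<alpha>\<close> carries the solution at
            \<open>Z'\<close> to a solution at \<open>Z\<close>, because it commutes with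
            \<open>TA\<close> and acts by linear combinations of the values of
            \<open>Ts\<close>.\<close>
          proof (rule state_adjoint[OF S tf[OF Z] Z bop_in[OF sX F] bop_in[OF sY y] bop_in[OF sU s]])
            fix p assume p: "p < ?n"
            have in1: "(TA X Z' F j, y j) \<in> hcarrier (hsum RX Y)" if "j \<in> {..<?m}" for j
              using bop_in[OF TA_bop[OF Z' Xp] F] y that by auto
            have "Ts (TA X Z (mat_op (mat_star \<alpha>) X F) p, mat_op (mat_star \<alpha>) Y y p)
                = Ts (\<Sum>j<?m. cnj (\<alpha> $$ (j, p)) *\<^sub>C (TA X Z' F j, y j))"
              unfolding sum_scale_prod TA_intertwine[OF Xp Z Z' \<alpha> eq F p] mat_star_apply[OF \<alpha> y p] ..
            also have "\<dots> = (\<Sum>j<?m. cnj (\<alpha> $$ (j, p)) *\<^sub>C Ts (TA X Z' F j, y j))"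
              by (rule bop_lincomb[OF RYp Ts_bop in1])
            also have "\<dots> = (\<Sum>j<?m. cnj (\<alpha> $$ (j, p)) *\<^sub>C (F j, g.Sst Z' y j))"
              by (rule sum.cong[OF refl]) (simp add: e)
            also have "\<dots> = (mat_op (mat_star \<alpha>) X F p, mat_op (mat_star \<alpha>) U (g.Sst Z' y) p)"
              unfolding sum_scale_prod mat_star_apply[OF \<alpha> F p] mat_star_apply[OF \<alpha> s p] ..
            finally show "Ts (TA X Z (mat_op (mat_star \<alpha>) X F) p, mat_op (mat_star \<alpha>) Y y p)
                = (mat_op (mat_star \<alpha>) X F p, mat_op (mat_star \<alpha>) U (g.Sst Z' y) p)" .
          qed
          have "hinner (hpow ?m Y) (mat_op \<alpha> Y (S Z u)) y = hinner (hpow ?n Y) (S Z u) (mat_op (mat_star \<alpha>) Y y)"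
            by (rule mat_op_inner[OF Yp \<alpha> Su y])
          also have "\<dots> = hinner (hpow ?n U) u (g.Sst Z (mat_op (mat_star \<alpha>) Y y))"
            by (rule g.Sst_inner[OF Z u bop_in[OF sY y]])
          also have "\<dots> = hinner (hpow ?m U) (mat_op \<alpha> U u) (g.Sst Z' y)"
            unfolding Sst by (rule mat_op_inner[OF Up \<alpha> u s, symmetric])
          also have "\<dots> = hinner (hpow ?m Y) (S Z' (mat_op \<alpha> U u)) y"
            by (rule g.Sst_inner[OF Z' au y, symmetric])
          finally show "hinner (hpow ?m Y) (mat_op \<alpha> Y (S Z u)) y = hinner (hpow ?m Y) (S Z' (mat_op \<alpha> U u)) y" .
        qed
      qed
    qed
  qed
  have "\<exists>F. F \<in> hcarrier (hpow (dim_row (fst e)) X) \<and>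
      (\<forall>p<dim_row (fst e). Ts (TA X (fst e) F p, snd (snd e) p) = (F p, snd (snd (g.adj e)) p))" if "e \<in> Ix Y" for e
    using st[of "fst e" "snd (snd e)"] that unfolding Ix_def g.adj_def by simp
  then obtain F where F: "\<And>e. e \<in> Ix Y \<Longrightarrow> F e \<in> hcarrier (hpow (dim_row (fst e)) X)"
    and Fe: "\<And>e p. e \<in> Ix Y \<Longrightarrow> p < dim_row (fst e) \<Longrightarrow>
      Ts (TA X (fst e) (F e) p, snd (snd e) p) = (F e p, snd (snd (g.adj e)) p)" by metis
  define G where "G x = (TA X (fst (fst x)) (F (fst x)) (snd x), snd (snd (fst x)) (snd x))"
    for x :: "('v mat \<times> (nat \<Rightarrow> complex) \<times> (nat \<Rightarrow> 'y)) \<times> nat"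
  let ?I = "SIGMA e:Ix Y. {..<dim_row (fst e)}"
  define kk where "kk x y = kker R Q (fst (fst x)) (fst (fst y))
      (\<lambda>a b. cnj (fst (snd (fst x)) a) * fst (snd (fst y)) b) (snd x) (snd y)"
    for x y :: "('v mat \<times> (nat \<Rightarrow> complex) \<times> (nat \<Rightarrow> 'y)) \<times> nat"
  \<comment> \<open>The defect kernel of the contraction \<open>Ts\<close> on the vectors
    \<open>G x\<close>. By the fixed point equation \<open>Ts (G x)\<close> consists of the entries
    of the state and of the adjoint output, so the blocks of the colligation disappear from the
    computation.\<close>
  define \<delta> where "\<delta> y x = hinner (hsum RX Y) (G x) (G y) - hinner (hsum X U) (Ts (G x)) (Ts (G y))" for y x
  have G: "G x \<in> hcarrier (hsum RX Y)" if "x \<in> ?I" for x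
  proof -
    have e: "fst x \<in> Ix Y" and p: "snd x < dim_row (fst (fst x))" using that by auto
    then have W: "fst (fst x) \<in> \<Delta>" and y: "snd (snd (fst x)) \<in> hcarrier (hpow (dim_row (fst (fst x))) Y)"
      unfolding Ix_def by auto
    show ?thesis
      using hpow_in[OF bop_in[OF TA_bop[OF W Xp] F[OF e]] p] hpow_in[OF y p] unfolding G_def by simp
  qed
  have p1: "psd ?I \<delta>" unfolding \<delta>_def by (rule psd_defect[OF RYp XUp Ts_bop Ts_bound G])
  have p2: "psd ?I kk"
    unfolding kk_def by (rule psd_kker[of "Ix Y" fst "\<lambda>e. fst (snd e)"]) (auto simp: Ix_def)
  have p3: "psd (Ix Y) (\<lambda>y x. \<Sum>i<dim_row (fst y). \<Sum>l<dim_row (fst x). kk (y, i) (x, l) * \<delta> (y, i) (x, l))"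
    by (rule psd_sum_index[OF psd_mult[OF p2 p1]])
  \<comment> \<open>Applying \<open>phi\<close> to the scalar kernel reproduces it up to the rank
    one term it started from. The Gram kernel of \<open>h\<close> is this term paired with the
    states, and supplies exactly what the weighted defect kernel lacks.\<close>
  define h where "h e = (\<Sum>b<dim_row (fst e). fst (snd e) b *\<^sub>C F e b)" for e
  have "h e \<in> hcarrier X" if "e \<in> Ix Y" for e
    unfolding h_def using F[OF that] by (intro sum_in[OF Xp] scale_in[OF Xp]) auto
  then have p4: "psd (Ix Y) (\<lambda>y x. hinner X (h x) (h y))" by (rule psd_gram[OF Xp])
  have "psd (Ix Y) g.KS"
  proof (rule psd_cong[OF psd_add[OF p3 p4]])
    fix x y assume x: "x \<in> Ix Y" and y: "y \<in> Ix Y"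
    have W: "fst x \<in> \<Delta>" and Z: "fst y \<in> \<Delta>" using x y unfolding Ix_def by auto
    let ?n = "dim_row (fst y)" and ?m = "dim_row (fst x)"
    let ?k = "kker R Q (fst y) (fst x) (\<lambda>a b. cnj (fst (snd y) a) * fst (snd x) b)"
    let ?f = "\<lambda>a b. hinner X (F x b) (F y a)"
    let ?yy = "\<lambda>i l. hinner Y (snd (snd x) l) (snd (snd y) i)"
    let ?ss = "\<lambda>i l. hinner U (snd (snd (g.adj x)) l) (snd (snd (g.adj y)) i)"
    let ?qq = "\<lambda>i l a b. hinner R (q (fst x) b l) (q (fst y) a i)"
    have d: "\<delta> (y, i) (x, l) = (\<Sum>a<?n. \<Sum>b<?m. ?qq i l a b * ?f a b) + ?yy i l - ?f i l - ?ss i l"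
      if i: "i < ?n" and l: "l < ?m" for i l
      unfolding \<delta>_def G_def fst_conv snd_conv hsum_inner Fe[OF x l] Fe[OF y i] TA_inner[OF Xp Z W F[OF y] F[OF x] i l] by simp
    have "(\<Sum>i<?n. \<Sum>l<?m. ?k i l * (\<Sum>a<?n. \<Sum>b<?m. ?qq i l a b * ?f a b))
        = (\<Sum>i<?n. \<Sum>l<?m. \<Sum>a<?n. \<Sum>b<?m. ?k i l * ?qq i l a b * ?f a b)"
      by (simp only: sum_distrib_left mult.assoc)
    also have "\<dots> = (\<Sum>a<?n. \<Sum>b<?m. \<Sum>i<?n. \<Sum>l<?m. ?k i l * ?qq i l a b * ?f a b)" by (rule sum4_swap)
    also have "\<dots> = (\<Sum>a<?n. \<Sum>b<?m. phi R Q (fst y) (fst x) ?k a b * ?f a b)"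
      unfolding phi_def sum_distrib_right ..
    also have "\<dots> = (\<Sum>a<?n. \<Sum>b<?m. (?k a b - cnj (fst (snd y) a) * fst (snd x) b) * ?f a b)"
    proof (rule sum.cong[OF refl], rule sum.cong[OF refl])
      fix a b assume "a \<in> {..<?n}" "b \<in> {..<?m}"
      then have "a < ?n" "b < ?m" by simp_all
      from kker_phi_left[OF Z W this, of "\<lambda>a b. cnj (fst (snd y) a) * fst (snd x) b"]
      show "phi R Q (fst y) (fst x) ?k a b * ?f a b = (?k a b - cnj (fst (snd y) a) * fst (snd x) b) * ?f a b" by simp
    qed
    finally have t: "(\<Sum>i<?n. \<Sum>l<?m. ?k i l * (\<Sum>a<?n. \<Sum>b<?m. ?qq i l a b * ?f a b))
      = (\<Sum>a<?n. \<Sum>b<?m. ?k a b * ?f a b) - (\<Sum>a<?n. \<Sum>b<?m. cnj (fst (snd y) a) * fst (snd x) b * ?f a b)"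
      unfolding left_diff_distrib sum_subtractf .
    have hh: "hinner X (h x) (h y) = (\<Sum>a<?n. \<Sum>b<?m. cnj (fst (snd y) a) * fst (snd x) b * ?f a b)"
    proof -
      have "hinner X (h x) (h y) = (\<Sum>b<?m. \<Sum>a<?n. fst (snd x) b * cnj (fst (snd y) a) * ?f a b)"
        unfolding h_def by (rule inner_lincomb[OF Xp]) (use F[OF x] F[OF y] in auto)
      then show ?thesis by (simp only: sum.swap[of _ "{..<?m}"] mult.commute)
    qed
    have kkk: "kk (y, i) (x, l) = ?k i l" for i l unfolding kk_def by simp
    have "(\<Sum>i<?n. \<Sum>l<?m. kk (y, i) (x, l) * \<delta> (y, i) (x, l))
      = (\<Sum>i<?n. \<Sum>l<?m. ?k i l * ((\<Sum>a<?n. \<Sum>b<?m. ?qq i l a b * ?f a b) + ?yy i l - ?f i l - ?ss i l))"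
      by (rule sum.cong[OF refl], rule sum.cong[OF refl]) (simp add: d kkk)
    also have "\<dots> = (\<Sum>i<?n. \<Sum>l<?m. ?k i l * (\<Sum>a<?n. \<Sum>b<?m. ?qq i l a b * ?f a b)) + (\<Sum>i<?n. \<Sum>l<?m. ?k i l * ?yy i l)
       - (\<Sum>i<?n. \<Sum>l<?m. ?k i l * ?f i l) - (\<Sum>i<?n. \<Sum>l<?m. ?k i l * ?ss i l)"
      by (simp only: distrib_left right_diff_distrib sum.distrib sum_subtractf)
    also have "(\<Sum>i<?n. \<Sum>l<?m. ?k i l * ?yy i l) = kap Y y x" unfolding kap_def ..
    also have "(\<Sum>i<?n. \<Sum>l<?m. ?k i l * ?ss i l) = kap U (g.adj y) (g.adj x)"
      unfolding kap_def by (simp add: g.adj_def)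
    finally show "g.KS y x = (\<Sum>i<?n. \<Sum>l<?m. kk (y, i) (x, l) * \<delta> (y, i) (x, l)) + hinner X (h x) (h y)"
      unfolding t hh g.KS_def by simp
  qed
  then show "S \<in> contractive_multipliers \<Delta> U Y (KE U) (KE Y)" by (rule g.psd_multiplier[OF nc])
qed

end

section \<open>The state space of a unitary realization\<close>

unbundle cardinal_syntax

lemma card_le_Un:
  assumes "infinite C" "|A| \<le>o |C|" "|B| \<le>o |C|"
  shows "|A \<union> B| \<le>o |C|"
  by (rule card_of_Un_ordLeq_infinite_Field[OF _ assms(2,3) card_of_Card_order]) (simp add: Field_card_of assms(1))

text \<open>A vector is recorded by its inner products with a total family indexed by
  \<open>'i\<close>; totality makes the record faithful, and the result is a copy of
  \<open>H\<close> inside the functions on \<open>'i\<close>.\<close>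

lemma hspace_embedding:
  fixes t :: "'i \<Rightarrow> 'a::complex_vector"
  assumes H: "hilbert_space H" and t: "\<And>i. t i \<in> hcarrier H"
    and tot: "\<And>z. z \<in> hcarrier H \<Longrightarrow> (\<And>i. hinner H z (t i) = 0) \<Longrightarrow> z = 0"
  obtains X :: "('i \<Rightarrow> complex) hspace" and \<phi> where "hilbert_space X" "hcarrier X = \<phi> ` hcarrier H"
    "\<And>x y. x \<in> hcarrier H \<Longrightarrow> y \<in> hcarrier H \<Longrightarrow> hinner X (\<phi> x) (\<phi> y) = hinner H x y"
proof -
  have Hp: "pre_hilbert H" using H by simp
  define \<phi> where "\<phi> h = (\<lambda>i. hinner H h (t i))" for h
  have add: "\<phi> (x + y) = \<phi> x + \<phi> y" if "x \<in> hcarrier H" "y \<in> hcarrier H" for x y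
    unfolding \<phi>_def using inner_add_left[OF Hp that t] by (simp add: fun_eq_iff)
  have scale: "\<phi> (a *\<^sub>C x) = a *\<^sub>C \<phi> x" if "x \<in> hcarrier H" for x a
    unfolding \<phi>_def using inner_scale_left[OF Hp that t] by (simp add: fun_eq_iff fun_scale_apply)
  have inj: "x = 0" if "x \<in> hcarrier H" "\<phi> x = 0" for x
    using that(2) by (intro tot[OF that(1)]) (simp add: \<phi>_def fun_eq_iff)
  show thesis
    by (rule that[OF htransport(1)[OF H add scale inj] htransport(3)[OF H add scale inj] htransport(2)[OF H add scale inj]])
qed

text \<open>The space is the sum of the reproducing kernel space of \<open>\<kappa>\<close> and an
  \<open>l^2\<close> space, embedded in the functions on \<open>'i\<close>. The family
  \<open>f\<close> realizes \<open>\<kappa>\<close>, \<open>\<eta>\<close> is an orthonormal family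
  of full size orthogonal to it, and \<open>t\<close> is a total family no larger than
  \<open>'i\<close>: the data from which the dimension of a complement is read off.\<close>

lemma state_space_exists:
  fixes E :: "'e set" and \<kappa> :: "'e \<Rightarrow> 'e \<Rightarrow> complex"
  assumes \<kappa>: "psd E \<kappa>" and card: "|E| \<le>o |UNIV :: 'i set|" and inf: "infinite (UNIV :: 'i set)"
  obtains X :: "('i \<Rightarrow> complex) hspace" and f \<eta> t where "hilbert_space X"
    "\<And>e. e \<in> E \<Longrightarrow> f e \<in> hcarrier X" "\<And>e e'. e \<in> E \<Longrightarrow> e' \<in> E \<Longrightarrow> hinner X (f e) (f e') = \<kappa> e' e"
    "\<And>i. \<eta> i \<in> hcarrier X" "\<And>i j. hinner X (\<eta> i) (\<eta> j) = (if i = (j::'i) then 1 else 0)"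
    "\<And>i e. e \<in> E \<Longrightarrow> hinner X (\<eta> i) (f e) = 0"
    "\<And>i::'i. t i \<in> hcarrier X" "\<And>z. z \<in> hcarrier X \<Longrightarrow> (\<And>i. hinner X z (t i) = 0) \<Longrightarrow> z = 0"
proof -
  \<comment> \<open>The reproducing kernel space of the Kronecker delta is \<open>l^2\<close> over
    \<open>'i\<close>, and its kernel functions form the standard orthonormal basis.\<close>
  define \<delta> where "\<delta> = (\<lambda>i j::'i. if i = j then 1 else 0 :: complex)"
  have \<delta>: "psd (UNIV :: 'i set) \<delta>"
  proof (rule psdI)
    show "\<delta> y x = cnj (\<delta> x y)" for x y unfolding \<delta>_def by simp
    fix F :: "'i set" and c :: "'i \<Rightarrow> complex" assume F: "finite F"
    have "(\<Sum>x\<in>F. \<Sum>y\<in>F. c x * cnj (c y) * \<delta> y x) = (\<Sum>x\<in>F. c x * cnj (c x))"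
      unfolding \<delta>_def using F by (intro sum.cong refl) (simp add: if_distrib cong: if_cong)
    also have "\<dots> = of_real (\<Sum>x\<in>F. (cmod (c x))\<^sup>2)"
      unfolding of_real_sum by (intro sum.cong refl) (simp only: complex_norm_square)
    finally show "0 \<le> Re (\<Sum>x\<in>F. \<Sum>y\<in>F. c x * cnj (c y) * \<delta> y x)" by (simp add: sum_nonneg)
  qed
  let ?P = "rk_space E \<kappa>" and ?L = "rk_space (UNIV :: 'i set) \<delta>"
  let ?H = "hsum ?P ?L"
  note P = rk_hilbert[OF \<kappa>] and L = rk_hilbert[OF \<delta>]
  have Pp: "pre_hilbert ?P" and Lp: "pre_hilbert ?L" using P L by simp_all
  have H: "hilbert_space ?H" by (rule hilbert_hsum[OF P L])
  define f0 where "f0 e = (rk_point E \<kappa> e, 0 :: 'i \<Rightarrow> complex)" for e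
  define \<eta>0 where "\<eta>0 i = (0 :: 'e \<Rightarrow> complex, rk_point (UNIV :: 'i set) \<delta> i)" for i
  note f0 = rk_point_in[OF \<kappa>] and e0 = rk_point_in[OF \<delta> UNIV_I]
  have f0H: "f0 e \<in> hcarrier ?H" if "e \<in> E" for e unfolding f0_def using f0[OF that] Lp by simp
  have \<eta>0H: "\<eta>0 i \<in> hcarrier ?H" for i unfolding \<eta>0_def using e0 Pp by simp
  let ?D = "f0 ` E \<union> range \<eta>0"
  have "|?D| \<le>o |UNIV :: 'i set|"
    by (rule card_le_Un[OF inf ordLeq_transitive[OF card_of_image card] card_of_image])
  moreover have "?D \<noteq> {}" by blast
  \<comment> \<open>The cardinality bound together with nonemptiness turns \<open>?D\<close> into
    the range of a function on all of \<open>'i\<close>, possibly with repetitions.\<close>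
  ultimately obtain t0 :: "'i \<Rightarrow> _" where t0: "range t0 = ?D" using card_of_ordLeq2[of ?D "UNIV :: 'i set"] by blast
  have t0H: "t0 i \<in> hcarrier ?H" for i
  proof -
    have "t0 i \<in> ?D" unfolding t0[symmetric] by blast
    then show ?thesis by (elim UnE imageE) (simp_all only: f0H \<eta>0H)
  qed
  have tot: "z = 0" if z: "z \<in> hcarrier ?H" and o: "\<And>i. hinner ?H z (t0 i) = 0" for z
  proof -
    have oD: "hinner ?H z d = 0" if "d \<in> ?D" for d
    proof -
      from that obtain i where "d = t0 i" unfolding t0[symmetric] by blast
      then show ?thesis using o by simp
    qed
    have z1: "fst z \<in> hcarrier ?P" and z2: "snd z \<in> hcarrier ?L" using z by simp_all
    have "fst z = 0"
    proof (rule rk_total[OF \<kappa> z1])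
      fix e assume "e \<in> E"
      then have "hinner ?H z (f0 e) = 0" by (intro oD) blast
      then show "hinner ?P (fst z) (rk_point E \<kappa> e) = 0" unfolding f0_def using inner_zero_right[OF Lp z2] by simp
    qed
    moreover have "snd z = 0"
    proof (rule rk_total[OF \<delta> z2])
      fix i :: 'i
      have "hinner ?H z (\<eta>0 i) = 0" by (intro oD) blast
      then show "hinner ?L (snd z) (rk_point UNIV \<delta> i) = 0" unfolding \<eta>0_def using inner_zero_right[OF Pp z1] by simp
    qed
    ultimately show ?thesis by (simp add: prod_eq_iff)
  qed
  obtain X :: "('i \<Rightarrow> complex) hspace" and \<phi> where X: "hilbert_space X" "hcarrier X = \<phi> ` hcarrier ?H"
    and in_X: "\<And>x y. x \<in> hcarrier ?H \<Longrightarrow> y \<in> hcarrier ?H \<Longrightarrow> hinner X (\<phi> x) (\<phi> y) = hinner ?H x y"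
    by (rule hspace_embedding[OF H t0H, of id]) (simp, rule tot, auto)
  show thesis
  proof (rule that[of X "\<lambda>e. \<phi> (f0 e)" "\<lambda>i. \<phi> (\<eta>0 i)" "\<lambda>i. \<phi> (t0 i)"])
    show "hilbert_space X" by (rule X(1))
    show "\<phi> (f0 e) \<in> hcarrier X" if "e \<in> E" for e unfolding X(2) by (rule imageI[OF f0H[OF that]])
    show "\<phi> (\<eta>0 i) \<in> hcarrier X" "\<phi> (t0 i) \<in> hcarrier X" for i
      unfolding X(2) by (rule imageI[OF \<eta>0H], rule imageI[OF t0H])
    show "hinner X (\<phi> (f0 e)) (\<phi> (f0 e')) = \<kappa> e' e" if "e \<in> E" "e' \<in> E" for e e'
      unfolding in_X[OF f0H[OF that(1)] f0H[OF that(2)]] unfolding f0_def using rk_inner[OF \<kappa> that] Lp by simp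
    show "hinner X (\<phi> (\<eta>0 i)) (\<phi> (\<eta>0 j)) = (if i = j then 1 else 0)" for i j
      unfolding in_X[OF \<eta>0H \<eta>0H] unfolding \<eta>0_def using rk_inner[OF \<delta> UNIV_I UNIV_I, of i j] Pp by (simp add: \<delta>_def)
    show "hinner X (\<phi> (\<eta>0 i)) (\<phi> (f0 e)) = 0" if "e \<in> E" for i e
      unfolding in_X[OF \<eta>0H f0H[OF that]] unfolding \<eta>0_def f0_def
      using inner_zero_left[OF Pp f0[OF that]] inner_zero_right[OF Lp e0] by simp
    fix z assume z: "z \<in> hcarrier X" and o: "\<And>i. hinner X z (\<phi> (t0 i)) = 0"
    from z obtain w where w: "w \<in> hcarrier ?H" "z = \<phi> w" unfolding X(2) by blast
    have "w = 0" using o unfolding w(2) in_X[OF w(1) t0H] by (rule tot[OF w(1)])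
    then have "hinner X z z = 0" unfolding w(2) in_X[OF w(1) w(1)]
      using inner_zero_left[OF hilbert_pre_hilbert[OF H] w(1)] by (simp only:)
    then show "z = 0" by (rule inner_eq_zero[OF X(1) z])
  qed
qed

lemma block_decompose:
  assumes X: "pre_hilbert X" and U: "pre_hilbert U" and V: "pre_hilbert V" and Y: "pre_hilbert Y"
    and T: "T \<in> bop (hsum X U) (hsum V Y)"
  obtains A B C D where "A \<in> bop X V" "B \<in> bop U V" "C \<in> bop X Y" "D \<in> bop U Y" "block_op X U A B C D = T"
proof -
  let ?i = "\<lambda>x. if x \<in> hcarrier X then (x, 0) else 0" and ?j = "\<lambda>x. if x \<in> hcarrier U then (0, x) else 0"
  let ?p = "\<lambda>p. if p \<in> hcarrier (hsum V Y) then fst p else 0" and ?q = "\<lambda>p. if p \<in> hcarrier (hsum V Y) then snd p else 0"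
  note S1 = pre_hilbert_hsum[OF X U] and S2 = pre_hilbert_hsum[OF V Y]
  note i = bop_compose[OF inl_bop(1)[OF X U] T X S1] and j = bop_compose[OF inr_bop(1)[OF X U] T U S1]
  have "block_op X U (?p \<circ> (T \<circ> ?i)) (?p \<circ> (T \<circ> ?j)) (?q \<circ> (T \<circ> ?i)) (?q \<circ> (T \<circ> ?j)) = T"
  proof (rule ext)
    fix p
    show "block_op X U (?p \<circ> (T \<circ> ?i)) (?p \<circ> (T \<circ> ?j)) (?q \<circ> (T \<circ> ?i)) (?q \<circ> (T \<circ> ?j)) p = T p"
    proof (cases "p \<in> hcarrier (hsum X U)")
      case False
      then show ?thesis unfolding block_op_def bop_off[OF T False] by (simp only: if_False)
    next
      case True
      obtain x u where p: "p = (x, u)" by (cases p)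
      then have x: "x \<in> hcarrier X" and u: "u \<in> hcarrier U" using True by simp_all
      have x0: "(x, 0) \<in> hcarrier (hsum X U)" and u0: "(0, u) \<in> hcarrier (hsum X U)" using x u X U by simp_all
      have "T p = T (x, 0) + T (0, u)" using bop_add[OF T x0 u0] p by simp
      moreover have "T (x, 0) \<in> hcarrier (hsum V Y)" "T (0, u) \<in> hcarrier (hsum V Y)" by (rule bop_in[OF T x0], rule bop_in[OF T u0])
      ultimately show ?thesis unfolding p block_apply[OF x u] o_apply using x u by (simp only: if_True prod_eq_iff fst_conv snd_conv fst_add snd_add)
    qed
  qed
  then show thesis
    by (rule that[OF bop_compose[OF i proj_bop(1)[OF V Y] X S2] bop_compose[OF j proj_bop(1)[OF V Y] U S2]
      bop_compose[OF i proj_bop(2)[OF V Y] X S2] bop_compose[OF j proj_bop(2)[OF V Y] U S2]])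
qed

lemma unitary_contractive:
  assumes H: "pre_hilbert H" and K: "pre_hilbert K" and T: "unitary_op H K T"
  shows "contractive_op H K T"
proof -
  have b: "T \<in> bop H K" and i: "\<And>x. x \<in> hcarrier H \<Longrightarrow> hinner K (T x) (T x) = hinner H x x"
    using T unfolding unitary_op_def by blast+
  have "op_norm H K T \<le> 1" by (rule op_norm_le[OF H]) (simp_all add: hnorm_def i)
  with b show ?thesis unfolding contractive_op_def by simp
qed

text \<open>If the complements of two families with the same Gram matrix have the same dimension, the
  isometry between their spans extends to a unitary operator.\<close>

lemma unitary_extension:
  fixes \<eta>1 :: "'i \<Rightarrow> 'a::complex_vector" and \<eta>2 :: "'i \<Rightarrow> 'b::complex_vector"
  assumes H: "hilbert_space H" and K: "hilbert_space K"
    and b: "\<And>e. e \<in> E \<Longrightarrow> b e \<in> hcarrier H" and a: "\<And>e. e \<in> E \<Longrightarrow> a e \<in> hcarrier K"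
    and gram: "\<And>e e'. e \<in> E \<Longrightarrow> e' \<in> E \<Longrightarrow> hinner K (a e) (a e') = hinner H (b e) (b e')"
    and \<eta>1: "\<And>i. \<eta>1 i \<in> hcarrier H" "\<And>i j. hinner H (\<eta>1 i) (\<eta>1 j) = (if i = j then 1 else 0)"
      "\<And>i e. e \<in> E \<Longrightarrow> hinner H (\<eta>1 i) (b e) = 0"
    and \<eta>2: "\<And>i. \<eta>2 i \<in> hcarrier K" "\<And>i j. hinner K (\<eta>2 i) (\<eta>2 j) = (if i = j then 1 else 0)"
      "\<And>i e. e \<in> E \<Longrightarrow> hinner K (\<eta>2 i) (a e) = 0"
    and inf: "infinite (UNIV :: 'i set)"
    and D1: "D1 \<subseteq> hcarrier H" "|D1| \<le>o |UNIV :: 'i set|" "\<And>z. z \<in> hcarrier H \<Longrightarrow> (\<And>t. t \<in> D1 \<Longrightarrow> hinner H z t = 0) \<Longrightarrow> z = 0"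
    and D2: "D2 \<subseteq> hcarrier K" "|D2| \<le>o |UNIV :: 'i set|" "\<And>z. z \<in> hcarrier K \<Longrightarrow> (\<And>t. t \<in> D2 \<Longrightarrow> hinner K z t = 0) \<Longrightarrow> z = 0"
  obtains T where "unitary_op H K T" "\<And>e. e \<in> E \<Longrightarrow> T (b e) = a e"
proof -
  have Hp: "pre_hilbert H" and Kp: "pre_hilbert K" using H K by simp_all
  define N1 where "N1 = {x\<in>hcarrier H. \<forall>y\<in>b ` E. hinner H x y = 0}"
  define N2 where "N2 = {x\<in>hcarrier K. \<forall>y\<in>a ` E. hinner K x y = 0}"
  have "\<exists>c::'i \<Rightarrow> 'a. (\<forall>i. c i \<in> N1) \<and> (\<forall>i j. hinner H (c i) (c j) = (if i = j then 1 else 0)) \<and>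
      (\<forall>x\<in>N1. (\<forall>i. hinner H x (c i) = 0) \<longrightarrow> x = 0)"
  proof -
    have n: "\<eta>1 i \<in> N1" for i unfolding N1_def using \<eta>1(1,3) by blast
    have s: "b ` E \<subseteq> hcarrier H" using b by blast
    have t: "x = 0" if "x \<in> N1" "\<And>t. t \<in> D1 \<Longrightarrow> hinner H x t = 0" for x using D1(3)[OF _ that(2)] that(1) unfolding N1_def by blast
    show ?thesis by (rule orthonormal_basis_indexed[OF H s N1_def n \<eta>1(2) inf D1(1,2) t]) (assumption | blast)+
  qed
  then obtain c1 :: "'i \<Rightarrow> 'a" where c1: "\<And>i. c1 i \<in> N1" "\<And>i j. hinner H (c1 i) (c1 j) = (if i = j then 1 else 0)"
    "\<And>x. x \<in> N1 \<Longrightarrow> (\<And>i. hinner H x (c1 i) = 0) \<Longrightarrow> x = 0" by blast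
  have "\<exists>c::'i \<Rightarrow> 'b. (\<forall>i. c i \<in> N2) \<and> (\<forall>i j. hinner K (c i) (c j) = (if i = j then 1 else 0)) \<and>
      (\<forall>x\<in>N2. (\<forall>i. hinner K x (c i) = 0) \<longrightarrow> x = 0)"
  proof -
    have n: "\<eta>2 i \<in> N2" for i unfolding N2_def using \<eta>2(1,3) by blast
    have s: "a ` E \<subseteq> hcarrier K" using a by blast
    have t: "x = 0" if "x \<in> N2" "\<And>t. t \<in> D2 \<Longrightarrow> hinner K x t = 0" for x using D2(3)[OF _ that(2)] that(1) unfolding N2_def by blast
    show ?thesis by (rule orthonormal_basis_indexed[OF K s N2_def n \<eta>2(2) inf D2(1,2) t]) (assumption | blast)+
  qed
  then obtain c2 :: "'i \<Rightarrow> 'b" where c2: "\<And>i. c2 i \<in> N2" "\<And>i j. hinner K (c2 i) (c2 j) = (if i = j then 1 else 0)"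
    "\<And>x. x \<in> N2 \<Longrightarrow> (\<And>i. hinner K x (c2 i) = 0) \<Longrightarrow> x = 0" by blast
  have c1H: "c1 i \<in> hcarrier H" for i using c1(1) unfolding N1_def by blast
  have c2K: "c2 i \<in> hcarrier K" for i using c2(1) unfolding N2_def by blast
  have c1b: "hinner H (c1 i) (b e) = 0" "hinner H (b e) (c1 i) = 0" if "e \<in> E" for i e
  proof -
    show 1: "hinner H (c1 i) (b e) = 0" using c1(1)[of i] that unfolding N1_def by blast
    show "hinner H (b e) (c1 i) = 0" using inner_commute[OF Hp c1H b[OF that], of i] 1 by simp
  qed
  have c2a: "hinner K (c2 i) (a e) = 0" "hinner K (a e) (c2 i) = 0" if "e \<in> E" for i e
  proof -
    show 1: "hinner K (c2 i) (a e) = 0" using c2(1)[of i] that unfolding N2_def by blast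
    show "hinner K (a e) (c2 i) = 0" using inner_commute[OF Kp c2K a[OF that], of i] 1 by simp
  qed
  \<comment> \<open>Adjoining bases of the complements, indexed by the common type
    \<open>'i\<close>, makes both families total while keeping their Gram matrices equal.\<close>
  define b' where "b' = case_sum b c1"
  define a' where "a' = case_sum a c2"
  have tot1: "z = 0" if z: "z \<in> hcarrier H" and o: "\<And>e. e \<in> E <+> (UNIV::'i set) \<Longrightarrow> hinner H z (b' e) = 0" for z
  proof (rule c1(3))
    show "z \<in> N1" unfolding N1_def using z o[OF InlI] by (auto simp: b'_def)
    show "hinner H z (c1 i) = 0" for i using o[OF InrI[OF UNIV_I], of i] by (simp add: b'_def)
  qed
  have tot2: "z = 0" if z: "z \<in> hcarrier K" and o: "\<And>e. e \<in> E <+> (UNIV::'i set) \<Longrightarrow> hinner K z (a' e) = 0" for z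
  proof (rule c2(3))
    show "z \<in> N2" unfolding N2_def using z o[OF InlI] by (auto simp: a'_def)
    show "hinner K z (c2 i) = 0" for i using o[OF InrI[OF UNIV_I], of i] by (simp add: a'_def)
  qed
  have i1: "b' e \<in> hcarrier H" "a' e \<in> hcarrier K" if "e \<in> E <+> (UNIV::'i set)" for e
    using that a b c1H c2K unfolding a'_def b'_def by auto
  have g: "hinner K (a' e) (a' e') = hinner H (b' e) (b' e')" if "e \<in> E <+> (UNIV::'i set)" "e' \<in> E <+> (UNIV::'i set)" for e e'
    using that unfolding a'_def b'_def by (auto simp: gram c1b c2a c1(2) c2(2))
  obtain T where "unitary_op H K T" and T: "\<And>e. e \<in> E <+> (UNIV::'i set) \<Longrightarrow> T (b' e) = a' e"
    by (rule gram_unitary[OF H K i1(1) i1(2) tot1 tot2 g]) (assumption | blast)+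
  moreover have "T (b e) = a e" if "e \<in> E" for e using T[OF InlI[OF that]] by (simp add: a'_def b'_def)
  ultimately show thesis using that by blast
qed

unbundle no cardinal_syntax

unbundle cardinal_syntax

text \<open>The leading numbers fix the lengths of the two segments that follow, so equal codes can
  be compared segment by segment. A vector of \<open>hpow\<close> is determined by its entries below
  the dimension, hence by finitely many letters.\<close>

definition point_code :: "'v mat \<times> nat \<times> (nat \<Rightarrow> 'y) \<Rightarrow> ('v + 'r + 'u + 'y + nat) list" where
  "point_code j = map (\<lambda>k. Inr (Inr (Inr (Inr k)))) [dim_row (fst j), dim_col (fst j), fst (snd j)]
     @ map (\<lambda>i. Inr (Inr (Inr (Inl (snd (snd j) i))))) [0..<dim_row (fst j)]
     @ map (\<lambda>x. Inl (fst j $$ x)) (List.product [0..<dim_row (fst j)] [0..<dim_col (fst j)])"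

lemma point_code_inj:
  assumes y: "y \<in> hcarrier (hpow (dim_row W) Y)" and y': "y' \<in> hcarrier (hpow (dim_row W') Y)"
    and eq: "point_code (W, p, y) = point_code (W', p', y')"
  shows "(W, p, y) = (W', p', y')"
proof -
  have d: "dim_row W = dim_row W'" "dim_col W = dim_col W'" "p = p'"
    using eq unfolding point_code_def by simp_all
  have "y i = y' i" for i
  proof (cases "i < dim_row W")
    case True
    then show ?thesis using eq unfolding point_code_def by (simp add: d)
  next
    case False
    then show ?thesis using hpow_off[OF y, of i] hpow_off[OF y', of i] d by simp
  qed
  moreover have "W = W'"
    by (rule eq_matI) (use eq in \<open>simp_all add: point_code_def d\<close>)
  ultimately show ?thesis using d by auto
qed

lemma uvec_pick:
  assumes "a < n" "b < m"
  shows "(\<Sum>i<n. \<Sum>l<m. cnj (uvec a i) * uvec b l * h i l) = h a b"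
proof -
  have "(\<Sum>l<m. cnj (uvec a i) * uvec b l * h i l) = (if i = a then h i b else 0)" for i
  proof -
    have "(\<Sum>l<m. cnj (uvec a i) * uvec b l * h i l) = (\<Sum>l<m. if l = b then cnj (uvec a i) * h i l else 0)"
      by (rule sum.cong[OF refl]) (simp add: uvec_def)
    also have "\<dots> = cnj (uvec a i) * h i b" using assms(2) by (simp only: sum.delta finite_lessThan lessThan_iff if_True)
    finally show ?thesis by (simp add: uvec_def)
  qed
  then have "(\<Sum>i<n. \<Sum>l<m. cnj (uvec a i) * uvec b l * h i l) = (\<Sum>i<n. if i = a then h i b else 0)"
    by (simp only:)
  also have "\<dots> = h a b" using assms(1) by (simp only: sum.delta finite_lessThan lessThan_iff if_True)
  finally show ?thesis .
qed

text \<open>For fixed \<open>r\<close> the adjoint of tensoring with \<open>r\<close> brings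
  \<open>z\<close> into \<open>X\<close>, where the family \<open>t\<close> is total. This yields a
  total set of \<open>R \<otimes> X\<close> indexed by pairs of a vector of \<open>R\<close> and an
  index, small enough for the dimension count.\<close>

lemma htensor_total:
  assumes R: "hilbert_space R" and X: "hilbert_space X" and t: "\<And>i. t i \<in> hcarrier X"
    and tot: "\<And>z. z \<in> hcarrier X \<Longrightarrow> (\<And>i. hinner X z (t i) = 0) \<Longrightarrow> z = 0"
    and z: "z \<in> hcarrier (htensor R X)"
    and o: "\<And>r i. r \<in> hcarrier R \<Longrightarrow> hinner (htensor R X) z (elem_tensor R X r (t i)) = 0"
  shows "z = 0"
proof -
  have Rp: "pre_hilbert R" and Xp: "pre_hilbert X" using R X by simp_all
  note RX = hilbert_htensor[OF Rp Xp]
  show ?thesis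
  proof (rule et_total[OF Rp Xp z])
    fix r x assume r: "r \<in> hcarrier R" and x: "x \<in> hcarrier X"
    note T = tensor_left_bop[OF Rp Xp r]
    let ?w = "op_adjoint X (htensor R X) (tensor_left R X r) z"
    have w: "?w \<in> hcarrier X" by (rule bop_in[OF op_adjoint_bop[OF X RX T] z])
    have tl: "tensor_left R X r x = elem_tensor R X r x" if "x \<in> hcarrier X" for x
      using that by (simp add: tensor_left_def[OF Rp Xp])
    have "?w = 0"
    proof (rule tot[OF w])
      show "hinner X ?w (t i) = 0" for i
        unfolding op_adjoint_inner'[OF X RX T t z, symmetric] tl[OF t] by (rule o[OF r])
    qed
    then show "hinner (htensor R X) z (elem_tensor R X r x) = 0"
      using op_adjoint_inner'[OF X RX T x z] inner_zero_left[OF Xp x] unfolding tl[OF x] by simp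
  qed
qed

lemma hsum_total:
  assumes H: "hilbert_space H" and K: "hilbert_space K" and z: "z \<in> hcarrier (hsum H K)"
    and tot: "\<And>z. z \<in> hcarrier H \<Longrightarrow> (\<And>t. t \<in> D \<Longrightarrow> hinner H z t = 0) \<Longrightarrow> z = 0"
    and o: "\<And>t. t \<in> (\<lambda>x. (x, 0)) ` D \<union> Pair 0 ` hcarrier K \<Longrightarrow> hinner (hsum H K) z t = 0"
  shows "z = 0"
proof -
  have Hp: "pre_hilbert H" and Kp: "pre_hilbert K" using H K by simp_all
  have z1: "fst z \<in> hcarrier H" and z2: "snd z \<in> hcarrier K" using z by simp_all
  have "fst z = 0"
  proof (rule tot[OF z1])
    fix t assume "t \<in> D"
    then have "hinner (hsum H K) z (t, 0) = 0" by (intro o) blast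
    then show "hinner H (fst z) t = 0" using inner_zero_right[OF Kp z2] by simp
  qed
  moreover have "snd z = 0"
  proof (rule inner_eq_zero[OF K z2])
    have "hinner (hsum H K) z (0, snd z) = 0" using z2 by (intro o) blast
    then show "hinner K (snd z) (snd z) = 0" using inner_zero_right[OF Hp z1] by simp
  qed
  ultimately show ?thesis by (simp add: prod_eq_iff)
qed

section \<open>The colligation of a positive kernel\<close>

context graded_ball
begin

text \<open>A coordinate \<open>p\<close> replaces the row \<open>v\<close> of a point of
  \<open>Ix Y\<close>: the colligation concerns single components of vectors, and a number, unlike a
  row of complex entries, is directly a letter of the lists.\<close>

definition J :: "('v mat \<times> nat \<times> (nat \<Rightarrow> 'y)) set" where
  "J = {j. fst j \<in> \<Delta> \<and> fst (snd j) < dim_row (fst j) \<and> snd (snd j) \<in> hcarrier (hpow (dim_row (fst j)) Y)}"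

definition pt :: "'v mat \<times> nat \<times> (nat \<Rightarrow> 'y) \<Rightarrow> 'v mat \<times> (nat \<Rightarrow> complex) \<times> (nat \<Rightarrow> 'y)" where
  "pt j = (fst j, uvec (fst (snd j)), snd (snd j))"

lemma J_iff: "(W, p, y) \<in> J \<longleftrightarrow> W \<in> \<Delta> \<and> p < dim_row W \<and> y \<in> hcarrier (hpow (dim_row W) Y)"
  unfolding J_def by simp

lemma pt_Ix: "j \<in> J \<Longrightarrow> pt j \<in> Ix Y"
  unfolding J_def pt_def Ix_def by simp

lemma J_card: "|J| \<le>o |UNIV :: ('v + 'r + 'u + 'y + nat) list set|"
proof (rule card_of_ordLeqI[of point_code])
  show "inj_on point_code J"
  proof (rule inj_onI)
    fix j j' assume "j \<in> J" "j' \<in> J" and eq: "point_code j = point_code j'"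
    then obtain W p y W' p' y' where "j = (W, p, y)" "j' = (W', p', y')"
      "y \<in> hcarrier (hpow (dim_row W) Y)" "y' \<in> hcarrier (hpow (dim_row W') Y)"
      unfolding J_def by (cases j, cases j') auto
    then show "j = j'" using point_code_inj eq by blast
  qed
qed simp

lemma KS_kker:
  "KS (Z, v', y') (W, v, y) = (\<Sum>i<dim_row Z. \<Sum>l<dim_row W. kker R Q Z W (\<lambda>a b. cnj (v' a) * v b) i l
    * (hinner Y (y l) (y' i) - hinner U (Sst W y l) (Sst Z y' i)))"
  unfolding KS_def kap_def adj_def by (simp add: right_diff_distrib sum_subtractf)

text \<open>In the converse direction this vector takes the place of the fixed point
  \<open>F\<close>: the component at \<open>l\<close> is the Gram vector of the point with unit row
  \<open>l\<close>.\<close>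

definition state :: "('v mat \<times> nat \<times> (nat \<Rightarrow> 'y) \<Rightarrow> 'x::complex_vector) \<Rightarrow> 'v mat \<Rightarrow> (nat \<Rightarrow> 'y) \<Rightarrow> nat \<Rightarrow> 'x" where
  "state f W y = (\<lambda>l. if l < dim_row W then f (W, l, y) else 0)"

lemma state_in:
  assumes "\<And>j. j \<in> J \<Longrightarrow> f j \<in> hcarrier X" "W \<in> \<Delta>" "y \<in> hcarrier (hpow (dim_row W) Y)"
  shows "state f W y \<in> hcarrier (hpow (dim_row W) X)"
  unfolding hpow_carrier state_def using assms by (auto simp: J_iff)

text \<open>The Gram matrices agree because \<open>kker (phi p) = kker p - p\<close>.\<close>

lemma colligation_gram:
  assumes X: "pre_hilbert X" and f: "\<And>j. j \<in> J \<Longrightarrow> f j \<in> hcarrier X"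
    and gram: "\<And>j j'. j \<in> J \<Longrightarrow> j' \<in> J \<Longrightarrow> hinner X (f j) (f j') = KS (pt j') (pt j)"
    and j: "(W, p, y) \<in> J" and j': "(Z, p', y') \<in> J"
  shows "hinner (htensor R X) (TA X W (state f W y) p) (TA X Z (state f Z y') p') + hinner Y (y p) (y' p')
    = hinner X (f (W, p, y)) (f (Z, p', y')) + hinner U (Sst W y p) (Sst Z y' p')"
proof -
  have W: "W \<in> \<Delta>" "p < dim_row W" "y \<in> hcarrier (hpow (dim_row W) Y)" using j by (simp_all add: J_iff)
  have Z: "Z \<in> \<Delta>" "p' < dim_row Z" "y' \<in> hcarrier (hpow (dim_row Z) Y)" using j' by (simp_all add: J_iff)
  let ?n = "dim_row Z" and ?m = "dim_row W"
  let ?g = "\<lambda>i l. hinner Y (y l) (y' i) - hinner U (Sst W y l) (Sst Z y' i)"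
  let ?E = "\<lambda>a b i l. cnj (uvec a i) * uvec b l :: complex"
  let ?c = "\<lambda>a b. hinner R (q W b p) (q Z a p')"
  let ?p = "phi R Q Z W (?E p' p)"
  \<comment> \<open>The combination of the matrix units \<open>?E a b\<close> with the coefficients
    \<open>?c a b\<close> is \<open>phi\<close> of the matrix unit at \<open>(p', p)\<close>.
    Linearity of \<open>kker\<close> collects the sum into one kernel value, to which
    \<open>kker_phi_right\<close> applies.\<close>
  have kk: "(\<Sum>a<?n. \<Sum>b<?m. ?c a b * kker R Q Z W (?E a b) i l) = kker R Q Z W (?E p' p) i l - ?E p' p i l"
    if i: "i < ?n" and l: "l < ?m" for i l
  proof -
    have "(\<Sum>a<?n. \<Sum>b<?m. ?c a b * kker R Q Z W (?E a b) i l)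
        = (\<Sum>x\<in>{..<?n} \<times> {..<?m}. (\<lambda>x. ?c (fst x) (snd x)) x * kker R Q Z W ((\<lambda>x. ?E (fst x) (snd x)) x) i l)"
      unfolding sum.cartesian_product by (simp add: case_prod_unfold)
    also have "\<dots> = kker R Q Z W (\<lambda>i l. \<Sum>x\<in>{..<?n} \<times> {..<?m}. ?c (fst x) (snd x) * ?E (fst x) (snd x) i l) i l"
      by (rule kker_sum[OF Z(1) W(1) i l, symmetric])
    also have "\<dots> = kker R Q Z W ?p i l"
    proof (rule kker_cong[OF _ i l])
      fix i l assume i: "i < ?n" and l: "l < ?m"
      have "(\<Sum>x\<in>{..<?n} \<times> {..<?m}. ?c (fst x) (snd x) * ?E (fst x) (snd x) i l)
          = (\<Sum>a<?n. \<Sum>b<?m. ?c a b * ?E a b i l)"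
        unfolding sum.cartesian_product by (simp add: case_prod_unfold)
      also have "\<dots> = ?c i l"
      proof (rule trans[OF _ uvec_pick[OF i l]])
        show "(\<Sum>a<?n. \<Sum>b<?m. ?c a b * ?E a b i l) = (\<Sum>a<?n. \<Sum>b<?m. cnj (uvec i a) * uvec l b * ?c a b)"
          by (rule sum.cong[OF refl], rule sum.cong[OF refl]) (simp add: uvec_def)
      qed
      also have "\<dots> = ?p i l"
        unfolding phi_def by (rule uvec_pick[OF Z(2) W(2), symmetric])
      finally show "(\<Sum>x\<in>{..<?n} \<times> {..<?m}. ?c (fst x) (snd x) * ?E (fst x) (snd x) i l) = ?p i l" .
    qed
    also have "\<dots> = kker R Q Z W (?E p' p) i l - ?E p' p i l"
      using kker_phi_right[OF Z(1) W(1) i l, of "?E p' p"] by simp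
    finally show ?thesis .
  qed
  have st: "hinner X (state f W y b) (state f Z y' a) = (\<Sum>i<?n. \<Sum>l<?m. kker R Q Z W (?E a b) i l * ?g i l)"
    if a: "a < ?n" and b: "b < ?m" for a b
  proof -
    have jj: "(W, b, y) \<in> J" "(Z, a, y') \<in> J" using W Z a b by (simp_all add: J_iff)
    have "hinner X (state f W y b) (state f Z y' a) = KS (pt (Z, a, y')) (pt (W, b, y))"
      using gram[OF jj] a b by (simp add: state_def)
    then show ?thesis unfolding pt_def fst_conv snd_conv KS_kker .
  qed
  have sW: "state f W y \<in> hcarrier (hpow (dim_row W) X)" by (rule state_in[OF _ W(1,3)]) (rule f)
  have sZ: "state f Z y' \<in> hcarrier (hpow (dim_row Z) X)" by (rule state_in[OF _ Z(1,3)]) (rule f)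
  have "hinner (htensor R X) (TA X W (state f W y) p) (TA X Z (state f Z y') p')
      = (\<Sum>a<?n. \<Sum>b<?m. ?c a b * (\<Sum>i<?n. \<Sum>l<?m. kker R Q Z W (?E a b) i l * ?g i l))"
    unfolding TA_inner[OF X Z(1) W(1) sZ sW Z(2) W(2)]
    by (rule sum.cong[OF refl], rule sum.cong[OF refl]) (simp add: st)
  also have "\<dots> = (\<Sum>a<?n. \<Sum>b<?m. \<Sum>i<?n. \<Sum>l<?m. ?c a b * kker R Q Z W (?E a b) i l * ?g i l)"
    by (simp only: sum_distrib_left mult.assoc)
  also have "\<dots> = (\<Sum>i<?n. \<Sum>l<?m. \<Sum>a<?n. \<Sum>b<?m. ?c a b * kker R Q Z W (?E a b) i l * ?g i l)" by (rule sum4_swap)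
  also have "\<dots> = (\<Sum>i<?n. \<Sum>l<?m. (\<Sum>a<?n. \<Sum>b<?m. ?c a b * kker R Q Z W (?E a b) i l) * ?g i l)"
    by (simp only: sum_distrib_right)
  also have "\<dots> = (\<Sum>i<?n. \<Sum>l<?m. (kker R Q Z W (?E p' p) i l - ?E p' p i l) * ?g i l)"
    by (rule sum.cong[OF refl], rule sum.cong[OF refl]) (simp only: lessThan_iff kk)
  also have "\<dots> = (\<Sum>i<?n. \<Sum>l<?m. kker R Q Z W (?E p' p) i l * ?g i l) - (\<Sum>i<?n. \<Sum>l<?m. ?E p' p i l * ?g i l)"
    by (simp only: left_diff_distrib sum_subtractf)
  also have "(\<Sum>i<?n. \<Sum>l<?m. kker R Q Z W (?E p' p) i l * ?g i l) = hinner X (f (W, p, y)) (f (Z, p', y'))"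
    unfolding st[OF Z(2) W(2), symmetric] using Z(2) W(2) by (simp add: state_def)
  also have "(\<Sum>i<?n. \<Sum>l<?m. ?E p' p i l * ?g i l) = ?g p' p"
    by (rule uvec_pick[OF Z(2) W(2)])
  finally show ?thesis by simp
qed

text \<open>Tensoring with this vector carries orthonormal families of \<open>X\<close> to
  orthonormal families of \<open>R \<otimes> X\<close>.\<close>

lemma unit_vector:
  assumes "hcarrier R \<noteq> {0}"
  obtains r where "r \<in> hcarrier R" "hinner R r r = 1"
proof -
  obtain x where x: "x \<in> hcarrier R" "x \<noteq> 0" using assms zero_in[OF Rp] by blast
  then have n: "hnorm R x \<noteq> 0" using hnorm_eq_zero[OF R] by blast
  show thesis
  proof (rule that)
    show "of_real (1 / hnorm R x) *\<^sub>C x \<in> hcarrier R" by (rule scale_in[OF Rp x(1)])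
    show "hinner R (of_real (1 / hnorm R x) *\<^sub>C x) (of_real (1 / hnorm R x) *\<^sub>C x) = 1"
      using x(1) n Rp inner_self[OF Rp x(1)] by (simp add: power2_eq_square)
  qed
qed

text \<open>The isometry sends \<open>b j\<close>, the state and input side of a point, to
  \<open>a j\<close>, its tensored state and output. The work lies in bounding the dimensions of
  both complements by the set of lists, from below by \<open>?e1\<close> and \<open>?e2\<close>,
  from above by \<open>?D1\<close> and \<open>?D2\<close>.\<close>

lemma unitary_realization:
  assumes psd: "psd (Ix Y) KS" and R0: "hcarrier R \<noteq> {0}"
  obtains X :: "('v, 'r, 'u, 'y) state_ambient hspace" and A B C D where
    "hilbert_space X" "A \<in> bop X (htensor R X)" "B \<in> bop U (htensor R X)" "C \<in> bop X Y" "D \<in> bop U Y"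
    "unitary_op (hsum X U) (hsum (htensor R X) Y) (block_op X U A B C D)"
    "\<And>W. W \<in> \<Delta> \<Longrightarrow> S W = transfer_function R X U Q A B C D W"
proof -
  have inf: "infinite (UNIV :: ('v + 'r + 'u + 'y + nat) list set)" by (rule infinite_UNIV_listI)
  have psdJ: "psd J (\<lambda>j' j. KS (pt j') (pt j))" by (rule psd_pullback[OF psd pt_Ix])
  obtain X :: "('v, 'r, 'u, 'y) state_ambient hspace" and f \<eta> t where X: "hilbert_space X"
    and f: "\<And>j. j \<in> J \<Longrightarrow> f j \<in> hcarrier X"
    and gram: "\<And>j j'. j \<in> J \<Longrightarrow> j' \<in> J \<Longrightarrow> hinner X (f j) (f j') = KS (pt j') (pt j)"
    and \<eta>: "\<And>i. \<eta> i \<in> hcarrier X"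
      "\<And>i k. hinner X (\<eta> i) (\<eta> k) = (if i = (k :: ('v + 'r + 'u + 'y + nat) list) then 1 else 0)"
      "\<And>i j. j \<in> J \<Longrightarrow> hinner X (\<eta> i) (f j) = 0"
    and t: "\<And>i :: ('v + 'r + 'u + 'y + nat) list. t i \<in> hcarrier X"
      "\<And>z. z \<in> hcarrier X \<Longrightarrow> (\<And>i. hinner X z (t i) = 0) \<Longrightarrow> z = 0"
    by (rule state_space_exists[OF psdJ J_card inf]) blast
  have Xp: "pre_hilbert X" using X by simp
  note RX = hilbert_htensor[OF Rp Xp]
  let ?V = "htensor R X"
  have Vp: "pre_hilbert ?V" using RX by simp
  note XU = hilbert_hsum[OF X U] and VY = hilbert_hsum[OF RX Y]
  obtain r where r: "r \<in> hcarrier R" "hinner R r r = 1" using unit_vector[OF R0] by blast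
  define a where "a j = (TA X (fst j) (state f (fst j) (snd (snd j))) (fst (snd j)), snd (snd j) (fst (snd j)))" for j
  define b where "b j = (f j, Sst (fst j) (snd (snd j)) (fst (snd j)))" for j
  have aV: "TA X W (state f W y) p \<in> hcarrier ?V" if "(W, p, y) \<in> J" for W p y
  proof -
    have W: "W \<in> \<Delta>" "p < dim_row W" "y \<in> hcarrier (hpow (dim_row W) Y)" using that by (simp_all add: J_iff)
    have sW: "state f W y \<in> hcarrier (hpow (dim_row W) X)" by (rule state_in[OF _ W(1,3)]) (rule f)
    show ?thesis by (rule hpow_in[OF bop_in[OF TA_bop[OF W(1) Xp] sW] W(2)])
  qed
  have a: "a j \<in> hcarrier (hsum ?V Y)" if "j \<in> J" for j
  proof -
    obtain W p y where j: "j = (W, p, y)" by (cases j)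
    show ?thesis using aV[of W p y] that unfolding j a_def by (auto simp: J_iff)
  qed
  have b: "b j \<in> hcarrier (hsum X U)" if "j \<in> J" for j
  proof -
    obtain W p y where j: "j = (W, p, y)" by (cases j)
    then have W: "W \<in> \<Delta>" "p < dim_row W" "y \<in> hcarrier (hpow (dim_row W) Y)" using that by (simp_all add: J_iff)
    show ?thesis using hpow_in[OF bop_in[OF Sst_bop[OF W(1)] W(3)] W(2)] f[OF that] unfolding j b_def by simp
  qed
  have g: "hinner (hsum ?V Y) (a j) (a j') = hinner (hsum X U) (b j) (b j')" if "j \<in> J" "j' \<in> J" for j j'
  proof -
    obtain W p y Z p' y' where j: "j = (W, p, y)" "j' = (Z, p', y')" by (cases j, cases j')
    show ?thesis
      using colligation_gram[OF Xp f gram that[unfolded j]] unfolding j a_def b_def by simp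
  qed
  \<comment> \<open>Both families come from \<open>\<eta>\<close>, which is orthogonal to all
    \<open>f j\<close>. Orthogonality to \<open>b j\<close> is immediate; for \<open>a j\<close> it
    holds because the first component is a sum of tensors whose second factors are vectors
    \<open>f\<close>.\<close>
  let ?e1 = "\<lambda>i. (\<eta> i, 0 :: 'u)" and ?e2 = "\<lambda>i. (elem_tensor R X r (\<eta> i), 0 :: 'y)"
  note ret = et_in[OF Rp Xp r(1) \<eta>(1)]
  have e1: "?e1 i \<in> hcarrier (hsum X U)" "?e2 i \<in> hcarrier (hsum ?V Y)" for i
    using \<eta>(1) Up Yp ret by simp_all
  have e2: "hinner (hsum X U) (?e1 i) (?e1 k) = (if i = k then 1 else 0)" for i k
    using \<eta>(2)[of i k] Up by simp
  have e3: "hinner (hsum ?V Y) (?e2 i) (?e2 k) = (if i = k then 1 else 0)" for i k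
    using et_inner[OF Rp Xp r(1) \<eta>(1) r(1) \<eta>(1), of i k] \<eta>(2)[of i k] Yp r(2) by simp
  have e4: "hinner (hsum X U) (?e1 i) (b j) = 0" if j: "j \<in> J" for i j
    using \<eta>(3)[OF j] b[OF j] Up unfolding b_def by simp
  have e5: "hinner (hsum ?V Y) (?e2 i) (a j) = 0" if "j \<in> J" for i j
  proof -
    obtain W p y where j: "j = (W, p, y)" by (cases j)
    then have W: "W \<in> \<Delta>" "p < dim_row W" "y \<in> hcarrier (hpow (dim_row W) Y)" using that by (simp_all add: J_iff)
    have sW: "state f W y \<in> hcarrier (hpow (dim_row W) X)" by (rule state_in[OF _ W(1,3)]) (rule f)
    have "hinner ?V (elem_tensor R X r (\<eta> i)) (TA X W (state f W y) p)
        = (\<Sum>l<dim_row W. hinner ?V (elem_tensor R X r (\<eta> i)) (elem_tensor R X (q W l p) (state f W y l)))"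
      unfolding TA_apply[OF W(1) Xp sW W(2)]
      by (rule inner_sum_right[where F = "{..<dim_row W}", OF Vp _ ret]) (use q_in[OF W(1)] sW Rp Xp in auto)
    also have "\<dots> = 0"
    proof (rule sum.neutral, rule ballI)
      fix l assume "l \<in> {..<dim_row W}"
      then have l: "l < dim_row W" by simp
      then have jl: "(W, l, y) \<in> J" using W by (simp add: J_iff)
      show "hinner ?V (elem_tensor R X r (\<eta> i)) (elem_tensor R X (q W l p) (state f W y l)) = 0"
        unfolding et_inner[OF Rp Xp r(1) \<eta>(1) q_in[OF W(1) l] hpow_in[OF sW l]]
        using \<eta>(3)[OF jl, of i] l by (simp add: state_def)
    qed
    finally show ?thesis using W Yp unfolding j a_def by simp
  qed
  let ?D1 = "(\<lambda>x. (x, 0 :: 'u)) ` range t \<union> Pair 0 ` hcarrier U"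
  let ?D = "(\<lambda>p. elem_tensor R X (fst p) (t (snd p))) ` (hcarrier R \<times> UNIV)"
  let ?D2 = "(\<lambda>x. (x, 0 :: 'y)) ` ?D \<union> Pair 0 ` hcarrier Y"
  have c1: "|hcarrier U| \<le>o |UNIV :: ('v + 'r + 'u + 'y + nat) list set|"
    by (rule card_of_ordLeqI[of "\<lambda>u. [Inr (Inr (Inl u))]"]) (auto intro: inj_onI)
  have c2: "|hcarrier Y| \<le>o |UNIV :: ('v + 'r + 'u + 'y + nat) list set|"
    by (rule card_of_ordLeqI[of "\<lambda>u. [Inr (Inr (Inr (Inl u)))]"]) (auto intro: inj_onI)
  \<comment> \<open>A pair is coded by putting a letter for the vector of \<open>R\<close> in front
    of the list, which is why \<open>'r\<close> occurs in the alphabet.\<close>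
  have c3: "|hcarrier R \<times> (UNIV :: ('v + 'r + 'u + 'y + nat) list set)| \<le>o |UNIV :: ('v + 'r + 'u + 'y + nat) list set|"
    by (rule card_of_ordLeqI[of "\<lambda>p. Inr (Inl (fst p)) # snd p"]) (auto intro: inj_onI simp: prod_eq_iff)
  have D1: "|?D1| \<le>o |UNIV :: ('v + 'r + 'u + 'y + nat) list set|"
    by (rule card_le_Un[OF inf ordLeq_transitive[OF card_of_image card_of_image] ordLeq_transitive[OF card_of_image c1]])
  have D2: "|?D2| \<le>o |UNIV :: ('v + 'r + 'u + 'y + nat) list set|"
    by (rule card_le_Un[OF inf ordLeq_transitive[OF card_of_image ordLeq_transitive[OF card_of_image c3]] ordLeq_transitive[OF card_of_image c2]])
  have D1H: "?D1 \<subseteq> hcarrier (hsum X U)" using t(1) Xp Up by auto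
  have D2H: "?D2 \<subseteq> hcarrier (hsum ?V Y)" using t(1) Rp Xp Vp Yp by auto
  have tot1: "z = 0" if "z \<in> hcarrier (hsum X U)" "\<And>t. t \<in> ?D1 \<Longrightarrow> hinner (hsum X U) z t = 0" for z
  proof (rule hsum_total[OF X U that(1) _ that(2)])
    show "z = 0" if "z \<in> hcarrier X" "\<And>x. x \<in> range t \<Longrightarrow> hinner X z x = 0" for z
      by (rule t(2)[OF that(1) that(2)[OF rangeI]])
  qed
  have tot2: "z = 0" if "z \<in> hcarrier (hsum ?V Y)" "\<And>t. t \<in> ?D2 \<Longrightarrow> hinner (hsum ?V Y) z t = 0" for z
  proof (rule hsum_total[OF RX Y that(1) _ that(2)])
    show "z = 0" if z: "z \<in> hcarrier ?V" and o: "\<And>x. x \<in> ?D \<Longrightarrow> hinner ?V z x = 0" for z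
    proof (rule htensor_total[OF R X t(1) t(2) z])
      show "hinner ?V z (elem_tensor R X r (t i)) = 0" if "r \<in> hcarrier R" for r i
        by (rule o) (use that in force)
    qed
  qed
  obtain T where T: "unitary_op (hsum X U) (hsum ?V Y) T" "\<And>j. j \<in> J \<Longrightarrow> T (b j) = a j"
    by (rule unitary_extension[where b = b and a = a and E = J and ?\<eta>1.0 = ?e1 and ?\<eta>2.0 = ?e2, OF XU VY b a g e1(1) e2 e4 e1(2) e3 e5 inf D1H D1 tot1 D2H D2 tot2])
      (assumption | blast)+
  have Tb: "T \<in> bop (hsum X U) (hsum ?V Y)" and Ti: "\<And>x y. x \<in> hcarrier (hsum X U) \<Longrightarrow> y \<in> hcarrier (hsum X U) \<Longrightarrow>
    hinner (hsum ?V Y) (T x) (T y) = hinner (hsum X U) x y" using T(1) unfolding unitary_op_def by blast+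
  obtain A B C D where A: "A \<in> bop X ?V" "B \<in> bop U ?V" "C \<in> bop X Y" "D \<in> bop U Y" and blk: "block_op X U A B C D = T"
    using block_decompose[OF Xp Up Vp Yp Tb] by blast
  interpret rz: realization R Q \<Delta> X U Y A B C D
    by unfold_locales (use X U Y A blk unitary_contractive[OF pre_hilbert_hsum[OF Xp Up] pre_hilbert_hsum[OF Vp Yp] T(1)] in simp_all)
  have "S W = transfer_function R X U Q A B C D W" if W: "W \<in> \<Delta>" for W
  proof (rule ext)
    fix u
    show "S W u = transfer_function R X U Q A B C D W u"
    proof (cases "u \<in> hcarrier (hpow (dim_row W) U)")
      case False
      show ?thesis unfolding bop_off[OF S[OF W] False] rz.transfer_off[OF W False] ..
    next
      case u: True
      show ?thesis
      proof (rule inner_ext[OF hilbert_hpow[OF Y] bop_in[OF S[OF W] u] rz.transfer_in[OF W u]])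
        fix y assume y: "y \<in> hcarrier (hpow (dim_row W) Y)"
        have "hinner (hpow (dim_row W) Y) (transfer_function R X U Q A B C D W u) y
            = (\<Sum>p<dim_row W. hinner U (u p) (Sst W y p))"
        proof (rule rz.transfer_adjoint[OF W u _ y])
          show "state f W y \<in> hcarrier (hpow (dim_row W) X)" by (rule state_in[OF _ W y]) (rule f)
        next
          fix p x v assume p: "p < dim_row W" and x: "x \<in> hcarrier X" and v: "v \<in> hcarrier U"
          have j: "(W, p, y) \<in> J" using W p y by (simp add: J_iff)
          have xv: "(x, v) \<in> hcarrier (hsum X U)" using x v by simp
          \<comment> \<open>Unitarity of \<open>T\<close>, tested against \<open>b j\<close> with
            image \<open>a j\<close>, is precisely the energy balance required by
            \<open>transfer_adjoint\<close>; hence the transfer function and \<open>S\<close> have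
            the same adjoint.\<close>
          have "hinner (hsum ?V Y) (T (x, v)) (T (b (W, p, y))) = hinner (hsum X U) (x, v) (b (W, p, y))"
            by (rule Ti[OF xv b[OF j]])
          then show "hinner ?V (A x + B v) (TA X W (state f W y) p) + hinner Y (C x + D v) (y p)
              = hinner X x (state f W y p) + hinner U v (Sst W y p)"
            unfolding T(2)[OF j] unfolding blk[symmetric] block_apply[OF x v] using p by (simp add: a_def b_def state_def)
        qed
        then show "hinner (hpow (dim_row W) Y) (S W u) y = hinner (hpow (dim_row W) Y) (transfer_function R X U Q A B C D W u) y"
          unfolding Sst_inner[OF W u y] hpow_inner[of _ U] by simp
      qed
    qed
  qed
  then show thesis using that[OF X A] T(1) blk by blast
qed

end

unbundle no cardinal_syntax

text \<open>The type of the state space is free here, so the same statement serves for the ambient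
  type of lists and for an arbitrary type.\<close>

lemma (in graded_ball) contractive_realization:
  fixes X :: "'x::complex_vector hspace"
  assumes X: "hilbert_space X" and A: "A \<in> bop X (htensor R X)" and B: "B \<in> bop U (htensor R X)"
    and C: "C \<in> bop X Y" and D: "D \<in> bop U Y"
    and contr: "contractive_op (hsum X U) (hsum (htensor R X) Y) (block_op X U A B C D)"
    and tf: "\<forall>Z\<in>\<Delta>. S Z = transfer_function R X U Q A B C D Z"
  shows "nc_function \<Delta> U Y S \<and> S \<in> contractive_multipliers \<Delta> U Y (KE U) (KE Y)"
proof -
  interpret rz: realization R Q \<Delta> X U Y A B C D
    by unfold_locales (use X U Y A B C D contr in simp_all)
  show ?thesis using rz.realization_multiplier[OF graded_ball_axioms] tf by blast
qed

text \<open>Both existential clauses range over one ambient type, which is large enough for a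
  unitary realization. The last clause complements them: a contractive realization suffices whatever
  the type of its state space.\<close>

theorem corollary5p8:
  fixes \<Xi> :: "'v::complex_vector mat set"
    and R :: "'r::complex_vector hspace"
    and U :: "'u::complex_vector hspace"
    and Y :: "'y::complex_vector hspace"
    and Q :: "'v mat \<Rightarrow> (nat \<Rightarrow> 'r) \<Rightarrow> (nat \<Rightarrow> complex)"
    and S :: "'v mat \<Rightarrow> (nat \<Rightarrow> 'u) \<Rightarrow> (nat \<Rightarrow> 'y)"
    and \<Delta> :: "'v mat set"
  assumes "full_nc_set \<Xi>"
    and "hilbert_space R" and "hcarrier R \<noteq> {0}"
    and "hilbert_space U" and "hcarrier U \<noteq> {0}"
    and "hilbert_space Y" and "hcarrier Y \<noteq> {0}"
    and "nc_function \<Xi> R complex_hspace Q"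
    and "\<Delta> = nc_ball \<Xi> R Q"
    and "graded \<Delta> U Y S"
  shows
    "((nc_function \<Delta> U Y S \<and>
       S \<in> contractive_multipliers \<Delta> U Y (kernel_Q_id R Q U) (kernel_Q_id R Q Y))
      \<longleftrightarrow>
      (\<exists>(X :: ('v, 'r, 'u, 'y) state_ambient hspace) A B C D.
         hilbert_space X \<and>
         A \<in> bop X (htensor R X) \<and> B \<in> bop U (htensor R X) \<and> C \<in> bop X Y \<and> D \<in> bop U Y \<and>
         contractive_op (hsum X U) (hsum (htensor R X) Y) (block_op X U A B C D) \<and>
         (\<forall>Z\<in>\<Delta>. S Z = transfer_function R X U Q A B C D Z)))
     \<and>
     ((nc_function \<Delta> U Y S \<and>
       S \<in> contractive_multipliers \<Delta> U Y (kernel_Q_id R Q U) (kernel_Q_id R Q Y))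
      \<longleftrightarrow>
      (\<exists>(X :: ('v, 'r, 'u, 'y) state_ambient hspace) A B C D.
         hilbert_space X \<and>
         A \<in> bop X (htensor R X) \<and> B \<in> bop U (htensor R X) \<and> C \<in> bop X Y \<and> D \<in> bop U Y \<and>
         unitary_op (hsum X U) (hsum (htensor R X) Y) (block_op X U A B C D) \<and>
         (\<forall>Z\<in>\<Delta>. S Z = transfer_function R X U Q A B C D Z)))
     \<and>
     ((\<exists>(X :: 'x::complex_vector hspace) A B C D.
         hilbert_space X \<and>
         A \<in> bop X (htensor R X) \<and> B \<in> bop U (htensor R X) \<and> C \<in> bop X Y \<and> D \<in> bop U Y \<and>
         contractive_op (hsum X U) (hsum (htensor R X) Y) (block_op X U A B C D) \<and>
         (\<forall>Z\<in>\<Delta>. S Z = transfer_function R X U Q A B C D Z))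
      \<longrightarrow>
      (nc_function \<Delta> U Y S \<and>
       S \<in> contractive_multipliers \<Delta> U Y (kernel_Q_id R Q U) (kernel_Q_id R Q Y)))"
    (is "(?M \<longleftrightarrow> ?contractive) \<and> (?M \<longleftrightarrow> ?unitary) \<and> (?any \<longrightarrow> ?M)")
proof -
  interpret graded_ball R Q \<Delta> U Y S
  proof
    show "hilbert_space R" "hilbert_space U" "hilbert_space Y" by fact+
    show "S W \<in> bop (hpow (dim_row W) U) (hpow (dim_row W) Y)" if "W \<in> \<Delta>" for W
      using assms(10) that unfolding graded_def by blast
    show "Q W \<in> bop (hpow (dim_row W) R) (cpow (dim_row W))" if "W \<in> \<Delta>" for W
      using assms(8,9) that unfolding nc_ball_def nc_function_def graded_def by blast
    show "op_norm (hpow (dim_row W) R) (cpow (dim_row W)) (Q W) < 1" if "W \<in> \<Delta>" for W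
      using assms(9) that unfolding nc_ball_def by blast
    show "mat_op \<alpha> complex_hspace \<circ> Q Z = Q Z' \<circ> mat_op \<alpha> R"
      if "Z \<in> \<Delta>" "Z' \<in> \<Delta>" "\<alpha> \<in> carrier_mat (dim_row Z') (dim_row Z)" "lact \<alpha> Z = ract Z' \<alpha>" for Z Z' \<alpha>
      using assms(8,9) that unfolding nc_ball_def nc_function_def by blast
  qed
  have any: "?any \<Longrightarrow> ?M" using contractive_realization by blast
  have contr: "?contractive \<Longrightarrow> ?M" using contractive_realization by blast
  have unit: "?unitary \<Longrightarrow> ?contractive"
  proof (elim exE conjE)
    fix X :: "('v, 'r, 'u, 'y) state_ambient hspace" and A B C D
    assume X: "hilbert_space X" and ABCD: "A \<in> bop X (htensor R X)" "B \<in> bop U (htensor R X)" "C \<in> bop X Y" "D \<in> bop U Y"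
      and u: "unitary_op (hsum X U) (hsum (htensor R X) Y) (block_op X U A B C D)"
      and tf: "\<forall>Z\<in>\<Delta>. S Z = transfer_function R X U Q A B C D Z"
    have Xp: "pre_hilbert X" using X by simp
    have "contractive_op (hsum X U) (hsum (htensor R X) Y) (block_op X U A B C D)"
      by (rule unitary_contractive[OF pre_hilbert_hsum[OF Xp Up]
        pre_hilbert_hsum[OF hilbert_pre_hilbert[OF hilbert_htensor[OF Rp Xp]] Yp] u])
    then show ?contractive using X ABCD tf by blast
  qed
  have "?M \<Longrightarrow> ?unitary"
  proof -
    assume ?M
    then have "psd (Ix Y) KS" using multiplier_psd by blast
    then show ?unitary by (rule unitary_realization[OF _ assms(3)]) blast
  qed
  then show ?thesis using any contr unit by blast
qed

end
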